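(* Let $k$ be a field of characteristic $0$ and let $M=\mathbb{A}^\ell_k\backslash\bigcup_{i=1}^N H_i$ be the complement of an affine hyperplane arrangement defined over $k$. Then the reduced bar construction $B(M)$ is a unipotent Picard–Vessiot extension of $\mathcal{O}_M$: it is a unipotent extension of $\mathcal{O}_M$, it has no non-trivial differential ideals (i.e. none except $0$ and $B(M)$), and its ring of constants is $k$. It is therefore a polynomial algebra over $\mathcal{O}_M$ (possibly in infinitely many variables). Furthermore, $B(M)$ contains $1$-primitives: $$H^1_{\mathrm{DR}}(B(M))=0.$$
   Context: Let $t_1,\ldots,t_\ell$ be coordinates on $\mathbb{A}^\ell$, let $\alpha_i$ be a linear (degree one) polynomial defining $H_i$ (the $H_i$ distinct), and let $\mathcal{O}_M=k[t_1,\ldots,t_\ell,\alpha_1^{-1},\ldots,\alpha_N^{-1}]$, a differential $k$-algebra for the commuting derivations $\partial/\partial t_i$. Let $\Omega^j(\mathcal{O}_M)$ be its algebraic differential $j$-forms and $\omega_i=d\log\alpha_i=d\alpha_i/\alpha_i$. For $m\ge 2$ let $V_m$ be the $k$-vector space of linear combinations of symbols $\sum_{I=(i_1,\ldots,i_m)}c_I[\omega_{i_1}|\cdots|\omega_{i_m}]$, $c_I\in k$ (regarded as elements of $(\bigoplus_i k\omega_i)^{\otimes m}$), satisfying the integrability condition $$\sum_I c_I\,\omega_{i_1}\otimes\cdots\otimes(\omega_{i_j}\wedge\omega_{i_{j+1}})\otimes\cdots\otimes\omega_{i_m}=0\quad\text{for all }1\le j<m,$$ and put $V_0=k$, $V_1=\bigoplus_i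 k\,\omega_i$. The reduced bar construction is $B(M)=\mathcal{O}_M\otimes_k\bigoplus_{m\ge0}V_m$, with multiplication given by the shuffle product of words. Put $\Omega^jB(M)=\Omega^j(\mathcal{O}_M)\otimes_k\bigoplus_mV_m$, with differential $$d\sum_I\phi_I\otimes[\omega_{i_1}|\cdots|\omega_{i_m}]=\sum_I d\phi_I\otimes[\omega_{i_1}|\cdots|\omega_{i_m}]+\sum_I(-1)^{\deg\phi_I}\phi_I\wedge\omega_{i_1}\otimes[\omega_{i_2}|\cdots|\omega_{i_m}];$$ then $d^2=0$ and $H^j_{\mathrm{DR}}(B(M))$ denotes the cohomology of this complex in degree $j$. Writing $df=\sum_i\partial_i(f)\,dt_i$ for $f\in B(M)$ defines $\ell$ commuting derivations $\partial_i$ on $B(M)$ extending $\partial/\partial t_i$. The ring of constants is $\bigcap_i\ker\partial_i=H^0_{\mathrm{DR}}$; a differential ideal is an ideal stable under all $\partial_i$. A differential $k$-algebra $B\supset R$ (with $R$ having constants $k$ and no non-trivial differential ideals) is a unipotent extension of $R$ if its ring of constants is $k$ and there is an exhaustive increasing filtration by differential $R$-subalgebras $R=W^0B\subset W^1B\subset\cdots$, $B=\bigcup_iW^iB$, such that $W^{i+1}B$ is generated as an algebra over $W^iB$ by finitely many elements $y$ with all $\partial_jy\in W^iB$. *)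

theory Defs
  imports
    "HOL-Library.Poly_Mapping"
    "HOL-Library.Multiset"
    "HOL-Computational_Algebra.Fraction_Field"
    "HOL-Algebra.Generated_Rings"
    "HOL-Algebra.Ideal"
    "HOL-Algebra.Elementary_Groups"
    "HOL-Algebra.Indexed_Polynomials"
begin

section \<open>Differential algebras and unipotent extensions\<close>

definition derivation :: "('b, 'm) ring_scheme \<Rightarrow> ('b \<Rightarrow> 'b) \<Rightarrow> bool" where
  "derivation B d \<longleftrightarrow>
     d \<in> carrier B \<rightarrow> carrier B \<and>
     (\<forall>x\<in>carrier B. \<forall>y\<in>carrier B.
        d (x \<oplus>\<^bsub>B\<^esub> y) = d x \<oplus>\<^bsub>B\<^esub> d y \<and>
        d (x \<otimes>\<^bsub>B\<^esub> y) = (d x \<otimes>\<^bsub>B\<^esub> y) \<oplus>\<^bsub>B\<^esub> (x \<otimes>\<^bsub>B\<^esub> d y))"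

text \<open>The base field is given as a subfield \<open>k\<close> of \<open>B\<close>; the derivations are
  \<open>D 0, \<dots>, D (l - 1)\<close>.\<close>

definition differential_algebra ::
    "'b set \<Rightarrow> ('b, 'm) ring_scheme \<Rightarrow> nat \<Rightarrow> (nat \<Rightarrow> 'b \<Rightarrow> 'b) \<Rightarrow> bool" where
  "differential_algebra k B l D \<longleftrightarrow>
     cring B \<and> subfield k B \<and>
     (\<forall>i<l. derivation B (D i) \<and> (\<forall>c\<in>k. D i c = \<zero>\<^bsub>B\<^esub>)) \<and>
     (\<forall>i<l. \<forall>j<l. \<forall>x\<in>carrier B. D i (D j x) = D j (D i x))"

definition differential_subalgebra ::
    "'b set \<Rightarrow> 'b set \<Rightarrow> ('b, 'm) ring_scheme \<Rightarrow> nat \<Rightarrow> (nat \<Rightarrow> 'b \<Rightarrow> 'b) \<Rightarrow> bool" where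
  "differential_subalgebra k R B l D \<longleftrightarrow>
     subring R B \<and> k \<subseteq> R \<and> (\<forall>i<l. \<forall>x\<in>R. D i x \<in> R)"

definition constants :: "('b, 'm) ring_scheme \<Rightarrow> nat \<Rightarrow> (nat \<Rightarrow> 'b \<Rightarrow> 'b) \<Rightarrow> 'b set" where
  "constants B l D = {x \<in> carrier B. \<forall>i<l. D i x = \<zero>\<^bsub>B\<^esub>}"

definition differential_ideal ::
    "'b set \<Rightarrow> ('b, 'm) ring_scheme \<Rightarrow> nat \<Rightarrow> (nat \<Rightarrow> 'b \<Rightarrow> 'b) \<Rightarrow> bool" where
  "differential_ideal J B l D \<longleftrightarrow> ideal J B \<and> (\<forall>i<l. \<forall>x\<in>J. D i x \<in> J)"

definition no_nontrivial_differential_ideals ::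
    "('b, 'm) ring_scheme \<Rightarrow> nat \<Rightarrow> (nat \<Rightarrow> 'b \<Rightarrow> 'b) \<Rightarrow> bool" where
  "no_nontrivial_differential_ideals B l D \<longleftrightarrow>
     (\<forall>J. differential_ideal J B l D \<longrightarrow> J = {\<zero>\<^bsub>B\<^esub>} \<or> J = carrier B)"

definition unipotent_extension ::
    "'b set \<Rightarrow> 'b set \<Rightarrow> ('b, 'm) ring_scheme \<Rightarrow> nat \<Rightarrow> (nat \<Rightarrow> 'b \<Rightarrow> 'b) \<Rightarrow> bool" where
  "unipotent_extension k R B l D \<longleftrightarrow>
     differential_algebra k B l D \<and>
     differential_subalgebra k R B l D \<and>
     constants (B\<lparr>carrier := R\<rparr>) l D = k \<and>
     no_nontrivial_differential_ideals (B\<lparr>carrier := R\<rparr>) l D \<and>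
     constants B l D = k \<and>
     (\<exists>W :: nat \<Rightarrow> 'b set.
        W 0 = R \<and>
        (\<forall>n. differential_subalgebra k (W n) B l D \<and> W n \<subseteq> W (Suc n)) \<and>
        carrier B = (\<Union>n. W n) \<and>
        (\<forall>n. \<exists>Y. finite Y \<and> Y \<subseteq> W (Suc n) \<and> (\<forall>y\<in>Y. \<forall>j<l. D j y \<in> W n) \<and>
             W (Suc n) = generate_ring B (W n \<union> Y)))"

definition unipotent_Picard_Vessiot ::
    "'b set \<Rightarrow> 'b set \<Rightarrow> ('b, 'm) ring_scheme \<Rightarrow> nat \<Rightarrow> (nat \<Rightarrow> 'b \<Rightarrow> 'b) \<Rightarrow> bool" where
  "unipotent_Picard_Vessiot k R B l D \<longleftrightarrow>
     unipotent_extension k R B l D \<and>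
     no_nontrivial_differential_ideals B l D \<and>
     constants B l D = k"

text \<open>\<open>ring.indexed_pset B S R\<close> is the set of polynomials with coefficients in \<open>R\<close> in variables
  indexed by \<open>S\<close>, a polynomial being a function from monomials (multisets of variables) to
  coefficients. Here the variables are themselves elements of \<open>B\<close>, and evaluation substitutes
  each variable by itself.\<close>

definition monomial_eval :: "('b, 'm) ring_scheme \<Rightarrow> 'b multiset \<Rightarrow> 'b" where
  "monomial_eval B M = (\<Otimes>\<^bsub>B\<^esub>s\<in>set_mset M. s [^]\<^bsub>B\<^esub> count M s)"

definition polynomial_eval :: "('b, 'm) ring_scheme \<Rightarrow> ('b multiset \<Rightarrow> 'b) \<Rightarrow> 'b" where
  "polynomial_eval B P = (\<Oplus>\<^bsub>B\<^esub>M\<in>{M. P M \<noteq> \<zero>\<^bsub>B\<^esub>}. P M \<otimes>\<^bsub>B\<^esub> monomial_eval B M)"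

definition is_polynomial_algebra :: "'b set \<Rightarrow> ('b, 'm) ring_scheme \<Rightarrow> bool" where
  "is_polynomial_algebra R B \<longleftrightarrow>
     (\<exists>S \<subseteq> carrier B. bij_betw (polynomial_eval B) (ring.indexed_pset B S R) (carrier B))"


section \<open>Polynomials and rational functions\<close>

text \<open>\<open>Poly_Mapping\<close> hides these names.\<close>

abbreviation (input) lookup :: "('a \<Rightarrow>\<^sub>0 'b::zero) \<Rightarrow> 'a \<Rightarrow> 'b" where
  "lookup \<equiv> Poly_Mapping.lookup"

abbreviation (input) keys :: "('a \<Rightarrow>\<^sub>0 'b::zero) \<Rightarrow> 'a set" where
  "keys \<equiv> Poly_Mapping.keys"

abbreviation (input) single :: "'a \<Rightarrow> 'b \<Rightarrow> ('a \<Rightarrow>\<^sub>0 'b::zero)" where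
  "single \<equiv> Poly_Mapping.single"

text \<open>Polynomials in countably many variables \<open>t\<^sub>0, t\<^sub>1, \<dots>\<close>; on affine \<open>l\<close>-space only
  \<open>t\<^sub>0, \<dots>, t\<^bsub>l-1\<^esub>\<close> are used.\<close>

type_synonym 'k mpoly = "(nat \<Rightarrow>\<^sub>0 nat) \<Rightarrow>\<^sub>0 'k"
type_synonym 'k ratfun = "'k mpoly fract"

definition Const :: "'k::field_char_0 \<Rightarrow> 'k mpoly" where
  "Const c = single 0 c"

definition Var :: "nat \<Rightarrow> 'k::field_char_0 mpoly" where
  "Var i = single (single i 1) 1"

definition mpoly_eval :: "'k::field_char_0 mpoly \<Rightarrow> (nat \<Rightarrow> 'k) \<Rightarrow> 'k" where
  "mpoly_eval p x = (\<Sum>m\<in>keys p. lookup p m * (\<Prod>i\<in>keys m. x i ^ lookup m i))"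

definition mpoly_deriv :: "nat \<Rightarrow> 'k::field_char_0 mpoly \<Rightarrow> 'k mpoly" where
  "mpoly_deriv i p =
     (\<Sum>m\<in>keys p. single (m - single i 1) (of_nat (lookup m i) * lookup p m))"

lemma mpoly_deriv_superset:
  assumes "finite A" "keys p \<subseteq> A"
  shows "mpoly_deriv i p =
    (\<Sum>m\<in>A. single (m - single i 1) (of_nat (lookup m i) * lookup p m))"
  unfolding mpoly_deriv_def using assms
  by (intro sum.mono_neutral_left) (auto simp: in_keys_iff)

lemma mpoly_deriv_add: "mpoly_deriv i (p + q) = mpoly_deriv i p + mpoly_deriv i q"
proof -
  let ?A = "keys p \<union> keys q"
  have "keys (p + q) \<subseteq> ?A" by (rule Poly_Mapping.keys_add)
  then show ?thesis
    by (simp add: mpoly_deriv_superset[of ?A] lookup_add distrib_left single_add sum.distrib)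
qed

lemma mpoly_deriv_single:
  "mpoly_deriv i (single m c) =
     single (m - single i 1) (of_nat (lookup m i) * c)"
  by (subst mpoly_deriv_superset[of "{m}"]) auto

lemma poly_mapping_induct [case_names single sum]:
  fixes P :: "('a \<Rightarrow>\<^sub>0 'b::comm_monoid_add) \<Rightarrow> bool"
  assumes single: "\<And>m c. P (single m c)" and sum: "\<And>f g. P f \<Longrightarrow> P g \<Longrightarrow> P (f + g)"
  shows "P p"
proof (induction p rule: update_induct)
  case const
  show ?case using single[of undefined 0] by simp
next
  case (update f a b)
  then have "Poly_Mapping.update a b f = f + single a b"
    by (intro poly_mapping_eqI)
       (auto simp: lookup_add lookup_update lookup_single when_def in_keys_iff)
  then show ?case using update single sum by simp
qed

lemma mpoly_deriv_mult:
  "mpoly_deriv i (p * q) = mpoly_deriv i p * q + p * mpoly_deriv i q"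
proof (induction p rule: poly_mapping_induct)
  case (single m c)
  show ?case
  proof (induction q rule: poly_mapping_induct)
    case (single n d)
    have eq: "m - single i 1 + n = m + n - single i 1"
      if "lookup m i \<noteq> 0" for m n :: "nat \<Rightarrow>\<^sub>0 nat"
      using that by (intro poly_mapping_eqI) (auto simp: lookup_add lookup_minus lookup_single when_def)
    show ?case
      using eq[of m n] eq[of n m]
      by (cases "lookup m i = 0"; cases "lookup n i = 0")
         (simp_all add: mult_single mpoly_deriv_single lookup_add add.commute
            flip: single_add, simp_all add: algebra_simps)
  next
    case (sum f g)
    then show ?case by (simp add: distrib_left mpoly_deriv_add)
  qed
next
  case (sum f g)
  then show ?case by (simp add: distrib_right mpoly_deriv_add algebra_simps)
qed

lift_definition ratfun_deriv :: "nat \<Rightarrow> 'k::field_char_0 ratfun \<Rightarrow> 'k ratfun" is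
  "\<lambda>i (a, b). (mpoly_deriv i a * b - a * mpoly_deriv i b, b * b)"
proof -
  fix i :: nat and x y :: "'k mpoly \<times> 'k mpoly"
  assume xy: "fractrel x y"
  obtain a b c d where [simp]: "x = (a, b)" "y = (c, d)" by (cases x, cases y)
  let ?D = "mpoly_deriv i"
  from xy have nz: "b \<noteq> 0" "d \<noteq> 0" and e: "a * d = c * b" by auto
  have "?D (a * d) = ?D (c * b)" using e by simp
  then have e': "?D a * d + a * ?D d = ?D c * b + c * ?D b" by (simp add: mpoly_deriv_mult)
  have "(?D a * b - a * ?D b) * (d * d) = b * d * (?D a * d) - (a * d) * (?D b * d)"
    by (simp add: algebra_simps)
  also have "\<dots> = b * d * (?D c * b + c * ?D b - a * ?D d) - (c * b) * (?D b * d)"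
    using e e' by (simp add: eq_diff_eq)
  also have "\<dots> = (?D c * d) * (b * b) - (a * d) * (b * ?D d)"
    by (simp add: algebra_simps)
  also have "\<dots> = (?D c * d - c * ?D d) * (b * b)"
    using e by (simp add: algebra_simps)
  finally show "fractrel (case x of (a, b) \<Rightarrow> (?D a * b - a * ?D b, b * b))
     (case y of (a, b) \<Rightarrow> (?D a * b - a * ?D b, b * b))"
    using nz by simp
qed

definition rat_of_mpoly :: "'k::field_char_0 mpoly \<Rightarrow> 'k ratfun" where
  "rat_of_mpoly p = Fraction_Field.Fract p 1"

definition rat_const :: "'k::field_char_0 \<Rightarrow> 'k ratfun" where
  "rat_const c = rat_of_mpoly (Const c)"

definition ratfun_ring :: "'k::field_char_0 ratfun ring" where
  "ratfun_ring = \<lparr>carrier = UNIV, monoid.mult = (*), one = 1, zero = 0, add = (+)\<rparr>"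


section \<open>Hyperplane arrangements\<close>

definition degree_one :: "nat \<Rightarrow> 'k::field_char_0 mpoly \<Rightarrow> bool" where
  "degree_one l p \<longleftrightarrow>
     (\<exists>b a. (\<exists>j<l. a j \<noteq> 0) \<and> p = Const b + (\<Sum>j<l. Const (a j) * Var j))"

text \<open>Points of \<open>k\<^sup>l\<close> are functions \<open>nat \<Rightarrow> 'k\<close> vanishing from index \<open>l\<close> on.\<close>

definition hyperplane :: "nat \<Rightarrow> 'k::field_char_0 mpoly \<Rightarrow> (nat \<Rightarrow> 'k) set" where
  "hyperplane l p = {x. (\<forall>j\<ge>l. x j = 0) \<and> mpoly_eval p x = 0}"

definition hyperplane_arrangement :: "nat \<Rightarrow> nat \<Rightarrow> (nat \<Rightarrow> 'k::field_char_0 mpoly) \<Rightarrow> bool" where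
  "hyperplane_arrangement l N \<alpha> \<longleftrightarrow>
     (\<forall>i<N. degree_one l (\<alpha> i)) \<and> inj_on (\<lambda>i. hyperplane l (\<alpha> i)) {..<N}"

definition coord_ring :: "nat \<Rightarrow> nat \<Rightarrow> (nat \<Rightarrow> 'k::field_char_0 mpoly) \<Rightarrow> 'k ratfun set" where
  "coord_ring l N \<alpha> = generate_ring ratfun_ring
     (Set.range rat_const \<union> (\<lambda>j. rat_of_mpoly (Var j)) ` {..<l}
        \<union> (\<lambda>i. inverse (rat_of_mpoly (\<alpha> i))) ` {..<N})"


section \<open>Differential forms\<close>

text \<open>A form is the family of its coefficients with respect to the basis \<open>dt\<^sub>J\<close>, where
  \<open>dt\<^sub>J = dt\<^bsub>j\<^sub>1\<^esub> \<and> \<dots> \<and> dt\<^bsub>j\<^sub>p\<^esub>\<close> for \<open>J = {j\<^sub>1 < \<dots> < j\<^sub>p}\<close>.\<close>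

type_synonym 'k form = "nat set \<Rightarrow>\<^sub>0 'k ratfun"

definition form_scale :: "'k::field_char_0 ratfun \<Rightarrow> 'k form \<Rightarrow> 'k form" where
  "form_scale f \<phi> = Poly_Mapping.map (\<lambda>g. f * g) \<phi>"

definition function_form :: "'k::field_char_0 ratfun \<Rightarrow> 'k form" where
  "function_form f = single {} f"

text \<open>\<open>dt\<^sub>I \<and> dt\<^sub>J = wedge_sign I J dt\<^bsub>I \<union> J\<^esub>\<close>\<close>

definition wedge_sign :: "nat set \<Rightarrow> nat set \<Rightarrow> 'k::field_char_0 ratfun" where
  "wedge_sign I J =
     (if I \<inter> J = {} then (- 1) ^ card {(i, j). i \<in> I \<and> j \<in> J \<and> j < i} else 0)"

definition wedge :: "'k::field_char_0 form \<Rightarrow> 'k form \<Rightarrow> 'k form" (infixl \<open>\<and>\<^sub>f\<close> 70) where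
  "\<phi> \<and>\<^sub>f \<psi> = (\<Sum>I\<in>keys \<phi>. \<Sum>J\<in>keys \<psi>.
     single (I \<union> J) (wedge_sign I J * lookup \<phi> I * lookup \<psi> J))"

definition ext_d :: "nat \<Rightarrow> 'k::field_char_0 form \<Rightarrow> 'k form" where
  "ext_d l \<phi> = (\<Sum>J\<in>keys \<phi>. \<Sum>i<l.
     single {i} (ratfun_deriv i (lookup \<phi> J)) \<and>\<^sub>f single J 1)"

definition forms :: "nat \<Rightarrow> nat \<Rightarrow> (nat \<Rightarrow> 'k::field_char_0 mpoly) \<Rightarrow> nat \<Rightarrow> 'k form set" where
  "forms l N \<alpha> j =
     {\<phi>. \<forall>J\<in>keys \<phi>. J \<subseteq> {..<l} \<and> card J = j \<and> lookup \<phi> J \<in> coord_ring l N \<alpha>}"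

definition dlog :: "nat \<Rightarrow> 'k::field_char_0 mpoly \<Rightarrow> 'k form" where
  "dlog l p = form_scale (inverse (rat_of_mpoly p)) (ext_d l (function_form (rat_of_mpoly p)))"


section \<open>The reduced bar construction\<close>

text \<open>The word \<open>[i\<^sub>1, \<dots>, i\<^sub>m]\<close> stands for the symbol
  \<open>[\<omega>\<^bsub>i\<^sub>1\<^esub>| \<dots> |\<omega>\<^bsub>i\<^sub>m\<^esub>]\<close>.\<close>

type_synonym word = "nat list"

text \<open>\<open>\<Sum>\<^sub>I c\<^sub>I \<omega>\<^bsub>i\<^sub>1\<^esub> \<otimes> \<dots> \<otimes> (\<omega>\<^bsub>i\<^sub>j\<^esub> \<and> \<omega>\<^bsub>i\<^sub>j\<^sub>+\<^sub>1\<^esub>) \<otimes> \<dots> \<otimes> \<omega>\<^bsub>i\<^sub>m\<^esub>\<close>, where positions are counted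
  from 0 and \<open>(u, v)\<close> indexes the basis of the tensor factors to the left and to the right of the
  two-form.\<close>

definition wedge_at ::
    "nat \<Rightarrow> (nat \<Rightarrow> 'k::field_char_0 mpoly) \<Rightarrow> nat \<Rightarrow> (word \<Rightarrow>\<^sub>0 'k) \<Rightarrow> (word \<times> word) \<Rightarrow>\<^sub>0 'k form" where
  "wedge_at l \<alpha> j c = (\<Sum>I\<in>keys c. single (take j I, drop (j + 2) I)
     (form_scale (rat_const (lookup c I)) (dlog l (\<alpha> (I ! j)) \<and>\<^sub>f dlog l (\<alpha> (I ! (j + 1))))))"

text \<open>For \<open>m \<le> 1\<close> the integrability condition is void, so \<open>V\<^sub>0 = k\<close> and \<open>V\<^sub>1\<close> is spanned by
  the letters.\<close>

definition integrable_words ::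
    "nat \<Rightarrow> nat \<Rightarrow> (nat \<Rightarrow> 'k::field_char_0 mpoly) \<Rightarrow> nat \<Rightarrow> (word \<Rightarrow>\<^sub>0 'k) set" where
  "integrable_words l N \<alpha> m =
     {c. (\<forall>I\<in>keys c. length I = m \<and> set I \<subseteq> {..<N}) \<and>
         (\<forall>j. j + 1 < m \<longrightarrow> wedge_at l \<alpha> j c = 0)}"

definition bar_words ::
    "nat \<Rightarrow> nat \<Rightarrow> (nat \<Rightarrow> 'k::field_char_0 mpoly) \<Rightarrow> (word \<Rightarrow>\<^sub>0 'k) set" where
  "bar_words l N \<alpha> = {\<Sum>m<n. v m | n v. \<forall>m<n. v m \<in> integrable_words l N \<alpha> m}"

text \<open>As \<open>k\<close> is a field, \<open>\<O>\<^sub>M \<otimes> \<Oplus>\<^sub>m V\<^sub>m\<close> embeds into the tensor product of \<open>\<O>\<^sub>M\<close> with the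
  space spanned by all words, i.e. into the finitely supported functions from words to \<open>\<O>\<^sub>M\<close>;
  similarly for the forms.\<close>

definition bar_carrier ::
    "nat \<Rightarrow> nat \<Rightarrow> (nat \<Rightarrow> 'k::field_char_0 mpoly) \<Rightarrow> (word \<Rightarrow>\<^sub>0 'k ratfun) set" where
  "bar_carrier l N \<alpha> =
     {\<Sum>a<n. Poly_Mapping.map (\<lambda>c. rat_const c * f a) (v a) | (n::nat) f v.
        \<forall>a<n. f a \<in> coord_ring l N \<alpha> \<and> v a \<in> bar_words l N \<alpha>}"

definition bar_forms ::
    "nat \<Rightarrow> nat \<Rightarrow> (nat \<Rightarrow> 'k::field_char_0 mpoly) \<Rightarrow> nat \<Rightarrow> (word \<Rightarrow>\<^sub>0 'k form) set" where
  "bar_forms l N \<alpha> j =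
     {\<Sum>a<n. Poly_Mapping.map (\<lambda>c. form_scale (rat_const c) (\<phi> a)) (v a) | (n::nat) \<phi> v.
        \<forall>a<n. \<phi> a \<in> forms l N \<alpha> j \<and> v a \<in> bar_words l N \<alpha>}"

text \<open>The library function \<open>shuffles\<close> yields a set and hence forgets multiplicities.\<close>

fun shuffle_words :: "'a list \<Rightarrow> 'a list \<Rightarrow> 'a list multiset" where
  "shuffle_words [] v = {#v#}"
| "shuffle_words u [] = {#u#}"
| "shuffle_words (a # u) (b # v) =
     image_mset ((#) a) (shuffle_words u (b # v)) + image_mset ((#) b) (shuffle_words (a # u) v)"

definition bar_mult ::
    "(word \<Rightarrow>\<^sub>0 'k::field_char_0 ratfun) \<Rightarrow> (word \<Rightarrow>\<^sub>0 'k ratfun) \<Rightarrow> (word \<Rightarrow>\<^sub>0 'k ratfun)" where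
  "bar_mult f g = (\<Sum>u\<in>keys f. \<Sum>v\<in>keys g. \<Sum>w\<in>#shuffle_words u v.
     single w (lookup f u * lookup g v))"

definition bar_ring ::
    "nat \<Rightarrow> nat \<Rightarrow> (nat \<Rightarrow> 'k::field_char_0 mpoly) \<Rightarrow> (word \<Rightarrow>\<^sub>0 'k ratfun) ring" where
  "bar_ring l N \<alpha> =
     \<lparr>carrier = bar_carrier l N \<alpha>, monoid.mult = bar_mult, one = single [] 1,
      zero = 0, add = (+)\<rparr>"

definition bar_function :: "'k::field_char_0 ratfun \<Rightarrow> (word \<Rightarrow>\<^sub>0 'k ratfun)" where
  "bar_function f = single [] f"

text \<open>The differential on forms of degree \<open>j\<close>.\<close>

definition bar_d ::
    "nat \<Rightarrow> (nat \<Rightarrow> 'k::field_char_0 mpoly) \<Rightarrow> nat \<Rightarrow> (word \<Rightarrow>\<^sub>0 'k form) \<Rightarrow> (word \<Rightarrow>\<^sub>0 'k form)" where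
  "bar_d l \<alpha> j x =
     (\<Sum>I\<in>keys x. single I (ext_d l (lookup x I))) +
     (\<Sum>I\<in>keys x - {[]}. single (tl I)
        (form_scale ((- 1) ^ j) (lookup x I \<and>\<^sub>f dlog l (\<alpha> (hd I)))))"

text \<open>\<open>\<partial>\<^sub>i f\<close> is the coefficient of \<open>dt\<^sub>i\<close> in \<open>df\<close>.\<close>

definition bar_deriv ::
    "nat \<Rightarrow> (nat \<Rightarrow> 'k::field_char_0 mpoly) \<Rightarrow> nat \<Rightarrow> (word \<Rightarrow>\<^sub>0 'k ratfun) \<Rightarrow> (word \<Rightarrow>\<^sub>0 'k ratfun)" where
  "bar_deriv l \<alpha> i f =
     Poly_Mapping.map (\<lambda>\<phi>. lookup \<phi> {i}) (bar_d l \<alpha> 0 (Poly_Mapping.map function_form f))"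

definition bar_cocycles ::
    "nat \<Rightarrow> nat \<Rightarrow> (nat \<Rightarrow> 'k::field_char_0 mpoly) \<Rightarrow> nat \<Rightarrow> (word \<Rightarrow>\<^sub>0 'k form) monoid" where
  "bar_cocycles l N \<alpha> j =
     \<lparr>carrier = {x \<in> bar_forms l N \<alpha> j. bar_d l \<alpha> j x = 0}, monoid.mult = (+), one = 0\<rparr>"

definition bar_coboundaries ::
    "nat \<Rightarrow> nat \<Rightarrow> (nat \<Rightarrow> 'k::field_char_0 mpoly) \<Rightarrow> nat \<Rightarrow> (word \<Rightarrow>\<^sub>0 'k form) set" where
  "bar_coboundaries l N \<alpha> j =
     (if j = 0 then {0} else bar_d l \<alpha> (j - 1) ` bar_forms l N \<alpha> (j - 1))"

definition H_DR ::
    "nat \<Rightarrow> nat \<Rightarrow> (nat \<Rightarrow> 'k::field_char_0 mpoly) \<Rightarrow> nat \<Rightarrow> (word \<Rightarrow>\<^sub>0 'k form) set monoid" where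
  "H_DR l N \<alpha> j = bar_cocycles l N \<alpha> j Mod bar_coboundaries l N \<alpha> j"

end

theory Submission
  imports Defs
begin

text \<open>The key input on the arrangement is that the cohomology of \<open>M\<close> is carried by logarithmic
  forms: every closed one-form is an exact form plus a combination of the \<open>\<omega>\<^sub>i\<close>, and a combination of
  the \<open>\<omega>\<^sub>i \<and> \<omega>\<^sub>j\<close> that is the differential of a one-form is zero. Both are proved by induction on the
  number of hyperplanes: one lowers the pole order along the last hyperplane and studies the residue,
  a function or a form on the restricted arrangement. The \<open>\<omega>\<^sub>i\<close> are moreover independent modulo exact
  forms.

  In \<open>B(M)\<close> one argues on words of maximal length. Their coefficients in a constant are constants of
  \<open>\<O>\<^sub>M\<close>, and the coefficients of the next shorter words would exhibit a combination of the \<open>\<omega>\<^sub>i\<close> as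
  exact. Similarly differential ideals contain elements of smaller and smaller length, and a closed
  one-form is made exact from the longest words downwards, where integrability of the correcting word
  is the statement on two-forms.

  Deleting the first letter is a derivation for the shuffle product, so a minimal algebraic relation
  between primitives can be differentiated, as in Ostrowski's theorem: bases of \<open>V\<^sub>n\<close> modulo products
  of words of smaller length are polynomial generators.\<close>

section \<open>Polynomials in several variables\<close>

text \<open>On restriction to the last hyperplane some of the other functions become constant and
  some become proportional, so the induction leaves the class of arrangements. Exact logarithmic
  forms are therefore studied for arbitrary nonzero affine functions, with a set \<open>Z\<close>
  that collects the coefficient vectors of such degenerate relations. For two-forms these relations
  lift: a constant restriction gives a vanishing product with \<open>d\<alpha>\<close>, and
  proportional restrictions come from three linearly dependent functions, hence from an Arnold
  relation. The number of variables is not lowered: functions on the hyperplane are represented by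
  their pullbacks under a projection. Characteristic 0 is used to divide by exponents and pole
  orders. Bar elements live in the shuffle algebra over the whole field of rational functions, where
  all operations are total; \<open>V\<close> and \<open>B\<close> are subsets of it. Integrability
  becomes the vanishing of a curvature, the commutator of the derivations on words. Curvature is
  itself a derivation, which makes \<open>V\<close> closed under shuffles.\<close>

lemma Const_add: "Const (a + b) = Const a + Const b"
  by (simp add: Const_def single_add)

lemma Const_mult: "Const (a * b) = Const a * Const b"
  by (simp add: Const_def mult_single)

lemma Const_0 [simp]: "Const 0 = 0"
  by (simp add: Const_def)

lemma Const_1 [simp]: "Const 1 = 1"
  by (simp add: Const_def)

lemma Const_eq_iff [simp]: "Const a = Const b \<longleftrightarrow> a = b"
  by (metis Const_def lookup_single_eq)

lemma Const_eq_0_iff [simp]: "Const a = 0 \<longleftrightarrow> a = 0"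
  using Const_eq_iff[of a 0] by simp

lemma Const_uminus: "Const (- a) = - Const a"
  by (simp add: Const_def single_uminus)

lemma lookup_Const_mult: "lookup (Const c * p) m = c * lookup p m"
  by (simp add: Const_def flip: mult_map_scale_conv_mult)
     (simp add: Poly_Mapping.map.rep_eq when_def)

lemma mpoly_induct [case_names Const Var add mult]:
  fixes p :: "'k::field_char_0 mpoly"
  assumes C: "\<And>c. P (Const c)" and V: "\<And>i. P (Var i)"
    and A: "\<And>p q. P p \<Longrightarrow> P q \<Longrightarrow> P (p + q)"
    and M: "\<And>p q. P p \<Longrightarrow> P q \<Longrightarrow> P (p * q)"
  shows "P p"
proof (induction p rule: poly_mapping_induct)
  case (single m c)
  have "P (single m 1)"
  proof (induction m rule: poly_mapping_induct)
    case (single i n)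
    show ?case
    proof (induction n)
      case 0
      show ?case using C[of 1] by simp
    next
      case (Suc n)
      have "single (single i (Suc n)) (1::'k) = Var i * single (single i n) 1"
        by (simp add: Var_def mult_single flip: single_add)
      with M[OF V Suc] show ?case by simp
    qed
  next
    case (sum f g)
    from M[OF this] show ?case by (simp add: mult_single)
  qed
  from M[OF C[of c] this] show ?case by (simp add: Const_def mult_single)
next
  case (sum f g)
  then show ?case by (rule A)
qed

section \<open>Polynomials in the first \<open>l\<close> variables\<close>

definition mpolys :: "nat \<Rightarrow> 'k::field_char_0 mpoly set" where
  "mpolys l = {p. \<forall>m\<in>keys p. keys m \<subseteq> {..<l}}"

lemma mpolys_Const [simp]: "Const c \<in> mpolys l"
  by (auto simp: mpolys_def Const_def)

lemma mpolys_0 [simp]: "0 \<in> mpolys l"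
  by (auto simp: mpolys_def)

lemma mpolys_1 [simp]: "1 \<in> mpolys l"
  using mpolys_Const[of 1] by simp

lemma mpolys_Var [simp]: "j < l \<Longrightarrow> Var j \<in> mpolys l"
  by (auto simp: mpolys_def Var_def)

lemma mpolys_add: "p \<in> mpolys l \<Longrightarrow> q \<in> mpolys l \<Longrightarrow> p + q \<in> mpolys l"
  using Poly_Mapping.keys_add[of p q] by (auto simp: mpolys_def)

lemma mpolys_uminus: "p \<in> mpolys l \<Longrightarrow> - p \<in> mpolys l"
  by (auto simp: mpolys_def)

lemma mpolys_diff: "p \<in> mpolys l \<Longrightarrow> q \<in> mpolys l \<Longrightarrow> p - q \<in> mpolys l"
  using mpolys_add[of p l "- q"] mpolys_uminus by auto

lemma mpolys_mult:
  assumes "p \<in> mpolys l" "q \<in> mpolys l" shows "p * q \<in> mpolys l"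
proof -
  have "keys m \<subseteq> {..<l}" if m: "m \<in> keys (p * q)" for m
  proof -
    from m obtain a b where ab: "m = a + b" "a \<in> keys p" "b \<in> keys q"
      using keys_mult[of p q] by blast
    have "keys m \<subseteq> keys a \<union> keys b" unfolding ab by (rule Poly_Mapping.keys_add)
    also have "\<dots> \<subseteq> {..<l}" using ab assms by (auto simp: mpolys_def)
    finally show ?thesis .
  qed
  then show ?thesis by (simp add: mpolys_def)
qed

lemma mpolys_sum: "(\<And>i. i \<in> A \<Longrightarrow> f i \<in> mpolys l) \<Longrightarrow> sum f A \<in> mpolys l"
  by (induction A rule: infinite_finite_induct) (auto intro: mpolys_add)

lemma mpolys_prod: "(\<And>i. i \<in> A \<Longrightarrow> f i \<in> mpolys l) \<Longrightarrow> prod f A \<in> mpolys l"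
  by (induction A rule: infinite_finite_induct) (auto intro: mpolys_mult)

lemma mpolys_power: "p \<in> mpolys l \<Longrightarrow> p ^ n \<in> mpolys l"
  by (induction n) (auto intro: mpolys_mult)

lemma mpolys_mono: "p \<in> mpolys l \<Longrightarrow> l \<le> l' \<Longrightarrow> p \<in> mpolys l'"
  by (fastforce simp: mpolys_def)

lemma sum_single_keys: "(\<Sum>m\<in>keys p. single m (lookup p m)) = p"
  by (intro poly_mapping_eqI) (auto simp: lookup_sum lookup_single when_def in_keys_iff sum.delta)

lemma mpolys_induct [consumes 1, case_names Const Var add mult]:
  assumes p: "p \<in> mpolys l"
    and C: "\<And>c. P (Const c)" and V: "\<And>i. i < l \<Longrightarrow> P (Var i)"
    and A: "\<And>p q. p \<in> mpolys l \<Longrightarrow> q \<in> mpolys l \<Longrightarrow> P p \<Longrightarrow> P q \<Longrightarrow> P (p + q)"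
    and M: "\<And>p q. p \<in> mpolys l \<Longrightarrow> q \<in> mpolys l \<Longrightarrow> P p \<Longrightarrow> P q \<Longrightarrow> P (p * q)"
  shows "P (p :: 'k::field_char_0 mpoly)"
proof -
  let ?Q = "\<lambda>p. p \<in> mpolys l \<and> P p"
  have pow: "?Q (single (single i n) 1)" if "i < l" for i n
  proof (induction n)
    case 0
    show ?case using C[of 1] by simp
  next
    case (Suc n)
    have "single (single i (Suc n)) (1::'k) = Var i * single (single i n) 1"
      by (simp add: Var_def mult_single flip: single_add)
    with M V[OF that] Suc that show ?case by (simp add: mpolys_mult)
  qed
  have mon: "?Q (single (\<Sum>i\<in>I. single i (e i)) 1)" if "finite I" "I \<subseteq> {..<l}" for I e
    using that
  proof (induction I rule: finite_induct)
    case empty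
    show ?case using C[of 1] by simp
  next
    case (insert i I)
    have "single (\<Sum>i\<in>insert i I. single i (e i)) (1::'k) =
        single (single i (e i)) 1 * single (\<Sum>i\<in>I. single i (e i)) 1"
      using insert by (simp add: mult_single)
    with insert pow[of i "e i"] M show ?case by (simp add: mpolys_mult)
  qed
  have "?Q (single m c)" if "keys m \<subseteq> {..<l}" for m c
  proof -
    have "single m c = Const c * single (\<Sum>i\<in>keys m. single i (lookup m i)) 1"
      by (simp add: sum_single_keys Const_def mult_single)
    with mon[OF finite_keys that, of "lookup m"] C M show ?thesis by (simp add: mpolys_mult)
  qed
  moreover have "keys m \<subseteq> {..<l}" if "m \<in> keys p" for m
    using p that by (auto simp: mpolys_def)
  moreover have "?Q (sum f S)" if "\<And>m. m \<in> S \<Longrightarrow> ?Q (f m)" "finite S" for f :: "(nat \<Rightarrow>\<^sub>0 nat) \<Rightarrow> 'k mpoly" and S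
    using that(2,1) C[of 0] A by (induction S rule: finite_induct) (auto intro: mpolys_add)
  ultimately have "?Q (\<Sum>m\<in>keys p. single m (lookup p m))" by simp
  then show ?thesis by (simp add: sum_single_keys)
qed

section \<open>Partial derivatives and their kernels\<close>

lemma lookup_mpoly_deriv:
  "lookup (mpoly_deriv i p) m = of_nat (lookup m i + 1) * lookup p (m + single i 1)"
proof -
  have "lookup (mpoly_deriv i p) m =
     (\<Sum>n\<in>keys p. of_nat (lookup n i) * lookup p n when n - single i 1 = m)"
    by (simp add: mpoly_deriv_def lookup_sum lookup_single)
  also have "\<dots> = (\<Sum>n\<in>keys p. of_nat (lookup n i) * lookup p n when n = m + single i 1)"
  proof (rule sum.cong[OF refl], goal_cases)
    case (1 n)
    show ?case
    proof (cases "lookup n i = 0")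
      case False
      have "n - single i 1 = m \<longleftrightarrow> n = m + single i 1"
      proof
        assume *: "n - single i 1 = m"
        show "n = m + single i 1" unfolding *[symmetric] using False
          by (intro poly_mapping_eqI) (auto simp: lookup_add lookup_minus lookup_single when_def)
      qed simp
      then show ?thesis by simp
    qed simp
  qed
  also have "\<dots> = of_nat (lookup m i + 1) * lookup p (m + single i 1)"
    by (simp add: when_def sum.delta lookup_add in_keys_iff)
  finally show ?thesis .
qed

lemma mpoly_deriv_commute: "mpoly_deriv i (mpoly_deriv j p) = mpoly_deriv j (mpoly_deriv i p)"
  by (intro poly_mapping_eqI)
     (auto simp: lookup_mpoly_deriv lookup_add lookup_single when_def algebra_simps)

lemma mpoly_deriv_Const [simp]: "mpoly_deriv i (Const c) = 0"
  by (simp add: Const_def mpoly_deriv_single)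

lemma mpoly_deriv_Var: "mpoly_deriv i (Var j) = (if i = j then 1 else 0)"
  by (auto simp: Var_def mpoly_deriv_single lookup_single when_def)

lemma mpoly_deriv_0 [simp]: "mpoly_deriv i 0 = 0"
  using mpoly_deriv_Const[of i 0] by simp

lemma mpoly_deriv_1 [simp]: "mpoly_deriv i 1 = 0"
  using mpoly_deriv_Const[of i 1] by simp

lemma mpoly_deriv_uminus: "mpoly_deriv i (- p) = - mpoly_deriv i p"
  using mpoly_deriv_add[of i p "- p"] by (simp add: eq_neg_iff_add_eq_0 add.commute)

lemma mpoly_deriv_diff: "mpoly_deriv i (p - q) = mpoly_deriv i p - mpoly_deriv i q"
  using mpoly_deriv_add[of i p "- q"] by (simp add: mpoly_deriv_uminus)

lemma mpoly_deriv_sum: "mpoly_deriv i (sum f A) = (\<Sum>a\<in>A. mpoly_deriv i (f a))"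
  by (induction A rule: infinite_finite_induct) (auto simp: mpoly_deriv_add)

lemma mpolys_deriv: "p \<in> mpolys l \<Longrightarrow> mpoly_deriv i p \<in> mpolys l"
  by (induction rule: mpolys_induct)
     (auto simp: mpoly_deriv_Var mpoly_deriv_add mpoly_deriv_mult intro: mpolys_add mpolys_mult)

lemma mpolys_deriv_eq_0: "p \<in> mpolys l \<Longrightarrow> l \<le> i \<Longrightarrow> mpoly_deriv i p = 0"
  by (induction rule: mpolys_induct) (auto simp: mpoly_deriv_Var mpoly_deriv_add mpoly_deriv_mult)

lemma split_key:
  assumes "lookup m i \<noteq> (0::nat)"
  obtains n where "m = n + single i 1"
proof
  show "m = (m - single i 1) + single i 1"
    using assms by (intro poly_mapping_eqI) (auto simp: lookup_add lookup_minus lookup_single when_def)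
qed

text \<open>Differentiation shifts the monomials containing the variable injectively, so nothing
  cancels, and the exponents it multiplies by are invertible in characteristic 0.\<close>

lemma deriv_eq_0_keys:
  assumes "mpoly_deriv i p = 0" "m \<in> keys p" shows "lookup m i = 0"
proof (rule ccontr)
  assume "lookup m i \<noteq> 0"
  then obtain n where n: "m = n + single i 1" by (rule split_key)
  have "of_nat (lookup n i + 1) * lookup p m = 0"
    using lookup_mpoly_deriv[of i p n] assms(1) n by simp
  with assms(2) show False by (simp add: in_keys_iff del: of_nat_Suc)
qed

lemma mpolys_lessI:
  assumes "p \<in> mpolys (Suc l)" "mpoly_deriv l p = 0" shows "p \<in> mpolys l"
proof -
  have "keys m \<subseteq> {..<l}" if "m \<in> keys p" for m
  proof
    fix i assume i: "i \<in> keys m"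
    with assms(1) that have "i < Suc l" by (auto simp: mpolys_def)
    moreover have "i \<noteq> l" using deriv_eq_0_keys[OF assms(2) that] i by (auto simp: in_keys_iff)
    ultimately show "i \<in> {..<l}" by simp
  qed
  then show ?thesis by (simp add: mpolys_def)
qed

lemma mpolys_zero_Const:
  assumes "p \<in> mpolys 0" obtains c where "p = Const c"
proof
  have "keys p \<subseteq> {0}" using assms by (auto simp: mpolys_def)
  then show "p = Const (lookup p 0)"
    by (intro poly_mapping_eqI) (auto simp: Const_def lookup_single when_def in_keys_iff)
qed

lemma mpolys_derivs_eq_0:
  assumes "p \<in> mpolys l" "\<And>i. i < l \<Longrightarrow> mpoly_deriv i p = 0"
  obtains c where "p = Const c"
  using assms
proof (induction l arbitrary: thesis)
  case 0
  then show ?case using mpolys_zero_Const by blast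
next
  case (Suc l)
  have "p \<in> mpolys l" by (rule mpolys_lessI[OF Suc.prems(2) Suc.prems(3)]) simp
  then show ?case using Suc.IH[OF Suc.prems(1)] Suc.prems(3) by simp
qed

text \<open>A bound on the total degree instead of a degree function, so the zero polynomial needs
  no convention. Differentiation lowers the bound, which makes it the induction measure wherever a
  polynomial is differentiated down to a constant.\<close>

definition bounded_degree :: "nat \<Rightarrow> 'k::field_char_0 mpoly \<Rightarrow> bool" where
  "bounded_degree d p \<longleftrightarrow> (\<forall>m\<in>keys p. (\<Sum>i\<in>keys m. lookup m i) \<le> d)"

lemma bounded_degree_exists: "\<exists>d. bounded_degree d p"
proof -
  let ?s = "\<lambda>m. \<Sum>i\<in>keys m. lookup m i"
  have "bounded_degree (Max (?s ` keys p)) p"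
    by (auto simp: bounded_degree_def intro: Max_ge)
  then show ?thesis ..
qed

lemma keys_plus_single_sum:
  "(\<Sum>i\<in>keys (m + single j 1). lookup (m + single j 1) i) = Suc (\<Sum>i\<in>keys m. lookup m i)"
proof -
  let ?A = "insert j (keys m)"
  have "(\<Sum>i\<in>keys (m + single j 1). lookup (m + single j 1) i) =
      (\<Sum>i\<in>?A. lookup m i + lookup (single j (1::nat)) i)"
    by (rule sum.mono_neutral_cong_left)
       (auto simp: in_keys_iff lookup_add lookup_single when_def split: if_splits)
  also have "\<dots> = (\<Sum>i\<in>?A. lookup m i) + (\<Sum>i\<in>?A. lookup (single j (1::nat)) i)"
    by (rule sum.distrib)
  also have "(\<Sum>i\<in>?A. lookup m i) = (\<Sum>i\<in>keys m. lookup m i)"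
    by (rule sum.mono_neutral_right) (auto simp: in_keys_iff)
  also have "(\<Sum>i\<in>?A. lookup (single j (1::nat)) i) = 1"
    by (simp add: lookup_single when_def sum.delta)
  finally show ?thesis by simp
qed

lemma bounded_degree_deriv:
  assumes "bounded_degree (Suc d) p" shows "bounded_degree d (mpoly_deriv i p)"
  unfolding bounded_degree_def
proof
  fix m assume "m \<in> keys (mpoly_deriv i p)"
  then have "m + single i 1 \<in> keys p"
    by (auto simp: in_keys_iff lookup_mpoly_deriv)
  with assms have "(\<Sum>j\<in>keys (m + single i 1). lookup (m + single i 1) j) \<le> Suc d"
    by (auto simp: bounded_degree_def)
  then show "(\<Sum>j\<in>keys m. lookup m j) \<le> d"
    using keys_plus_single_sum[of m i] by simp
qed

lemma bounded_degree_0: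
  assumes "bounded_degree 0 p" obtains c where "p = Const c"
proof
  have "keys p \<subseteq> {0}"
  proof
    fix m assume "m \<in> keys p"
    with assms have "\<forall>i\<in>keys m. lookup m i = 0" by (auto simp: bounded_degree_def)
    then have "lookup m i = 0" for i by (cases "i \<in> keys m") (auto simp: in_keys_iff)
    then have "m = 0" by (intro poly_mapping_eqI) simp
    then show "m \<in> {0}" by simp
  qed
  then show "p = Const (lookup p 0)"
    by (intro poly_mapping_eqI) (auto simp: Const_def lookup_single when_def in_keys_iff)
qed

text \<open>Monomialwise integration: the exponent of the variable \<open>i\<close> is raised and
  the coefficient divided by the new exponent. Variables other than \<open>i\<close> that are absent
  from \<open>p\<close> stay absent from \<open>q\<close>.\<close>

lemma ex_antiderivative:
  assumes "p \<in> mpolys l" "i < l"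
  obtains q where "q \<in> mpolys l" "mpoly_deriv i q = p"
    "\<And>j. mpoly_deriv j p = 0 \<Longrightarrow> j \<noteq> i \<Longrightarrow> mpoly_deriv j q = 0"
proof -
  define q where "q = (\<Sum>m\<in>keys p. single (m + single i 1) (lookup p m / of_nat (lookup m i + 1)))"
  have D: "mpoly_deriv j q =
    (\<Sum>m\<in>keys p. single (m + single i 1 - single j 1)
       (of_nat (lookup (m + single i 1) j) * (lookup p m / of_nat (lookup m i + 1))))" for j
    by (simp add: q_def mpoly_deriv_sum mpoly_deriv_single)
  have eq: "of_nat (lookup (m + single i 1) i) * (lookup p m / of_nat (lookup m i + 1)) = lookup p m" for m
    by (simp add: lookup_add del: of_nat_Suc)
  have "mpoly_deriv i q = p" unfolding D eq by (simp add: sum_single_keys)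
  moreover have "mpoly_deriv j q = 0" if "mpoly_deriv j p = 0" "j \<noteq> i" for j
    unfolding D using deriv_eq_0_keys[OF that(1)] that(2)
    by (intro sum.neutral) (auto simp: lookup_add lookup_single when_def)
  moreover have "q \<in> mpolys l"
    unfolding q_def
  proof (rule mpolys_sum)
    fix m assume "m \<in> keys p"
    then have "keys m \<subseteq> {..<l}" using assms by (auto simp: mpolys_def)
    then have "keys (m + single i 1) \<subseteq> {..<l}"
      using Poly_Mapping.keys_add[of m "single i 1"] assms(2) by auto
    then show "single (m + single i 1) (lookup p m / of_nat (lookup m i + 1)) \<in> mpolys l"
      by (auto simp: mpolys_def)
  qed
  ultimately show ?thesis using that by blast
qed

text \<open>Integrating the last component and subtracting the differential of the result leaves
  components that closedness makes independent of the last variable: a closed form in one variable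
  fewer.\<close>

lemma polynomial_poincare:
  assumes "\<And>j. j < l \<Longrightarrow> p j \<in> mpolys l"
    and "\<And>i j. i < l \<Longrightarrow> j < l \<Longrightarrow> mpoly_deriv i (p j) = mpoly_deriv j (p i)"
  obtains q where "q \<in> mpolys l" "\<And>j. j < l \<Longrightarrow> mpoly_deriv j q = p j"
  using assms
proof (induction l arbitrary: p thesis)
  case 0
  then show ?case using mpolys_0 by blast
next
  case (Suc l)
  obtain q where q: "q \<in> mpolys (Suc l)" "mpoly_deriv l q = p l"
    using ex_antiderivative[OF Suc.prems(2), of l l] by blast
  define p' where "p' j = p j - mpoly_deriv j q" for j
  have p': "p' j \<in> mpolys l" if "j < l" for j
  proof (rule mpolys_lessI)
    show "p' j \<in> mpolys (Suc l)"
      unfolding p'_def using that q Suc.prems by (intro mpolys_diff mpolys_deriv) auto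
    show "mpoly_deriv l (p' j) = 0"
      using Suc.prems(3)[of l j] that
      by (simp add: p'_def mpoly_deriv_diff mpoly_deriv_commute[of l j] q)
  qed
  have "mpoly_deriv i (p' j) = mpoly_deriv j (p' i)" if "i < l" "j < l" for i j
    using Suc.prems(3)[of i j] that by (simp add: p'_def mpoly_deriv_diff mpoly_deriv_commute[of i j])
  then obtain r where r: "r \<in> mpolys l" "\<And>j. j < l \<Longrightarrow> mpoly_deriv j r = p' j"
    using Suc.IH[of p'] p' by blast
  show ?case
  proof (rule Suc.prems(1))
    show "q + r \<in> mpolys (Suc l)" using q r mpolys_mono[of r l "Suc l"] by (auto intro: mpolys_add)
    show "mpoly_deriv j (q + r) = p j" if "j < Suc l" for j
    proof (cases "j = l")
      case True
      then show ?thesis using q r mpolys_deriv_eq_0[of r l l] by (simp add: mpoly_deriv_add)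
    next
      case False
      then have "mpoly_deriv j r = p' j" using r that by simp
      then show ?thesis by (simp add: mpoly_deriv_add p'_def)
    qed
  qed
qed


section \<open>Derivations of the field of rational functions\<close>

lemma rat_of_mpoly_0 [simp]: "rat_of_mpoly 0 = 0"
  by (simp add: rat_of_mpoly_def Zero_fract_def)

lemma rat_of_mpoly_1 [simp]: "rat_of_mpoly 1 = 1"
  by (simp add: rat_of_mpoly_def One_fract_def)

lemma rat_of_mpoly_add: "rat_of_mpoly (p + q) = rat_of_mpoly p + rat_of_mpoly q"
  by (simp add: rat_of_mpoly_def)

lemma rat_of_mpoly_mult: "rat_of_mpoly (p * q) = rat_of_mpoly p * rat_of_mpoly q"
  by (simp add: rat_of_mpoly_def)

lemma rat_of_mpoly_uminus: "rat_of_mpoly (- p) = - rat_of_mpoly p"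
  by (simp add: rat_of_mpoly_def)

lemma rat_of_mpoly_diff: "rat_of_mpoly (p - q) = rat_of_mpoly p - rat_of_mpoly q"
  by (simp add: rat_of_mpoly_def)

lemma rat_of_mpoly_power: "rat_of_mpoly (p ^ n) = rat_of_mpoly p ^ n"
  by (induction n) (simp_all add: rat_of_mpoly_mult)

lemma rat_of_mpoly_eq_iff [simp]: "rat_of_mpoly p = rat_of_mpoly q \<longleftrightarrow> p = q"
  by (simp add: rat_of_mpoly_def eq_fract)

lemma rat_of_mpoly_eq_0_iff [simp]: "rat_of_mpoly p = 0 \<longleftrightarrow> p = 0"
  using rat_of_mpoly_eq_iff[of p 0] by (simp del: rat_of_mpoly_eq_iff)

lemma rat_const_add: "rat_const (a + b) = rat_const a + rat_const b"
  by (simp add: rat_const_def Const_add rat_of_mpoly_add)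

lemma rat_const_mult: "rat_const (a * b) = rat_const a * rat_const b"
  by (simp add: rat_const_def Const_mult rat_of_mpoly_mult)

lemma rat_const_uminus: "rat_const (- a) = - rat_const a"
  by (simp add: rat_const_def Const_uminus rat_of_mpoly_uminus)

lemma rat_const_diff: "rat_const (a - b) = rat_const a - rat_const b"
  using rat_const_add[of a "- b"] by (simp add: rat_const_uminus)

lemma rat_const_0 [simp]: "rat_const 0 = 0"
  by (simp add: rat_const_def)

lemma rat_const_1 [simp]: "rat_const 1 = 1"
  by (simp add: rat_const_def)

lemma rat_const_eq_iff [simp]: "rat_const a = rat_const b \<longleftrightarrow> a = b"
  by (simp add: rat_const_def)

lemma rat_const_eq_0_iff [simp]: "rat_const a = 0 \<longleftrightarrow> a = 0"
  by (simp add: rat_const_def)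

lemma rat_const_inverse: "rat_const (inverse a) = inverse (rat_const a)"
proof (cases "a = 0")
  case False
  then have "rat_const (inverse a) * rat_const a = 1" by (simp flip: rat_const_mult)
  then show ?thesis by (metis inverse_unique mult.commute)
qed simp

lemma rat_const_of_nat: "rat_const (of_nat n) = of_nat n"
  by (induction n) (simp_all add: rat_const_add)

lemma rat_const_sum: "rat_const (sum f A) = (\<Sum>i\<in>A. rat_const (f i))"
  by (induction A rule: infinite_finite_induct) (simp_all add: rat_const_add)

lemma ratfun_deriv_Fract:
  assumes "b \<noteq> 0" shows "ratfun_deriv i (Fraction_Field.Fract a b) =
     Fraction_Field.Fract (mpoly_deriv i a * b - a * mpoly_deriv i b) (b * b)"
proof -
  have F: "Fraction_Field.Fract c d = abs_fract (c, d)" if "d \<noteq> 0" for c d :: "'k::field_char_0 mpoly"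
    using that by (simp add: Fraction_Field.Fract_def)
  have "fractrel (a, b) (a, b)" using assms by simp
  from ratfun_deriv.abs_eq[OF this, of i] show ?thesis using assms by (simp add: F)
qed

lemma ratfun_deriv_of_mpoly: "ratfun_deriv i (rat_of_mpoly p) = rat_of_mpoly (mpoly_deriv i p)"
  by (simp add: rat_of_mpoly_def ratfun_deriv_Fract)

lemma ratfun_deriv_const [simp]: "ratfun_deriv i (rat_const c) = 0"
  by (simp add: rat_const_def ratfun_deriv_of_mpoly)

lemma ratfun_deriv_0 [simp]: "ratfun_deriv i 0 = 0"
  using ratfun_deriv_const[of i 0] by (simp del: ratfun_deriv_const)

lemma ratfun_deriv_1 [simp]: "ratfun_deriv i 1 = 0"
  using ratfun_deriv_const[of i 1] by (simp del: ratfun_deriv_const)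

lemma ratfun_deriv_add: "ratfun_deriv i (f + g) = ratfun_deriv i f + ratfun_deriv i g"
proof -
  obtain a b where f: "f = Fraction_Field.Fract a b" "b \<noteq> 0" by (cases f)
  obtain c d where g: "g = Fraction_Field.Fract c d" "d \<noteq> 0" by (cases g)
  show ?thesis
    using f g by (simp add: ratfun_deriv_Fract eq_fract mpoly_deriv_add mpoly_deriv_mult)
      (simp add: algebra_simps)
qed

lemma ratfun_deriv_mult:
  "ratfun_deriv i (f * g) = ratfun_deriv i f * g + f * ratfun_deriv i g"
proof -
  obtain a b where f: "f = Fraction_Field.Fract a b" "b \<noteq> 0" by (cases f)
  obtain c d where g: "g = Fraction_Field.Fract c d" "d \<noteq> 0" by (cases g)
  show ?thesis
    using f g by (simp add: ratfun_deriv_Fract eq_fract mpoly_deriv_mult)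
      (simp add: algebra_simps)
qed

lemma ratfun_deriv_uminus: "ratfun_deriv i (- f) = - ratfun_deriv i f"
  using ratfun_deriv_add[of i f "- f"] by (simp add: eq_neg_iff_add_eq_0 add.commute)

lemma ratfun_deriv_sum: "ratfun_deriv i (sum f A) = (\<Sum>a\<in>A. ratfun_deriv i (f a))"
  by (induction A rule: infinite_finite_induct) (simp_all add: ratfun_deriv_add)

lemma ratfun_deriv_const_mult: "ratfun_deriv i (rat_const c * f) = rat_const c * ratfun_deriv i f"
  by (simp add: ratfun_deriv_mult)

lemma ratfun_deriv_inverse:
  "ratfun_deriv i (inverse f) = - ratfun_deriv i f * inverse f * inverse f"
proof (cases "f = 0")
  case False
  have "ratfun_deriv i f * inverse f + f * ratfun_deriv i (inverse f) = 0"
    using ratfun_deriv_mult[of i f "inverse f"] False by simp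
  then have "f * ratfun_deriv i (inverse f) = - ratfun_deriv i f * inverse f"
    by (simp add: eq_neg_iff_add_eq_0 add.commute)
  then show ?thesis using False by (simp add: field_simps)
qed simp

lemma ratfun_deriv_divide:
  "g \<noteq> 0 \<Longrightarrow> ratfun_deriv i (f / g) = (ratfun_deriv i f * g - f * ratfun_deriv i g) / (g * g)"
  by (simp add: ratfun_deriv_mult ratfun_deriv_inverse diff_divide_distrib)
     (simp add: ratfun_deriv_mult ratfun_deriv_inverse divide_inverse mult_ac)

lemma ratfun_deriv_power_Suc:
  "ratfun_deriv i (f ^ Suc n) = of_nat (Suc n) * f ^ n * ratfun_deriv i f"
proof (induction n)
  case (Suc n)
  have eq: "d * (f * p) + f * (k * p * d) = (1 + k) * (f * p) * d" for d p k
    by (simp only: distrib_left mult_1_right mult_1_left mult_ac)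
  have "ratfun_deriv i (f ^ Suc (Suc n)) =
      ratfun_deriv i f * (f * f ^ n) + f * (of_nat (Suc n) * f ^ n * ratfun_deriv i f)"
    unfolding power_Suc[of f "Suc n"] ratfun_deriv_mult Suc.IH by (simp only: power_Suc)
  also have "\<dots> = (1 + of_nat (Suc n)) * (f * f ^ n) * ratfun_deriv i f"
    by (rule eq)
  finally show ?case by (simp only: of_nat_Suc power_Suc)
qed simp

text \<open>The summands are kept apart by pole order: for \<open>f\<close> regular along
  \<open>g\<close>, only the second can have a pole of order \<open>n + 1\<close>. For
  \<open>g = 0\<close> both sides agree by the convention for division by 0.\<close>

lemma ratfun_deriv_divide_power:
  "ratfun_deriv i (f / g ^ n) =
    ratfun_deriv i f / g ^ n - of_nat n * f * ratfun_deriv i g / g ^ Suc n"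
proof -
  define c where "c = inverse g"
  have eq: "x / g ^ m = x * c ^ m" for x m by (simp add: c_def divide_inverse power_inverse)
  have c: "ratfun_deriv i c = - (ratfun_deriv i g * c * c)"
    by (simp add: c_def ratfun_deriv_inverse)
  have ring: "a * (c * d) + f * (k * d * - (b * c * c)) = a * (c * d) - k * f * b * (c * (c * d))"
    for a b d k by (simp only: mult_minus_right diff_conv_add_uminus mult_ac)
  show ?thesis
  proof (cases n)
    case (Suc m)
    have "ratfun_deriv i (f * c ^ Suc m) =
        ratfun_deriv i f * c ^ Suc m - of_nat (Suc m) * f * ratfun_deriv i g * c ^ Suc (Suc m)"
      unfolding ratfun_deriv_mult ratfun_deriv_power_Suc c by (simp only: power_Suc ring)
    then show ?thesis by (simp only: eq Suc)
  qed simp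
qed

lemma ratfun_cases:
  obtains p q where "f = rat_of_mpoly p / rat_of_mpoly q" "q \<noteq> 0"
proof -
  obtain a b where "f = Fraction_Field.Fract a b" "b \<noteq> 0" by (cases f)
  then have "f = rat_of_mpoly a / rat_of_mpoly b" by (simp add: rat_of_mpoly_def)
  with \<open>b \<noteq> 0\<close> show ?thesis by (rule that[rotated])
qed

text \<open>The commutator of two derivations is again a derivation and kills polynomials. Applied
  to \<open>f * q = p\<close> it shows that \<open>q\<close> times the commutator at
  \<open>f\<close> is 0.\<close>

lemma ratfun_deriv_commute: "ratfun_deriv i (ratfun_deriv j f) = ratfun_deriv j (ratfun_deriv i f)"
proof -
  obtain p q where f: "f = rat_of_mpoly p / rat_of_mpoly q" "q \<noteq> 0" by (rule ratfun_cases)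
  let ?q = "rat_of_mpoly q"
  have fq: "f * ?q = rat_of_mpoly p" using f by simp
  have "ratfun_deriv i (ratfun_deriv j (f * ?q)) = ratfun_deriv j (ratfun_deriv i (f * ?q))"
    unfolding fq by (simp add: ratfun_deriv_of_mpoly mpoly_deriv_commute)
  then have "ratfun_deriv i (ratfun_deriv j f) * ?q = ratfun_deriv j (ratfun_deriv i f) * ?q"
    by (simp add: ratfun_deriv_mult ratfun_deriv_add ratfun_deriv_of_mpoly mpoly_deriv_commute[of i j]
        algebra_simps)
  with f(2) show ?thesis by simp
qed


section \<open>The coordinate ring of the complement\<close>

lemma ratfun_ring_simps [simp]:
  "carrier ratfun_ring = UNIV" "monoid.mult ratfun_ring = (*)" "one ratfun_ring = 1"
  "ring.zero ratfun_ring = 0" "add ratfun_ring = (+)"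
  by (simp_all add: ratfun_ring_def)

lemma cring_ratfun_ring: "cring (ratfun_ring :: 'k::field_char_0 ratfun ring)"
proof (rule cringI)
  show "abelian_group (ratfun_ring :: 'k ratfun ring)"
    by (rule abelian_groupI) (auto simp: add.assoc add.commute intro: exI[of _ "- x" for x])
  show "comm_monoid (ratfun_ring :: 'k ratfun ring)"
    by (rule comm_monoidI) (auto simp: mult.assoc mult.commute)
qed (simp add: distrib_right)

lemma ratfun_ring_a_inv [simp]: "a_inv ratfun_ring f = - f"
proof -
  interpret cring "ratfun_ring :: 'k::field_char_0 ratfun ring" by (rule cring_ratfun_ring)
  show ?thesis by (rule minus_equality) auto
qed

lemma coord_ring_const [simp]: "rat_const c \<in> coord_ring l N \<alpha>"
  unfolding coord_ring_def by (intro generate_ring.incl) auto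

lemma coord_ring_0 [simp]: "0 \<in> coord_ring l N \<alpha>"
  using coord_ring_const[of 0] by simp

lemma coord_ring_1 [simp]: "1 \<in> coord_ring l N \<alpha>"
  using coord_ring_const[of 1] by simp

lemma coord_ring_add:
  "f \<in> coord_ring l N \<alpha> \<Longrightarrow> g \<in> coord_ring l N \<alpha> \<Longrightarrow> f + g \<in> coord_ring l N \<alpha>"
  unfolding coord_ring_def using generate_ring.eng_add[of f ratfun_ring _ g] by simp

lemma coord_ring_mult:
  "f \<in> coord_ring l N \<alpha> \<Longrightarrow> g \<in> coord_ring l N \<alpha> \<Longrightarrow> f * g \<in> coord_ring l N \<alpha>"
  unfolding coord_ring_def using generate_ring.eng_mult[of f ratfun_ring _ g] by simp

lemma coord_ring_uminus: "f \<in> coord_ring l N \<alpha> \<Longrightarrow> - f \<in> coord_ring l N \<alpha>"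
  unfolding coord_ring_def using generate_ring.a_inv[of f ratfun_ring] by simp

lemma coord_ring_diff:
  "f \<in> coord_ring l N \<alpha> \<Longrightarrow> g \<in> coord_ring l N \<alpha> \<Longrightarrow> f - g \<in> coord_ring l N \<alpha>"
  using coord_ring_add[of f l N \<alpha> "- g"] coord_ring_uminus by auto

lemma coord_ring_power: "f \<in> coord_ring l N \<alpha> \<Longrightarrow> f ^ n \<in> coord_ring l N \<alpha>"
  by (induction n) (auto intro: coord_ring_mult)

lemma coord_ring_sum: "(\<And>i. i \<in> A \<Longrightarrow> f i \<in> coord_ring l N \<alpha>) \<Longrightarrow> sum f A \<in> coord_ring l N \<alpha>"
  by (induction A rule: infinite_finite_induct) (auto intro: coord_ring_add)

lemma coord_ring_mpoly: "p \<in> mpolys l \<Longrightarrow> rat_of_mpoly p \<in> coord_ring l N \<alpha>"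
proof (induction rule: mpolys_induct)
  case (Const c)
  show ?case using coord_ring_const[of c] by (simp add: rat_const_def)
next
  case (Var i)
  then show ?case unfolding coord_ring_def by (intro generate_ring.incl) auto
qed (simp_all add: rat_of_mpoly_add rat_of_mpoly_mult coord_ring_add coord_ring_mult)

lemma coord_ring_inverse: "i < N \<Longrightarrow> inverse (rat_of_mpoly (\<alpha> i)) \<in> coord_ring l N \<alpha>"
  unfolding coord_ring_def by (intro generate_ring.incl) auto

lemma coord_ring_divide:
  "f \<in> coord_ring l N \<alpha> \<Longrightarrow> i < N \<Longrightarrow> f / rat_of_mpoly (\<alpha> i) \<in> coord_ring l N \<alpha>"
  by (simp add: divide_inverse coord_ring_mult coord_ring_inverse)

lemma coord_ring_induct [consumes 1, case_names const Var inverse uminus add mult]: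
  assumes "f \<in> coord_ring l N \<alpha>"
    and "\<And>c. P (rat_const c)"
    and "\<And>j. j < l \<Longrightarrow> P (rat_of_mpoly (Var j))"
    and "\<And>i. i < N \<Longrightarrow> P (inverse (rat_of_mpoly (\<alpha> i)))"
    and "\<And>f. f \<in> coord_ring l N \<alpha> \<Longrightarrow> P f \<Longrightarrow> P (- f)"
    and "\<And>f g. f \<in> coord_ring l N \<alpha> \<Longrightarrow> g \<in> coord_ring l N \<alpha> \<Longrightarrow> P f \<Longrightarrow> P g \<Longrightarrow> P (f + g)"
    and "\<And>f g. f \<in> coord_ring l N \<alpha> \<Longrightarrow> g \<in> coord_ring l N \<alpha> \<Longrightarrow> P f \<Longrightarrow> P g \<Longrightarrow> P (f * g)"
  shows "P f"
  using assms(1) unfolding coord_ring_def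
proof (induction rule: generate_ring.induct)
  case one
  show ?case using assms(2)[of 1] by simp
next
  case (incl h)
  then show ?case using assms(2-4) by auto
next
  case (a_inv h)
  then show ?case using assms(5) by (simp add: coord_ring_def)
next
  case (eng_add f g)
  then show ?case using assms(6) by (simp add: coord_ring_def)
next
  case (eng_mult f g)
  then show ?case using assms(7) by (simp add: coord_ring_def)
qed

lemma coord_ring_mono:
  assumes "f \<in> coord_ring l N \<alpha>" "N \<le> N'" shows "f \<in> coord_ring l N' \<alpha>"
  using assms by (induction rule: coord_ring_induct)
    (auto intro: coord_ring_inverse coord_ring_uminus coord_ring_add coord_ring_mult coord_ring_mpoly)

lemma coord_ring_deriv:
  assumes \<alpha>: "\<And>i. i < N \<Longrightarrow> \<alpha> i \<in> mpolys l" and f: "f \<in> coord_ring l N \<alpha>"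
  shows "ratfun_deriv i f \<in> coord_ring l N \<alpha>"
  using f
proof (induction rule: coord_ring_induct)
  case (inverse j)
  then show ?case
    unfolding ratfun_deriv_inverse ratfun_deriv_of_mpoly
    by (intro coord_ring_mult coord_ring_uminus coord_ring_inverse coord_ring_mpoly mpolys_deriv \<alpha>)
qed (simp_all add: ratfun_deriv_of_mpoly ratfun_deriv_uminus ratfun_deriv_add ratfun_deriv_mult
      coord_ring_mpoly mpolys_deriv coord_ring_add coord_ring_mult coord_ring_uminus)

text \<open>Powers of the one product of all \<open>\<alpha> i\<close> suffice as denominators,
  since adding or multiplying such fractions only adds exponents.\<close>

lemma coord_ring_fraction:
  assumes nz: "\<And>i. i < N \<Longrightarrow> \<alpha> i \<noteq> 0" and \<alpha>: "\<And>i. i < N \<Longrightarrow> \<alpha> i \<in> mpolys l"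
    and f: "f \<in> coord_ring l N \<alpha>"
  obtains p n where "p \<in> mpolys l" "f = rat_of_mpoly p / rat_of_mpoly (\<Prod>i<N. \<alpha> i) ^ n"
proof -
  let ?D = "rat_of_mpoly (\<Prod>i<N. \<alpha> i)"
  have D: "?D \<noteq> 0" "(\<Prod>i<N. \<alpha> i) \<in> mpolys l" using nz \<alpha> by (auto intro: mpolys_prod)
  have triv: "\<exists>p\<in>mpolys l. \<exists>n. rat_of_mpoly q = rat_of_mpoly p / ?D ^ n" if "q \<in> mpolys l" for q
    using that by (intro bexI[of _ q] exI[of _ 0]) auto
  have "\<exists>p\<in>mpolys l. \<exists>n. f = rat_of_mpoly p / ?D ^ n"
    using f
  proof (induction rule: coord_ring_induct)
    case (const c)
    show ?case unfolding rat_const_def by (rule triv) simp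
  next
    case (Var j)
    then show ?case by (intro triv) simp
  next
    case (inverse i)
    have "(\<Prod>j<N. \<alpha> j) = \<alpha> i * (\<Prod>j\<in>{..<N} - {i}. \<alpha> j)"
      using inverse by (intro prod.remove) auto
    moreover have "\<alpha> i \<noteq> 0" "(\<Prod>j\<in>{..<N} - {i}. \<alpha> j) \<noteq> 0" using nz inverse by auto
    ultimately have "inverse (rat_of_mpoly (\<alpha> i)) =
        rat_of_mpoly (\<Prod>j\<in>{..<N} - {i}. \<alpha> j) / ?D ^ 1"
      by (simp add: rat_of_mpoly_mult field_simps)
    moreover have "(\<Prod>j\<in>{..<N} - {i}. \<alpha> j) \<in> mpolys l" using \<alpha> by (intro mpolys_prod) auto
    ultimately show ?case by blast
  next
    case (uminus f)
    then obtain p n where "p \<in> mpolys l" "f = rat_of_mpoly p / ?D ^ n" by blast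
    then have "- p \<in> mpolys l" "- f = rat_of_mpoly (- p) / ?D ^ n"
      by (auto simp: rat_of_mpoly_uminus mpolys_uminus)
    then show ?case by blast
  next
    case (add f g)
    then obtain p n q m where *: "p \<in> mpolys l" "f = rat_of_mpoly p / ?D ^ n"
      "q \<in> mpolys l" "g = rat_of_mpoly q / ?D ^ m" by blast
    have "p * (\<Prod>i<N. \<alpha> i) ^ m + q * (\<Prod>i<N. \<alpha> i) ^ n \<in> mpolys l"
      using * D by (intro mpolys_add mpolys_mult mpolys_power)
    moreover have "f + g = rat_of_mpoly (p * (\<Prod>i<N. \<alpha> i) ^ m + q * (\<Prod>i<N. \<alpha> i) ^ n) / ?D ^ (n + m)"
      using D unfolding *(2,4)
      by (simp add: rat_of_mpoly_add rat_of_mpoly_mult rat_of_mpoly_power power_add add_frac_eq)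
    ultimately show ?case by blast
  next
    case (mult f g)
    then obtain p n q m where *: "p \<in> mpolys l" "f = rat_of_mpoly p / ?D ^ n"
      "q \<in> mpolys l" "g = rat_of_mpoly q / ?D ^ m" by blast
    have "p * q \<in> mpolys l" using * by (intro mpolys_mult)
    moreover have "f * g = rat_of_mpoly (p * q) / ?D ^ (n + m)"
      using * by (simp add: rat_of_mpoly_mult power_add)
    ultimately show ?case by blast
  qed
  then show ?thesis using that by blast
qed

lemma coord_ring_of_fraction:
  assumes "p \<in> mpolys l" shows "rat_of_mpoly p / rat_of_mpoly (\<Prod>i<N. \<alpha> i) ^ n \<in> coord_ring l N \<alpha>"
proof -
  have "inverse (rat_of_mpoly (\<Prod>i<M. \<alpha> i)) \<in> coord_ring l N \<alpha>" if "M \<le> N" for M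
    using that by (induction M) (auto simp: rat_of_mpoly_mult intro!: coord_ring_mult coord_ring_inverse)
  then have "inverse (rat_of_mpoly (\<Prod>i<N. \<alpha> i)) ^ n \<in> coord_ring l N \<alpha>"
    by (intro coord_ring_power) simp
  then show ?thesis
    using assms by (simp add: divide_inverse coord_ring_mult coord_ring_mpoly power_inverse)
qed

text \<open>Isolates the pole along the last hyperplane; the numerator may still have poles along
  the others.\<close>

lemma coord_ring_Suc:
  assumes nz: "\<And>i. i < Suc N \<Longrightarrow> \<alpha> i \<noteq> 0" and \<alpha>: "\<And>i. i < Suc N \<Longrightarrow> \<alpha> i \<in> mpolys l"
    and f: "f \<in> coord_ring l (Suc N) \<alpha>"
  obtains h n where "h \<in> coord_ring l N \<alpha>" "f = h / rat_of_mpoly (\<alpha> N) ^ n"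
proof -
  obtain p n where "p \<in> mpolys l" "f = rat_of_mpoly p / rat_of_mpoly (\<Prod>i<Suc N. \<alpha> i) ^ n"
    using coord_ring_fraction[OF nz \<alpha> f] by blast
  then have "f = (rat_of_mpoly p / rat_of_mpoly (\<Prod>i<N. \<alpha> i) ^ n) / rat_of_mpoly (\<alpha> N) ^ n"
    by (simp add: rat_of_mpoly_mult power_mult_distrib)
  with coord_ring_of_fraction[OF \<open>p \<in> mpolys l\<close>, where N = N and n = n and \<alpha> = \<alpha>] that show ?thesis by blast
qed

lemma coord_ring_Suc_family:
  assumes nz: "\<And>i. i < Suc N \<Longrightarrow> \<alpha> i \<noteq> 0" and \<alpha>: "\<And>i. i < Suc N \<Longrightarrow> \<alpha> i \<in> mpolys l"
    and f: "\<And>j. j < (m::nat) \<Longrightarrow> f j \<in> coord_ring l (Suc N) \<alpha>"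
  obtains h n where "\<And>j. j < m \<Longrightarrow> h j \<in> coord_ring l N \<alpha>"
    "\<And>j. j < m \<Longrightarrow> f j = h j / rat_of_mpoly (\<alpha> N) ^ n"
proof -
  let ?a = "rat_of_mpoly (\<alpha> N)"
  have a: "?a \<noteq> 0" "?a \<in> coord_ring l N \<alpha>" using nz \<alpha> by (auto intro: coord_ring_mpoly)
  have "\<forall>j. \<exists>h n. j < m \<longrightarrow> h \<in> coord_ring l N \<alpha> \<and> f j = h / ?a ^ n"
    using coord_ring_Suc[OF nz \<alpha> f] by metis
  then obtain h e where he: "\<And>j. j < m \<Longrightarrow> h j \<in> coord_ring l N \<alpha> \<and> f j = h j / ?a ^ e j" by metis
  \<comment> \<open>Any common bound of the exponents works; the sum avoids a maximum over a
    possibly empty set.\<close>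
  define n where "n = (\<Sum>j<m. e j)"
  have le: "e j \<le> n" if "j < m" for j
    unfolding n_def using that by (intro member_le_sum) auto
  show ?thesis
  proof (rule that)
    show "h j * ?a ^ (n - e j) \<in> coord_ring l N \<alpha>" if "j < m" for j
      using he[OF that] a by (auto intro: coord_ring_mult coord_ring_power)
    show "f j = h j * ?a ^ (n - e j) / ?a ^ n" if "j < m" for j
    proof -
      have "?a ^ n = ?a ^ e j * ?a ^ (n - e j)" using le[OF that] by (simp flip: power_add)
      then show ?thesis using conjunct2[OF he[OF that]] a(1) by simp
    qed
  qed
qed

text \<open>Multiplication by a power of the product of the \<open>\<alpha> i\<close> turns
  \<open>f\<close> into a nonzero polynomial in \<open>J\<close>. A polynomial that is not constant
  has a nonzero derivative, so repeated differentiation reaches a nonzero constant, a unit. Later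
  \<open>J\<close> is also a set of coefficients of bar elements at a fixed word.\<close>

lemma coord_ring_differentially_simple:
  assumes nz: "\<And>i. i < N \<Longrightarrow> \<alpha> i \<noteq> 0" and \<alpha>: "\<And>i. i < N \<Longrightarrow> \<alpha> i \<in> mpolys l"
    and J: "J \<subseteq> coord_ring l N \<alpha>"
    and mult: "\<And>f g. f \<in> coord_ring l N \<alpha> \<Longrightarrow> g \<in> J \<Longrightarrow> f * g \<in> J"
    and deriv: "\<And>i g. i < l \<Longrightarrow> g \<in> J \<Longrightarrow> ratfun_deriv i g \<in> J"
    and f: "f \<in> J" "f \<noteq> 0"
  shows "1 \<in> J"
proof -
  let ?D = "rat_of_mpoly (\<Prod>i<N. \<alpha> i)"
  obtain p n where p: "p \<in> mpolys l" "f = rat_of_mpoly p / ?D ^ n"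
    using coord_ring_fraction[OF nz \<alpha> subsetD[OF J f(1)]] by blast
  have D: "?D \<noteq> 0" "?D ^ n \<in> coord_ring l N \<alpha>"
    using nz \<alpha> by (auto intro!: coord_ring_power coord_ring_mpoly mpolys_prod)
  have "rat_of_mpoly p = ?D ^ n * f" using p D by simp
  then have pJ: "rat_of_mpoly p \<in> J" "p \<noteq> 0" using mult[OF D(2) f(1)] p f by auto
  obtain d where "bounded_degree d p" using bounded_degree_exists by blast
  then show ?thesis using p(1) pJ
  proof (induction d arbitrary: p)
    case 0
    then obtain c where c: "p = Const c" using bounded_degree_0 by blast
    with 0 have "rat_const (inverse c) * rat_const c = 1" by (simp flip: rat_const_mult)
    then show ?case using mult[OF coord_ring_const 0(3), of "inverse c"] c
      by (simp add: rat_const_def)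
  next
    case (Suc d)
    show ?case
    proof (cases "\<exists>i<l. mpoly_deriv i p \<noteq> 0")
      case True
      then obtain i where i: "i < l" "mpoly_deriv i p \<noteq> 0" by blast
      show ?thesis
        using Suc.IH[of "mpoly_deriv i p"] Suc.prems i deriv[OF i(1) Suc.prems(3)]
        by (simp add: bounded_degree_deriv mpolys_deriv ratfun_deriv_of_mpoly)
    next
      case False
      then obtain c where c: "p = Const c" using mpolys_derivs_eq_0[OF Suc.prems(2)] by blast
      with Suc.prems have "rat_const (inverse c) * rat_const c = 1" by (simp flip: rat_const_mult)
      then show ?thesis using mult[OF coord_ring_const Suc.prems(3), of "inverse c"] c
        by (simp add: rat_const_def)
    qed
  qed
qed

text \<open>Differentiating \<open>p = f q\<close> with \<open>f\<close> constant lowers the degree of the denominator \<open>q\<close>.\<close>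

lemma fraction_derivs_eq_0:
  assumes "f * rat_of_mpoly q = rat_of_mpoly p" "q \<noteq> 0" "p \<in> mpolys l" "q \<in> mpolys l"
    and f: "\<And>i. i < l \<Longrightarrow> ratfun_deriv i f = 0"
  obtains c where "f = rat_const c"
proof -
  have const: "\<exists>e. f = rat_const e"
    if q: "f * rat_of_mpoly (Const c) = rat_of_mpoly p" "c \<noteq> 0" "p \<in> mpolys l" for c p
  proof -
    have "rat_const c \<noteq> 0" "f * rat_const c = rat_of_mpoly p" using q by (simp_all add: rat_const_def)
    then have "f = inverse (rat_const c) * rat_of_mpoly p" by (simp add: field_simps)
    then have fp: "f = rat_of_mpoly (Const (inverse c) * p)"
      by (simp add: rat_of_mpoly_mult rat_const_inverse flip: rat_const_def)
    have "mpoly_deriv i (Const (inverse c) * p) = 0" if "i < l" for i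
      using f[OF that] unfolding fp by (simp add: ratfun_deriv_of_mpoly)
    with mpolys_derivs_eq_0[OF mpolys_mult[OF mpolys_Const q(3)]]
    obtain e where "Const (inverse c) * p = Const e" by blast
    then show ?thesis using fp by (auto simp: rat_const_def)
  qed
  obtain d where "bounded_degree d q" using bounded_degree_exists by blast
  then have "\<exists>c. f = rat_const c" using assms(1-4)
  proof (induction d arbitrary: p q)
    case 0
    obtain c where "q = Const c" using bounded_degree_0[OF 0(1)] by blast
    with 0 const[of c p] show ?case by simp
  next
    case (Suc d)
    show ?case
    proof (cases "\<exists>i<l. mpoly_deriv i q \<noteq> 0")
      case True
      then obtain i where i: "i < l" "mpoly_deriv i q \<noteq> 0" by blast
      have "f * rat_of_mpoly (mpoly_deriv i q) = ratfun_deriv i (f * rat_of_mpoly q)"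
        using i by (simp add: ratfun_deriv_mult f ratfun_deriv_of_mpoly)
      also have "\<dots> = rat_of_mpoly (mpoly_deriv i p)"
        using Suc.prems by (simp add: ratfun_deriv_of_mpoly)
      finally show ?thesis
        using Suc.IH[OF bounded_degree_deriv[OF Suc.prems(1)]] i Suc.prems(4,5)
        by (simp add: mpolys_deriv)
    next
      case False
      then obtain c where "q = Const c" using mpolys_derivs_eq_0[OF Suc.prems(5)] by blast
      with Suc.prems const[of c p] show ?thesis by simp
    qed
  qed
  then show ?thesis using that by blast
qed

lemma coord_ring_constants:
  assumes nz: "\<And>i. i < N \<Longrightarrow> \<alpha> i \<noteq> 0" and \<alpha>: "\<And>i. i < N \<Longrightarrow> \<alpha> i \<in> mpolys l"
    and f: "f \<in> coord_ring l N \<alpha>" "\<And>i. i < l \<Longrightarrow> ratfun_deriv i f = 0"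
  obtains c where "f = rat_const c"
proof -
  let ?D = "\<Prod>i<N. \<alpha> i"
  obtain p n where p: "p \<in> mpolys l" "f = rat_of_mpoly p / rat_of_mpoly ?D ^ n"
    using coord_ring_fraction[OF nz \<alpha> f(1)] by blast
  have "?D ^ n \<in> mpolys l" "?D \<noteq> 0" using nz \<alpha> by (auto intro!: mpolys_power mpolys_prod)
  moreover from this have "f * rat_of_mpoly (?D ^ n) = rat_of_mpoly p"
    using p by (simp add: rat_of_mpoly_power)
  ultimately show ?thesis using fraction_derivs_eq_0[of f "?D ^ n" p l] p f that by auto
qed

section \<open>Restriction to a hyperplane\<close>

definition mpoly_subst :: "(nat \<Rightarrow> 'k::field_char_0 mpoly) \<Rightarrow> 'k mpoly \<Rightarrow> 'k mpoly" where
  "mpoly_subst x p = (\<Sum>m\<in>keys p. Const (lookup p m) * (\<Prod>i\<in>keys m. x i ^ lookup m i))"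

lemma mpoly_subst_superset:
  "finite A \<Longrightarrow> keys p \<subseteq> A \<Longrightarrow>
     mpoly_subst x p = (\<Sum>m\<in>A. Const (lookup p m) * (\<Prod>i\<in>keys m. x i ^ lookup m i))"
  unfolding mpoly_subst_def by (intro sum.mono_neutral_left) (auto simp: in_keys_iff)

lemma mpoly_subst_add: "mpoly_subst x (p + q) = mpoly_subst x p + mpoly_subst x q"
  using Poly_Mapping.keys_add[of p q]
  by (simp add: mpoly_subst_superset[of "keys p \<union> keys q"] lookup_add Const_add distrib_right sum.distrib)

lemma mpoly_subst_single:
  "mpoly_subst x (single m c) = Const c * (\<Prod>i\<in>keys m. x i ^ lookup m i)"
  by (subst mpoly_subst_superset[of "{m}"]) auto

lemma mpoly_subst_mult: "mpoly_subst x (p * q) = mpoly_subst x p * mpoly_subst x q"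
proof (induction p rule: poly_mapping_induct)
  case (single m c)
  show ?case
  proof (induction q rule: poly_mapping_induct)
    case (single n d)
    have mono: "(\<Prod>i\<in>keys m'. x i ^ lookup m' i) = (\<Prod>i\<in>keys m \<union> keys n. x i ^ lookup m' i)"
      if "keys m' \<subseteq> keys m \<union> keys n" for m'
      using that by (intro prod.mono_neutral_left) (auto simp: in_keys_iff)
    have "(\<Prod>i\<in>keys (m + n). x i ^ lookup (m + n) i) =
        (\<Prod>i\<in>keys m. x i ^ lookup m i) * (\<Prod>i\<in>keys n. x i ^ lookup n i)"
      using mono[of m] mono[of n] mono[of "m + n"] Poly_Mapping.keys_add[of m n]
      by (simp add: lookup_add power_add prod.distrib)
    then show ?case
      by (simp add: mult_single mpoly_subst_single Const_mult mult_ac)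
  qed (simp add: distrib_left mpoly_subst_add)
qed (simp add: distrib_right mpoly_subst_add)

lemma mpoly_subst_Const [simp]: "mpoly_subst x (Const c) = Const c"
  by (simp add: Const_def mpoly_subst_single)

lemma mpoly_subst_Var [simp]: "mpoly_subst x (Var i) = x i"
  by (simp add: Var_def mpoly_subst_single)

lemma Const_diff: "Const (a - b) = Const a - Const b"
  by (simp add: Const_def single_diff)

text \<open>Unlike in \<open>degree_one\<close>, constants are allowed: the restriction of an affine
  function to a hyperplane may be constant.\<close>

definition affine :: "nat \<Rightarrow> 'k::field_char_0 mpoly \<Rightarrow> bool" where
  "affine l p \<longleftrightarrow> (\<exists>b a. p = Const b + (\<Sum>j<l. Const (a j) * Var j))"

lemma affine_mpolys: "affine l p \<Longrightarrow> p \<in> mpolys l"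
  by (auto simp: affine_def intro!: mpolys_add mpolys_sum mpolys_mult)

lemma affine_diff_mult:
  assumes "affine l p" "affine l q" shows "affine l (p - Const c * q)"
proof -
  obtain b a b' a' where *: "p = Const b + (\<Sum>j<l. Const (a j) * Var j)"
    "q = Const b' + (\<Sum>j<l. Const (a' j) * Var j)" using assms by (auto simp: affine_def)
  have "(\<Sum>j<l. Const (a j - c * a' j) * Var j) =
      (\<Sum>j<l. Const (a j) * Var j) - Const c * (\<Sum>j<l. Const (a' j) * Var j)"
    unfolding sum_distrib_left sum_subtractf[symmetric]
    by (intro sum.cong) (simp_all add: Const_diff Const_mult left_diff_distrib mult.assoc)
  then have "p - Const c * q = Const (b - c * b') + (\<Sum>j<l. Const (a j - c * a' j) * Var j)"
    unfolding * by (simp add: Const_diff Const_mult distrib_left)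
  then show ?thesis
    unfolding affine_def by (intro exI[of _ "b - c * b'"] exI[of _ "\<lambda>j. a j - c * a' j"])
qed

lemma affine_deriv:
  assumes "affine l p" obtains a where "\<And>j. mpoly_deriv j p = Const (a j)"
proof -
  obtain b a where p: "p = Const b + (\<Sum>j<l. Const (a j) * Var j)"
    using assms by (auto simp: affine_def)
  have "mpoly_deriv j p = Const (if j < l then a j else 0)" for j
    unfolding p by (simp add: mpoly_deriv_add mpoly_deriv_sum mpoly_deriv_mult mpoly_deriv_Var
        if_distrib[of "(*) _"] sum.delta cong: if_cong)
  then show ?thesis by (rule that)
qed

lemma affine_cases:
  assumes "affine l p"
  obtains c where "p = Const c"
  | s a where "s < l" "\<And>j. mpoly_deriv j p = Const (a j)" "a s \<noteq> 0"
proof -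
  obtain a where a: "\<And>j. mpoly_deriv j p = Const (a j)" using affine_deriv[OF assms] by blast
  show ?thesis
  proof (cases "\<exists>s<l. a s \<noteq> 0")
    case True
    then show ?thesis using that(2) a by blast
  next
    case False
    then have "mpoly_deriv j p = 0" if "j < l" for j using that a by simp
    then show ?thesis using mpolys_derivs_eq_0[OF affine_mpolys[OF assms]] that(1) by metis
  qed
qed

text \<open>The coefficient of \<open>dt_j\<close> in the logarithmic differential of
  \<open>p\<close>. One-forms are families of such coefficients until they are compared with the
  type \<open>form\<close>.\<close>

definition dlog_coeff :: "nat \<Rightarrow> 'k::field_char_0 mpoly \<Rightarrow> 'k ratfun" where
  "dlog_coeff j p = rat_of_mpoly (mpoly_deriv j p) / rat_of_mpoly p"

lemma dlog_coeff_closed: "ratfun_deriv i (dlog_coeff j p) = ratfun_deriv j (dlog_coeff i p)"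
proof (cases "p = 0")
  case False
  then show ?thesis
    using mpoly_deriv_commute[of i j p]
    by (simp add: dlog_coeff_def ratfun_deriv_divide ratfun_deriv_of_mpoly mult.commute)
qed (simp add: dlog_coeff_def)

lemma dlog_coeff_Const [simp]: "dlog_coeff j (Const c) = 0"
  by (simp add: dlog_coeff_def)

lemma dlog_coeff_mult_Const: "c \<noteq> 0 \<Longrightarrow> dlog_coeff j (Const c * p) = dlog_coeff j p"
  by (simp add: dlog_coeff_def mpoly_deriv_mult rat_of_mpoly_mult)

lemma coord_ring_dlog_coeff:
  "i < N \<Longrightarrow> \<alpha> i \<in> mpolys l \<Longrightarrow> dlog_coeff j (\<alpha> i) \<in> coord_ring l N \<alpha>"
  unfolding dlog_coeff_def by (intro coord_ring_divide coord_ring_mpoly mpolys_deriv)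

text \<open>Here \<open>d\<alpha>\<close> has the constant coefficients \<open>a j\<close>, and
  \<open>a s\<close> is a pivot: the equation \<open>\<alpha> = 0\<close> can be solved for the
  variable with index \<open>s\<close>.\<close>

locale hyperplane_restriction =
  fixes l :: nat and \<alpha> :: "'k::field_char_0 mpoly" and s :: nat and a :: "nat \<Rightarrow> 'k"
  assumes s: "s < l" and affine: "affine l \<alpha>"
    and deriv_\<alpha>: "\<And>j. mpoly_deriv j \<alpha> = Const (a j)" and a_s: "a s \<noteq> 0"
begin

text \<open>\<open>\<sigma>\<close> solves \<open>\<alpha> = 0\<close> for \<open>t\<^sub>s\<close>.\<close>

definition \<sigma> :: "'k mpoly \<Rightarrow> 'k mpoly" where
  "\<sigma> = mpoly_subst (\<lambda>i. if i = s then Var s - Const (inverse (a s)) * \<alpha> else Var i)"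

lemma \<sigma>_add: "\<sigma> (p + q) = \<sigma> p + \<sigma> q"
  by (simp add: \<sigma>_def mpoly_subst_add)

lemma \<sigma>_mult: "\<sigma> (p * q) = \<sigma> p * \<sigma> q"
  by (simp add: \<sigma>_def mpoly_subst_mult)

lemma \<sigma>_Const [simp]: "\<sigma> (Const c) = Const c"
  by (simp add: \<sigma>_def)

lemma \<sigma>_Var: "\<sigma> (Var i) = (if i = s then Var s - Const (inverse (a s)) * \<alpha> else Var i)"
  by (simp add: \<sigma>_def)

lemma \<sigma>_0 [simp]: "\<sigma> 0 = 0"
  using \<sigma>_Const[of 0] by simp

lemma \<sigma>_1 [simp]: "\<sigma> 1 = 1"
  using \<sigma>_Const[of 1] by simp

lemma \<sigma>_uminus: "\<sigma> (- p) = - \<sigma> p"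
  using \<sigma>_add[of p "- p"] by (simp add: eq_neg_iff_add_eq_0 add.commute)

lemma \<sigma>_diff: "\<sigma> (p - q) = \<sigma> p - \<sigma> q"
  using \<sigma>_add[of p "- q"] by (simp add: \<sigma>_uminus)

lemma \<sigma>_power: "\<sigma> (p ^ n) = \<sigma> p ^ n"
  by (induction n) (simp_all add: \<sigma>_mult)

lemma \<sigma>_prod: "\<sigma> (prod f A) = (\<Prod>i\<in>A. \<sigma> (f i))"
  by (induction A rule: infinite_finite_induct) (simp_all add: \<sigma>_mult)

lemma \<sigma>_sum: "\<sigma> (sum f A) = (\<Sum>i\<in>A. \<sigma> (f i))"
  by (induction A rule: infinite_finite_induct) (simp_all add: \<sigma>_add)

text \<open>The right-hand side is \<open>p\<close> moved along \<open>\<alpha>\<close> until the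
  variable \<open>s\<close> disappears. In particular, among affine functions
  \<open>\<sigma>\<close> kills only the multiples of \<open>\<alpha>\<close>.\<close>

lemma \<sigma>_affine:
  assumes "affine l p" "mpoly_deriv s p = Const c"
  shows "\<sigma> p = p - Const (c / a s) * \<alpha>"
proof -
  obtain b e where p: "p = Const b + (\<Sum>j<l. Const (e j) * Var j)"
    using assms by (auto simp: affine_def)
  have "mpoly_deriv s p = Const (e s)"
    using s unfolding p by (simp add: mpoly_deriv_add mpoly_deriv_sum mpoly_deriv_mult
        mpoly_deriv_Var if_distrib[of "(*) _"] sum.delta cong: if_cong)
  with assms have c: "c = e s" by simp
  have "\<sigma> p = Const b + (\<Sum>j<l. Const (e j) * Var j - (if j = s then Const (e s) * Const (inverse (a s)) * \<alpha> else 0))"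
    unfolding p \<sigma>_add \<sigma>_sum \<sigma>_mult \<sigma>_Const
    by (intro arg_cong2[where f = "(+)"] sum.cong) (auto simp: \<sigma>_Var right_diff_distrib mult.assoc)
  also have "\<dots> = p - Const (c / a s) * \<alpha>"
    using s by (simp add: p c sum_subtractf sum.delta divide_inverse Const_mult add_diff_eq)
  finally show ?thesis .
qed

lemma \<sigma>_\<alpha> [simp]: "\<sigma> \<alpha> = 0"
  using \<sigma>_affine[OF affine deriv_\<alpha>] a_s by simp

lemma \<alpha>_nonzero: "\<alpha> \<noteq> 0"
  using deriv_\<alpha>[of s] a_s by auto

lemma mpolys_\<sigma>: "p \<in> mpolys l \<Longrightarrow> \<sigma> p \<in> mpolys l"
proof (induction rule: mpolys_induct)
  case (Var i)
  then show ?case using s affine_mpolys[OF affine]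
    by (auto simp: \<sigma>_Var intro!: mpolys_diff mpolys_mult)
qed (auto simp: \<sigma>_add \<sigma>_mult intro: mpolys_add mpolys_mult)

text \<open>It suffices to check the generators, of which only the variable \<open>s\<close> is
  changed, by a multiple of \<open>\<alpha>\<close>. So the kernel of \<open>\<sigma>\<close> is the
  ideal of \<open>\<alpha>\<close>, which later turns vanishing on the hyperplane into
  divisibility.\<close>

lemma \<sigma>_congruent: "p \<in> mpolys l \<Longrightarrow> \<exists>q\<in>mpolys l. p = \<sigma> p + \<alpha> * q"
proof (induction rule: mpolys_induct)
  case (Const c)
  show ?case by (intro bexI[of _ 0]) auto
next
  case (Var i)
  show ?case
  proof (cases "i = s")
    case True
    then have "Var i = \<sigma> (Var i) + \<alpha> * Const (inverse (a s))" by (simp add: \<sigma>_def mult.commute)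
    then show ?thesis using mpolys_Const by blast
  next
    case False
    then have "Var i = \<sigma> (Var i) + \<alpha> * 0" by (simp add: \<sigma>_def)
    then show ?thesis using mpolys_0 by blast
  qed
next
  case (add p q)
  then obtain u v where uv: "u \<in> mpolys l" "v \<in> mpolys l" "p = \<sigma> p + \<alpha> * u" "q = \<sigma> q + \<alpha> * v" by blast
  have "p + q = (\<sigma> p + \<alpha> * u) + (\<sigma> q + \<alpha> * v)" using uv(3,4) by simp
  also have "\<dots> = \<sigma> (p + q) + \<alpha> * (u + v)" by (simp add: \<sigma>_add distrib_left)
  finally show ?case using uv mpolys_add by blast
next
  case (mult p q)
  then obtain u v where uv: "u \<in> mpolys l" "v \<in> mpolys l" "p = \<sigma> p + \<alpha> * u" "q = \<sigma> q + \<alpha> * v" by blast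
  have "p * q = (\<sigma> p + \<alpha> * u) * (\<sigma> q + \<alpha> * v)" using uv(3,4) by simp
  also have "\<dots> = \<sigma> (p * q) + \<alpha> * (\<sigma> p * v + u * \<sigma> q + \<alpha> * u * v)"
    by (simp add: \<sigma>_mult distrib_left distrib_right mult_ac add_ac)
  finally have "p * q = \<sigma> (p * q) + \<alpha> * (\<sigma> p * v + u * \<sigma> q + \<alpha> * u * v)" .
  moreover have "\<sigma> p * v + u * \<sigma> q + \<alpha> * u * v \<in> mpolys l"
    using uv mult(1,2) mpolys_\<sigma> affine_mpolys[OF affine] by (intro mpolys_add mpolys_mult) auto
  ultimately show ?case by blast
qed

text \<open>\<open>\<partial>\<^sub>j - (a\<^sub>j / a\<^sub>s) \<partial>\<^sub>s\<close> is the lift of \<open>\<partial>\<^sub>j\<close> tangent to the hyperplane.\<close>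

lemma deriv_\<sigma>:
  "mpoly_deriv j (\<sigma> p) = \<sigma> (mpoly_deriv j p - Const (a j / a s) * mpoly_deriv s p)"
proof (induction p rule: mpoly_induct)
  case (Var i)
  show ?case
    using a_s by (auto simp: \<sigma>_Var mpoly_deriv_diff mpoly_deriv_mult mpoly_deriv_Var deriv_\<alpha>
        divide_inverse \<sigma>_uminus simp flip: Const_mult simp: mult.commute)
next
  case (mult p q)
  then show ?case
    by (simp add: \<sigma>_mult mpoly_deriv_mult \<sigma>_diff \<sigma>_add right_diff_distrib left_diff_distrib
        distrib_left distrib_right mult_ac)
qed (simp_all add: \<sigma>_add mpoly_deriv_add \<sigma>_diff \<sigma>_mult distrib_left)

text \<open>Restriction to the hyperplane, pulled back under the projection \<open>\<sigma>\<close>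
  and made total by a definite description. It is meaningful for fractions that have some
  denominator not vanishing on the hyperplane.\<close>

definition restr :: "'k ratfun \<Rightarrow> 'k ratfun" where
  "restr f = (THE y. \<exists>p q. \<sigma> q \<noteq> 0 \<and> f = rat_of_mpoly p / rat_of_mpoly q \<and>
     y = rat_of_mpoly (\<sigma> p) / rat_of_mpoly (\<sigma> q))"

text \<open>Independent of the chosen fraction, since the multiplicative map \<open>\<sigma>\<close>
  preserves equality of cross products.\<close>

lemma restr_eq:
  assumes "\<sigma> q \<noteq> 0"
  shows "restr (rat_of_mpoly p / rat_of_mpoly q) = rat_of_mpoly (\<sigma> p) / rat_of_mpoly (\<sigma> q)"
  unfolding restr_def
proof (rule the_equality)
  fix y assume "\<exists>p' q'. \<sigma> q' \<noteq> 0 \<and> rat_of_mpoly p / rat_of_mpoly q = rat_of_mpoly p' / rat_of_mpoly q' \<and>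
      y = rat_of_mpoly (\<sigma> p') / rat_of_mpoly (\<sigma> q')"
  then obtain p' q' where *: "\<sigma> q' \<noteq> 0" "rat_of_mpoly p / rat_of_mpoly q = rat_of_mpoly p' / rat_of_mpoly q'"
    "y = rat_of_mpoly (\<sigma> p') / rat_of_mpoly (\<sigma> q')" by blast
  have "q \<noteq> 0" "q' \<noteq> 0" using * assms by auto
  with * have "p * q' = p' * q" by (simp add: frac_eq_eq flip: rat_of_mpoly_mult)
  then have "\<sigma> p * \<sigma> q' = \<sigma> p' * \<sigma> q" by (metis \<sigma>_mult)
  then show "y = rat_of_mpoly (\<sigma> p) / rat_of_mpoly (\<sigma> q)"
    using * assms by (simp add: frac_eq_eq flip: rat_of_mpoly_mult)
qed (use assms in blast)

lemma restr_const [simp]: "restr (rat_const c) = rat_const c"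
  using restr_eq[of 1 "Const c"] by (simp add: rat_const_def)

end

text \<open>\<open>\<O>\<close> is the coordinate ring before the hyperplane
  \<open>\<alpha> = 0\<close> is removed. No \<open>\<gamma> i\<close> vanishes identically on that
  hyperplane, so every element of \<open>\<O>\<close> can be restricted to it.\<close>

locale restricted_complement = hyperplane_restriction l \<alpha> s a
  for l and \<alpha> :: "'k::field_char_0 mpoly" and s a +
  fixes N :: nat and \<gamma> :: "nat \<Rightarrow> 'k mpoly"
  assumes \<gamma>: "\<And>i. i < N \<Longrightarrow> \<gamma> i \<in> mpolys l" and \<sigma>_\<gamma>: "\<And>i. i < N \<Longrightarrow> \<sigma> (\<gamma> i) \<noteq> 0"
begin

abbreviation "\<O> \<equiv> coord_ring l N \<gamma>"

lemma \<gamma>_nonzero: "i < N \<Longrightarrow> \<gamma> i \<noteq> 0"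
  using \<sigma>_\<gamma> by force

lemma coord_ring_regular:
  assumes "f \<in> \<O>"
  obtains p q where "p \<in> mpolys l" "\<sigma> q \<noteq> 0" "f = rat_of_mpoly p / rat_of_mpoly q"
    "\<exists>n. q = (\<Prod>i<N. \<gamma> i) ^ n"
proof -
  obtain p n where p: "p \<in> mpolys l" "f = rat_of_mpoly p / rat_of_mpoly (\<Prod>i<N. \<gamma> i) ^ n"
    using coord_ring_fraction[OF \<gamma>_nonzero \<gamma> assms] by blast
  have "\<sigma> ((\<Prod>i<N. \<gamma> i) ^ n) \<noteq> 0" using \<sigma>_\<gamma> by (simp add: \<sigma>_power \<sigma>_prod)
  with p that[of p "(\<Prod>i<N. \<gamma> i) ^ n"] show ?thesis by (auto simp: rat_of_mpoly_power)
qed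

lemma restr_add:
  assumes "f \<in> \<O>" "g \<in> \<O>" shows "restr (f + g) = restr f + restr g"
proof -
  obtain p q where f: "\<sigma> q \<noteq> 0" "f = rat_of_mpoly p / rat_of_mpoly q"
    using coord_ring_regular[OF assms(1)] by metis
  obtain p' q' where g: "\<sigma> q' \<noteq> 0" "g = rat_of_mpoly p' / rat_of_mpoly q'"
    using coord_ring_regular[OF assms(2)] by metis
  have nz: "q \<noteq> 0" "q' \<noteq> 0" "\<sigma> (q * q') \<noteq> 0" using f g by (auto simp: \<sigma>_mult)
  have "f + g = rat_of_mpoly (p * q' + p' * q) / rat_of_mpoly (q * q')"
    using nz unfolding f(2) g(2) by (simp add: add_frac_eq rat_of_mpoly_add rat_of_mpoly_mult)
  then have "restr (f + g) = rat_of_mpoly (\<sigma> (p * q' + p' * q)) / rat_of_mpoly (\<sigma> (q * q'))"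
    using restr_eq[OF nz(3)] by simp
  also have "\<dots> = restr f + restr g"
    using f g by (simp add: restr_eq add_frac_eq \<sigma>_add \<sigma>_mult rat_of_mpoly_add rat_of_mpoly_mult)
  finally show ?thesis .
qed

lemma restr_mult:
  assumes "f \<in> \<O>" "g \<in> \<O>" shows "restr (f * g) = restr f * restr g"
proof -
  obtain p q where f: "\<sigma> q \<noteq> 0" "f = rat_of_mpoly p / rat_of_mpoly q"
    using coord_ring_regular[OF assms(1)] by metis
  obtain p' q' where g: "\<sigma> q' \<noteq> 0" "g = rat_of_mpoly p' / rat_of_mpoly q'"
    using coord_ring_regular[OF assms(2)] by metis
  have nz: "\<sigma> (q * q') \<noteq> 0" using f g by (auto simp: \<sigma>_mult)
  have "f * g = rat_of_mpoly (p * p') / rat_of_mpoly (q * q')"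
    unfolding f(2) g(2) by (simp add: rat_of_mpoly_mult)
  then have "restr (f * g) = rat_of_mpoly (\<sigma> (p * p')) / rat_of_mpoly (\<sigma> (q * q'))"
    using restr_eq[OF nz] by simp
  also have "\<dots> = restr f * restr g"
    using f g by (simp add: restr_eq \<sigma>_mult rat_of_mpoly_mult)
  finally show ?thesis .
qed

lemma restr_0 [simp]: "restr 0 = 0"
  using restr_const[of 0] by (simp del: restr_const)

lemma restr_uminus: "f \<in> \<O> \<Longrightarrow> restr (- f) = - restr f"
  using restr_add[of f "- f"] by (simp add: coord_ring_uminus eq_neg_iff_add_eq_0 add.commute)

lemma restr_diff: "f \<in> \<O> \<Longrightarrow> g \<in> \<O> \<Longrightarrow> restr (f - g) = restr f - restr g"
  using restr_add[of f "- g"] by (simp add: restr_uminus coord_ring_uminus)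

lemma restr_sum: "(\<And>i. i \<in> A \<Longrightarrow> f i \<in> \<O>) \<Longrightarrow> restr (sum f A) = (\<Sum>i\<in>A. restr (f i))"
  by (induction A rule: infinite_finite_induct) (simp_all add: restr_add coord_ring_sum)

lemma restr_coord_ring:
  assumes "f \<in> \<O>" shows "restr f \<in> coord_ring l N (\<lambda>i. \<sigma> (\<gamma> i))"
proof -
  obtain p q n where f: "p \<in> mpolys l" "\<sigma> q \<noteq> 0" "f = rat_of_mpoly p / rat_of_mpoly q"
    "q = (\<Prod>i<N. \<gamma> i) ^ n"
    using coord_ring_regular[OF assms] by metis
  have "restr f = rat_of_mpoly (\<sigma> p) / rat_of_mpoly (\<Prod>i<N. \<sigma> (\<gamma> i)) ^ n"
    using restr_eq[OF f(2), of p] unfolding f(3) by (simp add: f(4) \<sigma>_power \<sigma>_prod rat_of_mpoly_power)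
  then show ?thesis using coord_ring_of_fraction[OF mpolys_\<sigma>[OF f(1)]] by simp
qed

text \<open>Chain rule for the projection: the substituted expression for the variable
  \<open>s\<close> has derivative \<open>- a j / a s\<close>, so differentiating a restriction
  amounts to restricting the tangential derivative.\<close>

lemma deriv_restr:
  assumes "f \<in> \<O>"
  shows "ratfun_deriv j (restr f) =
    restr (ratfun_deriv j f - rat_const (a j / a s) * ratfun_deriv s f)"
proof -
  obtain p q where f: "\<sigma> q \<noteq> 0" "f = rat_of_mpoly p / rat_of_mpoly q"
    using coord_ring_regular[OF assms] by metis
  have nz: "q \<noteq> 0" "\<sigma> (q * q) \<noteq> 0" using f by (auto simp: \<sigma>_mult)
  let ?D = "\<lambda>p. mpoly_deriv j p - Const (a j / a s) * mpoly_deriv s p"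
  have "ratfun_deriv j f - rat_const (a j / a s) * ratfun_deriv s f =
      rat_of_mpoly (?D p * q - p * ?D q) / rat_of_mpoly (q * q)"
  proof -
    have ring: "(x * w - y * z) / (w * w) - c * ((x' * w - y * z') / (w * w)) =
        ((x - c * x') * w - y * (z - c * z')) / (w * w)" for c w x x' y z z' :: "'k ratfun"
      by (simp only: times_divide_eq_right diff_divide_distrib[symmetric]) (simp add: algebra_simps)
    show ?thesis
      unfolding f(2) using nz
      by (simp only: ratfun_deriv_divide rat_of_mpoly_eq_0_iff ratfun_deriv_of_mpoly ring
          rat_of_mpoly_diff rat_of_mpoly_mult rat_const_def not_False_eq_True simp_thms)
  qed
  then have "restr (ratfun_deriv j f - rat_const (a j / a s) * ratfun_deriv s f) =
      rat_of_mpoly (\<sigma> (?D p) * \<sigma> q - \<sigma> p * \<sigma> (?D q)) / rat_of_mpoly (\<sigma> q * \<sigma> q)"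
    using restr_eq[OF nz(2)] by (simp only: \<sigma>_mult \<sigma>_diff)
  also have "\<dots> = ratfun_deriv j (rat_of_mpoly (\<sigma> p) / rat_of_mpoly (\<sigma> q))"
    using f(1) by (simp add: ratfun_deriv_divide ratfun_deriv_of_mpoly deriv_\<sigma>
        rat_of_mpoly_diff rat_of_mpoly_mult)
  also have "\<dots> = ratfun_deriv j (restr f)"
    unfolding f(2) restr_eq[OF f(1)] ..
  finally show ?thesis ..
qed

text \<open>The denominator is a unit of \<open>\<O>\<close>, so divisibility of the numerator by
  \<open>\<alpha>\<close> among polynomials carries over.\<close>

lemma restr_eq_0:
  assumes "f \<in> \<O>" "restr f = 0"
  obtains g where "g \<in> \<O>" "f = rat_of_mpoly \<alpha> * g"
proof -
  obtain p q n where f: "p \<in> mpolys l" "\<sigma> q \<noteq> 0" "f = rat_of_mpoly p / rat_of_mpoly q"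
    "q = (\<Prod>i<N. \<gamma> i) ^ n"
    using coord_ring_regular[OF assms(1)] by metis
  have "\<sigma> p = 0" using assms(2) f(2) unfolding f(3) restr_eq[OF f(2)] by simp
  then obtain r where r: "r \<in> mpolys l" "p = \<alpha> * r" using \<sigma>_congruent[OF f(1)] by auto
  show ?thesis
  proof (rule that)
    show "rat_of_mpoly r / rat_of_mpoly q \<in> \<O>"
      using coord_ring_of_fraction[OF r(1)] by (simp add: f(4) rat_of_mpoly_power)
    show "f = rat_of_mpoly \<alpha> * (rat_of_mpoly r / rat_of_mpoly q)"
      by (simp add: f(3) r(2) rat_of_mpoly_mult)
  qed
qed

lemma \<alpha>_coord_ring: "rat_of_mpoly \<alpha> \<in> \<O>"
  using affine by (intro coord_ring_mpoly affine_mpolys)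

lemma restr_\<alpha>_mult: "f \<in> \<O> \<Longrightarrow> restr (rat_of_mpoly \<alpha> * f) = 0"
  using restr_mult[OF \<alpha>_coord_ring] restr_eq[of 1 \<alpha>] by simp

lemma restr_dlog_coeff:
  assumes "i < N"
  shows "restr (dlog_coeff j (\<gamma> i) - rat_const (a j / a s) * dlog_coeff s (\<gamma> i)) = dlog_coeff j (\<sigma> (\<gamma> i))"
proof -
  have "dlog_coeff j (\<gamma> i) - rat_const (a j / a s) * dlog_coeff s (\<gamma> i) =
      rat_of_mpoly (mpoly_deriv j (\<gamma> i) - Const (a j / a s) * mpoly_deriv s (\<gamma> i)) / rat_of_mpoly (\<gamma> i)"
    by (simp only: dlog_coeff_def rat_of_mpoly_diff rat_of_mpoly_mult rat_const_def
        times_divide_eq_right diff_divide_distrib)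
  then show ?thesis
    using restr_eq[OF \<sigma>_\<gamma>[OF assms]] by (simp only: dlog_coeff_def deriv_\<sigma>)
qed

lemma dlog_coeff_\<alpha>: "dlog_coeff j \<alpha> = rat_const (a j) / rat_of_mpoly \<alpha>"
  by (simp add: dlog_coeff_def deriv_\<alpha> rat_const_def)

text \<open>The tangential derivatives are those of the restriction, which lies in the coordinate
  ring of the restricted functions, where only constants have zero derivatives.\<close>

lemma restr_constant:
  assumes "f \<in> \<O>"
    and "\<And>j. j < l \<Longrightarrow> restr (ratfun_deriv j f - rat_const (a j / a s) * ratfun_deriv s f) = 0"
  obtains c g where "g \<in> \<O>" "f = rat_const c + rat_of_mpoly \<alpha> * g"
proof -
  have "ratfun_deriv j (restr f) = 0" if "j < l" for j
    using deriv_restr[OF assms(1)] assms(2)[OF that] by simp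
  then obtain c where c: "restr f = rat_const c"
    using coord_ring_constants[OF \<sigma>_\<gamma> mpolys_\<sigma>[OF \<gamma>] restr_coord_ring[OF assms(1)]] by blast
  have "restr (f - rat_const c) = 0"
    using restr_diff[OF assms(1) coord_ring_const] c by simp
  then obtain g where "g \<in> \<O>" "f - rat_const c = rat_of_mpoly \<alpha> * g"
    using restr_eq_0[OF coord_ring_diff[OF assms(1) coord_ring_const]] by blast
  then show ?thesis using that[of g c] by (simp add: algebra_simps)
qed

text \<open>\<open>\<alpha>\<close> is not a unit of \<open>\<O>\<close>: restriction kills the
  right-hand side. In this way a constant residue is shown to vanish.\<close>

lemma dvd_imp_const_0:
  assumes "rat_const c = rat_of_mpoly \<alpha> * g" "g \<in> \<O>" shows "c = 0"
  using restr_\<alpha>_mult[OF assms(2)] assms(1)[symmetric] by simp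

end

section \<open>Logarithmic forms\<close>

text \<open>Pole comparison: against at most a simple pole on the left, the numerator of the pole of
  order \<open>m + 2\<close> must be divisible by \<open>x\<close>. The cofactor is displayed so
  that it can be checked to lie in the coordinate ring.\<close>

lemma clear_pole:
  fixes x :: "'a::field"
  assumes "x \<noteq> 0" "t + k / x = d / x ^ Suc m - e / x ^ Suc (Suc m)"
  shows "e = x * (d - x ^ Suc m * t - k * x ^ m)"
proof -
  have "e / x ^ Suc (Suc m) = d / x ^ Suc m - t - k / x"
    unfolding assms(2)[symmetric] diff_diff_eq[symmetric] using assms(2) by (simp add: algebra_simps)
  then have "e = (d / x ^ Suc m - t - k / x) * x ^ Suc (Suc m)"
    using assms(1) by (simp add: divide_eq_eq)
  also have "\<dots> = x * (d - x ^ Suc m * t - k * x ^ m)"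
    using assms(1) by (simp add: left_diff_distrib right_diff_distrib mult_ac)
  finally show ?thesis .
qed

text \<open>By the formula for \<open>\<sigma>\<close> on affine functions,
  \<open>\<gamma> i\<close> could vanish on the hyperplane only by being a multiple of
  \<open>\<gamma> N\<close>.\<close>

lemma restricted_complementI:
  assumes aff: "\<And>i. i \<le> N \<Longrightarrow> affine l (\<gamma> i)"
    and nz: "\<And>i. i < N \<Longrightarrow> \<gamma> i \<noteq> 0"
    and np: "\<And>i t. i < N \<Longrightarrow> \<gamma> N \<noteq> Const t * \<gamma> i"
    and s: "s < l" "\<And>j. mpoly_deriv j (\<gamma> N) = Const (a j)" "a s \<noteq> 0"
  shows "restricted_complement l (\<gamma> N) s a N \<gamma>"
proof -
  interpret hyperplane_restriction l "\<gamma> N" s a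
    by unfold_locales (use aff s in auto)
  show ?thesis
  proof
    show "\<gamma> i \<in> mpolys l" if "i < N" for i using aff that by (intro affine_mpolys) auto
    show "\<sigma> (\<gamma> i) \<noteq> 0" if i: "i < N" for i
    proof
      assume 0: "\<sigma> (\<gamma> i) = 0"
      obtain b where "\<And>j. mpoly_deriv j (\<gamma> i) = Const (b j)" using affine_deriv[OF aff] i by (meson less_imp_le)
      then obtain r where r: "\<gamma> i = Const r * \<gamma> N" using \<sigma>_affine[OF aff, of i "b s"] i 0 by auto
      then have "r \<noteq> 0" using nz[OF i] by auto
      then have "\<gamma> N = Const (inverse r) * \<gamma> i"
        unfolding r by (simp add: mult.assoc[symmetric] flip: Const_mult)
      then show False using np[OF i] by blast
    qed
  qed
qed

text \<open>Meant for a \<open>\<gamma> N\<close> that is constant or proportional to an earlier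
  function: inverting it then adds nothing to the ring.\<close>

lemma coord_ring_Suc_eq:
  assumes "inverse (rat_of_mpoly (\<gamma> N)) \<in> coord_ring l N \<gamma>" "f \<in> coord_ring l (Suc N) \<gamma>"
  shows "f \<in> coord_ring l N \<gamma>"
  using assms(2)
proof (induction rule: coord_ring_induct)
  case (inverse i)
  then show ?case using assms(1) by (cases "i = N") (auto intro: coord_ring_inverse)
qed (auto intro: coord_ring_mpoly coord_ring_add coord_ring_mult coord_ring_uminus)

text \<open>The logarithmic derivatives of constants vanish and those of proportional functions agree; all
  coefficient vectors of exact logarithmic forms arise from these relations.\<close>

lemma exact_log_form_coeffs:
  assumes "\<And>i. i < N \<Longrightarrow> affine l (\<gamma> i)" "\<And>i. i < N \<Longrightarrow> \<gamma> i \<noteq> 0"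
    and "g \<in> coord_ring l N \<gamma>"
    and "\<And>j. j < l \<Longrightarrow> (\<Sum>i<N. rat_const (c i) * dlog_coeff j (\<gamma> i)) = ratfun_deriv j g"
    and "\<And>i. i \<ge> N \<Longrightarrow> c i = 0"
    and Z0: "(\<lambda>_. 0) \<in> Z" and Zadd: "\<And>c d. c \<in> Z \<Longrightarrow> d \<in> Z \<Longrightarrow> (\<lambda>i. c i + d i) \<in> Z"
    and "\<And>i t x. i < N \<Longrightarrow> \<gamma> i = Const t \<Longrightarrow> (\<lambda>n. if n = i then x else 0) \<in> Z"
    and "\<And>i j t x. i < N \<Longrightarrow> j < N \<Longrightarrow> \<gamma> i = Const t * \<gamma> j \<Longrightarrow>
          (\<lambda>n. (if n = i then x else 0) - (if n = j then x else 0)) \<in> Z"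
  shows "c \<in> (Z :: (nat \<Rightarrow> 'k::field_char_0) set)"
  using assms(1-5,8,9)
proof (induction N arbitrary: c g)
  case 0
  then have "c = (\<lambda>_. 0)" by auto
  then show ?case using Z0 by simp
next
  case (Suc N)
  note aff = Suc.prems(1) and nz = Suc.prems(2) and g = Suc.prems(3) and eq = Suc.prems(4)
    and supp = Suc.prems(5) and Zconst = Suc.prems(6) and Zprop = Suc.prems(7)
  have IH: "c' \<in> Z" if "g' \<in> coord_ring l N \<gamma>"
    "\<And>j. j < l \<Longrightarrow> (\<Sum>i<N. rat_const (c' i) * dlog_coeff j (\<gamma> i)) = ratfun_deriv j g'"
    "\<And>i. i \<ge> N \<Longrightarrow> c' i = 0" for c' g'
    by (rule Suc.IH[OF aff nz that Zconst Zprop]) auto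
  show ?case
  proof (cases "\<exists>t. \<gamma> N = Const t")
    case True
    then obtain t where t: "\<gamma> N = Const t" by blast
    have "inverse (rat_of_mpoly (\<gamma> N)) \<in> coord_ring l N \<gamma>"
      unfolding t using coord_ring_const[of "inverse t"]
      unfolding rat_const_inverse by (simp add: rat_const_def)
    from coord_ring_Suc_eq[OF this g] have g': "g \<in> coord_ring l N \<gamma>" .
    \<comment> \<open>A constant has zero logarithmic derivative, so its coefficient is arbitrary
      and is split off.\<close>
    have "c(N := 0) \<in> Z"
    proof (rule IH[OF g'])
      show "(\<Sum>i<N. rat_const ((c(N := 0)) i) * dlog_coeff j (\<gamma> i)) = ratfun_deriv j g" if "j < l" for j
        using eq[OF that] by (simp add: t)
      show "(c(N := 0)) i = 0" if "i \<ge> N" for i using that supp[of i] by auto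
    qed
    from Zadd[OF this Zconst[of N t "c N"]] t
    have "(\<lambda>i. (c(N := 0)) i + (if i = N then c N else 0)) \<in> Z" by simp
    also have "(\<lambda>i. (c(N := 0)) i + (if i = N then c N else 0)) = c" by auto
    finally show ?thesis .
  next
    case nconst: False
    show ?thesis
    proof (cases "\<exists>i<N. \<exists>t. \<gamma> N = Const t * \<gamma> i")
      case True
      then obtain i t where i: "i < N" "\<gamma> N = Const t * \<gamma> i" by blast
      have t: "t \<noteq> 0" using nconst i by auto
      have "inverse (rat_of_mpoly (\<gamma> N)) = rat_const (inverse t) * inverse (rat_of_mpoly (\<gamma> i))"
        unfolding i(2) rat_const_inverse by (simp add: rat_of_mpoly_mult rat_const_def)
      then have "inverse (rat_of_mpoly (\<gamma> N)) \<in> coord_ring l N \<gamma>"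
        using i(1) by (auto intro: coord_ring_mult coord_ring_inverse)
      from coord_ring_Suc_eq[OF this g] have g': "g \<in> coord_ring l N \<gamma>" .
      \<comment> \<open>Proportional functions have equal logarithmic derivatives, so the
        coefficient of \<open>N\<close> is transferred to \<open>i\<close>; what is lost is one of
        the proportionality vectors in \<open>Z\<close>.\<close>
      let ?c = "c(i := c i + c N, N := 0)"
      have "?c \<in> Z"
      proof (rule IH[OF g'])
        show "(\<Sum>k<N. rat_const (?c k) * dlog_coeff j (\<gamma> k)) = ratfun_deriv j g" if "j < l" for j
        proof -
          have dl: "dlog_coeff j (\<gamma> N) = dlog_coeff j (\<gamma> i)"
            using dlog_coeff_mult_Const[OF t] i(2) by simp
          have "(\<Sum>k<N. rat_const (?c k) * dlog_coeff j (\<gamma> k)) =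
              (\<Sum>k<N. rat_const (c k) * dlog_coeff j (\<gamma> k) +
                 (if k = i then rat_const (c N) * dlog_coeff j (\<gamma> i) else 0))"
            by (rule sum.cong) (auto simp: rat_const_add distrib_right)
          also have "\<dots> = (\<Sum>k<N. rat_const (c k) * dlog_coeff j (\<gamma> k)) + rat_const (c N) * dlog_coeff j (\<gamma> N)"
            using i(1) by (simp add: sum.distrib sum.delta dl)
          also have "\<dots> = ratfun_deriv j g" using eq[OF that] by simp
          finally show ?thesis .
        qed
        show "?c k = 0" if "k \<ge> N" for k using that supp[of k] i(1) by auto
      qed
      from Zadd[OF this Zprop[of N i t "c N"]] i
      have "(\<lambda>k. ?c k + ((if k = N then c N else 0) - (if k = i then c N else 0))) \<in> Z" by simp
      also have "(\<lambda>k. ?c k + ((if k = N then c N else 0) - (if k = i then c N else 0))) = c"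
        using i(1) by auto
      finally show ?thesis .
    next
      case nprop: False
      obtain s a where sa: "s < l" "\<And>j. mpoly_deriv j (\<gamma> N) = Const (a j)" "a s \<noteq> 0"
        using affine_cases[OF aff[of N]] nconst by auto
      interpret restricted_complement l "\<gamma> N" s a N \<gamma>
        by (rule restricted_complementI) (use aff nz nprop sa in auto)
      let ?x = "rat_of_mpoly (\<gamma> N)"
      have x: "?x \<noteq> 0" using \<alpha>_nonzero by simp
      define t where "t = (\<Sum>i<N. rat_const (c i) * dlog_coeff s (\<gamma> i))"
      have t: "t \<in> \<O>" unfolding t_def
        by (intro coord_ring_sum coord_ring_mult coord_ring_const coord_ring_dlog_coeff \<gamma>) auto
      have eq_s: "t + rat_const (c N * a s) / ?x = ratfun_deriv s g"
        using eq[OF sa(1)] by (simp add: t_def dlog_coeff_\<alpha> rat_const_mult)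
      \<comment> \<open>The pole order of \<open>g\<close> along the last hyperplane, as the least
        possible exponent; a positive value is refuted by producing a smaller one.\<close>
      define n where "n = (LEAST n. \<exists>h\<in>\<O>. g = h / ?x ^ n)"
      have "\<exists>n. \<exists>h\<in>\<O>. g = h / ?x ^ n"
        using coord_ring_Suc[OF nz affine_mpolys[OF aff] g] by metis
      from LeastI_ex[OF this] obtain h where h: "h \<in> \<O>" "g = h / ?x ^ n"
        unfolding n_def by blast
      have n: "n = 0"
      proof (cases n)
        case (Suc m)
        have e: "t + rat_const (c N * a s) / ?x = ratfun_deriv s h / ?x ^ Suc m -
            of_nat (Suc m) * h * ratfun_deriv s ?x / ?x ^ Suc (Suc m)"
          unfolding eq_s h(2) Suc ratfun_deriv_divide_power ..
        \<comment> \<open>The factor that the numerator picks up when the derivative in direction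
          \<open>s\<close> raises the pole of order \<open>m + 1\<close>; it is nonzero in
          characteristic 0.\<close>
        define b where "b = of_nat (Suc m) * a s"
        define k where "k = rat_const b"
        have "b \<noteq> 0" using sa(3) by (simp add: b_def del: of_nat_Suc)
        then have k: "k \<noteq> 0" "rat_const (inverse b) = inverse k"
          by (simp_all add: k_def rat_const_inverse)
        have "of_nat (Suc m) * h * ratfun_deriv s ?x = k * h"
          unfolding ratfun_deriv_of_mpoly sa(2) k_def b_def rat_const_mult rat_const_of_nat
          by (simp only: rat_const_def mult_ac)
        with clear_pole[OF x e]
        have kh: "k * h = ?x * (ratfun_deriv s h - ?x ^ Suc m * t - rat_const (c N * a s) * ?x ^ m)" by simp
        define h' where "h' = rat_const (inverse b) *
          (ratfun_deriv s h - ?x ^ Suc m * t - rat_const (c N * a s) * ?x ^ m)"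
        have h': "h' \<in> \<O>" unfolding h'_def
          by (intro coord_ring_mult coord_ring_diff coord_ring_power coord_ring_const \<alpha>_coord_ring
              coord_ring_deriv \<gamma> h t)
        have "h = inverse k * (k * h)"
          using k(1) by (simp only: mult.assoc[symmetric] left_inverse mult_1_left not_False_eq_True)
        also have "\<dots> = ?x * h'" unfolding kh h'_def k(2) by (simp only: mult_ac)
        finally have "g = h' / ?x ^ m" unfolding h(2) Suc using x by simp
        then have "n \<le> m" unfolding n_def using h' by (intro Least_le) blast
        then show ?thesis using Suc by simp
      qed simp
      with h have g': "g \<in> \<O>" by simp
      \<comment> \<open>Now \<open>g\<close> is regular, so the residue \<open>c N * a s\<close> is
        divisible by \<open>\<gamma> N\<close> and hence vanishes.\<close>
      have "rat_const (c N * a s) / ?x = ratfun_deriv s g - t" using eq_s by (simp add: algebra_simps)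
      then have "rat_const (c N * a s) = ?x * (ratfun_deriv s g - t)" using x by (simp add: divide_eq_eq mult.commute)
      from dvd_imp_const_0[OF this] have cN: "c N = 0"
        using sa(3) coord_ring_diff[OF coord_ring_deriv[OF \<gamma> g'] t] by simp
      show ?thesis
      proof (rule IH[OF g'])
        show "(\<Sum>i<N. rat_const (c i) * dlog_coeff j (\<gamma> i)) = ratfun_deriv j g" if "j < l" for j
          using eq[OF that] cN by simp
        show "c i = 0" if "i \<ge> N" for i using that supp[of i] cN by (cases "i = N") auto
      qed
    qed
  qed
qed

text \<open>The algebraic substitute for distinctness of the hyperplanes as point sets: it enters
  directly into linear relations between the functions and is inherited by initial segments of the
  family.\<close>

definition nonproportional :: "nat \<Rightarrow> nat \<Rightarrow> (nat \<Rightarrow> 'k::field_char_0 mpoly) \<Rightarrow> bool" where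
  "nonproportional l N \<gamma> \<longleftrightarrow>
     (\<forall>i<N. affine l (\<gamma> i) \<and> (\<forall>c. \<gamma> i \<noteq> Const c)) \<and>
     (\<forall>i<N. \<forall>j<N. \<forall>t. \<gamma> i = Const t * \<gamma> j \<longrightarrow> i = j)"

lemma nonproportional_affine: "nonproportional l N \<gamma> \<Longrightarrow> i < N \<Longrightarrow> affine l (\<gamma> i)"
  by (simp add: nonproportional_def)

lemma nonproportional_mpolys: "nonproportional l N \<gamma> \<Longrightarrow> i < N \<Longrightarrow> \<gamma> i \<in> mpolys l"
  by (simp add: nonproportional_affine affine_mpolys)

lemma nonproportional_nonzero: "nonproportional l N \<gamma> \<Longrightarrow> i < N \<Longrightarrow> \<gamma> i \<noteq> 0"
  using Const_0 by (metis nonproportional_def)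

lemma nonproportional_SucD: "nonproportional l (Suc N) \<gamma> \<Longrightarrow> nonproportional l N \<gamma>"
  by (simp add: nonproportional_def)

lemma nonproportional_restricted_complement:
  assumes "nonproportional l (Suc N) \<gamma>"
  obtains s a where "restricted_complement l (\<gamma> N) s a N \<gamma>"
proof -
  have aff: "affine l (\<gamma> i)" if "i \<le> N" for i
    using nonproportional_affine[OF assms] that by simp
  obtain s a where s: "s < l" "\<And>j. mpoly_deriv j (\<gamma> N) = Const (a j)" "a s \<noteq> 0"
    using affine_cases[OF aff[of N]] assms by (auto simp: nonproportional_def)
  have "restricted_complement l (\<gamma> N) s a N \<gamma>"
  proof (rule restricted_complementI[OF aff])
    show "\<gamma> i \<noteq> 0" if "i < N" for i using nonproportional_nonzero[OF assms, of i] that by simp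
    show "\<gamma> N \<noteq> Const t * \<gamma> i" if "i < N" for i t
    proof
      assume "\<gamma> N = Const t * \<gamma> i"
      then have "N = i" using assms that unfolding nonproportional_def by (metis less_SucI lessI)
      with that show False by simp
    qed
  qed (use s in auto)
  then show ?thesis by (rule that)
qed

text \<open>Without constants and proportionalities among the \<open>\<gamma> i\<close> there are no
  degenerate relations, so \<open>Z\<close> may consist of the zero vector alone.\<close>

lemma log_forms_not_exact:
  fixes c :: "nat \<Rightarrow> 'k::field_char_0"
  assumes "nonproportional l N \<gamma>" "g \<in> coord_ring l N \<gamma>"
    and "\<And>j. j < l \<Longrightarrow> (\<Sum>i<N. rat_const (c i) * dlog_coeff j (\<gamma> i)) = ratfun_deriv j g"
    and "i < N"
  shows "c i = 0"
proof -
  \<comment> \<open>Truncated, because the lemma on coefficient vectors speaks about whole functions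
    that vanish from \<open>N\<close> on.\<close>
  let ?c = "\<lambda>i. if i < N then c i else 0"
  have "?c \<in> {\<lambda>_. 0}"
  proof (rule exact_log_form_coeffs[where N = N and l = l and \<gamma> = \<gamma> and g = g])
    show "(\<lambda>n. (if n = i then x else 0) - (if n = j then x else 0)) \<in> {\<lambda>_. 0}"
      if "i < N" "j < N" "\<gamma> i = Const t * \<gamma> j" for i j t and x :: 'k
    proof -
      have "i = j" using that assms(1) by (auto simp: nonproportional_def)
      then show ?thesis by simp
    qed
    show "(\<lambda>n. if n = i then x else 0) \<in> {\<lambda>_. 0}" if "i < N" "\<gamma> i = Const t" for i t and x :: 'k
      using that assms(1) by (auto simp: nonproportional_def)
    show "(\<Sum>i<N. rat_const (if i < N then c i else 0) * dlog_coeff j (\<gamma> i)) = ratfun_deriv j g" if "j < l" for j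
      using assms(3)[OF that] by simp
    show "(\<lambda>i. c i + d i) \<in> {\<lambda>_. 0}" if "c \<in> {\<lambda>_. 0}" "d \<in> {\<lambda>_. 0}"
      for c d :: "nat \<Rightarrow> 'k" using that by simp
  qed (use assms(2) nonproportional_affine[OF assms(1)] nonproportional_nonzero[OF assms(1)] in simp_all)
  then have "?c = (\<lambda>_. 0)" by simp
  from fun_cong[OF this, of i] assms(4) show ?thesis by simp
qed

section \<open>Lowering the pole order along a hyperplane\<close>

context restricted_complement
begin

abbreviation "ratfun_\<alpha> \<equiv> rat_of_mpoly \<alpha>"

lemma ratfun_\<alpha>_nonzero: "ratfun_\<alpha> \<noteq> 0"
  using \<alpha>_nonzero by simp

lemma deriv_ratfun_\<alpha>: "ratfun_deriv j ratfun_\<alpha> = rat_const (a j)"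
  by (simp add: ratfun_deriv_of_mpoly deriv_\<alpha> rat_const_def)

lemma deriv_pole:
  "ratfun_deriv i (h / ratfun_\<alpha> ^ n) =
     ratfun_deriv i h / ratfun_\<alpha> ^ n - rat_const (of_nat n * a i) * h / ratfun_\<alpha> ^ Suc n"
  unfolding ratfun_deriv_divide_power deriv_ratfun_\<alpha> rat_const_mult rat_const_of_nat
  by (simp only: mult_ac)

text \<open>The polar part of a form whose differential has at most a simple pole is a multiple of
  \<open>d\<alpha>\<close>.\<close>

lemma polar_part:
  assumes h: "\<And>j. j < l \<Longrightarrow> h j \<in> \<O>"
    and z: "\<And>i j. i < l \<Longrightarrow> j < l \<Longrightarrow> ratfun_\<alpha> * z i j \<in> \<O>"
    and eq: "\<And>i j. i < l \<Longrightarrow> j < l \<Longrightarrow>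
       ratfun_deriv i (h j / ratfun_\<alpha> ^ Suc m) - ratfun_deriv j (h i / ratfun_\<alpha> ^ Suc m) = z i j"
  obtains u r where "u \<in> \<O>" "\<And>j. j < l \<Longrightarrow> r j \<in> \<O>"
    "\<And>j. j < l \<Longrightarrow> h j = rat_const (a j) * u + ratfun_\<alpha> * r j"
proof -
  let ?x = ratfun_\<alpha>
  let ?D = ratfun_deriv
  have gen: "n * c * h'' - n * b * h' = x * (d' - d'' - x ^ m * (x * w))"
    if "(d' / x ^ Suc m - n * c * h'' / x ^ Suc (Suc m)) - (d'' / x ^ Suc m - n * b * h' / x ^ Suc (Suc m)) = w"
      "x \<noteq> 0" for n b c d' d'' h' h'' w x :: "'k ratfun"
  proof -
    have "w * x ^ Suc (Suc m) = x * (d' - d'') - (n * c * h'' - n * b * h')"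
      unfolding that(1)[symmetric] using that(2) by (simp add: left_diff_distrib right_diff_distrib)
    then show ?thesis by (simp add: right_diff_distrib mult_ac)
  qed
  define n where "n = (of_nat (Suc m) :: 'k)"
  have n: "n \<noteq> 0" by (simp add: n_def del: of_nat_Suc)
  define b where "b = n * a s"
  have b: "b \<noteq> 0" using n a_s by (simp add: b_def)
  \<comment> \<open>Contraction with the direction \<open>s\<close>: the leading poles of the
    component with indices \<open>s\<close> and \<open>j\<close> show that
    \<open>a s * h j - a j * h s\<close> is divisible by \<open>\<alpha>\<close>. Thus
    \<open>h\<close> is \<open>h s / a s\<close> times \<open>d\<alpha>\<close> up to multiples of
    \<open>\<alpha>\<close>.\<close>
  define u where "u = rat_const (inverse (a s)) * h s"
  define r where "r j = rat_const (inverse b) * (?D s (h j) - ?D j (h s) - ?x ^ m * (?x * z s j))" for j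
  show ?thesis
  proof (rule that)
    show "u \<in> \<O>" unfolding u_def using h s by (intro coord_ring_mult coord_ring_const) auto
    show "r j \<in> \<O>" if "j < l" for j
      unfolding r_def using h s that
      by (intro coord_ring_mult[OF coord_ring_const] coord_ring_diff coord_ring_deriv \<gamma>
          coord_ring_mult[OF coord_ring_power[OF \<alpha>_coord_ring] z]) auto
    show "h j = rat_const (a j) * u + ?x * r j" if "j < l" for j
    proof -
      have "(?D s (h j) / ?x ^ Suc m - rat_const n * rat_const (a s) * h j / ?x ^ Suc (Suc m)) -
          (?D j (h s) / ?x ^ Suc m - rat_const n * rat_const (a j) * h s / ?x ^ Suc (Suc m)) = z s j"
        using eq[OF s that] by (simp only: deriv_pole n_def rat_const_mult)
      from gen[OF this ratfun_\<alpha>_nonzero]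
      have *: "rat_const n * rat_const (a s) * h j - rat_const n * rat_const (a j) * h s =
          ?x * (?D s (h j) - ?D j (h s) - ?x ^ m * (?x * z s j))" .
      have "inverse b * n * a s = 1" "inverse b * n = inverse (a s)"
        using b n by (simp_all add: b_def mult_ac)
      then have cb: "rat_const (inverse b) * rat_const n * rat_const (a s) = 1"
        and ca: "rat_const (inverse b) * rat_const n = rat_const (inverse (a s))"
        by (simp_all only: rat_const_1 flip: rat_const_mult)
      have "h j - rat_const (a j) * u =
          rat_const (inverse b) * (rat_const n * rat_const (a s) * h j - rat_const n * rat_const (a j) * h s)"
        unfolding right_diff_distrib mult.assoc[symmetric] cb u_def ca[symmetric]
        by (simp only: mult_1_left mult_ac)
      also have "\<dots> = ?x * r j" unfolding * r_def by (simp add: mult_ac)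
      finally show ?thesis by (simp add: diff_eq_eq add.commute)
    qed
  qed
qed

text \<open>Integration by parts of \<open>u d\<alpha> / \<alpha>^(m+2)\<close>: subtracting the
  differential of \<open>k u / \<alpha>^(m+1)\<close> with \<open>k = -1/(m+1)\<close> leaves a pole
  of order \<open>m + 1\<close>. A simple pole is out of reach, which is where logarithmic forms
  come from.\<close>

lemma pole_reduction:
  obtains k where "\<And>j u r. (rat_const (a j) * u + ratfun_\<alpha> * r) / ratfun_\<alpha> ^ Suc (Suc m) =
     ratfun_deriv j (rat_const k * u / ratfun_\<alpha> ^ Suc m) +
     (r - rat_const k * ratfun_deriv j u) / ratfun_\<alpha> ^ Suc m"
proof
  fix j u r
  let ?x = ratfun_\<alpha>
  define k where "k = - inverse (of_nat (Suc m) :: 'k)"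
  have "of_nat (Suc m) * a j * k = - a j" by (simp add: k_def del: of_nat_Suc)
  then have k: "rat_const (of_nat (Suc m) * a j) * rat_const k = - rat_const (a j)"
    by (simp only: rat_const_uminus flip: rat_const_mult)
  have gen: "(c * u + x * r) / x ^ Suc (Suc m) = (k * d / x ^ Suc m - n * (k * u) / x ^ Suc (Suc m)) + (r - k * d) / x ^ Suc m"
    if "n * k = - c" "x \<noteq> 0" for c d k n u x r :: "'k ratfun"
  proof -
    have "n * (k * u) = - c * u" by (simp only: mult.assoc[symmetric] that(1))
    then show ?thesis using that(2) by (simp add: add_divide_distrib diff_divide_distrib)
  qed
  show "(rat_const (a j) * u + ?x * r) / ?x ^ Suc (Suc m) =
     ratfun_deriv j (rat_const (- inverse (of_nat (Suc m))) * u / ?x ^ Suc m) +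
     (r - rat_const (- inverse (of_nat (Suc m))) * ratfun_deriv j u) / ?x ^ Suc m"
    unfolding k_def[symmetric] deriv_pole ratfun_deriv_const_mult
    by (rule gen[OF k ratfun_\<alpha>_nonzero])
qed

text \<open>Integration by parts is repeated until the pole is simple. Exact corrections do not
  change the differential \<open>z\<close>, so the bound on its pole persists throughout. The choice
  \<open>z = 0\<close> serves closed forms, a logarithmic \<open>z\<close> serves two-forms.\<close>

lemma log_pole_normal_form:
  assumes \<alpha>: "\<gamma> N = \<alpha>"
    and \<beta>: "\<And>j. j < l \<Longrightarrow> \<beta> j \<in> coord_ring l (Suc N) \<gamma>"
    and z: "\<And>i j. i < l \<Longrightarrow> j < l \<Longrightarrow> ratfun_\<alpha> * z i j \<in> \<O>"
    and eq: "\<And>i j. i < l \<Longrightarrow> j < l \<Longrightarrow> ratfun_deriv i (\<beta> j) - ratfun_deriv j (\<beta> i) = z i j"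
  obtains g u r where "g \<in> coord_ring l (Suc N) \<gamma>" "u \<in> \<O>" "\<And>j. j < l \<Longrightarrow> r j \<in> \<O>"
    "\<And>j. j < l \<Longrightarrow> \<beta> j = ratfun_deriv j g + rat_const (a j) * u / ratfun_\<alpha> + r j"
proof -
  let ?x = ratfun_\<alpha> and ?O' = "coord_ring l (Suc N) \<gamma>"
  have inv: "f / ?x ^ n \<in> ?O'" if "f \<in> \<O>" for f n
  proof -
    have "inverse ?x \<in> ?O'" using coord_ring_inverse[of N "Suc N" \<gamma>] \<alpha> by simp
    moreover have "f / ?x ^ n = f * inverse ?x ^ n" by (simp only: divide_inverse power_inverse)
    ultimately show ?thesis using coord_ring_mono[OF that, of "Suc N"]
      by (simp only: coord_ring_mult coord_ring_power le_SucI order_refl)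
  qed
  have \<gamma>': "\<gamma> i \<in> mpolys l" "\<gamma> i \<noteq> 0" if "i < Suc N" for i
    using \<gamma>[of i] \<gamma>_nonzero[of i] affine_mpolys[OF affine] \<alpha>_nonzero that \<alpha>
    by (metis less_SucE)+
  have "\<exists>h n. \<forall>j<l. h j \<in> \<O> \<and> \<beta> j = h j / ?x ^ n"
  proof (rule coord_ring_Suc_family[where N = N and \<alpha> = \<gamma> and m = l and f = \<beta> and l = l])
    fix h n
    assume "\<And>j. j < l \<Longrightarrow> h j \<in> \<O>" "\<And>j. j < l \<Longrightarrow> \<beta> j = h j / rat_of_mpoly (\<gamma> N) ^ n"
    then show ?thesis unfolding \<alpha> by blast
  qed (use \<gamma>' \<beta> in auto)
  then obtain h n where h: "\<And>j. j < l \<Longrightarrow> h j \<in> \<O>" "\<And>j. j < l \<Longrightarrow> \<beta> j = h j / ?x ^ n"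
    by blast
  have "\<exists>g u r. g \<in> ?O' \<and> u \<in> \<O> \<and> (\<forall>j<l. r j \<in> \<O> \<and>
      \<beta> j = ratfun_deriv j g + rat_const (a j) * u / ?x + r j)"
    using h eq
  proof (induction n arbitrary: \<beta> h)
    case 0
    then show ?case by (intro exI[of _ 0] exI[of _ h]) auto
  next
    case (Suc n)
    have eq': "ratfun_deriv i (h j / ?x ^ Suc n) - ratfun_deriv j (h i / ?x ^ Suc n) = z i j"
      if "i < l" "j < l" for i j
      using Suc.prems(2,3) that by metis
    obtain u r where ur: "u \<in> \<O>" "\<And>j. j < l \<Longrightarrow> r j \<in> \<O>"
      "\<And>j. j < l \<Longrightarrow> h j = rat_const (a j) * u + ?x * r j"
      using polar_part[OF Suc.prems(1) z eq'] by blast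
    show ?case
    proof (cases n)
      case 0
      then have "\<beta> j = ratfun_deriv j 0 + rat_const (a j) * u / ?x + r j" if "j < l" for j
        using Suc.prems(2)[OF that] ur(3)[OF that] ratfun_\<alpha>_nonzero by (simp add: add_divide_distrib)
      then show ?thesis using ur by (intro exI[of _ 0] exI[of _ u] exI[of _ r]) auto
    next
      case (Suc m)
      obtain k where k: "\<And>j u r. (rat_const (a j) * u + ?x * r) / ?x ^ Suc (Suc m) =
         ratfun_deriv j (rat_const k * u / ?x ^ Suc m) + (r - rat_const k * ratfun_deriv j u) / ?x ^ Suc m"
        using pole_reduction by blast
      define g0 where "g0 = rat_const k * u / ?x ^ Suc m"
      define h' where "h' j = r j - rat_const k * ratfun_deriv j u" for j
      define \<beta>' where "\<beta>' j = h' j / ?x ^ n" for j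
      have \<beta>': "\<beta> j = ratfun_deriv j g0 + \<beta>' j" if "j < l" for j
        using Suc.prems(2)[OF that] ur(3)[OF that] k unfolding g0_def h'_def \<beta>'_def Suc by simp
      have h': "h' j \<in> \<O>" if "j < l" for j
        unfolding h'_def using ur that
        by (intro coord_ring_diff coord_ring_mult coord_ring_const coord_ring_deriv \<gamma>) auto
      have "ratfun_deriv i (\<beta>' j) - ratfun_deriv j (\<beta>' i) = z i j" if "i < l" "j < l" for i j
        using Suc.prems(3)[OF that] that
        by (simp add: \<beta>' ratfun_deriv_add ratfun_deriv_commute[of i j])
      from Suc.IH[of h' \<beta>', OF h' _ this]
      obtain g u' r' where *: "g \<in> ?O'" "u' \<in> \<O>"
        "\<forall>j<l. r' j \<in> \<O> \<and> \<beta>' j = ratfun_deriv j g + rat_const (a j) * u' / ?x + r' j"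
        by (auto simp: \<beta>'_def)
      have "g0 \<in> ?O'" unfolding g0_def using ur by (intro inv coord_ring_mult coord_ring_const)
      then have "g0 + g \<in> ?O'" using * by (intro coord_ring_add)
      moreover have "\<forall>j<l. r' j \<in> \<O> \<and> \<beta> j = ratfun_deriv j (g0 + g) + rat_const (a j) * u' / ?x + r' j"
        using * \<beta>' by (auto simp: ratfun_deriv_add add.assoc)
      ultimately show ?thesis using *(2) by blast
    qed
  qed
  then show ?thesis using that by blast
qed

text \<open>The double pole has a numerator proportional to \<open>a i * a j\<close>, symmetric in
  the indices, and drops out of the antisymmetric expression; for constant \<open>u\<close> this
  says that \<open>d\<alpha> / \<alpha>\<close> is closed.\<close>

lemma curl_log_pole:
  "ratfun_deriv i (rat_const (a j) * u / ratfun_\<alpha>) - ratfun_deriv j (rat_const (a i) * u / ratfun_\<alpha>) =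
     (rat_const (a j) * ratfun_deriv i u - rat_const (a i) * ratfun_deriv j u) / ratfun_\<alpha>"
proof -
  have "ratfun_deriv i (rat_const (a j) * u / ratfun_\<alpha>) =
      rat_const (a j) * ratfun_deriv i u / ratfun_\<alpha> - rat_const (a i) * (rat_const (a j) * u) / ratfun_\<alpha> ^ 2" for i j
    using deriv_pole[of i "rat_const (a j) * u" 1]
    by (simp add: ratfun_deriv_const_mult numeral_2_eq_2)
  then show ?thesis by (simp add: diff_divide_distrib mult_ac)
qed

text \<open>A function whose differential is proportional to \<open>d\<alpha>\<close> along the hyperplane is constant
  there.\<close>

lemma constant_along_hyperplane:
  assumes u: "u \<in> \<O>"
    and "\<And>i. i < l \<Longrightarrow> \<exists>r\<in>\<O>. rat_const (a s) * ratfun_deriv i u - rat_const (a i) * ratfun_deriv s u = ratfun_\<alpha> * r"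
  obtains c v where "v \<in> \<O>" "u = rat_const c + ratfun_\<alpha> * v"
proof -
  have "restr (ratfun_deriv i u - rat_const (a i / a s) * ratfun_deriv s u) = 0" if i: "i < l" for i
  proof -
    obtain r where r: "r \<in> \<O>" "rat_const (a s) * ratfun_deriv i u - rat_const (a i) * ratfun_deriv s u = ratfun_\<alpha> * r"
      using assms(2)[OF i] by blast
    have "ratfun_deriv i u - rat_const (a i / a s) * ratfun_deriv s u =
        rat_const (inverse (a s)) * (rat_const (a s) * ratfun_deriv i u - rat_const (a i) * ratfun_deriv s u)"
      using a_s by (simp add: right_diff_distrib mult.assoc[symmetric] divide_inverse mult.commute
          flip: rat_const_mult)
    also have "\<dots> = ratfun_\<alpha> * (rat_const (inverse (a s)) * r)" unfolding r(2) by (simp only: mult_ac)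
    finally show ?thesis using restr_\<alpha>_mult[OF coord_ring_mult[OF coord_ring_const r(1)]] by simp
  qed
  from restr_constant[OF u this] show ?thesis using that by blast
qed

text \<open>With \<open>u = c + \<alpha> v\<close>, the form \<open>u d\<alpha> / \<alpha>\<close>
  is the closed form \<open>c d\<alpha> / \<alpha>\<close> plus the form
  \<open>v d\<alpha>\<close>.\<close>

lemma curl_log_pole_regular:
  assumes "u = rat_const c + ratfun_\<alpha> * v"
  shows "(rat_const (a j) * ratfun_deriv i u - rat_const (a i) * ratfun_deriv j u) / ratfun_\<alpha> =
    ratfun_deriv i (rat_const (a j) * v) - ratfun_deriv j (rat_const (a i) * v)"
proof -
  have gen: "(p * (q * v + x * d) - q * (p * v + x * d')) / x = p * d - q * d'"
    if "x \<noteq> 0" for p q v x d d' :: "'k ratfun"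
    using that by (simp add: right_diff_distrib distrib_left add_divide_distrib diff_divide_distrib mult_ac)
  have "ratfun_deriv i u = rat_const (a i) * v + ratfun_\<alpha> * ratfun_deriv i v" for i
    by (simp add: assms ratfun_deriv_add ratfun_deriv_mult deriv_ratfun_\<alpha>)
  then show ?thesis by (simp only: gen[OF ratfun_\<alpha>_nonzero] ratfun_deriv_const_mult)
qed

end

text \<open>Up to exact forms the polar part along the last hyperplane is
  \<open>u d\<alpha> / \<alpha>\<close>, and closedness forces \<open>u\<close> to be a constant
  \<open>c\<close> there. Removing \<open>c d\<alpha> / \<alpha>\<close> leaves a closed form with
  one hyperplane fewer; without hyperplanes the Poincare lemma for polynomials applies.\<close>

theorem closed_form_cohomologous_log:
  assumes "nonproportional l N \<gamma>"
    and "\<And>j. j < l \<Longrightarrow> \<eta> j \<in> coord_ring l N \<gamma>"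
    and "\<And>i j. i < l \<Longrightarrow> j < l \<Longrightarrow> ratfun_deriv i (\<eta> j) = ratfun_deriv j (\<eta> i)"
  shows "\<exists>g c. g \<in> coord_ring l N \<gamma> \<and>
    (\<forall>j<l. \<eta> j = ratfun_deriv j g + (\<Sum>i<N. rat_const (c i) * dlog_coeff j (\<gamma> i)))"
  using assms
proof (induction N arbitrary: \<eta>)
  case 0
  have "\<exists>p. p \<in> mpolys l \<and> \<eta> j = rat_of_mpoly p" if "j < l" for j
    using coord_ring_fraction[OF _ _ 0(2)[OF that]] by fastforce
  then obtain p where p: "\<And>j. j < l \<Longrightarrow> p j \<in> mpolys l \<and> \<eta> j = rat_of_mpoly (p j)" by metis
  have "mpoly_deriv i (p j) = mpoly_deriv j (p i)" if "i < l" "j < l" for i j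
    using 0(3)[OF that] p that by (simp add: ratfun_deriv_of_mpoly)
  then obtain q where q: "q \<in> mpolys l" "\<And>j. j < l \<Longrightarrow> mpoly_deriv j q = p j"
    using polynomial_poincare[of l p] p by blast
  show ?case
    using p q by (intro exI[of _ "rat_of_mpoly q"] exI[of _ "\<lambda>_. 0"])
      (auto simp: coord_ring_mpoly ratfun_deriv_of_mpoly)
next
  case (Suc N)
  obtain s a where "restricted_complement l (\<gamma> N) s a N \<gamma>"
    using nonproportional_restricted_complement[OF Suc.prems(1)] by blast
  then interpret restricted_complement l "\<gamma> N" s a N \<gamma> .
  let ?O' = "coord_ring l (Suc N) \<gamma>" and ?D = ratfun_deriv
  have curl: "?D i (\<eta> j) - ?D j (\<eta> i) = 0" if "i < l" "j < l" for i j
    using Suc.prems(3)[OF that] by simp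
  have "\<exists>g u r. g \<in> ?O' \<and> u \<in> \<O> \<and> (\<forall>j<l. r j \<in> \<O> \<and>
      \<eta> j = ?D j g + rat_const (a j) * u / ratfun_\<alpha> + r j)"
    by (rule log_pole_normal_form[where \<beta> = \<eta> and z = "\<lambda>_ _. 0", OF refl Suc.prems(2) _ curl]) auto
  then obtain g u r where gur: "g \<in> ?O'" "u \<in> \<O>" "\<And>j. j < l \<Longrightarrow> r j \<in> \<O>"
    and \<eta>: "\<And>j. j < l \<Longrightarrow> \<eta> j = ?D j g + rat_const (a j) * u / ratfun_\<alpha> + r j"
    by blast
  have closed: "(rat_const (a j) * ?D i u - rat_const (a i) * ?D j u) / ratfun_\<alpha> + (?D i (r j) - ?D j (r i)) = 0"
    if "i < l" "j < l" for i j
  proof -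
    have "?D i (\<eta> j) - ?D j (\<eta> i) = (?D i (rat_const (a j) * u / ratfun_\<alpha>) - ?D j (rat_const (a i) * u / ratfun_\<alpha>))
        + (?D i (r j) - ?D j (r i))"
      using that by (simp add: \<eta> ratfun_deriv_add ratfun_deriv_commute[of i j g])
    then show ?thesis using Suc.prems(3)[OF that] by (simp add: curl_log_pole)
  qed
  have "\<exists>w\<in>\<O>. rat_const (a s) * ?D i u - rat_const (a i) * ?D s u = ratfun_\<alpha> * w" if i: "i < l" for i
  proof (rule bexI)
    have "rat_const (a s) * ?D i u - rat_const (a i) * ?D s u = - (?D i (r s) - ?D s (r i)) * ratfun_\<alpha>"
      using closed[OF i s] ratfun_\<alpha>_nonzero by (simp only: eq_neg_iff_add_eq_0[symmetric] divide_eq_eq simp_thms if_False)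
    then show "rat_const (a s) * ?D i u - rat_const (a i) * ?D s u = ratfun_\<alpha> * - (?D i (r s) - ?D s (r i))"
      by (simp only: mult.commute)
    show "- (?D i (r s) - ?D s (r i)) \<in> \<O>"
      using gur i s by (intro coord_ring_uminus coord_ring_diff coord_ring_deriv \<gamma>) auto
  qed
  then obtain c v where v: "v \<in> \<O>" and u: "u = rat_const c + ratfun_\<alpha> * v"
    using constant_along_hyperplane[OF gur(2)] by blast
  \<comment> \<open>What remains after the exact part and the residue are removed; it is regular
    along the last hyperplane.\<close>
  define \<rho> where "\<rho> j = rat_const (a j) * v + r j" for j
  have \<eta>\<rho>: "\<eta> j = ?D j g + rat_const c * dlog_coeff j (\<gamma> N) + \<rho> j" if "j < l" for j
    using that ratfun_\<alpha>_nonzero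
    by (simp add: \<eta> u \<rho>_def dlog_coeff_\<alpha> distrib_left add_divide_distrib mult_ac add_ac)
  have \<rho>_O: "\<rho> j \<in> \<O>" if "j < l" for j
    using that v gur by (auto simp: \<rho>_def intro!: coord_ring_add coord_ring_mult)
  have \<rho>_closed: "?D i (\<rho> j) = ?D j (\<rho> i)" if "i < l" "j < l" for i j
    using Suc.prems(3)[OF that] that
    by (simp add: \<eta>\<rho> ratfun_deriv_add ratfun_deriv_const_mult dlog_coeff_closed[of i j]
        ratfun_deriv_commute[of i j g])
  obtain g' c' where g': "g' \<in> \<O>"
    and \<rho>: "\<And>j. j < l \<Longrightarrow> \<rho> j = ?D j g' + (\<Sum>i<N. rat_const (c' i) * dlog_coeff j (\<gamma> i))"
    using Suc.IH[OF nonproportional_SucD[OF Suc.prems(1)] \<rho>_O \<rho>_closed] by auto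
  have "g + g' \<in> ?O'" using gur(1) coord_ring_mono[OF g', of "Suc N"] by (auto intro: coord_ring_add)
  moreover have "\<eta> j = ?D j (g + g') + (\<Sum>i<Suc N. rat_const ((c'(N := c)) i) * dlog_coeff j (\<gamma> i))"
    if "j < l" for j
    using that by (simp add: \<eta>\<rho> \<rho> ratfun_deriv_add)
  ultimately show ?case by blast
qed

section \<open>Logarithmic two-forms\<close>

definition dlog_wedge :: "nat \<Rightarrow> nat \<Rightarrow> 'k::field_char_0 mpoly \<Rightarrow> 'k mpoly \<Rightarrow> 'k ratfun" where
  "dlog_wedge i j p q = dlog_coeff i p * dlog_coeff j q - dlog_coeff j p * dlog_coeff i q"

lemma dlog_wedge_self [simp]: "dlog_wedge i j p p = 0"
  by (simp add: dlog_wedge_def)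

lemma dlog_wedge_swap: "dlog_wedge i j q p = - dlog_wedge i j p q"
  by (simp add: dlog_wedge_def mult.commute)

lemma coord_ring_dlog_wedge:
  "a < N \<Longrightarrow> b < N \<Longrightarrow> \<gamma> a \<in> mpolys l \<Longrightarrow> \<gamma> b \<in> mpolys l \<Longrightarrow>
     dlog_wedge i j (\<gamma> a) (\<gamma> b) \<in> coord_ring l N \<gamma>"
  unfolding dlog_wedge_def by (intro coord_ring_diff coord_ring_mult coord_ring_dlog_coeff)

text \<open>The Arnold relation of three linearly dependent functions. After multiplication by the
  common denominator it is a linear identity between the 2 by 2 minors of the gradients.\<close>

lemma dlog_wedge_three_term:
  assumes p: "p = Const t * q + Const m * x" and nz: "p \<noteq> 0" "q \<noteq> 0" "x \<noteq> 0"
  shows "dlog_wedge i j p x - dlog_wedge i j q x = dlog_wedge i j p q"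
proof -
  have gen: "(p1 / P) * (x2 / x) - (p2 / P) * (x1 / x) - ((q1 / Q) * (x2 / x) - (q2 / Q) * (x1 / x)) =
      (p1 / P) * (q2 / Q) - (p2 / P) * (q1 / Q)"
    if "P = t * Q + m * x" "p1 = t * q1 + m * x1" "p2 = t * q2 + m * x2"
      "P \<noteq> 0" "Q \<noteq> 0" "x \<noteq> 0" for P Q x p1 p2 q1 q2 x1 x2 t m :: "'a ratfun"
  proof -
    have "(p1 * x2 - p2 * x1) * Q - (q1 * x2 - q2 * x1) * P = (p1 * q2 - p2 * q1) * x"
      unfolding that(1-3) by (simp add: algebra_simps)
    then have "((p1 * x2 - p2 * x1) * Q - (q1 * x2 - q2 * x1) * P) / (P * Q * x) =
        ((p1 * q2 - p2 * q1) * x) / (P * Q * x)" by simp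
    then show ?thesis using that(4-6) by (simp add: diff_divide_distrib left_diff_distrib mult_ac)
  qed
  have "rat_of_mpoly p = rat_const t * rat_of_mpoly q + rat_const m * rat_of_mpoly x"
    unfolding p by (simp only: rat_of_mpoly_add rat_of_mpoly_mult rat_const_def)
  moreover have "rat_of_mpoly (mpoly_deriv i p) =
      rat_const t * rat_of_mpoly (mpoly_deriv i q) + rat_const m * rat_of_mpoly (mpoly_deriv i x)" for i
    unfolding p by (simp add: rat_of_mpoly_add rat_of_mpoly_mult rat_const_def mpoly_deriv_add mpoly_deriv_mult)
  moreover have "rat_of_mpoly p \<noteq> 0" "rat_of_mpoly q \<noteq> 0" "rat_of_mpoly x \<noteq> 0" using nz by simp_all
  ultimately show ?thesis
    unfolding dlog_wedge_def dlog_coeff_def by (intro gen[where t = "rat_const t" and m = "rat_const m"])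
qed

lemma (in restricted_complement) dlog_wedge_\<alpha>:
  "dlog_wedge i j p \<alpha> = (rat_const (a j) * dlog_coeff i p - rat_const (a i) * dlog_coeff j p) / ratfun_\<alpha>"
  by (simp add: dlog_wedge_def dlog_coeff_\<alpha> diff_divide_distrib mult.commute)

text \<open>If \<open>\<theta> = \<Sum> c\<^sub>k \<omega>\<^sub>k\<close> becomes exact on the hyperplane, then \<open>\<theta> \<and> d\<alpha>/\<alpha>\<close> has no pole along
  it.\<close>

lemma (in restricted_complement) residue_exact_imp_regular:
  assumes aff: "\<And>k. k < N \<Longrightarrow> affine l (\<gamma> k)"
    and u: "u \<in> \<O>"
    and ex: "\<And>i. i < l \<Longrightarrow> (\<Sum>k<N. rat_const (c k) * dlog_coeff i (\<sigma> (\<gamma> k))) = ratfun_deriv i (restr u)"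
  obtains e where "\<And>i j. (\<Sum>k<N. rat_const (c k) * dlog_wedge i j (\<gamma> k) \<alpha>) =
     (\<Sum>m<N. \<Sum>n<N. rat_const (e m n) * dlog_wedge i j (\<gamma> m) (\<gamma> n))"
proof -
  \<comment> \<open>Coefficient vectors for which the pole along \<open>\<alpha> = 0\<close> can be
    removed; by additivity only the degenerate relations have to be checked.\<close>
  define Z where "Z = {c. \<exists>e. \<forall>i j. (\<Sum>k<N. rat_const (c k) * dlog_wedge i j (\<gamma> k) \<alpha>) =
     (\<Sum>m<N. \<Sum>n<N. rat_const (e m n) * dlog_wedge i j (\<gamma> m) (\<gamma> n))}"
  have \<sigma>_aff: "\<exists>r. \<sigma> p = p - Const r * \<alpha>" if "affine l p" for p
    using affine_deriv[OF that] \<sigma>_affine[OF that] by metis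
  let ?c = "\<lambda>k. if k < N then c k else 0"
  have "?c \<in> Z"
  proof (rule exact_log_form_coeffs[where \<gamma> = "\<lambda>k. \<sigma> (\<gamma> k)" and N = N and l = l and g = "restr u"])
    show "affine l (\<sigma> (\<gamma> k))" if "k < N" for k
      using \<sigma>_aff[OF aff[OF that]] affine_diff_mult[OF aff[OF that] affine] by auto
    show "\<sigma> (\<gamma> k) \<noteq> 0" if "k < N" for k using \<sigma>_\<gamma> that .
    show "restr u \<in> coord_ring l N (\<lambda>k. \<sigma> (\<gamma> k))" by (rule restr_coord_ring[OF u])
    show "(\<Sum>k<N. rat_const (?c k) * dlog_coeff j (\<sigma> (\<gamma> k))) = ratfun_deriv j (restr u)" if "j < l" for j
      using ex[OF that] by simp
    show "?c k = 0" if "k \<ge> N" for k using that by simp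
    show "(\<lambda>_. 0) \<in> Z" unfolding Z_def by (auto intro!: exI[of _ "\<lambda>_ _. 0"])
    show "(\<lambda>k. c k + d k) \<in> Z" if "c \<in> Z" "d \<in> Z" for c d
    proof -
      obtain e where e: "\<And>i j. (\<Sum>k<N. rat_const (c k) * dlog_wedge i j (\<gamma> k) \<alpha>) =
         (\<Sum>m<N. \<Sum>n<N. rat_const (e m n) * dlog_wedge i j (\<gamma> m) (\<gamma> n))"
        using \<open>c \<in> Z\<close> unfolding Z_def by blast
      obtain e' where e': "\<And>i j. (\<Sum>k<N. rat_const (d k) * dlog_wedge i j (\<gamma> k) \<alpha>) =
         (\<Sum>m<N. \<Sum>n<N. rat_const (e' m n) * dlog_wedge i j (\<gamma> m) (\<gamma> n))"
        using \<open>d \<in> Z\<close> unfolding Z_def by blast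
      show ?thesis unfolding Z_def
        by (intro CollectI exI[of _ "\<lambda>m n. e m n + e' m n"])
           (simp add: rat_const_add distrib_right sum.distrib e e')
    qed
    \<comment> \<open>Parallel hyperplanes: \<open>\<gamma> k\<close> is a constant plus a multiple
      of \<open>\<alpha>\<close>, so its differential is proportional to
      \<open>d\<alpha>\<close>.\<close>
    show "(\<lambda>n. if n = k then x else 0) \<in> Z" if k: "k < N" "\<sigma> (\<gamma> k) = Const t" for k t x
    proof -
      obtain r where r: "\<gamma> k = Const t + Const r * \<alpha>"
        using \<sigma>_aff[OF aff[OF k(1)]] k(2) by (metis diff_add_cancel)
      have "dlog_wedge i j (\<gamma> k) \<alpha> = 0" for i j
        by (simp add: dlog_wedge_def dlog_coeff_def r mpoly_deriv_add mpoly_deriv_mult rat_of_mpoly_mult mult_ac)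
      then have "(\<Sum>n<N. rat_const (if n = k then x else 0) * dlog_wedge i j (\<gamma> n) \<alpha>) = 0" for i j
        by (intro sum.neutral) simp
      then show ?thesis unfolding Z_def by (auto intro!: exI[of _ "\<lambda>_ _. 0"])
    qed
    \<comment> \<open>Equal intersections with the hyperplane: \<open>\<gamma> k\<close>,
      \<open>\<gamma> k'\<close> and \<open>\<alpha>\<close> are linearly dependent, and the Arnold
      relation rewrites the difference without \<open>\<alpha>\<close>.\<close>
    show "(\<lambda>n. (if n = k then x else 0) - (if n = k' then x else 0)) \<in> Z"
      if k: "k < N" "k' < N" "\<sigma> (\<gamma> k) = Const t * \<sigma> (\<gamma> k')" for k k' t x
    proof -
      have "\<sigma> (\<gamma> k - Const t * \<gamma> k') = 0" using k by (simp add: \<sigma>_diff \<sigma>_mult)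
      moreover have "affine l (\<gamma> k - Const t * \<gamma> k')" using k by (intro affine_diff_mult aff)
      ultimately obtain r where "\<gamma> k - Const t * \<gamma> k' = Const r * \<alpha>"
        using \<sigma>_aff by (metis eq_iff_diff_eq_0)
      then have "\<gamma> k = Const t * \<gamma> k' + Const r * \<alpha>" by (metis add.commute diff_add_cancel)
      from dlog_wedge_three_term[OF this \<gamma>_nonzero[OF k(1)] \<gamma>_nonzero[OF k(2)] \<alpha>_nonzero]
      have *: "dlog_wedge i j (\<gamma> k) \<alpha> - dlog_wedge i j (\<gamma> k') \<alpha> = dlog_wedge i j (\<gamma> k) (\<gamma> k')" for i j .
      have "(\<Sum>n<N. rat_const ((if n = k then x else 0) - (if n = k' then x else 0)) * dlog_wedge i j (\<gamma> n) \<alpha>) =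
          (\<Sum>m<N. \<Sum>n<N. rat_const (if m = k \<and> n = k' then x else 0) * dlog_wedge i j (\<gamma> m) (\<gamma> n))" for i j
      proof -
        have "(\<Sum>n<N. rat_const ((if n = k then x else 0) - (if n = k' then x else 0)) * dlog_wedge i j (\<gamma> n) \<alpha>) =
          (\<Sum>n<N. (if n = k then rat_const x * dlog_wedge i j (\<gamma> n) \<alpha> else 0) - (if n = k' then rat_const x * dlog_wedge i j (\<gamma> n) \<alpha> else 0))"
          by (rule sum.cong) (auto simp: rat_const_diff left_diff_distrib)
        also have "\<dots> = rat_const x * dlog_wedge i j (\<gamma> k) (\<gamma> k')"
          using k by (simp add: sum_subtractf sum.delta flip: right_diff_distrib *)
        also have "\<dots> = (\<Sum>m<N. if m = k then \<Sum>n<N. (if n = k' then rat_const x * dlog_wedge i j (\<gamma> m) (\<gamma> n) else 0) else 0)"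
          using k by (simp add: sum.delta)
        also have "\<dots> = (\<Sum>m<N. \<Sum>n<N. if m = k then (if n = k' then rat_const x * dlog_wedge i j (\<gamma> m) (\<gamma> n) else 0) else 0)"
          by (intro sum.cong refl) simp
        also have "\<dots> = (\<Sum>m<N. \<Sum>n<N. rat_const (if m = k \<and> n = k' then x else 0) * dlog_wedge i j (\<gamma> m) (\<gamma> n))"
          by (intro sum.cong refl) auto
        finally show ?thesis .
      qed
      then show ?thesis unfolding Z_def
        by (intro CollectI exI[of _ "\<lambda>m n. if m = k \<and> n = k' then x else 0"] allI)
    qed
  qed
  then obtain e where "\<And>i j. (\<Sum>k<N. rat_const (?c k) * dlog_wedge i j (\<gamma> k) \<alpha>) =
     (\<Sum>m<N. \<Sum>n<N. rat_const (e m n) * dlog_wedge i j (\<gamma> m) (\<gamma> n))"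
    unfolding Z_def by blast
  then show ?thesis using that[of e] by simp
qed

text \<open>Two descriptions of the simple pole along the last hyperplane are compared. In the
  logarithmic expression its residue is a combination of restricted logarithmic forms; in the normal
  form of \<open>\<beta>\<close> it is the differential of the restriction of \<open>u\<close>. So
  this combination is exact, which rewrites the two-form without the last function. Then
  \<open>u\<close> is constant on the hyperplane, and \<open>\<beta>\<close> can be replaced by a
  form regular there.\<close>

theorem exact_log_two_form_eq_0:
  assumes "nonproportional l N \<gamma>"
    and "\<And>j. j < l \<Longrightarrow> \<beta> j \<in> coord_ring l N \<gamma>"
    and "\<And>i j. i < l \<Longrightarrow> j < l \<Longrightarrow>
      (\<Sum>m<N. \<Sum>n<N. rat_const (e m n) * dlog_wedge i j (\<gamma> m) (\<gamma> n)) =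
        ratfun_deriv i (\<beta> j) - ratfun_deriv j (\<beta> i)"
    and "i < l" "j < l"
  shows "(\<Sum>m<N. \<Sum>n<N. rat_const (e m n) * dlog_wedge i j (\<gamma> m) (\<gamma> n)) = 0"
  using assms
proof (induction N arbitrary: \<beta> e)
  case 0
  show ?case by simp
next
  case (Suc N)
  note ij = Suc.prems(4,5)
  obtain s a where "restricted_complement l (\<gamma> N) s a N \<gamma>"
    using nonproportional_restricted_complement[OF Suc.prems(1)] by blast
  then interpret restricted_complement l "\<gamma> N" s a N \<gamma> .
  let ?D = ratfun_deriv and ?x = ratfun_\<alpha>
  \<comment> \<open>The total coefficient of the product of the \<open>k\<close>-th and the last
    logarithmic form: the double sum runs over ordered pairs and the product is
    antisymmetric.\<close>
  define c where "c k = e k N - e N k" for k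
  define w where "w e i j = (\<Sum>m<N. \<Sum>n<N. rat_const (e m n) * dlog_wedge i j (\<gamma> m) (\<gamma> n))" for e i j
  define z where "z i j = (\<Sum>m<Suc N. \<Sum>n<Suc N. rat_const (e m n) * dlog_wedge i j (\<gamma> m) (\<gamma> n))" for i j
  define \<theta> where "\<theta> i = (\<Sum>k<N. rat_const (c k) * dlog_coeff i (\<gamma> k))" for i
  have w_O: "w e i j \<in> \<O>" for e i j
    unfolding w_def by (intro coord_ring_sum coord_ring_mult coord_ring_const coord_ring_dlog_wedge \<gamma>) auto
  have \<theta>_O: "\<theta> i \<in> \<O>" for i
    unfolding \<theta>_def by (intro coord_ring_sum coord_ring_mult coord_ring_const coord_ring_dlog_coeff \<gamma>) auto
  have z_split: "z i j = w e i j + (\<Sum>k<N. rat_const (c k) * dlog_wedge i j (\<gamma> k) (\<gamma> N))" for i j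
  proof -
    have "z i j = w e i j + (\<Sum>k<N. rat_const (e k N) * dlog_wedge i j (\<gamma> k) (\<gamma> N)) +
        (\<Sum>k<N. rat_const (e N k) * dlog_wedge i j (\<gamma> N) (\<gamma> k))"
      by (simp add: z_def w_def sum.distrib)
    also have "\<dots> = w e i j + (\<Sum>k<N. rat_const (e k N) * dlog_wedge i j (\<gamma> k) (\<gamma> N) +
        rat_const (e N k) * dlog_wedge i j (\<gamma> N) (\<gamma> k))"
      by (simp add: sum.distrib add.assoc)
    also have "\<dots> = w e i j + (\<Sum>k<N. rat_const (c k) * dlog_wedge i j (\<gamma> k) (\<gamma> N))"
      by (simp add: c_def rat_const_diff left_diff_distrib dlog_wedge_swap[of i j "\<gamma> N"])
    finally show ?thesis .
  qed
  have z_pole: "z i j = w e i j + (rat_const (a j) * \<theta> i - rat_const (a i) * \<theta> j) / ?x" for i j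
    unfolding z_split dlog_wedge_\<alpha> \<theta>_def
    by (simp add: sum_distrib_left sum_subtractf sum_divide_distrib diff_divide_distrib right_diff_distrib mult_ac)
  have xz: "?x * z i j \<in> \<O>" for i j
  proof -
    have "?x * z i j = ?x * w e i j + (rat_const (a j) * \<theta> i - rat_const (a i) * \<theta> j)"
      using ratfun_\<alpha>_nonzero by (simp add: z_pole distrib_left)
    also have "\<dots> \<in> \<O>"
      by (intro coord_ring_add coord_ring_mult coord_ring_diff coord_ring_const \<alpha>_coord_ring w_O \<theta>_O)
    finally show ?thesis .
  qed
  have curl: "?D i (\<beta> j) - ?D j (\<beta> i) = z i j" if "i < l" "j < l" for i j
    using Suc.prems(3)[OF that] by (simp only: z_def)
  have "\<exists>g u r. u \<in> \<O> \<and> (\<forall>j<l. r j \<in> \<O> \<and>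
      \<beta> j = ?D j g + rat_const (a j) * u / ?x + r j)"
    by (rule log_pole_normal_form[where \<beta> = \<beta> and z = z, OF refl Suc.prems(2) xz curl]) auto
  then obtain g u r where gur: "u \<in> \<O>" "\<And>j. j < l \<Longrightarrow> r j \<in> \<O>"
    and \<beta>: "\<And>j. j < l \<Longrightarrow> \<beta> j = ?D j g + rat_const (a j) * u / ?x + r j"
    by blast
  have z_eq: "z i j = (rat_const (a j) * ?D i u - rat_const (a i) * ?D j u) / ?x + (?D i (r j) - ?D j (r i))"
    if "i < l" "j < l" for i j
  proof -
    have "?D i (\<beta> j) - ?D j (\<beta> i) = (?D i (rat_const (a j) * u / ?x) - ?D j (rat_const (a i) * u / ?x))
        + (?D i (r j) - ?D j (r i))"
      using that by (simp add: \<beta> ratfun_deriv_add ratfun_deriv_commute[of i j g])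
    then show ?thesis using curl[OF that] by (simp add: curl_log_pole)
  qed
  have curl_O: "?D i (r j) - ?D j (r i) \<in> \<O>" if "i < l" "j < l" for i j
    using gur that by (intro coord_ring_diff coord_ring_deriv \<gamma>) auto
  have ex: "(\<Sum>k<N. rat_const (c k) * dlog_coeff i (\<sigma> (\<gamma> k))) = ?D i (restr u)" if i: "i < l" for i
  proof -
    \<comment> \<open>The difference of the regular parts in the two expressions for the component
      with indices \<open>i\<close> and \<open>s\<close>; the residues agree up to
      \<open>\<alpha>\<close> times a constant multiple of it.\<close>
    define q where "q = ?D i (r s) - ?D s (r i) - w e i s"
    have q: "q \<in> \<O>" unfolding q_def using curl_O[OF i s] w_O by (rule coord_ring_diff)
    have grp: "p1 - p2 = p3 - p4" if "p4 + p1 = p2 + p3" for p1 p2 p3 p4 :: "'a ratfun"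
    proof -
      have "p1 = p2 + p3 - p4" unfolding that[symmetric] by simp
      then show ?thesis by simp
    qed
    have gen: "(\<theta>1 - b / c * \<theta>2) - (d1 - b / c * d2) = x * (inverse c * (q1 - w1))"
      if "w1 + (c * \<theta>1 - b * \<theta>2) / x = (c * d1 - b * d2) / x + q1" "x \<noteq> 0" "c \<noteq> 0"
      for b c \<theta>1 \<theta>2 d1 d2 q1 w1 x :: "'a ratfun"
    proof -
      have "(c * \<theta>1 - b * \<theta>2) / x - (c * d1 - b * d2) / x = q1 - w1"
        by (rule grp[OF that(1)])
      then have "((c * \<theta>1 - b * \<theta>2) - (c * d1 - b * d2)) / x = q1 - w1" by (simp only: diff_divide_distrib)
      then have "(c * \<theta>1 - b * \<theta>2) - (c * d1 - b * d2) = x * (q1 - w1)"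
        using that(2) by (simp only: divide_eq_eq simp_thms if_False mult.commute)
      then have "((c * \<theta>1 - b * \<theta>2) - (c * d1 - b * d2)) / c = x * (q1 - w1) / c" by simp
      moreover have "((c * \<theta>1 - b * \<theta>2) - (c * d1 - b * d2)) / c = (\<theta>1 - b / c * \<theta>2) - (d1 - b / c * d2)"
        using that(3) by (simp add: diff_divide_distrib)
      moreover have "x * (q1 - w1) / c = x * (inverse c * (q1 - w1))"
        by (simp only: divide_inverse mult_ac)
      ultimately show ?thesis by simp
    qed
    have as: "rat_const (a s) \<noteq> 0" using a_s by simp
    have aa: "rat_const (a i / a s) = rat_const (a i) / rat_const (a s)"
      by (simp only: divide_inverse rat_const_mult rat_const_inverse)
    have "(\<theta> i - rat_const (a i / a s) * \<theta> s) - (?D i u - rat_const (a i / a s) * ?D s u) =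
        ?x * (inverse (rat_const (a s)) * q)"
      unfolding q_def aa using z_eq[OF i s] unfolding z_pole by (rule gen[OF _ ratfun_\<alpha>_nonzero as])
    moreover have "inverse (rat_const (a s)) * q \<in> \<O>"
      unfolding rat_const_inverse[symmetric] by (intro coord_ring_mult coord_ring_const q)
    ultimately have "restr ((\<theta> i - rat_const (a i / a s) * \<theta> s) - (?D i u - rat_const (a i / a s) * ?D s u)) = 0"
      by (simp add: restr_\<alpha>_mult)
    moreover have "\<theta> i - rat_const (a i / a s) * \<theta> s \<in> \<O>" "?D i u - rat_const (a i / a s) * ?D s u \<in> \<O>"
      using \<theta>_O gur(1) by (auto intro!: coord_ring_diff coord_ring_mult coord_ring_deriv \<gamma>)
    ultimately have "restr (\<theta> i - rat_const (a i / a s) * \<theta> s) = ?D i (restr u)"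
      by (simp add: restr_diff deriv_restr[OF gur(1)])
    also have "\<theta> i - rat_const (a i / a s) * \<theta> s =
        (\<Sum>k<N. rat_const (c k) * (dlog_coeff i (\<gamma> k) - rat_const (a i / a s) * dlog_coeff s (\<gamma> k)))"
      by (simp only: \<theta>_def sum_distrib_left sum_subtractf right_diff_distrib mult_ac)
    also have "restr \<dots> = (\<Sum>k<N. rat_const (c k) * dlog_coeff i (\<sigma> (\<gamma> k)))"
      by (subst restr_sum; (intro sum.cong refl)?)
         (auto intro!: coord_ring_mult coord_ring_diff coord_ring_dlog_coeff \<gamma>
           simp: restr_dlog_coeff restr_mult coord_ring_diff coord_ring_mult coord_ring_dlog_coeff \<gamma>)
    finally show ?thesis .
  qed
  have "\<exists>e'. \<forall>i j. (\<Sum>k<N. rat_const (c k) * dlog_wedge i j (\<gamma> k) (\<gamma> N)) = w e' i j"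
    unfolding w_def
  proof (rule residue_exact_imp_regular[where c = c and u = u, OF _ gur(1) ex])
    show "affine l (\<gamma> k)" if "k < N" for k
      using nonproportional_affine[OF Suc.prems(1), of k] that by simp
  qed blast+
  then obtain e' where e': "\<And>i j. (\<Sum>k<N. rat_const (c k) * dlog_wedge i j (\<gamma> k) (\<gamma> N)) = w e' i j"
    by blast
  have zw: "z i j = w (\<lambda>m n. e m n + e' m n) i j" for i j
    unfolding z_split e' by (simp add: w_def rat_const_add distrib_right sum.distrib)
  \<comment> \<open>The logarithmic expression no longer involves the last function, so the pole
    contributed by \<open>u\<close> has to cancel.\<close>
  have "\<exists>q\<in>\<O>. rat_const (a s) * ?D i u - rat_const (a i) * ?D s u = ?x * q" if i: "i < l" for i
  proof (rule bexI)
    have "(rat_const (a s) * ?D i u - rat_const (a i) * ?D s u) / ?x = z i s - (?D i (r s) - ?D s (r i))"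
      using z_eq[OF i s] by simp
    then show "rat_const (a s) * ?D i u - rat_const (a i) * ?D s u = ?x * (z i s - (?D i (r s) - ?D s (r i)))"
      using ratfun_\<alpha>_nonzero by (simp only: divide_eq_eq simp_thms if_False mult.commute)
    show "z i s - (?D i (r s) - ?D s (r i)) \<in> \<O>"
      unfolding zw using w_O curl_O[OF i s] by (rule coord_ring_diff)
  qed
  then obtain c0 v where v: "v \<in> \<O>" and u: "u = rat_const c0 + ?x * v"
    using constant_along_hyperplane[OF gur(1)] by blast
  define \<rho> where "\<rho> j = rat_const (a j) * v + r j" for j
  have "w (\<lambda>m n. e m n + e' m n) i j = 0"
    unfolding w_def
  proof (rule Suc.IH[OF nonproportional_SucD[OF Suc.prems(1)] _ _ ij, of \<rho>])
    show "\<rho> j \<in> \<O>" if "j < l" for j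
      using that v gur by (auto simp: \<rho>_def intro!: coord_ring_add coord_ring_mult)
    show "(\<Sum>m<N. \<Sum>n<N. rat_const (e m n + e' m n) * dlog_wedge i j (\<gamma> m) (\<gamma> n)) = ?D i (\<rho> j) - ?D j (\<rho> i)"
      if "i < l" "j < l" for i j
    proof -
      have "w (\<lambda>m n. e m n + e' m n) i j = ?D i (\<rho> j) - ?D j (\<rho> i)"
        using z_eq[OF that] unfolding zw curl_log_pole_regular[OF u] \<rho>_def ratfun_deriv_add by simp
      then show ?thesis by (simp only: w_def)
    qed
  qed
  then show ?case by (simp only: zw[symmetric] z_def)
qed

section \<open>The shuffle algebra\<close>

definition shuffle_product :: "(word \<Rightarrow>\<^sub>0 'a::comm_ring_1) \<Rightarrow> (word \<Rightarrow>\<^sub>0 'a) \<Rightarrow> (word \<Rightarrow>\<^sub>0 'a)" where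
  "shuffle_product f g = (\<Sum>u\<in>keys f. \<Sum>v\<in>keys g. \<Sum>w\<in>#shuffle_words u v.
     single w (lookup f u * lookup g v))"

lemma bar_mult_eq_shuffle_product: "bar_mult = shuffle_product"
  by (intro ext) (simp add: bar_mult_def shuffle_product_def)

lemma shuffle_words_Nil2 [simp]: "shuffle_words u [] = {#u#}"
  by (cases u) simp_all

lemma shuffle_words_commute: "shuffle_words u v = shuffle_words v u"
  by (induction u v rule: shuffle_words.induct) (simp_all add: add.commute)

lemma single_add_mset: "(\<Sum>w\<in>#M. single w (c + d)) = (\<Sum>w\<in>#M. single w c) + (\<Sum>w\<in>#M. single w d)"
  by (simp add: single_add sum_mset.distrib)

lemma shuffle_product_superset:
  assumes "finite A" "keys f \<subseteq> A" "finite B" "keys g \<subseteq> B"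
  shows "shuffle_product f g = (\<Sum>u\<in>A. \<Sum>v\<in>B. \<Sum>w\<in>#shuffle_words u v.
     single w (lookup f u * lookup g v))"
proof -
  have "shuffle_product f g = (\<Sum>u\<in>keys f. \<Sum>v\<in>B. \<Sum>w\<in>#shuffle_words u v.
     single w (lookup f u * lookup g v))"
    unfolding shuffle_product_def using assms
    by (intro sum.cong refl sum.mono_neutral_left) (auto simp: in_keys_iff)
  also have "\<dots> = (\<Sum>u\<in>A. \<Sum>v\<in>B. \<Sum>w\<in>#shuffle_words u v.
     single w (lookup f u * lookup g v))"
    using assms by (intro sum.mono_neutral_left) (auto simp: in_keys_iff)
  finally show ?thesis .
qed

lemma shuffle_product_add_left: "shuffle_product (f + f') g = shuffle_product f g + shuffle_product f' g"
  using Poly_Mapping.keys_add[of f f']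
  by (simp add: shuffle_product_superset[of "keys f \<union> keys f'" _ "keys g"] lookup_add distrib_right
      single_add_mset sum.distrib)

lemma shuffle_product_commute: "shuffle_product f g = shuffle_product g f"
  unfolding shuffle_product_def
  by (subst sum.swap) (simp add: shuffle_words_commute mult.commute)

lemma shuffle_product_add_right: "shuffle_product f (g + g') = shuffle_product f g + shuffle_product f g'"
  using shuffle_product_add_left[of g g' f] by (simp add: shuffle_product_commute)

lemma shuffle_product_0_left [simp]: "shuffle_product 0 g = 0"
  by (simp add: shuffle_product_def)

lemma shuffle_product_0_right [simp]: "shuffle_product f 0 = 0"
  by (simp add: shuffle_product_def)

lemma shuffle_product_single:
  "shuffle_product (single u c) (single v d) = (\<Sum>w\<in>#shuffle_words u v. single w (c * d))"
  by (subst shuffle_product_superset[of "{u}" _ "{v}"]) auto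

lemma shuffle_product_single_Nil: "shuffle_product (single [] c) (single v d) = single v (c * d)"
  by (simp add: shuffle_product_single)

text \<open>\<open>delete_first a\<close> keeps the words starting with the letter \<open>a\<close> and deletes this letter. It is a
  derivation for the shuffle product, and together with the constant term these operations separate
  elements; identities of the shuffle algebra are proved by induction on the length in this way.\<close>

definition delete_first :: "nat \<Rightarrow> (word \<Rightarrow>\<^sub>0 'a::zero) \<Rightarrow> (word \<Rightarrow>\<^sub>0 'a)" where
  "delete_first a = Poly_Mapping.map_key (Cons a)"

lemma lookup_delete_first [simp]: "lookup (delete_first a f) w = lookup f (a # w)"
  by (simp add: delete_first_def map_key.rep_eq)

lemma delete_first_add: "delete_first a (f + g) = delete_first a f + delete_first a g"
  by (intro poly_mapping_eqI) (simp add: lookup_add)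

lemma delete_first_0 [simp]: "delete_first a 0 = 0"
  by (intro poly_mapping_eqI) simp

lemma delete_first_single_Nil [simp]: "delete_first a (single [] c) = 0"
  by (intro poly_mapping_eqI) (simp add: lookup_single)

lemma delete_first_single_Cons [simp]:
  "delete_first a (single (b # u) c) = (if a = b then single u c else 0)"
  by (intro poly_mapping_eqI) (simp add: lookup_single when_def)

lemma delete_first_sum_mset: "delete_first a (\<Sum>x\<in>#M. f x) = (\<Sum>x\<in>#M. delete_first a (f x))"
  by (induction M) (simp_all add: delete_first_add)

lemma delete_first_separates:
  assumes "lookup f [] = lookup g []" "\<And>a. delete_first a f = delete_first a g" shows "f = g"
proof (rule poly_mapping_eqI)
  fix w show "lookup f w = lookup g w"
    using assms(1) by (cases w) (auto simp flip: lookup_delete_first simp: assms(2))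
qed

text \<open>This is the recursion of \<open>shuffle_words\<close>: the first letter of a shuffle is
  the first letter of one of the two words.\<close>

lemma delete_first_shuffle_product:
  "delete_first a (shuffle_product f g) =
     shuffle_product (delete_first a f) g + shuffle_product f (delete_first a g)"
proof (induction f rule: poly_mapping_induct)
  case (single u c)
  show ?case
  proof (induction g rule: poly_mapping_induct)
    case (single v d)
    show ?case
      by (cases u; cases v)
         (auto simp: shuffle_product_single delete_first_sum_mset image_mset.compositionality o_def delete_first_add)
  qed (simp add: shuffle_product_add_right delete_first_add)
qed (simp add: shuffle_product_add_left delete_first_add)

lemma lookup_Nil_shuffle_product: "lookup (shuffle_product f g) [] = lookup f [] * lookup g []"
proof (induction f rule: poly_mapping_induct)
  case (single u c)
  show ?case
  proof (induction g rule: poly_mapping_induct)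
    case (single v d)
    have "lookup (\<Sum>w\<in>#M. single (b # w) e) [] = 0" for b :: nat and M and e :: 'a
      by (induction M) (auto simp: lookup_add lookup_single when_def)
    then show ?case
      by (cases u; cases v) (auto simp: shuffle_product_single lookup_single when_def lookup_add image_mset.compositionality o_def)
  qed (simp add: shuffle_product_add_right lookup_add distrib_left)
qed (simp add: shuffle_product_add_left lookup_add distrib_right)

lemma shuffle_product_assoc_single:
  "shuffle_product (shuffle_product (single u c) (single v d)) (single w e) =
     shuffle_product (single u c) (shuffle_product (single v d) (single w e))"
proof (induction "length u + length v + length w" arbitrary: u v w rule: less_induct)
  case less
  have IH1: "shuffle_product (shuffle_product (delete_first a (single u c)) (single v d)) (single w e) =
     shuffle_product (delete_first a (single u c)) (shuffle_product (single v d) (single w e))" for a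
    by (cases u) (simp_all add: less)
  have IH2: "shuffle_product (shuffle_product (single u c) (delete_first a (single v d))) (single w e) =
     shuffle_product (single u c) (shuffle_product (delete_first a (single v d)) (single w e))" for a
    by (cases v) (simp_all add: less)
  have IH3: "shuffle_product (shuffle_product (single u c) (single v d)) (delete_first a (single w e)) =
     shuffle_product (single u c) (shuffle_product (single v d) (delete_first a (single w e)))" for a
    by (cases w) (simp_all add: less)
  show ?case
    by (rule delete_first_separates)
       (simp_all add: lookup_Nil_shuffle_product mult.assoc delete_first_shuffle_product
          shuffle_product_add_left shuffle_product_add_right IH1 IH2 IH3 add.assoc)
qed

lemma shuffle_product_assoc:
  "shuffle_product (shuffle_product f g) h = shuffle_product f (shuffle_product g h)"
proof (induction f rule: poly_mapping_induct)
  case (single u c)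
  show ?case
  proof (induction g rule: poly_mapping_induct)
    case (single v d)
    show ?case
      by (induction h rule: poly_mapping_induct)
         (simp_all add: shuffle_product_add_right shuffle_product_assoc_single)
  qed (simp add: shuffle_product_add_right shuffle_product_add_left)
qed (simp add: shuffle_product_add_left)

lemma shuffle_product_1_left: "shuffle_product (single [] 1) f = f"
  by (induction f rule: poly_mapping_induct)
     (simp_all add: shuffle_product_add_right shuffle_product_single_Nil)

text \<open>A type of its own, so that powers, products over multisets and ring normalization refer
  to the shuffle product.\<close>

typedef (overloaded) 'a shuffle_algebra = "UNIV :: (word \<Rightarrow>\<^sub>0 'a::comm_ring_1) set"
  morphisms words_of of_words ..

setup_lifting type_definition_shuffle_algebra

instantiation shuffle_algebra :: (comm_ring_1) comm_ring_1
begin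

lift_definition zero_shuffle_algebra :: "'a shuffle_algebra" is 0 .
lift_definition one_shuffle_algebra :: "'a shuffle_algebra" is "single [] 1" .
lift_definition plus_shuffle_algebra :: "'a shuffle_algebra \<Rightarrow> 'a shuffle_algebra \<Rightarrow> 'a shuffle_algebra" is "(+)" .
lift_definition minus_shuffle_algebra :: "'a shuffle_algebra \<Rightarrow> 'a shuffle_algebra \<Rightarrow> 'a shuffle_algebra" is "(-)" .
lift_definition uminus_shuffle_algebra :: "'a shuffle_algebra \<Rightarrow> 'a shuffle_algebra" is uminus .
lift_definition times_shuffle_algebra :: "'a shuffle_algebra \<Rightarrow> 'a shuffle_algebra \<Rightarrow> 'a shuffle_algebra"
  is shuffle_product .

instance
proof
  fix x y z :: "'a shuffle_algebra"
  note rep = words_of_inject[symmetric] times_shuffle_algebra.rep_eq plus_shuffle_algebra.rep_eq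
    minus_shuffle_algebra.rep_eq uminus_shuffle_algebra.rep_eq zero_shuffle_algebra.rep_eq
    one_shuffle_algebra.rep_eq
  show "x * y * z = x * (y * z)" by (simp add: rep shuffle_product_assoc)
  show "x * y = y * x" unfolding rep by (rule shuffle_product_commute)
  show "1 * x = x" by (simp add: rep shuffle_product_1_left)
  show "(x + y) * z = x * z + y * z" by (simp add: rep shuffle_product_add_left)
  have "lookup 0 [] \<noteq> lookup (single [] (1::'a)) []" by simp
  then show "(0 :: 'a shuffle_algebra) \<noteq> 1" unfolding rep by metis
  show "x + y + z = x + (y + z)" "x + y = y + x" "0 + x = x" "- x + x = 0" "x - y = x + - y"
    by (simp_all add: rep algebra_simps)
qed

end

lift_definition coeff :: "'a::comm_ring_1 shuffle_algebra \<Rightarrow> word \<Rightarrow> 'a" is Poly_Mapping.lookup .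
lift_definition scalar :: "'a::comm_ring_1 \<Rightarrow> 'a shuffle_algebra" is "single []" .
lift_definition delete :: "nat \<Rightarrow> 'a::comm_ring_1 shuffle_algebra \<Rightarrow> 'a shuffle_algebra" is delete_first .

lemma shuffle_algebra_eqI: "(\<And>w. coeff x w = coeff y w) \<Longrightarrow> x = y"
  unfolding words_of_inject[symmetric] coeff.rep_eq by (rule poly_mapping_eqI)

lemma finite_coeff: "finite {w. coeff x w \<noteq> 0}"
  by (simp add: coeff.rep_eq)

lemma coeff_0 [simp]: "coeff 0 w = 0"
  by (simp add: coeff.rep_eq zero_shuffle_algebra.rep_eq)

lemma coeff_add [simp]: "coeff (x + y) w = coeff x w + coeff y w"
  by (simp add: coeff.rep_eq plus_shuffle_algebra.rep_eq lookup_add)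

lemma coeff_diff [simp]: "coeff (x - y) w = coeff x w - coeff y w"
  by (simp add: coeff.rep_eq minus_shuffle_algebra.rep_eq lookup_minus)

lemma coeff_uminus [simp]: "coeff (- x) w = - coeff x w"
  by (simp add: coeff.rep_eq uminus_shuffle_algebra.rep_eq)

lemma coeff_sum: "coeff (sum f A) w = (\<Sum>a\<in>A. coeff (f a) w)"
  by (induction A rule: infinite_finite_induct) auto

lemma coeff_1: "coeff 1 w = (if w = [] then 1 else 0)"
  by (simp add: coeff.rep_eq one_shuffle_algebra.rep_eq lookup_single when_def)

lemma coeff_scalar: "coeff (scalar c) w = (if w = [] then c else 0)"
  by (simp add: coeff.rep_eq scalar.rep_eq lookup_single when_def)

lemma coeff_scalar_mult [simp]: "coeff (scalar c * x) w = c * coeff x w"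
proof -
  have "lookup (shuffle_product (single [] c) y) w = c * lookup y w" for y
    by (induction y rule: poly_mapping_induct)
       (simp_all add: shuffle_product_add_right shuffle_product_single_Nil lookup_add distrib_left
          lookup_single when_def)
  then show ?thesis by (simp add: coeff.rep_eq times_shuffle_algebra.rep_eq scalar.rep_eq)
qed

lemma coeff_delete [simp]: "coeff (delete a x) w = coeff x (a # w)"
  by (simp add: coeff.rep_eq delete.rep_eq)

lemma coeff_mult_Nil [simp]: "coeff (x * y) [] = coeff x [] * coeff y []"
  by (simp add: coeff.rep_eq times_shuffle_algebra.rep_eq lookup_Nil_shuffle_product)

lemma delete_mult: "delete a (x * y) = delete a x * y + x * delete a y"
  by (simp add: words_of_inject[symmetric] times_shuffle_algebra.rep_eq plus_shuffle_algebra.rep_eq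
      delete.rep_eq delete_first_shuffle_product)

lemma delete_add: "delete a (x + y) = delete a x + delete a y"
  by (rule shuffle_algebra_eqI) simp

lemma delete_0 [simp]: "delete a 0 = 0"
  by (rule shuffle_algebra_eqI) simp

lemma delete_sum: "delete a (sum f A) = (\<Sum>i\<in>A. delete a (f i))"
  by (induction A rule: infinite_finite_induct) (auto simp: delete_add)

lemma delete_1 [simp]: "delete a 1 = 0"
  by (rule shuffle_algebra_eqI) (simp add: coeff_1)

lemma delete_scalar_mult [simp]: "delete a (scalar c * x) = scalar c * delete a x"
  by (rule shuffle_algebra_eqI) simp

lemma scalar_0 [simp]: "scalar 0 = 0" and scalar_1 [simp]: "scalar 1 = 1"
  by (rule shuffle_algebra_eqI, simp add: coeff_scalar coeff_1)+

lemma scalar_add: "scalar (c + d) = scalar c + scalar d"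
  by (rule shuffle_algebra_eqI) (simp add: coeff_scalar)

lemma scalar_uminus: "scalar (- c) = - scalar c"
  by (rule shuffle_algebra_eqI) (simp add: coeff_scalar)

lemma scalar_diff: "scalar (c - d) = scalar c - scalar d"
  by (rule shuffle_algebra_eqI) (simp add: coeff_scalar)

lemma scalar_mult: "scalar (c * d) = scalar c * scalar d"
  by (rule shuffle_algebra_eqI) (simp add: coeff_scalar)

lemma scalar_eq_iff [simp]: "scalar c = scalar d \<longleftrightarrow> c = d"
  by (metis coeff_scalar)

text \<open>The operations \<open>delete a\<close> form a family of derivations whose common
  constants are the scalars; they replace differentiation in the transcendence argument.\<close>

lemma delete_eq_0_imp_scalar:
  assumes "\<And>a. delete a x = 0" shows "x = scalar (coeff x [])"
proof (rule shuffle_algebra_eqI)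
  fix w show "coeff x w = coeff (scalar (coeff x [])) w"
    using coeff_delete[of "hd w" x "tl w"] by (cases w) (auto simp: coeff_scalar assms)
qed

section \<open>Forms in coordinates\<close>

lemma lookup_map: "f 0 = 0 \<Longrightarrow> lookup (Poly_Mapping.map f p) k = f (lookup p k)"
  by (simp add: Poly_Mapping.map.rep_eq when_def)

lemma lookup_form_scale [simp]: "lookup (form_scale f \<phi>) S = f * lookup \<phi> S"
  by (simp add: form_scale_def lookup_map)

lemma form_scale_add: "form_scale f (\<phi> + \<psi>) = form_scale f \<phi> + form_scale f \<psi>"
  by (intro poly_mapping_eqI) (simp add: lookup_add distrib_left)

lemma form_scale_0 [simp]: "form_scale f 0 = 0" "form_scale 0 \<phi> = 0"
  by (intro poly_mapping_eqI, simp)+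

lemma wedge_superset:
  assumes "finite A" "keys \<phi> \<subseteq> A" "finite B" "keys \<psi> \<subseteq> B"
  shows "\<phi> \<and>\<^sub>f \<psi> = (\<Sum>I\<in>A. \<Sum>J\<in>B. single (I \<union> J) (wedge_sign I J * lookup \<phi> I * lookup \<psi> J))"
proof -
  have "\<phi> \<and>\<^sub>f \<psi> = (\<Sum>I\<in>keys \<phi>. \<Sum>J\<in>B. single (I \<union> J) (wedge_sign I J * lookup \<phi> I * lookup \<psi> J))"
    unfolding wedge_def using assms
    by (intro sum.cong refl sum.mono_neutral_left) (auto simp: in_keys_iff)
  also have "\<dots> = (\<Sum>I\<in>A. \<Sum>J\<in>B. single (I \<union> J) (wedge_sign I J * lookup \<phi> I * lookup \<psi> J))"
    using assms by (intro sum.mono_neutral_left) (auto simp: in_keys_iff)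
  finally show ?thesis .
qed

lemma wedge_single:
  "single I f \<and>\<^sub>f single J g = single (I \<union> J) (wedge_sign I J * f * g)"
  by (subst wedge_superset[of "{I}" _ "{J}"]) auto

lemma wedge_add_left: "(\<phi> + \<phi>') \<and>\<^sub>f \<psi> = \<phi> \<and>\<^sub>f \<psi> + \<phi>' \<and>\<^sub>f \<psi>"
  using Poly_Mapping.keys_add[of \<phi> \<phi>']
  by (simp add: wedge_superset[of "keys \<phi> \<union> keys \<phi>'" _ "keys \<psi>"] lookup_add distrib_left distrib_right
      single_add sum.distrib)

lemma wedge_add_right: "\<phi> \<and>\<^sub>f (\<psi> + \<psi>') = \<phi> \<and>\<^sub>f \<psi> + \<phi> \<and>\<^sub>f \<psi>'"
  using Poly_Mapping.keys_add[of \<psi> \<psi>']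
  by (simp add: wedge_superset[of "keys \<phi>" _ "keys \<psi> \<union> keys \<psi>'"] lookup_add distrib_left distrib_right
      single_add sum.distrib)

lemma wedge_0_left [simp]: "0 \<and>\<^sub>f \<psi> = 0"
  by (simp add: wedge_def)

lemma wedge_0_right [simp]: "\<phi> \<and>\<^sub>f 0 = 0"
  by (simp add: wedge_def)

lemma wedge_sum_left: "sum f A \<and>\<^sub>f \<psi> = (\<Sum>a\<in>A. f a \<and>\<^sub>f \<psi>)"
  by (induction A rule: infinite_finite_induct) (auto simp: wedge_add_left)

lemma wedge_sum_right: "\<phi> \<and>\<^sub>f sum f A = (\<Sum>a\<in>A. \<phi> \<and>\<^sub>f f a)"
  by (induction A rule: infinite_finite_induct) (auto simp: wedge_add_right)

lemma wedge_sign_empty [simp]: "wedge_sign {} J = 1"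
  by (simp add: wedge_sign_def)

lemma wedge_sign_empty2 [simp]: "wedge_sign I {} = 1"
  by (simp add: wedge_sign_def)

lemma wedge_sign_singletons:
  "wedge_sign {i} {j} = (if i = j then 0 else if i < j then 1 else - 1)"
proof -
  have "{(i', j'). i' \<in> {i} \<and> j' \<in> {j} \<and> j' < i'} = (if j < i then {(i, j)} else {})" by auto
  then show ?thesis by (simp add: wedge_sign_def)
qed

definition one_form :: "nat \<Rightarrow> (nat \<Rightarrow> 'k::field_char_0 ratfun) \<Rightarrow> 'k form" where
  "one_form l \<eta> = (\<Sum>j<l. single {j} (\<eta> j))"

text \<open>Only entries with \<open>i < j\<close> are read, one for each two-element set of the
  basis; the matrices that occur are antisymmetric.\<close>

definition two_form :: "nat \<Rightarrow> (nat \<Rightarrow> nat \<Rightarrow> 'k::field_char_0 ratfun) \<Rightarrow> 'k form" where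
  "two_form l z = (\<Sum>i<l. \<Sum>j<l. if i < j then single {i, j} (z i j) else 0)"

lemma lookup_one_form: "j < l \<Longrightarrow> lookup (one_form l \<eta>) {j} = \<eta> j"
  by (simp add: one_form_def lookup_sum lookup_single when_def sum.delta)

lemma lookup_one_form_eq_0: "\<not> (\<exists>j<l. S = {j}) \<Longrightarrow> lookup (one_form l \<eta>) S = 0"
  by (auto simp: one_form_def lookup_sum lookup_single when_def intro!: sum.neutral)

lemma one_form_eqI:
  assumes "\<And>S. S \<in> keys \<phi> \<Longrightarrow> S \<subseteq> {..<l} \<and> card S = 1"
  shows "\<phi> = one_form l (\<lambda>j. lookup \<phi> {j})"
proof (rule poly_mapping_eqI)
  fix S show "lookup \<phi> S = lookup (one_form l (\<lambda>j. lookup \<phi> {j})) S"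
  proof (cases "\<exists>j<l. S = {j}")
    case False
    then have "S \<notin> keys \<phi>" using assms[of S] by (auto simp: card_1_singleton_iff)
    then show ?thesis using lookup_one_form_eq_0[OF False] by (simp add: in_keys_iff)
  qed (auto simp: lookup_one_form)
qed

lemma one_form_add: "one_form l \<eta> + one_form l \<theta> = one_form l (\<lambda>j. \<eta> j + \<theta> j)"
  by (simp add: one_form_def single_add sum.distrib)

lemma one_form_sum: "(\<Sum>a\<in>A. one_form l (\<eta> a)) = one_form l (\<lambda>j. \<Sum>a\<in>A. \<eta> a j)"
  by (induction A rule: infinite_finite_induct) (auto simp: one_form_add, simp_all add: one_form_def)

lemma form_scale_single: "form_scale f (single S g) = single S (f * g)"
  by (intro poly_mapping_eqI) (simp add: lookup_single when_def)

lemma form_scale_sum: "form_scale f (sum \<phi> A) = (\<Sum>a\<in>A. form_scale f (\<phi> a))"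
  by (induction A rule: infinite_finite_induct) (auto simp: form_scale_add)

lemma form_scale_one_form: "form_scale f (one_form l \<eta>) = one_form l (\<lambda>j. f * \<eta> j)"
  by (simp add: one_form_def form_scale_sum form_scale_single)

lemma form_scale_two_form: "form_scale f (two_form l z) = two_form l (\<lambda>i j. f * z i j)"
  unfolding two_form_def form_scale_sum by (intro sum.cong refl) (simp add: form_scale_single)

lemma two_form_add: "two_form l y + two_form l z = two_form l (\<lambda>i j. y i j + z i j)"
  unfolding two_form_def sum.distrib[symmetric] by (intro sum.cong refl) (simp add: single_add)

lemma two_form_sum: "(\<Sum>a\<in>A. two_form l (z a)) = two_form l (\<lambda>i j. \<Sum>a\<in>A. z a i j)"
  by (induction A rule: infinite_finite_induct) (auto simp: two_form_add, simp_all add: two_form_def cong: if_cong)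

lemma doubleton_eq_ordered: "i < j \<Longrightarrow> p < q \<Longrightarrow> {i, j} = {p, q} \<longleftrightarrow> i = p \<and> j = (q::nat)"
  by (auto simp: doubleton_eq_iff)

lemma lookup_two_form:
  assumes "p < q" "q < l" shows "lookup (two_form l z) {p, q} = z p q"
proof -
  have "lookup (two_form l z) {p, q} =
      (\<Sum>i<l. \<Sum>j<l. if i = p then (if j = q then z p q else 0) else 0)"
    unfolding two_form_def lookup_sum
  proof (intro sum.cong refl)
    fix i j show "lookup (if i < j then single {i, j} (z i j) else 0) {p, q} =
        (if i = p then (if j = q then z p q else 0) else 0)"
      using assms doubleton_eq_ordered[of i j p q] by (auto simp: lookup_single when_def)
  qed
  also have "\<dots> = (\<Sum>i<l. if i = p then (\<Sum>j<l. if j = q then z p q else 0) else 0)"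
    by (intro sum.cong refl) simp
  also have "\<dots> = z p q" using assms by (simp add: sum.delta)
  finally show ?thesis .
qed

lemma two_form_eq_0_iff: "two_form l z = 0 \<longleftrightarrow> (\<forall>i<l. \<forall>j<l. i < j \<longrightarrow> z i j = 0)"
proof
  assume "two_form l z = 0"
  then show "\<forall>i<l. \<forall>j<l. i < j \<longrightarrow> z i j = 0" by (metis lookup_two_form lookup_zero)
next
  assume "\<forall>i<l. \<forall>j<l. i < j \<longrightarrow> z i j = 0"
  then show "two_form l z = 0" unfolding two_form_def by (intro sum.neutral ballI) simp
qed

lemma wedge_one_forms:
  "one_form l \<eta> \<and>\<^sub>f one_form l \<theta> = two_form l (\<lambda>i j. \<eta> i * \<theta> j - \<eta> j * \<theta> i)"
proof -
  let ?f = "\<lambda>i j. single {i, j} (\<eta> i * \<theta> j)"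
  have "one_form l \<eta> \<and>\<^sub>f one_form l \<theta> = (\<Sum>i<l. \<Sum>j<l. single ({i} \<union> {j}) (wedge_sign {i} {j} * \<eta> i * \<theta> j))"
    unfolding one_form_def wedge_sum_left wedge_sum_right wedge_single
    by (rule sum.swap)
  also have "\<dots> = (\<Sum>i<l. \<Sum>j<l. (if i < j then ?f i j else 0) + (if j < i then - ?f i j else 0))"
    by (intro sum.cong refl) (auto simp: wedge_sign_singletons insert_commute single_uminus)
  also have "\<dots> = (\<Sum>i<l. \<Sum>j<l. if i < j then ?f i j else 0) + (\<Sum>i<l. \<Sum>j<l. if j < i then - ?f i j else 0)"
    by (simp add: sum.distrib)
  also have "(\<Sum>i<l. \<Sum>j<l. if j < i then - ?f i j else 0) = (\<Sum>i<l. \<Sum>j<l. if i < j then - ?f j i else 0)"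
    by (rule sum.swap)
  also have "(\<Sum>i<l. \<Sum>j<l. if i < j then ?f i j else 0) + (\<Sum>i<l. \<Sum>j<l. if i < j then - ?f j i else 0) =
      (\<Sum>i<l. \<Sum>j<l. if i < j then single {i, j} (\<eta> i * \<theta> j - \<eta> j * \<theta> i) else 0)"
    unfolding sum.distrib[symmetric]
    by (intro sum.cong refl) (auto simp: single_diff insert_commute)
  finally show ?thesis by (simp only: two_form_def)
qed

lemma function_form_wedge: "function_form f \<and>\<^sub>f \<psi> = form_scale f \<psi>"
proof -
  have "function_form f \<and>\<^sub>f \<psi> = (\<Sum>J\<in>keys \<psi>. single J (f * lookup \<psi> J))"
    by (subst wedge_superset[of "{{}}" _ "keys \<psi>"]) (auto simp: function_form_def)
  also have "\<dots> = form_scale f (\<Sum>J\<in>keys \<psi>. single J (lookup \<psi> J))"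
    by (simp add: form_scale_sum form_scale_single)
  finally show ?thesis by (simp add: sum_single_keys)
qed

lemma ext_d_superset:
  assumes "finite A" "keys \<phi> \<subseteq> A"
  shows "ext_d l \<phi> = (\<Sum>J\<in>A. \<Sum>i<l. single {i} (ratfun_deriv i (lookup \<phi> J)) \<and>\<^sub>f single J 1)"
  unfolding ext_d_def using assms by (intro sum.mono_neutral_left) (auto simp: in_keys_iff)

lemma ext_d_0 [simp]: "ext_d l 0 = 0"
  by (simp add: ext_d_def)

lemma ext_d_function_form: "ext_d l (function_form f) = one_form l (\<lambda>i. ratfun_deriv i f)"
  by (subst ext_d_superset[of "{{}}"]) (auto simp: function_form_def one_form_def wedge_single)

lemma ext_d_one_form: "ext_d l (one_form l \<eta>) = two_form l (\<lambda>i j. ratfun_deriv i (\<eta> j) - ratfun_deriv j (\<eta> i))"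
proof -
  let ?d = "\<lambda>i j. ratfun_deriv i (\<eta> j)"
  have "keys (one_form l \<eta>) \<subseteq> (\<lambda>j. {j}) ` {..<l}"
    using lookup_one_form_eq_0[of l _ \<eta>] by (auto simp: in_keys_iff)
  then have "ext_d l (one_form l \<eta>) = (\<Sum>j<l. \<Sum>i<l. single {i} (?d i j) \<and>\<^sub>f single {j} 1)"
    by (subst ext_d_superset[of "(\<lambda>j. {j}) ` {..<l}"])
       (auto simp: sum.reindex inj_on_def lookup_one_form intro!: sum.cong)
  also have "\<dots> = (\<Sum>i<l. \<Sum>j<l. (if i < j then single {i, j} (?d i j) else 0) + (if j < i then - single {i, j} (?d i j) else 0))"
    by (subst sum.swap, intro sum.cong refl)
       (auto simp: wedge_single wedge_sign_singletons insert_commute single_uminus)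
  also have "\<dots> = (\<Sum>i<l. \<Sum>j<l. if i < j then single {i, j} (?d i j) else 0) + (\<Sum>i<l. \<Sum>j<l. if j < i then - single {i, j} (?d i j) else 0)"
    by (simp add: sum.distrib)
  also have "(\<Sum>i<l. \<Sum>j<l. if j < i then - single {i, j} (?d i j) else 0) = (\<Sum>i<l. \<Sum>j<l. if i < j then - single {j, i} (?d j i) else 0)"
    by (rule sum.swap)
  also have "(\<Sum>i<l. \<Sum>j<l. if i < j then single {i, j} (?d i j) else 0) + (\<Sum>i<l. \<Sum>j<l. if i < j then - single {j, i} (?d j i) else 0) =
      (\<Sum>i<l. \<Sum>j<l. if i < j then single {i, j} (?d i j - ?d j i) else 0)"
    unfolding sum.distrib[symmetric]
    by (intro sum.cong refl) (auto simp: single_diff insert_commute)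
  finally show ?thesis by (simp only: two_form_def)
qed

lemma dlog_eq_one_form: "dlog l p = one_form l (\<lambda>j. dlog_coeff j p)"
  by (simp add: dlog_def ext_d_function_form form_scale_one_form dlog_coeff_def ratfun_deriv_of_mpoly
      divide_inverse mult.commute)

lemma wedge_dlog: "dlog l p \<and>\<^sub>f dlog l q = two_form l (\<lambda>i j. dlog_wedge i j p q)"
  by (simp add: dlog_eq_one_form wedge_one_forms dlog_wedge_def)

text \<open>\<open>A\<close> may be any finite set containing the possible first letters, so for
  elements in the \<open>N\<close> letters the sum can run over all of them.\<close>

lemma lookup_bar_d:
  assumes A: "finite A" "\<And>a. lookup x (a # w) \<noteq> 0 \<Longrightarrow> a \<in> A"
  shows "lookup (bar_d l \<alpha> j x) w = ext_d l (lookup x w) +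
    (\<Sum>a\<in>A. form_scale ((- 1) ^ j) (lookup x (a # w) \<and>\<^sub>f dlog l (\<alpha> a)))"
proof -
  let ?t = "\<lambda>a. form_scale ((- 1) ^ j) (lookup x (a # w) \<and>\<^sub>f dlog l (\<alpha> a))"
  let ?K = "{I \<in> keys x - {[]}. tl I = w}"
  have "lookup (\<Sum>I\<in>keys x. single I (ext_d l (lookup x I))) w = ext_d l (lookup x w)"
    by (simp add: lookup_sum lookup_single when_def sum.delta in_keys_iff)
  moreover have "lookup (\<Sum>I\<in>keys x - {[]}. single (tl I)
        (form_scale ((- 1) ^ j) (lookup x I \<and>\<^sub>f dlog l (\<alpha> (hd I))))) w = (\<Sum>a\<in>A. ?t a)"
  proof -
    have "lookup (\<Sum>I\<in>keys x - {[]}. single (tl I)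
        (form_scale ((- 1) ^ j) (lookup x I \<and>\<^sub>f dlog l (\<alpha> (hd I))))) w =
      (\<Sum>I\<in>?K. form_scale ((- 1) ^ j) (lookup x I \<and>\<^sub>f dlog l (\<alpha> (hd I))))"
      by (auto simp: lookup_sum lookup_single when_def intro!: sum.mono_neutral_cong_right split: if_splits)
    also have "\<dots> = (\<Sum>I\<in>(\<lambda>a. a # w) ` {a. a # w \<in> keys x}. form_scale ((- 1) ^ j) (lookup x I \<and>\<^sub>f dlog l (\<alpha> (hd I))))"
    proof (rule sum.cong)
      show "?K = (\<lambda>a. a # w) ` {a. a # w \<in> keys x}"
        by (auto simp: image_iff) (metis list.collapse)
    qed simp
    also have "\<dots> = (\<Sum>a\<in>{a. a # w \<in> keys x}. ?t a)"
      by (subst sum.reindex) (auto simp: inj_on_def)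
    also have "\<dots> = (\<Sum>a\<in>A. ?t a)"
      using A by (intro sum.mono_neutral_left) (auto simp: in_keys_iff)
    finally show ?thesis .
  qed
  ultimately show ?thesis by (simp add: bar_d_def lookup_add)
qed

section \<open>The reduced bar construction inside the shuffle algebra\<close>

text \<open>The sets of elementary tensors to which this is applied are stable under scalars, so
  finite sums already give the span. The carriers of the bar construction are presented in this
  shape.\<close>

definition sums_of :: "'a::comm_monoid_add set \<Rightarrow> 'a set" where
  "sums_of G = {\<Sum>a<n. g a | (n::nat) g. \<forall>a<n. g a \<in> G}"

lemma sums_of_0: "0 \<in> sums_of G"
  unfolding sums_of_def by (auto intro!: exI[of _ "0::nat"])

lemma sums_of_add_generator:
  assumes "x \<in> sums_of G" "y \<in> G" shows "x + y \<in> sums_of G"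
proof -
  obtain n g where g: "x = (\<Sum>a<(n::nat). g a)" "\<forall>a<n. g a \<in> G" using assms(1) by (auto simp: sums_of_def)
  have "(\<Sum>a<Suc n. (g(n := y)) a) = x + y" by (simp add: g(1))
  moreover have "\<forall>a<Suc n. (g(n := y)) a \<in> G" using g(2) assms(2) by (auto simp: less_Suc_eq)
  ultimately show ?thesis unfolding sums_of_def by (intro CollectI exI[of _ "Suc n"] exI[of _ "g(n := y)"]) simp
qed

lemma sums_of_induct [consumes 1, case_names zero add]:
  assumes "x \<in> sums_of G" "P 0" "\<And>x y. x \<in> sums_of G \<Longrightarrow> P x \<Longrightarrow> y \<in> G \<Longrightarrow> P (x + y)"
  shows "P x"
proof -
  obtain n g where g: "x = (\<Sum>a<(n::nat). g a)" "\<forall>a<n. g a \<in> G" using assms(1) by (auto simp: sums_of_def)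
  have "P (\<Sum>a<m. g a) \<and> (\<Sum>a<m. g a) \<in> sums_of G" if "m \<le> n" for m
    using that
  proof (induction m)
    case (Suc m)
    then have "g m \<in> G" "P (\<Sum>a<m. g a)" "(\<Sum>a<m. g a) \<in> sums_of G" using g(2) by auto
    then show ?case using assms(3) by (simp add: sums_of_add_generator)
  qed (simp add: assms(2) sums_of_0)
  then show ?thesis using g by blast
qed

lemma sums_of_add:
  assumes "x \<in> sums_of G" "y \<in> sums_of G" shows "x + y \<in> sums_of G"
  using assms(2)
proof (induction rule: sums_of_induct)
  case (add y z)
  then show ?case using sums_of_add_generator[of "x + y" G z] by (simp add: add.assoc)
qed (simp add: assms(1))

lemma sums_of_incl: "y \<in> G \<Longrightarrow> y \<in> sums_of G"
  using sums_of_add_generator[OF sums_of_0] by simp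

lift_definition homogeneous_part :: "nat \<Rightarrow> 'a::comm_ring_1 shuffle_algebra \<Rightarrow> 'a shuffle_algebra"
  is "\<lambda>m. Poly_Mapping.mapp (\<lambda>w c. if length w = m then c else 0)" .

lemma coeff_homogeneous_part [simp]:
  "coeff (homogeneous_part m x) w = (if length w = m then coeff x w else 0)"
  by (simp add: coeff.rep_eq homogeneous_part.rep_eq lookup_mapp when_def in_keys_iff)

lemma homogeneous_part_add: "homogeneous_part m (x + y) = homogeneous_part m x + homogeneous_part m y"
  by (rule shuffle_algebra_eqI) simp

lemma homogeneous_part_0 [simp]: "homogeneous_part m 0 = 0"
  by (rule shuffle_algebra_eqI) simp

lemma homogeneous_part_scalar_mult:
  "homogeneous_part m (scalar c * x) = scalar c * homogeneous_part m x"
  by (rule shuffle_algebra_eqI) simp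

lemma word_length_bound: "\<exists>n. \<forall>w. coeff x w \<noteq> 0 \<longrightarrow> length w < n"
proof -
  have "finite (length ` {w. coeff x w \<noteq> 0})" by (intro finite_imageI finite_coeff)
  then obtain k where "\<forall>m\<in>length ` {w. coeff x w \<noteq> 0}. m \<le> k" using finite_nat_set_iff_bounded_le by blast
  then show ?thesis by (intro exI[of _ "Suc k"]) (auto simp: less_Suc_eq_le)
qed

lemma sum_homogeneous_parts:
  assumes "\<And>w. coeff x w \<noteq> 0 \<Longrightarrow> length w < n" shows "x = (\<Sum>m<n. homogeneous_part m x)"
proof (rule shuffle_algebra_eqI)
  fix w show "coeff x w = coeff (\<Sum>m<n. homogeneous_part m x) w"
    using assms[of w] by (simp add: coeff_sum sum.delta) auto
qed

lift_definition coeff_deriv :: "nat \<Rightarrow> 'k::field_char_0 ratfun shuffle_algebra \<Rightarrow> 'k ratfun shuffle_algebra"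
  is "\<lambda>i. Poly_Mapping.map (ratfun_deriv i)" .

lemma coeff_coeff_deriv [simp]: "coeff (coeff_deriv i x) w = ratfun_deriv i (coeff x w)"
  by (simp add: coeff.rep_eq coeff_deriv.rep_eq lookup_map)

lemma coeff_deriv_add: "coeff_deriv i (x + y) = coeff_deriv i x + coeff_deriv i y"
  by (rule shuffle_algebra_eqI) (simp add: ratfun_deriv_add)

lemma coeff_deriv_delete: "coeff_deriv i (delete a x) = delete a (coeff_deriv i x)"
  by (rule shuffle_algebra_eqI) simp

text \<open>At the empty word this is the Leibniz rule for rational functions; longer words are
  reached through \<open>delete\<close>, which commutes with coefficientwise
  differentiation.\<close>

lemma coeff_deriv_mult: "coeff_deriv i (x * y) = coeff_deriv i x * y + x * coeff_deriv i y"
proof (rule shuffle_algebra_eqI)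
  fix w show "coeff (coeff_deriv i (x * y)) w = coeff (coeff_deriv i x * y + x * coeff_deriv i y) w"
  proof (induction w arbitrary: x y)
    case Nil
    then show ?case by (simp add: ratfun_deriv_mult)
  next
    case (Cons a w)
    have "coeff (coeff_deriv i (x * y)) (a # w) = coeff (coeff_deriv i (delete a (x * y))) w" by simp
    also have "\<dots> = coeff (coeff_deriv i (delete a x * y)) w + coeff (coeff_deriv i (x * delete a y)) w"
      by (simp only: delete_mult coeff_deriv_add coeff_add)
    also have "\<dots> = coeff (delete a (coeff_deriv i x * y + x * coeff_deriv i y)) w"
      by (simp only: Cons.IH coeff_add delete_add delete_mult coeff_deriv_delete add_ac)
    finally show ?case by simp
  qed
qed

section \<open>Integrable words and the derivations of the bar construction\<close>

locale bar_construction =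
  fixes l N :: nat and \<alpha> :: "nat \<Rightarrow> 'k::field_char_0 mpoly"
  assumes arr: "nonproportional l N \<alpha>"
begin

abbreviation "\<O> \<equiv> coord_ring l N \<alpha>"
abbreviation "\<omega> i a \<equiv> dlog_coeff i (\<alpha> a)"

lemma \<alpha>_mpolys: "i < N \<Longrightarrow> \<alpha> i \<in> mpolys l"
  by (rule nonproportional_mpolys[OF arr])

lemma \<alpha>_nonzero: "i < N \<Longrightarrow> \<alpha> i \<noteq> 0"
  by (rule nonproportional_nonzero[OF arr])

lemma \<O>_deriv: "f \<in> \<O> \<Longrightarrow> ratfun_deriv i f \<in> \<O>"
  by (rule coord_ring_deriv[OF \<alpha>_mpolys])

lemma \<omega>_in_\<O>: "a < N \<Longrightarrow> \<omega> i a \<in> \<O>"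
  by (rule coord_ring_dlog_coeff) (auto simp: \<alpha>_mpolys)

definition in_letters :: "'k ratfun shuffle_algebra \<Rightarrow> bool" where
  "in_letters x \<longleftrightarrow> (\<forall>w. coeff x w \<noteq> 0 \<longrightarrow> set w \<subseteq> {..<N})"

text \<open>The component with indices \<open>i\<close> and \<open>j\<close> of the two-form
  obtained by multiplying the first two letters of each word. It is the obstruction to commutation
  of the derivations \<open>deriv\<close> on words with constant coefficients.\<close>

definition curvature :: "nat \<Rightarrow> nat \<Rightarrow> 'k ratfun shuffle_algebra \<Rightarrow> 'k ratfun shuffle_algebra" where
  "curvature i j x = (\<Sum>a<N. \<Sum>b<N. scalar (dlog_wedge i j (\<alpha> a) (\<alpha> b)) * delete b (delete a x))"

text \<open>The integrability conditions at all positions and in all lengths at once: deleting a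
  prefix \<open>u\<close> brings the position \<open>length u\<close> to the front. The coefficients
  lie in \<open>k\<close> although the ambient algebra is over the rational functions.\<close>

definition V :: "'k ratfun shuffle_algebra set" where
  "V = {x. (\<forall>w. coeff x w \<in> Set.range rat_const) \<and> in_letters x \<and>
     (\<forall>u. \<forall>i<l. \<forall>j<l. curvature i j (fold delete u x) = 0)}"

lemma coeff_fold_delete: "coeff (fold delete u x) w = coeff x (u @ w)"
  by (induction u arbitrary: x) auto

lemma coeff_curvature:
  "coeff (curvature i j (fold delete u x)) w =
     (\<Sum>a<N. \<Sum>b<N. dlog_wedge i j (\<alpha> a) (\<alpha> b) * coeff x (u @ a # b # w))"
  by (simp add: curvature_def coeff_sum coeff_fold_delete)

lemma fold_delete_add: "fold delete u (x + y) = fold delete u x + fold delete u y"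
  by (induction u arbitrary: x y) (auto simp: delete_add)

lemma curvature_add: "curvature i j (x + y) = curvature i j x + curvature i j y"
  by (simp add: curvature_def delete_add distrib_left sum.distrib)

text \<open>In the mixed terms one deleted letter comes from each factor. Exchanging the two letters
  exchanges these terms and changes the sign of the two-form, so they cancel.\<close>

lemma curvature_mult: "curvature i j (x * y) = curvature i j x * y + x * curvature i j y"
proof -
  let ?W = "\<lambda>a b. scalar (dlog_wedge i j (\<alpha> a) (\<alpha> b))"
  let ?c = "\<lambda>a b. ?W a b * (delete a x * delete b y)" and ?d = "\<lambda>a b. ?W a b * (delete b x * delete a y)"
  have "(\<Sum>a<N. \<Sum>b<N. ?d a b) = (\<Sum>a<N. \<Sum>b<N. ?d b a)" by (rule sum.swap)
  also have "\<dots> = (\<Sum>a<N. \<Sum>b<N. - ?c a b)"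
  proof (intro sum.cong refl)
    fix a b
    have "?W b a = - ?W a b" by (simp only: dlog_wedge_swap[of i j "\<alpha> b" "\<alpha> a"] scalar_uminus)
    then show "?d b a = - ?c a b" by simp
  qed
  finally have cd: "(\<Sum>a<N. \<Sum>b<N. ?c a b) + (\<Sum>a<N. \<Sum>b<N. ?d a b) = 0" by (simp add: sum_negf)
  have "curvature i j (x * y) = (\<Sum>a<N. \<Sum>b<N. (?W a b * delete b (delete a x)) * y + x * (?W a b * delete b (delete a y)) + (?c a b + ?d a b))"
    unfolding curvature_def by (intro sum.cong refl) (simp add: delete_mult delete_add algebra_simps)
  also have "\<dots> = (\<Sum>a<N. \<Sum>b<N. (?W a b * delete b (delete a x)) * y) + (\<Sum>a<N. \<Sum>b<N. x * (?W a b * delete b (delete a y)))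
      + ((\<Sum>a<N. \<Sum>b<N. ?c a b) + (\<Sum>a<N. \<Sum>b<N. ?d a b))"
    by (simp only: sum.distrib)
  also have "\<dots> = curvature i j x * y + x * curvature i j y"
    unfolding cd by (simp add: curvature_def sum_distrib_left sum_distrib_right)
  finally show ?thesis .
qed

lemma in_letters_delete:
  assumes "in_letters x" shows "in_letters (delete a x)"
  unfolding in_letters_def coeff_delete
proof (intro allI impI)
  fix w assume "coeff x (a # w) \<noteq> 0"
  with assms have "set (a # w) \<subseteq> {..<N}" unfolding in_letters_def by blast
  then show "set w \<subseteq> {..<N}" by simp
qed

lemma in_letters_delete_eq_0: "in_letters x \<Longrightarrow> N \<le> a \<Longrightarrow> delete a x = 0"
  by (rule shuffle_algebra_eqI) (force simp: in_letters_def)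

lemma in_letters_mult:
  assumes "in_letters x" "in_letters y" shows "in_letters (x * y)"
proof -
  have "set w \<subseteq> {..<N}" if "coeff (x * y) w \<noteq> 0" for w
    using assms that
  proof (induction w arbitrary: x y)
    case (Cons a w)
    have *: "coeff (x * y) (a # w) = coeff (delete a x * y) w + coeff (x * delete a y) w"
      by (simp only: coeff_delete[symmetric] delete_mult coeff_add)
    then have "coeff (delete a x * y) w \<noteq> 0 \<or> coeff (x * delete a y) w \<noteq> 0" using Cons.prems by auto
    then have "set w \<subseteq> {..<N}" using Cons.IH Cons.prems in_letters_delete by blast
    moreover have "a < N" using * Cons.prems in_letters_delete_eq_0[of x a] in_letters_delete_eq_0[of y a]
      by (cases "a < N") auto
    ultimately show ?case by simp
  qed simp
  then show ?thesis by (simp add: in_letters_def)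
qed

lemma in_letters_add:
  assumes "in_letters x" "in_letters y" shows "in_letters (x + y)"
  unfolding in_letters_def coeff_add
proof (intro allI impI)
  fix w assume "coeff x w + coeff y w \<noteq> 0"
  then have "coeff x w \<noteq> 0 \<or> coeff y w \<noteq> 0" by auto
  with assms show "set w \<subseteq> {..<N}" unfolding in_letters_def by blast
qed

lemma in_letters_0 [simp]: "in_letters 0"
  by (simp add: in_letters_def)

lemma in_letters_scalar_mult: "in_letters x \<Longrightarrow> in_letters (scalar c * x)"
  by (auto simp: in_letters_def)

lemma rational_mult:
  assumes "\<And>w. coeff x w \<in> Set.range rat_const" "\<And>w. coeff y w \<in> Set.range rat_const"
  shows "coeff (x * y) w \<in> Set.range (rat_const :: 'k \<Rightarrow> _)"
  using assms
proof (induction w arbitrary: x y)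
  case Nil
  obtain c d where "coeff x [] = rat_const c" "coeff y [] = rat_const d" using Nil by (meson rangeE)
  then show ?case by (simp flip: rat_const_mult)
next
  case (Cons a w)
  have "coeff (x * y) (a # w) = coeff (delete a x * y) w + coeff (x * delete a y) w"
    by (simp only: coeff_delete[symmetric] delete_mult coeff_add)
  moreover have "coeff (delete a x * y) w \<in> Set.range rat_const"
    by (rule Cons.IH) (simp_all add: Cons.prems)
  moreover have "coeff (x * delete a y) w \<in> Set.range rat_const"
    by (rule Cons.IH) (simp_all add: Cons.prems)
  ultimately show ?case by (auto simp flip: rat_const_add)
qed

lemma V_rational: "x \<in> V \<Longrightarrow> coeff x w \<in> Set.range rat_const"
  by (simp add: V_def)

lemma V_in_letters: "x \<in> V \<Longrightarrow> in_letters x"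
  by (simp add: V_def)

lemma V_curvature: "x \<in> V \<Longrightarrow> i < l \<Longrightarrow> j < l \<Longrightarrow> curvature i j x = 0"
  by (auto simp: V_def dest: spec[of _ "[]"])

lemma V_curvature_fold: "x \<in> V \<Longrightarrow> i < l \<Longrightarrow> j < l \<Longrightarrow> curvature i j (fold delete u x) = 0"
  by (simp add: V_def)

lemma V_iff:
  "x \<in> V \<longleftrightarrow> (\<forall>w. coeff x w \<in> Set.range rat_const) \<and> in_letters x \<and>
     (\<forall>u w. \<forall>i<l. \<forall>j<l. (\<Sum>a<N. \<Sum>b<N. dlog_wedge i j (\<alpha> a) (\<alpha> b) * coeff x (u @ a # b # w)) = 0)"
  unfolding V_def coeff_curvature[symmetric] by (auto intro: shuffle_algebra_eqI)

lemma V_scalar: "scalar (rat_const c) \<in> V"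
  by (auto simp: V_iff in_letters_def coeff_scalar image_iff intro: exI[of _ 0])

lemma V_1: "1 \<in> V"
  using V_scalar[of 1] by simp

lemma V_0: "0 \<in> V"
  using V_scalar[of 0] by simp

lemma V_add: "x \<in> V \<Longrightarrow> y \<in> V \<Longrightarrow> x + y \<in> V"
proof -
  assume xy: "x \<in> V" "y \<in> V"
  have "coeff (x + y) w \<in> Set.range rat_const" for w
    using V_rational[OF xy(1), of w] V_rational[OF xy(2), of w] by (auto simp flip: rat_const_add)
  then show ?thesis
    using xy unfolding V_def by (simp add: in_letters_add fold_delete_add curvature_add)
qed

lemma V_delete: "x \<in> V \<Longrightarrow> delete a x \<in> V"
  using V_curvature_fold[of x _ _ "a # u" for u] unfolding V_def by (auto simp: in_letters_delete)

text \<open>By the Leibniz rule, deleting a prefix from a product gives a sum of products of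
  elements of \<open>V\<close>, on which the curvature vanishes because it is a derivation.\<close>

lemma V_mult:
  assumes "x \<in> V" "y \<in> V" shows "x * y \<in> V"
proof -
  have "curvature i j (fold delete u (x * y)) = 0" if "i < l" "j < l" for u i j
    using assms
  proof (induction u arbitrary: x y)
    case Nil
    then show ?case using that by (simp add: curvature_mult V_curvature)
  next
    case (Cons a u)
    then show ?case using that by (simp add: delete_mult fold_delete_add curvature_add V_delete)
  qed
  then show ?thesis
    using assms rational_mult in_letters_mult unfolding V_def by blast
qed

lemma V_scalar_mult: "x \<in> V \<Longrightarrow> scalar (rat_const c) * x \<in> V"
  by (rule V_mult[OF V_scalar])

lemma V_uminus: "x \<in> V \<Longrightarrow> - x \<in> V"
  using V_scalar_mult[of x "- 1"] by (simp add: rat_const_uminus scalar_uminus)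

lemma V_sum: "(\<And>i. i \<in> A \<Longrightarrow> f i \<in> V) \<Longrightarrow> sum f A \<in> V"
  by (induction A rule: infinite_finite_induct) (auto intro: V_add V_0)

text \<open>Each integrability condition involves words of one length only.\<close>

lemma V_homogeneous_part:
  assumes "x \<in> V" shows "homogeneous_part m x \<in> V"
  unfolding V_iff
proof (intro conjI allI impI)
  show "coeff (homogeneous_part m x) w \<in> Set.range rat_const" for w
    using V_rational[OF assms] by (auto simp: image_iff intro: exI[of _ 0])
  show "in_letters (homogeneous_part m x)" using V_in_letters[OF assms] by (auto simp: in_letters_def)
  fix u w i j assume ij: "i < l" "j < l"
  show "(\<Sum>a<N. \<Sum>b<N. dlog_wedge i j (\<alpha> a) (\<alpha> b) * coeff (homogeneous_part m x) (u @ a # b # w)) = 0"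
  proof (cases "length u + length w + 2 = m")
    case True
    then show ?thesis using assms ij by (simp add: V_iff)
  qed (auto intro!: sum.neutral)
qed

definition "B = sums_of {scalar f * v | f v. f \<in> \<O> \<and> v \<in> V}"

lemma B_induct [consumes 1, case_names zero add]:
  assumes "x \<in> B" "P 0"
    and "\<And>x f v. x \<in> B \<Longrightarrow> P x \<Longrightarrow> f \<in> \<O> \<Longrightarrow> v \<in> V \<Longrightarrow> P (x + scalar f * v)"
  shows "P x"
  using assms(1) unfolding B_def
proof (induction rule: sums_of_induct)
  case (add x y)
  then obtain f v where "y = scalar f * v" "f \<in> \<O>" "v \<in> V" by blast
  then show ?case using assms(3) add by (simp add: B_def)
qed (rule assms(2))

lemma B_incl: "f \<in> \<O> \<Longrightarrow> v \<in> V \<Longrightarrow> scalar f * v \<in> B"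
  unfolding B_def by (rule sums_of_incl) blast

lemma B_0: "0 \<in> B"
  unfolding B_def by (rule sums_of_0)

lemma B_add: "x \<in> B \<Longrightarrow> y \<in> B \<Longrightarrow> x + y \<in> B"
  unfolding B_def by (rule sums_of_add)

lemma B_sum: "(\<And>i. i \<in> A \<Longrightarrow> f i \<in> B) \<Longrightarrow> sum f A \<in> B"
  by (induction A rule: infinite_finite_induct) (auto intro: B_add B_0)

lemma B_V: "v \<in> V \<Longrightarrow> v \<in> B"
  using B_incl[OF coord_ring_1] by fastforce

lemma B_scalar: "f \<in> \<O> \<Longrightarrow> scalar f \<in> B"
  using B_incl[OF _ V_1] by fastforce

lemma B_1: "1 \<in> B"
  by (rule B_V[OF V_1])

lemma B_scalar_mult:
  assumes "f \<in> \<O>" "x \<in> B" shows "scalar f * x \<in> B"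
  using assms(2)
proof (induction rule: B_induct)
  case (add x g v)
  have "scalar f * (x + scalar g * v) = scalar f * x + scalar (f * g) * v"
    by (simp add: distrib_left scalar_mult mult.assoc)
  with add assms(1) show ?case by (auto intro: B_add B_incl coord_ring_mult)
qed (simp add: B_0)

lemma B_mult_V: "x \<in> B \<Longrightarrow> v \<in> V \<Longrightarrow> v * x \<in> B"
proof (induction x rule: B_induct)
  case (add x g v')
  have "v * (x + scalar g * v') = v * x + scalar g * (v * v')"
    by (simp add: algebra_simps)
  with add show ?case by (auto intro: B_add B_incl V_mult)
qed (simp add: B_0)

lemma B_mult:
  assumes "x \<in> B" "y \<in> B" shows "x * y \<in> B"
  using assms(1)
proof (induction rule: B_induct)
  case (add x f v)
  have "(x + scalar f * v) * y = x * y + scalar f * (v * y)"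
    by (simp add: algebra_simps)
  with add show ?case using assms(2) by (auto intro: B_add B_scalar_mult B_mult_V)
qed (simp add: B_0)

lemma B_uminus: "x \<in> B \<Longrightarrow> - x \<in> B"
  using B_mult[OF B_V[OF V_uminus[OF V_1]]] by fastforce

lemma B_diff: "x \<in> B \<Longrightarrow> y \<in> B \<Longrightarrow> x - y \<in> B"
  using B_add[OF _ B_uminus] by fastforce

lemma B_coeff: "x \<in> B \<Longrightarrow> coeff x w \<in> \<O>"
proof (induction x rule: B_induct)
  case (add x f v)
  obtain c where "coeff v w = rat_const c" using V_rational[OF \<open>v \<in> V\<close>, of w] by blast
  with add show ?case by (auto intro!: coord_ring_add coord_ring_mult)
qed simp

lemma B_in_letters: "x \<in> B \<Longrightarrow> in_letters x"
  by (induction x rule: B_induct) (simp_all add: in_letters_add in_letters_scalar_mult V_in_letters)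

text \<open>The differential of the bar construction in coordinates: coefficients are
  differentiated, and the first letter is turned into its logarithmic form.\<close>

definition deriv :: "nat \<Rightarrow> 'k ratfun shuffle_algebra \<Rightarrow> 'k ratfun shuffle_algebra" where
  "deriv i x = coeff_deriv i x + (\<Sum>a<N. scalar (\<omega> i a) * delete a x)"

lemma coeff_deriv_eq: "coeff (deriv i x) w = ratfun_deriv i (coeff x w) + (\<Sum>a<N. \<omega> i a * coeff x (a # w))"
  by (simp add: deriv_def coeff_sum)

lemma deriv_add: "deriv i (x + y) = deriv i x + deriv i y"
  by (simp add: deriv_def coeff_deriv_add delete_add distrib_left sum.distrib)

lemma deriv_0 [simp]: "deriv i 0 = 0"
  by (rule shuffle_algebra_eqI) (simp add: coeff_deriv_eq)

lemma deriv_sum: "deriv i (sum f A) = (\<Sum>a\<in>A. deriv i (f a))"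
  by (induction A rule: infinite_finite_induct) (simp_all add: deriv_add)

lemma deriv_mult: "deriv i (x * y) = deriv i x * y + x * deriv i y"
  by (simp add: deriv_def coeff_deriv_mult delete_mult distrib_left distrib_right sum.distrib
      sum_distrib_left sum_distrib_right mult_ac)

lemma deriv_scalar: "deriv i (scalar f) = scalar (ratfun_deriv i f)"
  by (rule shuffle_algebra_eqI) (simp add: coeff_deriv_eq coeff_scalar)

lemma deriv_1 [simp]: "deriv i 1 = 0"
  using deriv_scalar[of i 1] by simp

lemma deriv_uminus: "deriv i (- x) = - deriv i x"
  using deriv_add[of i x "- x"] by (simp add: eq_neg_iff_add_eq_0 add.commute)

lemma deriv_diff: "deriv i (x - y) = deriv i x - deriv i y"
  using deriv_add[of i x "- y"] by (simp add: deriv_uminus)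

lemma deriv_V: "v \<in> V \<Longrightarrow> deriv i v = (\<Sum>a<N. scalar (\<omega> i a) * delete a v)"
proof -
  assume v: "v \<in> V"
  have "coeff_deriv i v = 0"
  proof (rule shuffle_algebra_eqI)
    fix w obtain c where "coeff v w = rat_const c" using V_rational[OF v, of w] by blast
    then show "coeff (coeff_deriv i v) w = coeff 0 w" by simp
  qed
  then show ?thesis by (simp add: deriv_def)
qed

lemma deriv_V_in_B: "v \<in> V \<Longrightarrow> deriv i v \<in> B"
  unfolding deriv_V by (intro B_sum B_incl \<omega>_in_\<O> V_delete) auto

lemma deriv_B: "x \<in> B \<Longrightarrow> deriv i x \<in> B"
  by (induction x rule: B_induct)
     (simp_all add: deriv_add deriv_mult deriv_scalar B_0 B_add B_incl B_scalar_mult deriv_V_in_B \<O>_deriv)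

text \<open>Since the logarithmic forms are closed, the commutator is exactly the curvature, up to
  the order of the two indices.\<close>

lemma deriv_commute_V:
  assumes v: "v \<in> V" and ij: "i < l" "j < l" shows "deriv i (deriv j v) = deriv j (deriv i v)"
proof -
  have eq: "deriv i (deriv j v) = (\<Sum>a<N. scalar (ratfun_deriv i (\<omega> j a)) * delete a v) +
      (\<Sum>a<N. \<Sum>b<N. scalar (\<omega> j a * \<omega> i b) * delete b (delete a v))" for i j
  proof -
    have "deriv i (deriv j v) = (\<Sum>a<N. deriv i (scalar (\<omega> j a) * delete a v))"
      unfolding deriv_V[OF v] by (rule deriv_sum)
    also have "\<dots> = (\<Sum>a<N. scalar (ratfun_deriv i (\<omega> j a)) * delete a v +
        (\<Sum>b<N. scalar (\<omega> j a * \<omega> i b) * delete b (delete a v)))"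
      by (simp add: deriv_mult deriv_scalar deriv_V[OF V_delete[OF v]] sum_distrib_left scalar_mult mult.assoc)
    finally show ?thesis by (simp add: sum.distrib)
  qed
  have "deriv i (deriv j v) - deriv j (deriv i v) =
      (\<Sum>a<N. \<Sum>b<N. scalar (\<omega> j a * \<omega> i b) * delete b (delete a v)) -
      (\<Sum>a<N. \<Sum>b<N. scalar (\<omega> i a * \<omega> j b) * delete b (delete a v))"
    by (simp add: eq dlog_coeff_closed[of i j])
  also have "\<dots> = curvature j i v"
    unfolding curvature_def sum_subtractf[symmetric]
    by (intro sum.cong refl) (simp add: dlog_wedge_def scalar_diff left_diff_distrib)
  also have "\<dots> = 0" using V_curvature[OF v] ij by simp
  finally show ?thesis by simp
qed

lemma deriv_commute:
  assumes "x \<in> B" "i < l" "j < l" shows "deriv i (deriv j x) = deriv j (deriv i x)"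
  using assms(1)
  by (induction rule: B_induct)
     (simp_all add: deriv_add deriv_mult deriv_scalar deriv_commute_V[OF _ assms(2,3)]
        ratfun_deriv_commute[of i j] add_ac)

end

section \<open>Linear algebra over the base field\<close>

interpretation ratfun_space: vector_space "\<lambda>(c::'k::field_char_0) f. rat_const c * f"
  by unfold_locales (simp_all add: rat_const_add rat_const_mult algebra_simps)

interpretation rational_space:
  vector_space "\<lambda>(c::'k::field_char_0) (x::'k ratfun shuffle_algebra). scalar (rat_const c) * x"
  by unfold_locales (simp_all add: rat_const_add rat_const_mult scalar_add scalar_mult algebra_simps)

text \<open>A vanishing combination is mapped to a relation over the base field by a linear functional on
  the field of rational functions that does not vanish on a given coefficient.\<close>

lemma independent_over_ratfun:
  fixes F :: "'k::field_char_0 ratfun shuffle_algebra set"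
  assumes F: "finite F" "rational_space.independent F"
    and rat: "\<And>v w. v \<in> F \<Longrightarrow> coeff v w \<in> Set.range rat_const"
    and sum: "(\<Sum>v\<in>F. scalar (\<phi> v) * v) = 0" and v: "v \<in> F"
  shows "\<phi> v = 0"
proof (rule ccontr)
  assume nz: "\<phi> v \<noteq> 0"
  define d :: "'k ratfun shuffle_algebra \<Rightarrow> word \<Rightarrow> 'k"
    where "d u w = inv_into UNIV rat_const (coeff u w)" for u w
  have d: "coeff u w = rat_const (d u w)" if "u \<in> F" for u w
    unfolding d_def by (rule f_inv_into_f[OF rat[OF that], symmetric])
  have ind: "ratfun_space.independent {\<phi> v}" using nz by simp
  \<comment> \<open>The coordinate at \<open>\<phi> v\<close> with respect to a basis containing it
    is \<open>k\<close>-linear and has the value 1 there.\<close>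
  define E where "E = ratfun_space.extend_basis {\<phi> v}"
  have E: "ratfun_space.independent E" "ratfun_space.span E = UNIV" "\<phi> v \<in> E"
    using ratfun_space.independent_extend_basis[OF ind] ratfun_space.span_extend_basis[OF ind]
      ratfun_space.extend_basis_superset[OF ind] by (auto simp: E_def)
  define L where "L f = ratfun_space.representation E f (\<phi> v)" for f
  have L_sum: "L (\<Sum>u\<in>F. \<phi> u * rat_const (d u w)) = (\<Sum>u\<in>F. L (\<phi> u) * d u w)" for w
    using E unfolding L_def
    by (subst ratfun_space.representation_sum) (auto simp: mult.commute[of _ "rat_const _"] mult.commute[of "d _ _"] ratfun_space.representation_scale)
  have "(\<Sum>u\<in>F. scalar (rat_const (L (\<phi> u))) * u) = 0"
  proof (rule shuffle_algebra_eqI)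
    fix w
    have "coeff (\<Sum>u\<in>F. scalar (\<phi> u) * u) w = 0" using sum by simp
    then have "(\<Sum>u\<in>F. \<phi> u * rat_const (d u w)) = 0" by (simp add: coeff_sum d cong: sum.cong)
    then have "(\<Sum>u\<in>F. L (\<phi> u) * d u w) = 0"
      using L_sum[of w] by (simp add: L_def ratfun_space.representation_zero)
    then have "rat_const (\<Sum>u\<in>F. L (\<phi> u) * d u w) = 0" by simp
    then show "coeff (\<Sum>u\<in>F. scalar (rat_const (L (\<phi> u))) * u) w = coeff 0 w"
      by (simp add: coeff_sum d rat_const_sum rat_const_mult cong: sum.cong)
  qed
  then have "L (\<phi> v) = 0"
    using F v rational_space.independentD[OF F(2) F(1) subset_refl, of "\<lambda>u. L (\<phi> u)" v] by simp
  moreover have "L (\<phi> v) = 1"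
    unfolding L_def using ratfun_space.representation_basis[OF E(1,3)] by simp
  ultimately show False by simp
qed

lift_definition word_element :: "word \<Rightarrow> 'a::comm_ring_1 shuffle_algebra" is "\<lambda>w. single w 1" .

lemma coeff_word_element: "coeff (word_element v) w = (if v = w then 1 else 0)"
  by (simp add: coeff.rep_eq word_element.rep_eq lookup_single when_def)

text \<open>A section of \<open>delete a\<close>; primitives of logarithmic parts are built from
  it.\<close>

lift_definition prepend :: "nat \<Rightarrow> 'a::comm_ring_1 shuffle_algebra \<Rightarrow> 'a shuffle_algebra"
  is "\<lambda>a p. \<Sum>w\<in>keys p. single (a # w) (lookup p w)" .

lemma coeff_prepend_Cons: "coeff (prepend a x) (b # w) = (if a = b then coeff x w else 0)"
proof -
  have "coeff (prepend a x) (b # w) =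
      (\<Sum>v\<in>keys (words_of x). if a = b then (if v = w then coeff x w else 0) else 0)"
    by (auto simp: coeff.rep_eq prepend.rep_eq lookup_sum lookup_single when_def intro!: sum.cong)
  also have "\<dots> = (if a = b then coeff x w else 0)"
    by (simp add: sum.delta coeff.rep_eq in_keys_iff)
  finally show ?thesis .
qed

lemma coeff_prepend_Nil [simp]: "coeff (prepend a x) [] = 0"
  by (simp add: coeff.rep_eq prepend.rep_eq lookup_sum lookup_single)

section \<open>Graded pieces of the integrable words\<close>

context bar_construction
begin

definition Vm :: "nat \<Rightarrow> 'k ratfun shuffle_algebra set" where
  "Vm m = {x \<in> V. \<forall>w. coeff x w \<noteq> 0 \<longrightarrow> length w = m}"

lemma Vm_V: "x \<in> Vm m \<Longrightarrow> x \<in> V"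
  by (simp add: Vm_def)

lemma homogeneous_part_Vm: "x \<in> V \<Longrightarrow> homogeneous_part m x \<in> Vm m"
  by (simp add: Vm_def V_homogeneous_part)

lemma Vm_homogeneous_part: "x \<in> Vm m \<Longrightarrow> homogeneous_part n x = (if n = m then x else 0)"
  by (rule shuffle_algebra_eqI) (auto simp: Vm_def)

lemma subspace_V: "rational_space.subspace V"
  by (intro rational_space.subspaceI V_0 V_add V_scalar_mult)

lemma subspace_Vm: "rational_space.subspace (Vm m)"
proof -
  have len: "length w = m" if "x \<in> Vm m" "y \<in> Vm m" "coeff x w + coeff y w \<noteq> 0" for x y w
  proof -
    have "coeff x w \<noteq> 0 \<or> coeff y w \<noteq> 0" using that(3) by auto
    then show ?thesis using that(1,2) unfolding Vm_def by blast
  qed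
  have add: "x + y \<in> Vm m" if "x \<in> Vm m" "y \<in> Vm m" for x y
  proof -
    have "x + y \<in> V" using that by (intro V_add Vm_V)
    then show ?thesis using len[OF that] by (simp add: Vm_def)
  qed
  have scale: "scalar (rat_const c) * x \<in> Vm m" if "x \<in> Vm m" for c x
    using that V_scalar_mult[of x c] by (simp add: Vm_def)
  have zero: "0 \<in> Vm m" by (simp add: Vm_def V_0)
  show ?thesis by (rule rational_space.subspaceI[OF zero add scale])
qed

lemma Vm_subset_span_words:
  "Vm m \<subseteq> rational_space.span (word_element ` {w. set w \<subseteq> {..<N} \<and> length w = m})"
proof
  fix x assume x: "x \<in> Vm m"
  let ?W = "{w. set w \<subseteq> {..<N} \<and> length w = m}"
  have fin: "finite ?W" by (rule finite_lists_length_eq) simp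
  define c where "c w = inv_into UNIV rat_const (coeff x w)" for w
  have c: "coeff x w = rat_const (c w)" for w
    unfolding c_def by (rule f_inv_into_f[OF V_rational[OF Vm_V[OF x]], symmetric])
  have W: "w \<in> ?W" if "coeff x w \<noteq> 0" for w
    using x that V_in_letters[OF Vm_V[OF x]] unfolding Vm_def in_letters_def by blast
  have "x = (\<Sum>w\<in>?W. scalar (rat_const (c w)) * word_element w)"
  proof (rule shuffle_algebra_eqI)
    fix v
    have "coeff (\<Sum>w\<in>?W. scalar (rat_const (c w)) * word_element w) v = (\<Sum>w\<in>?W. if w = v then coeff x v else 0)"
      unfolding coeff_sum by (intro sum.cong refl) (simp add: coeff_word_element c)
    also have "\<dots> = (if v \<in> ?W then coeff x v else 0)" using fin by (simp add: sum.delta)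
    also have "\<dots> = coeff x v" using W[of v] by auto
    finally show "coeff x v = coeff (\<Sum>w\<in>?W. scalar (rat_const (c w)) * word_element w) v" ..
  qed
  also have "\<dots> \<in> rational_space.span (word_element ` ?W)"
    by (intro rational_space.span_sum rational_space.span_scale rational_space.span_base) auto
  finally show "x \<in> rational_space.span (word_element ` ?W)" .
qed

lemma finite_independent_Vm:
  assumes "rational_space.independent S" "S \<subseteq> Vm m" shows "finite S"
proof -
  have "finite (word_element ` {w. set w \<subseteq> {..<N} \<and> length w = m} :: 'k ratfun shuffle_algebra set)"
    by (intro finite_imageI finite_lists_length_eq) simp
  from rational_space.independent_span_bound[OF this assms(1)] show ?thesis
    using assms(2) Vm_subset_span_words by blast
qed

lemma ex_basis_Vm:
  obtains F where "F \<subseteq> Vm m" "rational_space.independent F" "Vm m \<subseteq> rational_space.span F" "finite F"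
proof -
  obtain F where F: "F \<subseteq> Vm m" "rational_space.independent F" "Vm m \<subseteq> rational_space.span F"
    using rational_space.maximal_independent_subset[of "Vm m"] by auto
  then show ?thesis using that finite_independent_Vm[of F m] by blast
qed

text \<open>Coordinates of the tensor product of \<open>\<O>\<close> with \<open>Vm m\<close> with
  respect to generators of \<open>Vm m\<close>. For a basis, their uniqueness comes from
  independence over the rational functions.\<close>

lemma B_homogeneous_part_basis:
  assumes F: "finite F" "F \<subseteq> Vm m" "Vm m \<subseteq> rational_space.span F" and x: "x \<in> B"
  shows "\<exists>\<phi>. (\<forall>v\<in>F. \<phi> v \<in> \<O>) \<and> homogeneous_part m x = (\<Sum>v\<in>F. scalar (\<phi> v) * v)"
  using x
proof (induction rule: B_induct)
  case zero
  show ?case by (intro exI[of _ "\<lambda>_. 0"]) simp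
next
  case (add x f v)
  then obtain \<phi> where \<phi>: "\<forall>v\<in>F. \<phi> v \<in> \<O>" "homogeneous_part m x = (\<Sum>v\<in>F. scalar (\<phi> v) * v)" by blast
  have "homogeneous_part m v \<in> rational_space.span F" using homogeneous_part_Vm[OF \<open>v \<in> V\<close>] F(3) by blast
  then obtain c where c: "homogeneous_part m v = (\<Sum>u\<in>F. scalar (rat_const (c u)) * u)"
    unfolding rational_space.span_finite[OF F(1)] by auto
  have "homogeneous_part m (x + scalar f * v) = (\<Sum>u\<in>F. scalar (\<phi> u + f * rat_const (c u)) * u)"
    by (simp add: homogeneous_part_add homogeneous_part_scalar_mult \<phi>(2) c sum_distrib_left
        scalar_add scalar_mult distrib_right sum.distrib mult.assoc)
  moreover have "\<forall>u\<in>F. \<phi> u + f * rat_const (c u) \<in> \<O>"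
    using \<phi>(1) \<open>f \<in> \<O>\<close> by (auto intro!: coord_ring_add coord_ring_mult)
  ultimately show ?case by (intro exI[of _ "\<lambda>u. \<phi> u + f * rat_const (c u)"]) simp
qed


section \<open>Constants, differential ideals and primitives\<close>

text \<open>Deletion terms at \<open>v\<close> come from longer words, and at maximal length there
  are none.\<close>

lemma coeff_deriv_top:
  assumes "\<And>w. coeff x w \<noteq> 0 \<Longrightarrow> length w \<le> length v"
  shows "coeff (deriv i x) v = ratfun_deriv i (coeff x v)"
proof -
  have "coeff x (a # v) = 0" for a using assms[of "a # v"] by auto
  then show ?thesis by (simp add: coeff_deriv_eq)
qed

lemma deriv_length_le:
  assumes "\<And>w. coeff x w \<noteq> 0 \<Longrightarrow> length w \<le> m" "coeff (deriv i x) w \<noteq> 0" shows "length w \<le> m"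
proof (rule ccontr)
  assume "\<not> length w \<le> m"
  then have "coeff x w = 0" "\<And>a. coeff x (a # w) = 0" using assms(1)[of w] assms(1)[of "a # w" for a] by auto
  then show False using assms(2) by (simp add: coeff_deriv_eq)
qed

lemma constants_B:
  assumes x: "x \<in> B" "\<And>i. i < l \<Longrightarrow> deriv i x = 0"
  obtains c where "x = scalar (rat_const c)"
proof -
  obtain n where "\<And>w. coeff x w \<noteq> 0 \<Longrightarrow> length w \<le> n"
    using word_length_bound[of x] less_imp_le by metis
  then have "\<exists>c. x = scalar (rat_const c)"
  proof (induction n)
    case 0
    then have w: "coeff x w = 0" if "w \<noteq> []" for w using that by force
    have "ratfun_deriv i (coeff x []) = 0" if "i < l" for i
      using coeff_deriv_top[of x "[]" i] x(2)[OF that] 0 by simp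
    then obtain c where "coeff x [] = rat_const c"
      using coord_ring_constants[OF \<alpha>_nonzero \<alpha>_mpolys B_coeff[OF x(1)]] by blast
    then show ?case using w by (intro exI[of _ c] shuffle_algebra_eqI) (auto simp: coeff_scalar)
  next
    case (Suc n)
    have const: "\<exists>c. coeff x w = rat_const c" if "length w = Suc n" for w
    proof -
      have "ratfun_deriv i (coeff x w) = 0" if "i < l" for i
        using coeff_deriv_top[of x w i] x(2)[OF that] Suc.prems \<open>length w = Suc n\<close> by simp
      then show ?thesis using coord_ring_constants[OF \<alpha>_nonzero \<alpha>_mpolys B_coeff[OF x(1)], of w] by blast
    qed
    have zero: "coeff x (a # w) = 0" if w: "length w = n" for a w
    proof (cases "a < N")
      case True
      define c where "c b = inv_into UNIV rat_const (coeff x (b # w))" for b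
      have c: "coeff x (b # w) = rat_const (c b)" for b
      proof -
        have "coeff x (b # w) \<in> Set.range rat_const" using const[of "b # w"] w by auto
        then show ?thesis by (simp add: c_def f_inv_into_f)
      qed
      \<comment> \<open>The coefficient of \<open>deriv j x\<close> at \<open>w\<close>, one letter
        below the top, presents a combination of the logarithmic forms as exact.\<close>
      have "(\<Sum>b<N. rat_const (c b) * \<omega> j b) = ratfun_deriv j (- coeff x w)" if "j < l" for j
      proof -
        have "coeff (deriv j x) w = 0" using x(2)[OF that] by simp
        then have "ratfun_deriv j (coeff x w) + (\<Sum>b<N. rat_const (c b) * \<omega> j b) = 0"
          by (simp add: coeff_deriv_eq c mult.commute)
        then show ?thesis by (simp add: ratfun_deriv_uminus eq_neg_iff_add_eq_0 add.commute)
      qed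
      from log_forms_not_exact[OF arr coord_ring_uminus[OF B_coeff[OF x(1)]] this True] c show ?thesis by simp
    next
      case False
      then show ?thesis using B_in_letters[OF x(1)] by (force simp: in_letters_def)
    qed
    have "length w \<le> n" if "coeff x w \<noteq> 0" for w
    proof (rule ccontr)
      assume "\<not> length w \<le> n"
      with Suc.prems[OF that] have "length w = Suc n" by simp
      then obtain a v where "w = a # v" "length v = n" by (auto simp: length_Suc_conv)
      with zero that show False by simp
    qed
    then show ?case by (rule Suc.IH)
  qed
  then show ?thesis using that by blast
qed

text \<open>Take a nonzero element of \<open>J\<close> of minimal length and, among these, with the
  fewest words of top length. Once one top coefficient is normalised to 1, each derivative has fewer
  top words, hence is zero by minimality, and the element is a nonzero constant.\<close>

lemma B_differentially_simple:
  assumes J: "J \<subseteq> B"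
    and mult: "\<And>x y. x \<in> B \<Longrightarrow> y \<in> J \<Longrightarrow> x * y \<in> J"
    and deriv: "\<And>i y. i < l \<Longrightarrow> y \<in> J \<Longrightarrow> deriv i y \<in> J"
    and ex: "\<exists>x\<in>J. x \<noteq> 0"
  shows "1 \<in> J"
proof -
  define S where "S m = {x \<in> J. x \<noteq> 0 \<and> (\<forall>w. coeff x w \<noteq> 0 \<longrightarrow> length w \<le> m)}" for m
  have "\<exists>m. S m \<noteq> {}"
  proof -
    obtain x where "x \<in> J" "x \<noteq> 0" using ex by blast
    moreover obtain n where "\<forall>w. coeff x w \<noteq> 0 \<longrightarrow> length w < n" using word_length_bound by blast
    ultimately have "x \<in> S n" by (auto simp: S_def less_imp_le)
    then show ?thesis by blast
  qed
  define m where "m = (LEAST m. S m \<noteq> {})"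
  have m: "S m \<noteq> {}" and m_min: "S n = {}" if "n < m" for n
    using LeastI_ex[OF \<open>\<exists>m. S m \<noteq> {}\<close>] not_less_Least[of n "\<lambda>m. S m \<noteq> {}"] that by (auto simp: m_def)
  have m: "S m \<noteq> {}" using LeastI_ex[OF \<open>\<exists>m. S m \<noteq> {}\<close>] by (simp add: m_def)
  define top where "top x = {w. length w = m \<and> coeff x w \<noteq> 0}" for x :: "'k ratfun shuffle_algebra"
  have fin: "finite (top x)" for x
    unfolding top_def by (rule finite_subset[OF _ finite_coeff[of x]]) auto
  obtain f where f: "f \<in> S m" and f_min: "\<And>x. x \<in> S m \<Longrightarrow> card (top f) \<le> card (top x)"
    using ex_has_least_nat[of "\<lambda>x. x \<in> S m" _ "\<lambda>x. card (top x)"] m by auto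
  have "top f \<noteq> {}"
  proof
    assume "top f = {}"
    then have less: "length w < m" if "coeff f w \<noteq> 0" for w
      using f that by (fastforce simp: S_def top_def le_less)
    obtain w where "coeff f w \<noteq> 0" using f shuffle_algebra_eqI[of f 0] by (auto simp: S_def)
    with less have "0 < m" by force
    moreover have "f \<in> S (m - 1)" using f less by (fastforce simp: S_def)
    ultimately show False using m_min[of "m - 1"] by auto
  qed
  then obtain w0 where w0: "length w0 = m" "coeff f w0 \<noteq> 0" by (auto simp: top_def)
  \<comment> \<open>Elements of \<open>J\<close> whose top words are among those of
    \<open>f\<close>. Their coefficients at \<open>w0\<close> are stable under the coordinate ring
    and its derivations, so 1 occurs among them.\<close>
  define G where "G = {g \<in> J. (\<forall>w. coeff g w \<noteq> 0 \<longrightarrow> length w \<le> m) \<and> top g \<subseteq> top f}"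
  have "1 \<in> (\<lambda>g. coeff g w0) ` G"
  proof (rule coord_ring_differentially_simple[OF \<alpha>_nonzero \<alpha>_mpolys])
    show "(\<lambda>g. coeff g w0) ` G \<subseteq> \<O>" using J B_coeff by (auto simp: G_def)
    show "coeff f w0 \<in> (\<lambda>g. coeff g w0) ` G" "coeff f w0 \<noteq> 0" using f w0 by (auto simp: G_def S_def)
    show "h * y \<in> (\<lambda>g. coeff g w0) ` G" if h: "h \<in> \<O>" and y: "y \<in> (\<lambda>g. coeff g w0) ` G" for h y
    proof -
      obtain g where g: "g \<in> G" "y = coeff g w0" using y by blast
      have "scalar h * g \<in> G" using g(1) mult[OF B_scalar[OF h]] by (auto simp: G_def top_def)
      then show ?thesis using g(2) by (intro image_eqI[of _ _ "scalar h * g"]) auto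
    qed
    show "ratfun_deriv i y \<in> (\<lambda>g. coeff g w0) ` G" if i: "i < l" and y: "y \<in> (\<lambda>g. coeff g w0) ` G" for i y
    proof -
      obtain g where g: "g \<in> G" "y = coeff g w0" using y by blast
      have len: "\<And>w. coeff g w \<noteq> 0 \<Longrightarrow> length w \<le> m" using g by (auto simp: G_def)
      have top: "coeff (deriv i g) w = ratfun_deriv i (coeff g w)" if "length w = m" for w
        using coeff_deriv_top[of g w i] len that by simp
      have "top (deriv i g) \<subseteq> top g" by (auto simp: top_def top)
      then have "deriv i g \<in> G" using g(1) deriv[OF i] deriv_length_le[OF len] by (auto simp: G_def)
      then show ?thesis using g(2) top[OF w0(1)] by (intro image_eqI[of _ _ "deriv i g"]) auto
    qed
  qed
  then obtain g where g: "g \<in> G" "coeff g w0 = 1" by auto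
  have len: "\<And>w. coeff g w \<noteq> 0 \<Longrightarrow> length w \<le> m" using g by (auto simp: G_def)
  \<comment> \<open>The coefficient 1 at \<open>w0\<close> is killed and no new top word appears, so
    a nonzero derivative would contradict the choice of \<open>f\<close>.\<close>
  have "deriv i g = 0" if i: "i < l" for i
  proof (rule ccontr)
    assume "deriv i g \<noteq> 0"
    then have "deriv i g \<in> S m" using g deriv[OF i] deriv_length_le[OF len] by (auto simp: S_def G_def)
    then have "card (top f) \<le> card (top (deriv i g))" by (rule f_min)
    moreover have top: "coeff (deriv i g) w = ratfun_deriv i (coeff g w)" if "length w = m" for w
      using coeff_deriv_top[of g w i] len that by simp
    have "top (deriv i g) \<subset> top f"
    proof
      show "top (deriv i g) \<subseteq> top f" using g(1) by (auto simp: G_def top_def top)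
      have "w0 \<in> top f" "w0 \<notin> top (deriv i g)" using w0 top[OF w0(1)] g(2) by (auto simp: top_def)
      then show "top (deriv i g) \<noteq> top f" by blast
    qed
    then have "card (top (deriv i g)) < card (top f)" by (rule psubset_card_mono[OF fin])
    ultimately show False by simp
  qed
  moreover have "g \<in> B" using g J by (auto simp: G_def)
  ultimately obtain c where c: "g = scalar (rat_const c)" using constants_B by blast
  then have "rat_const c = 1" using g(2) by (auto simp: coeff_scalar split: if_splits)
  then show ?thesis using g(1) c by (simp add: G_def)
qed

end

context bar_construction
begin

lemma subset_span_sum_Vm:
  assumes "F \<subseteq> Vm m" shows "(\<Sum>v\<in>F. scalar (rat_const (c v)) * v) \<in> Vm m"
  using assms by (intro rational_space.subspace_sum[OF subspace_Vm] rational_space.subspace_scale[OF subspace_Vm]) auto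

lemma ex_rational_coeff:
  assumes "x \<in> V" shows "\<exists>d. \<forall>w. coeff x w = rat_const (d w)"
proof -
  have "\<forall>w. \<exists>d. coeff x w = rat_const d" using V_rational[OF assms] by auto
  then show ?thesis by (rule choice)
qed

text \<open>Conditions behind the new first letter are those of the \<open>u a\<close>; only the
  condition at the two leading letters is new.\<close>

lemma sum_prepend_V:
  assumes u: "\<And>a. a < N \<Longrightarrow> u a \<in> V"
    and curv: "\<And>i j w. i < l \<Longrightarrow> j < l \<Longrightarrow>
      (\<Sum>a<N. \<Sum>b<N. dlog_wedge i j (\<alpha> a) (\<alpha> b) * coeff (u a) (b # w)) = 0"
  shows "(\<Sum>a<N. prepend a (u a)) \<in> V"
proof -
  let ?U = "\<Sum>a<N. prepend a (u a)"
  have Cons: "coeff ?U (a # w) = (if a < N then coeff (u a) w else 0)" for a w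
    by (simp add: coeff_sum coeff_prepend_Cons sum.delta)
  have Nil: "coeff ?U [] = 0" by (simp add: coeff_sum)
  show ?thesis
    unfolding V_iff
  proof (intro conjI allI impI)
    have zero: "(0 :: 'k ratfun) \<in> Set.range rat_const" by (rule range_eqI[of _ _ 0]) simp
    show "coeff ?U w \<in> Set.range rat_const" for w
      using V_rational[OF u] zero by (cases w) (auto simp: Cons Nil)
    show "in_letters ?U"
      unfolding in_letters_def
    proof (intro allI impI)
      fix w assume w: "coeff ?U w \<noteq> 0"
      then obtain a v where av: "w = a # v" using Nil by (cases w) auto
      with w have "a < N" "coeff (u a) v \<noteq> 0" by (auto simp: Cons split: if_splits)
      moreover from this V_in_letters[OF u] have "set v \<subseteq> {..<N}" unfolding in_letters_def by blast
      ultimately show "set w \<subseteq> {..<N}" using av by simp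
    qed
    fix p w i j assume ij: "i < l" "j < l"
    show "(\<Sum>a<N. \<Sum>b<N. dlog_wedge i j (\<alpha> a) (\<alpha> b) * coeff ?U (p @ a # b # w)) = 0"
    proof (cases p)
      case Nil
      have "(\<Sum>a<N. \<Sum>b<N. dlog_wedge i j (\<alpha> a) (\<alpha> b) * coeff ?U (p @ a # b # w)) =
          (\<Sum>a<N. \<Sum>b<N. dlog_wedge i j (\<alpha> a) (\<alpha> b) * coeff (u a) (b # w))"
        by (intro sum.cong refl) (simp add: Nil Cons)
      then show ?thesis using curv[OF ij] by simp
    next
      case p: (Cons c q)
      show ?thesis
      proof (cases "c < N")
        case True
        then show ?thesis using u[OF True] ij by (simp add: p Cons V_iff)
      qed (simp add: p Cons)
    qed
  qed
qed

text \<open>In a basis of \<open>Vm m\<close> the top coefficients are closed one-forms on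
  \<open>M\<close>, hence exact up to logarithmic forms. The exact parts are removed by a primitive
  of the same length, the logarithmic parts by words one letter longer, so a strict length bound
  drops by one.\<close>

theorem closed_imp_exact:
  assumes "\<And>j. j < l \<Longrightarrow> \<eta> j \<in> B"
    and "\<And>i j. i < l \<Longrightarrow> j < l \<Longrightarrow> deriv i (\<eta> j) = deriv j (\<eta> i)"
    and "\<And>j w. j < l \<Longrightarrow> coeff (\<eta> j) w \<noteq> 0 \<Longrightarrow> length w < n"
  shows "\<exists>f\<in>B. \<forall>j<l. deriv j f = \<eta> j"
  using assms
proof (induction n arbitrary: \<eta>)
  case 0
  have "\<eta> j = 0" if "j < l" for j
    by (rule shuffle_algebra_eqI) (use 0(3)[OF that] in force)
  then show ?case by (intro bexI[of _ 0] B_0) simp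
next
  case (Suc m)
  note \<eta>_B = Suc.prems(1) and closed = Suc.prems(2) and len = Suc.prems(3)
  obtain F where F: "F \<subseteq> Vm m" "rational_space.independent F" "Vm m \<subseteq> rational_space.span F" "finite F"
    by (rule ex_basis_Vm)
  have F_V: "v \<in> V" if "v \<in> F" for v using F(1) that Vm_V by blast
  have F_len: "coeff v w = 0" if "v \<in> F" "length w \<noteq> m" for v w
    using F(1) that unfolding Vm_def by blast
  have F_const: "ratfun_deriv i (coeff v w) = 0" if "v \<in> F" for v w i
    using V_rational[OF F_V[OF that], of w] by auto
  have "\<exists>\<phi>. (\<forall>v\<in>F. \<phi> v \<in> \<O>) \<and> homogeneous_part m (\<eta> j) = (\<Sum>v\<in>F. scalar (\<phi> v) * v)" if "j < l" for j
    by (rule B_homogeneous_part_basis[OF F(4,1,3) \<eta>_B[OF that]])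
  then have "\<forall>j. \<exists>\<phi>. j < l \<longrightarrow> (\<forall>v\<in>F. \<phi> v \<in> \<O>) \<and> homogeneous_part m (\<eta> j) = (\<Sum>v\<in>F. scalar (\<phi> v) * v)"
    by blast
  from choice[OF this] obtain \<phi> where \<phi>: "\<And>j v. j < l \<Longrightarrow> v \<in> F \<Longrightarrow> \<phi> j v \<in> \<O>"
    and hom: "\<And>j. j < l \<Longrightarrow> homogeneous_part m (\<eta> j) = (\<Sum>v\<in>F. scalar (\<phi> j v) * v)" by blast
  have \<eta>_top: "coeff (\<eta> j) w = (\<Sum>v\<in>F. \<phi> j v * coeff v w)" if "j < l" "length w = m" for j w
  proof -
    have "coeff (\<eta> j) w = coeff (homogeneous_part m (\<eta> j)) w" using that by simp
    also have "\<dots> = (\<Sum>v\<in>F. \<phi> j v * coeff v w)" unfolding hom[OF that(1)] by (simp add: coeff_sum)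
    finally show ?thesis .
  qed
  have deriv_top: "coeff (deriv i (\<eta> j)) w = (\<Sum>v\<in>F. ratfun_deriv i (\<phi> j v) * coeff v w)"
    if "j < l" "length w = m" for i j w
  proof -
    have "coeff (deriv i (\<eta> j)) w = ratfun_deriv i (coeff (\<eta> j) w)"
      by (rule coeff_deriv_top) (use len[OF that(1)] that(2) in force)
    also have "\<dots> = (\<Sum>v\<in>F. ratfun_deriv i (\<phi> j v) * coeff v w)"
      unfolding \<eta>_top[OF that] ratfun_deriv_sum
      by (intro sum.cong refl) (simp add: ratfun_deriv_mult F_const)
    finally show ?thesis .
  qed
  \<comment> \<open>At top length the derivations act on coefficients only, and a basis of
    \<open>Vm m\<close> remains independent over the rational functions.\<close>
  have \<phi>_closed: "ratfun_deriv i (\<phi> j v) = ratfun_deriv j (\<phi> i v)" if ij: "i < l" "j < l" and v: "v \<in> F" for i j v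
  proof -
    have "(\<Sum>v\<in>F. scalar (ratfun_deriv i (\<phi> j v) - ratfun_deriv j (\<phi> i v)) * v) = 0"
    proof (rule shuffle_algebra_eqI)
      fix w
      show "coeff (\<Sum>v\<in>F. scalar (ratfun_deriv i (\<phi> j v) - ratfun_deriv j (\<phi> i v)) * v) w = coeff 0 w"
      proof (cases "length w = m")
        case True
        have "coeff (deriv i (\<eta> j)) w = coeff (deriv j (\<eta> i)) w" using closed[OF ij] by simp
        then show ?thesis
          unfolding deriv_top[OF ij(2) True] deriv_top[OF ij(1) True]
          by (simp add: coeff_sum left_diff_distrib sum_subtractf)
      next
        case False
        then show ?thesis by (simp add: coeff_sum F_len)
      qed
    qed
    from independent_over_ratfun[OF F(4,2) V_rational[OF F_V] this v] show ?thesis by simp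
  qed
  have "\<exists>g c. g \<in> \<O> \<and> (\<forall>j<l. \<phi> j v = ratfun_deriv j g + (\<Sum>a<N. rat_const (c a) * \<omega> j a))" if v: "v \<in> F" for v
    by (rule closed_form_cohomologous_log[OF arr]) (use \<phi> \<phi>_closed v in auto)
  then have "\<forall>v. \<exists>g. v \<in> F \<longrightarrow> (\<exists>c. g \<in> \<O> \<and> (\<forall>j<l. \<phi> j v = ratfun_deriv j g + (\<Sum>a<N. rat_const (c a) * \<omega> j a)))"
    by blast
  from choice[OF this] obtain g where
    "\<forall>v. \<exists>c. v \<in> F \<longrightarrow> (g v \<in> \<O> \<and> (\<forall>j<l. \<phi> j v = ratfun_deriv j (g v) + (\<Sum>a<N. rat_const (c a) * \<omega> j a)))"
    by blast
  from choice[OF this] obtain c where g: "\<And>v. v \<in> F \<Longrightarrow> g v \<in> \<O>"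
    and \<phi>_eq: "\<And>v j. v \<in> F \<Longrightarrow> j < l \<Longrightarrow> \<phi> j v = ratfun_deriv j (g v) + (\<Sum>a<N. rat_const (c v a) * \<omega> j a)"
    by blast
  \<comment> \<open>\<open>G\<close> integrates the exact parts. \<open>u a\<close> collects the
    coefficients of the \<open>a\<close>-th logarithmic form, so the top part that remains is the
    sum of the logarithmic forms times the \<open>u a\<close>.\<close>
  define G where "G = (\<Sum>v\<in>F. scalar (g v) * v)"
  define u where "u a = (\<Sum>v\<in>F. scalar (rat_const (c v a)) * v)" for a
  define \<eta>' where "\<eta>' j = \<eta> j - deriv j G" for j
  have G: "G \<in> B" unfolding G_def using g F_V by (intro B_sum B_incl) auto
  have G_len: "length w \<le> m" if "coeff G w \<noteq> 0" for w
  proof (rule ccontr)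
    assume "\<not> length w \<le> m"
    then have "coeff G w = 0" unfolding G_def coeff_sum by (intro sum.neutral) (auto simp: F_len)
    with that show False by simp
  qed
  have u: "u a \<in> Vm m" for a unfolding u_def by (rule subset_span_sum_Vm[OF F(1)])
  have u_len: "coeff (u a) w = 0" if "length w \<noteq> m" for a w
    using u[of a] that unfolding Vm_def by blast
  have \<eta>'_B: "\<eta>' j \<in> B" if "j < l" for j
    unfolding \<eta>'_def using \<eta>_B[OF that] G by (intro B_diff deriv_B)
  have \<eta>'_closed: "deriv i (\<eta>' j) = deriv j (\<eta>' i)" if "i < l" "j < l" for i j
    using closed[OF that] deriv_commute[OF G that] by (simp add: \<eta>'_def deriv_diff)
  have \<eta>'_top: "coeff (\<eta>' j) w = (\<Sum>a<N. \<omega> j a * coeff (u a) w)" if "j < l" "length w = m" for j w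
  proof -
    have "coeff (deriv j G) w = ratfun_deriv j (coeff G w)"
      by (rule coeff_deriv_top) (use G_len that(2) in force)
    also have "\<dots> = (\<Sum>v\<in>F. ratfun_deriv j (g v) * coeff v w)"
      unfolding G_def coeff_sum ratfun_deriv_sum
      by (intro sum.cong refl) (simp add: ratfun_deriv_mult F_const)
    finally have "coeff (\<eta>' j) w = (\<Sum>v\<in>F. (\<phi> j v - ratfun_deriv j (g v)) * coeff v w)"
      by (simp add: \<eta>'_def \<eta>_top[OF that] left_diff_distrib sum_subtractf)
    also have "\<dots> = (\<Sum>v\<in>F. \<Sum>a<N. \<omega> j a * (rat_const (c v a) * coeff v w))"
      by (intro sum.cong refl) (simp add: \<phi>_eq that(1) sum_distrib_left mult_ac)
    also have "\<dots> = (\<Sum>a<N. \<omega> j a * coeff (u a) w)"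
      by (subst sum.swap) (simp add: u_def coeff_sum sum_distrib_left)
    finally show ?thesis .
  qed
  have \<eta>'_len: "length w \<le> m" if "j < l" "coeff (\<eta>' j) w \<noteq> 0" for j w
  proof (rule ccontr)
    assume m: "\<not> length w \<le> m"
    then have "coeff (deriv j G) w = 0" using deriv_length_le[OF G_len] by blast
    moreover have "coeff (\<eta> j) w = 0" using len[OF that(1), of w] m by auto
    ultimately show False using that(2) by (simp add: \<eta>'_def)
  qed
  \<comment> \<open>Deleting the prepended letters shows that the derivatives of \<open>U\<close>
    reproduce this sum once \<open>U\<close> is known to be integrable.\<close>
  define U where "U = (\<Sum>a<N. prepend a (u a))"
  have U: "U \<in> V"
    unfolding U_def
  proof (rule sum_prepend_V)
    show "u a \<in> V" if "a < N" for a using u Vm_V by blast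
    fix i j w assume ij: "i < l" "j < l"
    show "(\<Sum>a<N. \<Sum>b<N. dlog_wedge i j (\<alpha> a) (\<alpha> b) * coeff (u a) (b # w)) = 0"
    proof (cases "Suc (length w) = m")
      case False
      then show ?thesis by (simp add: u_len)
    next
      case True
      have "\<forall>a. \<exists>d. \<forall>w. coeff (u a) w = rat_const (d w)"
        using ex_rational_coeff[OF Vm_V[OF u]] by blast
      from choice[OF this] obtain d where d: "\<And>a w. coeff (u a) w = rat_const (d a w)" by blast
      \<comment> \<open>In the closedness relation at a word of length \<open>m - 1\<close>, the
        deletion terms form a logarithmic two-form that is the differential of a one-form, so they
        vanish.\<close>
      have "(\<Sum>a<N. \<Sum>b<N. rat_const (d a (b # w)) * dlog_wedge i j (\<alpha> a) (\<alpha> b)) = 0"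
      proof (rule exact_log_two_form_eq_0[OF arr _ _ ij, where \<beta> = "\<lambda>j. coeff (\<eta>' j) w"])
        show "coeff (\<eta>' j) w \<in> \<O>" if "j < l" for j by (rule B_coeff[OF \<eta>'_B[OF that]])
        fix i j assume ij: "i < l" "j < l"
        have exp: "coeff (deriv i (\<eta>' j)) w = ratfun_deriv i (coeff (\<eta>' j) w) +
            (\<Sum>b<N. \<Sum>a<N. rat_const (d a (b # w)) * (\<omega> i b * \<omega> j a))" if "i < l" "j < l" for i j
          unfolding coeff_deriv_eq using \<eta>'_top[OF that(2)] True
          by (simp add: sum_distrib_left d mult_ac)
        have "coeff (deriv i (\<eta>' j)) w = coeff (deriv j (\<eta>' i)) w" using \<eta>'_closed[OF ij] by simp
        then have "ratfun_deriv i (coeff (\<eta>' j) w) - ratfun_deriv j (coeff (\<eta>' i) w) =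
            (\<Sum>b<N. \<Sum>a<N. rat_const (d a (b # w)) * (\<omega> j b * \<omega> i a)) -
            (\<Sum>b<N. \<Sum>a<N. rat_const (d a (b # w)) * (\<omega> i b * \<omega> j a))"
          unfolding exp[OF ij] exp[OF ij(2,1)] by (simp add: algebra_simps)
        also have "\<dots> = (\<Sum>b<N. \<Sum>a<N. rat_const (d a (b # w)) * dlog_wedge i j (\<alpha> a) (\<alpha> b))"
          unfolding sum_subtractf[symmetric]
          by (intro sum.cong refl) (simp add: dlog_wedge_def right_diff_distrib mult_ac)
        also have "\<dots> = (\<Sum>a<N. \<Sum>b<N. rat_const (d a (b # w)) * dlog_wedge i j (\<alpha> a) (\<alpha> b))"
          by (rule sum.swap)
        finally show "(\<Sum>a<N. \<Sum>b<N. rat_const (d a (b # w)) * dlog_wedge i j (\<alpha> a) (\<alpha> b)) =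
            ratfun_deriv i (coeff (\<eta>' j) w) - ratfun_deriv j (coeff (\<eta>' i) w)" ..
      qed
      then show ?thesis by (simp add: d mult.commute)
    qed
  qed
  have deriv_U: "coeff (deriv j U) w = (\<Sum>a<N. \<omega> j a * coeff (u a) w)" for j w
    unfolding deriv_V[OF U] coeff_sum
    by (intro sum.cong refl) (simp add: U_def coeff_sum coeff_prepend_Cons sum.delta)
  have "\<exists>f\<in>B. \<forall>j<l. deriv j f = \<eta>' j - deriv j U"
  proof (rule Suc.IH)
    show "\<eta>' j - deriv j U \<in> B" if "j < l" for j
      using \<eta>'_B[OF that] deriv_V_in_B[OF U] by (rule B_diff)
    show "deriv i (\<eta>' j - deriv j U) = deriv j (\<eta>' i - deriv i U)" if "i < l" "j < l" for i j
      using \<eta>'_closed[OF that] deriv_commute_V[OF U that] by (simp add: deriv_diff)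
    show "length w < m" if j: "j < l" and nz: "coeff (\<eta>' j - deriv j U) w \<noteq> 0" for j w
    proof (rule ccontr)
      assume "\<not> length w < m"
      then consider "length w = m" | "m < length w" by linarith
      then have "coeff (\<eta>' j - deriv j U) w = 0"
      proof cases
        case 1
        then show ?thesis using \<eta>'_top[OF j] by (simp add: deriv_U)
      next
        case 2
        then have "coeff (\<eta>' j) w = 0" using \<eta>'_len[OF j, of w] by force
        moreover have "coeff (deriv j U) w = 0" using 2 by (simp add: deriv_U u_len)
        ultimately show ?thesis by simp
      qed
      with nz show False by simp
    qed
  qed
  then obtain f where f: "f \<in> B" "\<And>j. j < l \<Longrightarrow> deriv j f = \<eta>' j - deriv j U" by blast
  show ?case
  proof (intro bexI allI impI)
    show "f + G + U \<in> B" using f G B_V[OF U] by (intro B_add)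
    show "deriv j (f + G + U) = \<eta> j" if "j < l" for j
      using f(2)[OF that] by (simp add: deriv_add \<eta>'_def)
  qed
qed

end

section \<open>Polynomial generators\<close>

definition homogeneous :: "nat \<Rightarrow> 'a::comm_ring_1 shuffle_algebra \<Rightarrow> bool" where
  "homogeneous m x \<longleftrightarrow> (\<forall>w. coeff x w \<noteq> 0 \<longrightarrow> length w = m)"

lemma homogeneous_delete: "homogeneous (Suc m) x \<Longrightarrow> homogeneous m (delete a x)"
  by (force simp: homogeneous_def)

lemma homogeneous_0_delete: "homogeneous 0 x \<Longrightarrow> delete a x = 0"
  by (rule shuffle_algebra_eqI) (force simp: homogeneous_def)

lemma homogeneous_mult:
  assumes "homogeneous i x" "homogeneous j y" shows "homogeneous (i + j) (x * y)"
proof -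
  have "length w = i + j" if "coeff (x * y) w \<noteq> 0" for w
    using assms that
  proof (induction w arbitrary: i j x y)
    case Nil
    then have "coeff x [] \<noteq> 0" "coeff y [] \<noteq> 0" by auto
    with Nil show ?case unfolding homogeneous_def by fastforce
  next
    case (Cons a w)
    have "coeff (x * y) (a # w) = coeff (delete a x * y) w + coeff (x * delete a y) w"
      by (simp only: coeff_delete[symmetric] delete_mult coeff_add)
    then consider "coeff (delete a x * y) w \<noteq> 0" | "coeff (x * delete a y) w \<noteq> 0" using Cons.prems by force
    then show ?case
    proof cases
      case 1
      then obtain i' where i: "i = Suc i'" using Cons.prems(1) homogeneous_0_delete by (cases i) force+
      then show ?thesis using Cons.IH[OF homogeneous_delete Cons.prems(2) 1, of i'] Cons.prems(1) by simp
    next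
      case 2
      then obtain j' where j: "j = Suc j'" using Cons.prems(2) homogeneous_0_delete by (cases j) force+
      then show ?thesis using Cons.IH[OF Cons.prems(1) homogeneous_delete 2, of j'] Cons.prems(2) by simp
    qed
  qed
  then show ?thesis by (simp add: homogeneous_def)
qed

text \<open>The \<open>k\<close>-subalgebra generated by \<open>S\<close>, with monomials given as
  multisets of generators.\<close>

definition monomial_span :: "'k::field_char_0 ratfun shuffle_algebra set \<Rightarrow> 'k ratfun shuffle_algebra set" where
  "monomial_span S = rational_space.span (prod_mset ` {M. set_mset M \<subseteq> S})"

lemma monomial_span_subspace: "rational_space.subspace (monomial_span S)"
  unfolding monomial_span_def by (rule rational_space.subspace_span)

lemma monomial_span_prod_mset: "set_mset M \<subseteq> S \<Longrightarrow> prod_mset M \<in> monomial_span S"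
  unfolding monomial_span_def by (intro rational_space.span_base) auto

lemma monomial_span_1: "1 \<in> monomial_span S"
  using monomial_span_prod_mset[of "{#}" S] by simp

lemma monomial_span_scalar: "scalar (rat_const c) \<in> monomial_span S"
  using rational_space.subspace_scale[OF monomial_span_subspace monomial_span_1, of c] by simp

lemma monomial_span_incl: "x \<in> S \<Longrightarrow> x \<in> monomial_span S"
  using monomial_span_prod_mset[of "{#x#}" S] by simp

lemma monomial_span_mono: "S \<subseteq> S' \<Longrightarrow> monomial_span S \<subseteq> monomial_span S'"
  unfolding monomial_span_def by (intro rational_space.span_mono) auto

lemma monomial_span_mult:
  assumes "x \<in> monomial_span S" "y \<in> monomial_span S" shows "x * y \<in> monomial_span S"
proof -
  have *: "prod_mset M * z \<in> monomial_span S" if "set_mset M \<subseteq> S" "z \<in> monomial_span S" for M z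
    using that(2) unfolding monomial_span_def
  proof (induction rule: rational_space.span_induct_alt)
    case base
    then show ?case by (simp add: rational_space.span_zero)
  next
    case (step c y z)
    then obtain M' where M': "y = prod_mset M'" "set_mset M' \<subseteq> S" by blast
    have "prod_mset M * (scalar (rat_const c) * y + z) =
        scalar (rat_const c) * prod_mset (M + M') + prod_mset M * z"
      by (simp add: M' algebra_simps)
    moreover have "prod_mset (M + M') \<in> rational_space.span (prod_mset ` {M. set_mset M \<subseteq> S})"
      using that(1) M'(2) by (intro rational_space.span_base imageI) auto
    ultimately show ?case
      using step by (simp only: rational_space.span_add rational_space.span_scale)
  qed
  show ?thesis
    using assms(1) unfolding monomial_span_def[of S]
  proof (induction rule: rational_space.span_induct_alt)
    case base
    then show ?case by (simp add: rational_space.span_zero)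
  next
    case (step c x z)
    then have "x * y \<in> monomial_span S" using * assms(2) by blast
    then show ?case
      using step unfolding monomial_span_def
      by (simp add: distrib_right mult.assoc rational_space.span_add rational_space.span_scale)
  qed
qed

lemma monomial_span_delete:
  assumes S: "\<And>s. s \<in> S \<Longrightarrow> delete a s \<in> monomial_span S" and x: "x \<in> monomial_span S"
  shows "delete a x \<in> monomial_span S"
proof -
  have M: "delete a (prod_mset M) \<in> monomial_span S" if "set_mset M \<subseteq> S" for M
    using that
  proof (induction M)
    case empty
    then show ?case by (simp add: rational_space.subspace_0[OF monomial_span_subspace])
  next
    case (add s M)
    then have "s \<in> S" "set_mset M \<subseteq> S" by auto
    then have "delete a s * prod_mset M \<in> monomial_span S" "s * delete a (prod_mset M) \<in> monomial_span S"
      using add.IH S by (simp_all add: monomial_span_mult monomial_span_prod_mset monomial_span_incl)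
    then show ?case
      by (simp add: delete_mult rational_space.subspace_add[OF monomial_span_subspace])
  qed
  show ?thesis
    using x unfolding monomial_span_def[of S]
  proof (induction rule: rational_space.span_induct_alt)
    case base
    then show ?case by (simp add: rational_space.span_zero)
  next
    case (step c y z)
    then have "delete a y \<in> monomial_span S" using M by blast
    then show ?case
      using step unfolding monomial_span_def
      by (simp add: delete_add rational_space.span_add rational_space.span_scale)
  qed
qed

text \<open>Algebraic independence over \<open>k\<close>; a relation is a finite family of multisets
  with coefficients.\<close>

definition independent_monomials :: "'k::field_char_0 ratfun shuffle_algebra set \<Rightarrow> bool" where
  "independent_monomials S \<longleftrightarrow>
     (\<forall>\<M> c. finite \<M> \<longrightarrow> (\<forall>M\<in>\<M>. set_mset M \<subseteq> S) \<longrightarrow>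
        (\<Sum>M\<in>\<M>. scalar (rat_const (c M)) * prod_mset M) = 0 \<longrightarrow> (\<forall>M\<in>\<M>. c M = 0))"

lemma delete_power_Suc: "delete a (s ^ Suc n) = of_nat (Suc n) * s ^ n * delete a s"
  by (induction n) (simp_all add: delete_mult algebra_simps)

text \<open>A relation of minimal degree whose leading coefficient has minimal length has a constant
  leading coefficient; comparing the next coefficient puts \<open>s\<close> into \<open>A\<close>.\<close>

lemma transcendental_over:
  fixes A :: "'k::field_char_0 ratfun shuffle_algebra set"
  assumes A: "rational_space.subspace A" "1 \<in> A" "\<And>x y. x \<in> A \<Longrightarrow> y \<in> A \<Longrightarrow> x * y \<in> A"
    and rat: "\<And>x w. x \<in> A \<Longrightarrow> coeff x w \<in> Set.range rat_const"
    and ratS: "\<And>w. coeff s w \<in> Set.range rat_const"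
    and del: "\<And>x b. x \<in> A \<Longrightarrow> delete b x \<in> A" and dels: "\<And>b. delete b s \<in> A"
    and s: "s \<notin> A"
    and a: "\<And>j. j \<le> d \<Longrightarrow> a j \<in> A" and rel: "(\<Sum>j\<le>d. a j * s ^ j) = 0"
  shows "\<forall>j\<le>d. a j = 0"
  using a rel
proof (induction d arbitrary: a)
  case 0
  then show ?case by simp
next
  case (Suc d)
  note IHd = Suc.IH
  have add: "x + y \<in> A" if "x \<in> A" "y \<in> A" for x y using rational_space.subspace_add[OF A(1) that] .
  have scal: "scalar (rat_const c) \<in> A" for c using rational_space.subspace_scale[OF A(1,2), of c] by simp
  have nat: "of_nat n \<in> A" for n
    by (induction n) (use rational_space.subspace_0[OF A(1)] add A(2) in simp_all)
  have lead: "a (Suc d) = 0"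
    if "\<And>j. j \<le> Suc d \<Longrightarrow> a j \<in> A" "(\<Sum>j\<le>Suc d. a j * s ^ j) = 0"
      "\<And>w. coeff (a (Suc d)) w \<noteq> 0 \<Longrightarrow> length w < n" for n a
    using that
  proof (induction n arbitrary: a)
    case 0
    then show ?case by (intro shuffle_algebra_eqI) force
  next
    case (Suc n)
    \<comment> \<open>Coefficients of the relation obtained by applying \<open>delete x\<close>,
      sorted by powers of \<open>s\<close>; its leading coefficient is shorter than the original
      one.\<close>
    define b where "b x j = delete x (a j) + (if j \<le> d then of_nat (Suc j) * a (Suc j) * delete x s else 0)" for x j
    have b_A: "b x j \<in> A" if "j \<le> Suc d" for x j
      using that Suc.prems(1) rational_space.subspace_0[OF A(1)] by (auto simp: b_def intro!: add A(3) nat del dels simp del: of_nat_Suc)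
    have b_rel: "(\<Sum>j\<le>Suc d. b x j * s ^ j) = 0" for x
    proof -
      have "0 = delete x (\<Sum>j\<le>Suc d. a j * s ^ j)" using Suc.prems(2) by simp
      also have "\<dots> = (\<Sum>j\<le>Suc d. delete x (a j) * s ^ j) + (\<Sum>j\<le>Suc d. a j * delete x (s ^ j))"
        by (simp only: delete_sum delete_mult sum.distrib)
      also have "(\<Sum>j\<le>Suc d. a j * delete x (s ^ j)) = (\<Sum>j\<le>d. a (Suc j) * delete x (s ^ Suc j))"
        by (subst sum.atMost_Suc_shift) simp
      also have "\<dots> = (\<Sum>j\<le>d. (if j \<le> d then of_nat (Suc j) * a (Suc j) * delete x s else 0) * s ^ j)"
        by (intro sum.cong refl) (simp only: delete_power_Suc atMost_iff if_True mult_ac)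
      also have "\<dots> = (\<Sum>j\<le>Suc d. (if j \<le> d then of_nat (Suc j) * a (Suc j) * delete x s else 0) * s ^ j)"
        by simp
      finally show ?thesis by (simp only: b_def distrib_right sum.distrib)
    qed
    have b_top: "b x (Suc d) = delete x (a (Suc d))" for x by (simp add: b_def)
    have b_lead: "b x (Suc d) = 0" for x
    proof (rule Suc.IH[OF b_A b_rel])
      fix w assume "coeff (b x (Suc d)) w \<noteq> 0"
      then show "length w < n" using Suc.prems(3)[of "x # w"] by (simp add: b_top)
    qed
    \<comment> \<open>With the leading coefficient gone, the outer induction on the degree applies
      to the derived relation.\<close>
    have b_next: "b x d = 0" for x
      using IHd[of "b x"] b_A[of _ x] b_rel[of x] b_lead[of x] by simp
    have "a (Suc d) = scalar (coeff (a (Suc d)) [])"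
      using b_lead by (intro delete_eq_0_imp_scalar) (simp add: b_top)
    moreover obtain c where c: "coeff (a (Suc d)) [] = rat_const c" using rat[OF Suc.prems(1)[of "Suc d"]] by auto
    ultimately have a_c: "a (Suc d) = scalar (rat_const c)" by simp
    \<comment> \<open>The constant in front of \<open>delete x s\<close> in the derived relation at
      degree \<open>d\<close>: adding \<open>k\<close> times \<open>s\<close> to \<open>a d\<close>
      gives an element killed by all deletions.\<close>
    define k where "k = of_nat (Suc d) * c"
    have k: "of_nat (Suc d) * a (Suc d) = scalar (rat_const k)"
    proof -
      have "of_nat n = scalar (rat_const (of_nat n :: 'k))" for n
        by (induction n) (simp_all add: rat_const_add scalar_add)
      then show ?thesis by (simp only: a_c k_def rat_const_mult scalar_mult)
    qed
    have "delete x (a d + scalar (rat_const k) * s) = 0" for x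
    proof -
      have "delete x (a d) + (of_nat (Suc d) * a (Suc d)) * delete x s = 0"
        using b_next[of x] by (simp only: b_def order_refl if_True)
      then show ?thesis unfolding k by (simp add: delete_add)
    qed
    then have const: "a d + scalar (rat_const k) * s = scalar (coeff (a d + scalar (rat_const k) * s) [])"
      by (rule delete_eq_0_imp_scalar)
    obtain e where e: "coeff (a d + scalar (rat_const k) * s) [] = rat_const e"
    proof -
      obtain e1 where "coeff (a d) [] = rat_const e1"
        using rat[OF Suc.prems(1)[of d], of "[]"] by auto
      moreover obtain e2 where "coeff s [] = rat_const e2" using ratS[of "[]"] by auto
      ultimately have "coeff (a d + scalar (rat_const k) * s) [] = rat_const (e1 + k * e2)"
        by (simp add: rat_const_add rat_const_mult coeff_scalar)
      then show ?thesis by (rule that)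
    qed
    have "a d + scalar (rat_const k) * s = scalar (rat_const e)" using const unfolding e .
    then have eq: "scalar (rat_const k) * s = scalar (rat_const e) - a d" by (simp add: eq_diff_eq add.commute)
    have "k = 0"
    proof (rule ccontr)
      assume "k \<noteq> 0"
      have "scalar (rat_const e) - a d \<in> A"
        using Suc.prems(1)[of d] scal by (intro rational_space.subspace_diff[OF A(1)]) auto
      then have "scalar (rat_const (inverse k)) * (scalar (rat_const k) * s) \<in> A"
        unfolding eq by (intro A(3) scal)
      moreover have "scalar (rat_const (inverse k)) * (scalar (rat_const k) * s) = s"
        using \<open>k \<noteq> 0\<close> by (simp flip: mult.assoc scalar_mult rat_const_mult)
      ultimately show False using s by simp
    qed
    then have "c = 0" unfolding k_def by (simp del: of_nat_Suc)
    then show ?case by (simp add: a_c)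
  qed
  obtain n where "\<forall>w. coeff (a (Suc d)) w \<noteq> 0 \<longrightarrow> length w < n" using word_length_bound by blast
  with lead[of a n] Suc.prems have top: "a (Suc d) = 0" by blast
  with Suc.prems(2) have "(\<Sum>j\<le>d. a j * s ^ j) = 0" by simp
  then have "\<forall>j\<le>d. a j = 0" by (intro IHd) (simp_all add: Suc.prems(1))
  with top show ?case by (auto simp: le_Suc_eq)
qed

text \<open>Sorted by powers of \<open>s\<close>, a relation becomes a polynomial with coefficients
  in the algebra generated by \<open>S\<close>. Transcendence of \<open>s\<close> makes each
  coefficient vanish, and independence of \<open>S\<close> then applies to it.\<close>

lemma independent_monomials_insert:
  fixes S :: "'k::field_char_0 ratfun shuffle_algebra set"
  assumes ind: "independent_monomials S" and s: "s \<notin> monomial_span S"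
    and rat: "\<And>x w. x \<in> monomial_span S \<Longrightarrow> coeff x w \<in> Set.range rat_const"
    and ratS: "\<And>w. coeff s w \<in> Set.range rat_const"
    and del: "\<And>x b. x \<in> S \<Longrightarrow> delete b x \<in> monomial_span S"
    and dels: "\<And>b. delete b s \<in> monomial_span S"
  shows "independent_monomials (insert s S)"
  unfolding independent_monomials_def
proof (intro allI impI)
  fix \<M> :: "'k ratfun shuffle_algebra multiset set" and c
  assume fin: "finite \<M>" and \<M>: "\<forall>M\<in>\<M>. set_mset M \<subseteq> insert s S"
    and rel: "(\<Sum>M\<in>\<M>. scalar (rat_const (c M)) * prod_mset M) = 0"
  define r where "r M = filter_mset (\<lambda>x. x \<noteq> s) M" for M
  have split: "M = r M + replicate_mset (count M s) s" for M
    unfolding r_def by (rule multiset_eqI) auto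
  have r_S: "set_mset (r M) \<subseteq> S" if "M \<in> \<M>" for M using \<M> that by (auto simp: r_def)
  have prod: "prod_mset M = prod_mset (r M) * s ^ count M s" for M
    by (subst split) (simp only: prod_mset_Un prod_mset_replicate_mset)
  obtain d where d: "\<And>M. M \<in> \<M> \<Longrightarrow> count M s \<le> d"
    using fin finite_nat_set_iff_bounded_le[of "(\<lambda>M. count M s) ` \<M>"] by auto
  define P where "P j = {M \<in> \<M>. count M s = j}" for j
  have fP: "finite (P j)" for j using fin by (simp add: P_def)
  define a where "a j = (\<Sum>M\<in>P j. scalar (rat_const (c M)) * prod_mset (r M))" for j
  have a_A: "a j \<in> monomial_span S" for j
    unfolding a_def P_def using r_S
    by (intro rational_space.subspace_sum[OF monomial_span_subspace]
        rational_space.subspace_scale[OF monomial_span_subspace] monomial_span_prod_mset) auto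
  have "(\<Sum>j\<le>d. a j * s ^ j) = (\<Sum>j\<le>d. \<Sum>M\<in>P j. scalar (rat_const (c M)) * prod_mset M)"
    unfolding a_def sum_distrib_right
  proof (intro sum.cong refl)
    fix j M assume "M \<in> P j"
    then have "prod_mset M = prod_mset (r M) * s ^ j" using prod[of M] by (simp add: P_def)
    then show "scalar (rat_const (c M)) * prod_mset (r M) * s ^ j = scalar (rat_const (c M)) * prod_mset M"
      by (simp only: mult.assoc)
  qed
  also have "\<dots> = 0"
    unfolding P_def rel[symmetric] by (rule sum.group[OF fin]) (use d in auto)
  finally have a_rel: "(\<Sum>j\<le>d. a j * s ^ j) = 0" .
  have "\<forall>j\<le>d. a j = 0"
    by (rule transcendental_over[where A = "monomial_span S" and s = s])
       (use monomial_span_subspace monomial_span_1 monomial_span_mult rat ratS monomial_span_delete[OF del] dels s a_A a_rel in auto)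
  then have a0: "a j = 0" if "j \<le> d" for j using that by blast
  have inj: "inj_on r (P j)" for j
  proof (rule inj_onI)
    fix M M' assume "M \<in> P j" "M' \<in> P j" "r M = r M'"
    then show "M = M'" using split[of M] split[of M'] by (simp add: P_def)
  qed
  show "\<forall>M\<in>\<M>. c M = 0"
  proof
    fix M assume M: "M \<in> \<M>"
    define j where "j = count M s"
    have eq: "r M' + replicate_mset j s = M'" if "M' \<in> P j" for M' using split[of M'] that by (simp add: P_def)
    have "(\<Sum>M'\<in>r ` P j. scalar (rat_const (c (M' + replicate_mset j s))) * prod_mset M') = a j"
      unfolding a_def by (subst sum.reindex[OF inj]) (simp add: eq)
    also have "\<dots> = 0" using a0 d[OF M] by (simp add: j_def)
    finally have "\<forall>M'\<in>r ` P j. c (M' + replicate_mset j s) = 0"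
      using ind[unfolded independent_monomials_def, rule_format, of "r ` P j" "\<lambda>M'. c (M' + replicate_mset j s)"]
        fP r_S by (auto simp: P_def)
    moreover have "M \<in> P j" using M by (simp add: P_def j_def)
    ultimately show "c M = 0" using eq[of M] by auto
  qed
qed

section \<open>Generators chosen weight by weight\<close>

context bar_construction
begin

lemma Vm_iff_homogeneous: "x \<in> Vm m \<longleftrightarrow> x \<in> V \<and> homogeneous m x"
  by (simp add: Vm_def homogeneous_def)

lemma Vm_mult: "x \<in> Vm i \<Longrightarrow> y \<in> Vm j \<Longrightarrow> x * y \<in> Vm (i + j)"
  by (simp add: Vm_iff_homogeneous V_mult homogeneous_mult)

lemma Vm_delete: "x \<in> Vm (Suc m) \<Longrightarrow> delete a x \<in> Vm m"
  by (simp add: Vm_iff_homogeneous V_delete homogeneous_delete)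

lemma Vm_0: "x \<in> Vm 0 \<Longrightarrow> \<exists>c. x = scalar (rat_const c)"
proof -
  assume x: "x \<in> Vm 0"
  then have "x = scalar (coeff x [])"
    by (intro delete_eq_0_imp_scalar homogeneous_0_delete) (simp add: Vm_iff_homogeneous)
  then show ?thesis using V_rational[OF Vm_V[OF x], of "[]"] by (metis rangeE)
qed

lemma delete_Vm_0: "x \<in> Vm 0 \<Longrightarrow> delete a x = 0"
  by (simp add: Vm_iff_homogeneous homogeneous_0_delete)

text \<open>The weight \<open>n\<close> part of the square of the augmentation ideal of
  \<open>V\<close>.\<close>

definition decomposable :: "nat \<Rightarrow> 'k ratfun shuffle_algebra set" where
  "decomposable n = rational_space.span {x * y | x y. \<exists>i j. 0 < i \<and> 0 < j \<and> i + j = n \<and> x \<in> Vm i \<and> y \<in> Vm j}"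

lemma decomposable_Vm: "decomposable n \<subseteq> Vm n"
  unfolding decomposable_def using Vm_mult
  by (intro rational_space.span_minimal subspace_Vm) blast

text \<open>A basis of the decomposables is extended to a basis of \<open>Vm n\<close>; the added
  vectors represent a basis of the indecomposable quotient. Independence is stated element by
  element because generators are adjoined one at a time.\<close>

lemma ex_indecomposables:
  "\<exists>S. S \<subseteq> Vm n \<and> finite S \<and> Vm n \<subseteq> rational_space.span (S \<union> decomposable n) \<and>
     (\<forall>s\<in>S. s \<notin> rational_space.span ((S - {s}) \<union> decomposable n))"
proof -
  obtain E where E: "E \<subseteq> decomposable n" "rational_space.independent E" "decomposable n \<subseteq> rational_space.span E"
    using rational_space.maximal_independent_subset[of "decomposable n"] by auto
  have "E \<subseteq> Vm n" using E(1) decomposable_Vm by blast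
  then obtain F where F: "E \<subseteq> F" "F \<subseteq> Vm n" "rational_space.independent F" "Vm n \<subseteq> rational_space.span F"
    using rational_space.maximal_independent_subset_extend[OF _ E(2)] by metis
  let ?S = "F - E"
  have "rational_space.span F \<subseteq> rational_space.span (?S \<union> decomposable n)"
    using E(1) by (intro rational_space.span_mono) auto
  moreover have "s \<notin> rational_space.span ((?S - {s}) \<union> decomposable n)" if s: "s \<in> ?S" for s
  proof
    assume a: "s \<in> rational_space.span ((?S - {s}) \<union> decomposable n)"
    have "?S - {s} \<subseteq> rational_space.span (F - {s})" by (intro subsetI rational_space.span_base) auto
    moreover have "rational_space.span E \<subseteq> rational_space.span (F - {s})"
      using F(1) s by (intro rational_space.span_mono) auto
    ultimately have "(?S - {s}) \<union> decomposable n \<subseteq> rational_space.span (F - {s})" using E(3) by blast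
    from rational_space.span_minimal[OF this rational_space.subspace_span] a
    have "s \<in> rational_space.span (F - {s})" by blast
    then show False using F(3) s by (auto simp: rational_space.dependent_def)
  qed
  moreover have "finite ?S" using finite_independent_Vm[OF F(3,2)] by simp
  ultimately show ?thesis using F(2,4) by (intro exI[of _ ?S]) auto
qed

definition generators :: "nat \<Rightarrow> 'k ratfun shuffle_algebra set" where
  "generators n = (SOME S. S \<subseteq> Vm n \<and> finite S \<and> Vm n \<subseteq> rational_space.span (S \<union> decomposable n) \<and>
     (\<forall>s\<in>S. s \<notin> rational_space.span ((S - {s}) \<union> decomposable n)))"

lemma generators:
  "generators n \<subseteq> Vm n" "finite (generators n)"
  "Vm n \<subseteq> rational_space.span (generators n \<union> decomposable n)"
  "s \<in> generators n \<Longrightarrow> s \<notin> rational_space.span ((generators n - {s}) \<union> decomposable n)"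
  using someI_ex[OF ex_indecomposables[of n]] unfolding generators_def[symmetric] by blast+

definition generators_upto :: "nat \<Rightarrow> 'k ratfun shuffle_algebra set" where
  "generators_upto n = (\<Union>i\<in>{1..n}. generators i)"

lemma generators_upto_Suc: "generators_upto (Suc n) = generators_upto n \<union> generators (Suc n)"
  by (auto simp: generators_upto_def atLeastAtMostSuc_conv)

lemma generators_upto_mono: "m \<le> n \<Longrightarrow> generators_upto m \<subseteq> generators_upto n"
  by (fastforce simp: generators_upto_def)

lemma generators_upto_weight:
  assumes "s \<in> generators_upto n" shows "\<exists>i. 0 < i \<and> i \<le> n \<and> s \<in> Vm i"
proof -
  obtain i where "i \<in> {1..n}" "s \<in> generators i" using assms by (auto simp: generators_upto_def)
  then show ?thesis using generators(1)[of i] by (intro exI[of _ i]) auto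
qed

text \<open>Decomposable elements are combinations of products with factors of smaller weight, so
  induction on the weight reaches them from the generators.\<close>

lemma Vm_subset_monomial_span: "Vm n \<subseteq> monomial_span (generators_upto n)"
proof (induction n rule: less_induct)
  case (less n)
  show ?case
  proof (cases n)
    case 0
    then show ?thesis using Vm_0 monomial_span_scalar by fastforce
  next
    case (Suc m)
    let ?A = "monomial_span (generators_upto n)"
    have "generators n \<subseteq> ?A"
      using monomial_span_incl[of _ "generators_upto n"] by (auto simp: Suc generators_upto_Suc)
    moreover have "decomposable n \<subseteq> ?A"
      unfolding decomposable_def
    proof (rule rational_space.span_minimal[OF _ monomial_span_subspace], safe)
      fix x y i j assume ij: "n = i + j" "0 < i" "0 < j" and "x \<in> Vm i" "y \<in> Vm j"
      then have "x \<in> monomial_span (generators_upto i)" "y \<in> monomial_span (generators_upto j)"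
        using less.IH[of i] less.IH[of j] by auto
      moreover have "monomial_span (generators_upto k) \<subseteq> monomial_span (generators_upto (i + j))" if "k \<le> i + j" for k
        by (intro monomial_span_mono generators_upto_mono that)
      ultimately show "x * y \<in> monomial_span (generators_upto (i + j))"
        by (meson le_add1 le_add2 monomial_span_mult subsetD)
    qed
    ultimately have "rational_space.span (generators n \<union> decomposable n) \<subseteq> ?A"
      by (intro rational_space.span_minimal[OF _ monomial_span_subspace]) auto
    then show ?thesis using generators(3)[of n] by blast
  qed
qed

lemma monomial_span_V: "S \<subseteq> V \<Longrightarrow> monomial_span S \<subseteq> V"
proof -
  assume S: "S \<subseteq> V"
  have "prod_mset M \<in> V" if "set_mset M \<subseteq> S" for M
    using that S by (induction M) (auto intro: V_1 V_mult)
  then show ?thesis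
    unfolding monomial_span_def by (intro rational_space.span_minimal[OF _ subspace_V]) auto
qed

lemma generators_upto_V: "generators_upto n \<subseteq> V"
  using generators(1) Vm_V by (fastforce simp: generators_upto_def)

lemma prod_mset_Vm:
  assumes "set_mset M \<subseteq> generators_upto n" "M \<noteq> {#}"
  shows "\<exists>j>0. prod_mset M \<in> Vm j"
  using assms
proof (induction M)
  case (add x M)
  then obtain i where i: "0 < i" "x \<in> Vm i" using generators_upto_weight[of x n] by auto
  show ?case
  proof (cases "M = {#}")
    case True
    then show ?thesis using i by auto
  next
    case False
    then obtain j where "0 < j" "prod_mset M \<in> Vm j" using add by auto
    then have "prod_mset (add_mset x M) \<in> Vm (i + j)" using Vm_mult[OF i(2)] by simp
    then show ?thesis using i(1) by (intro exI[of _ "i + j"]) simp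
  qed
qed simp

text \<open>In weight \<open>n + 1\<close>, the algebra generated by \<open>G\<close> and the generators of smaller weight is
  spanned by \<open>G\<close> modulo decomposable elements.\<close>

lemma homogeneous_part_monomial_span:
  assumes G: "G \<subseteq> generators (Suc n)" and x: "x \<in> monomial_span (generators_upto n \<union> G)"
  shows "homogeneous_part (Suc n) x \<in> rational_space.span (G \<union> decomposable (Suc n))"
proof -
  let ?T = "rational_space.span (G \<union> decomposable (Suc n))"
  have T: "rational_space.subspace ?T" by (rule rational_space.subspace_span)
  have sub: "generators_upto n \<union> G \<subseteq> generators_upto (Suc n)"
    using G by (auto simp: generators_upto_Suc)
  have M: "homogeneous_part (Suc n) (prod_mset M) \<in> ?T" if M: "set_mset M \<subseteq> generators_upto n \<union> G" for M
  proof (cases M)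
    case empty
    have "homogeneous_part (Suc n) (1 :: 'k ratfun shuffle_algebra) = 0"
      by (rule shuffle_algebra_eqI) (simp add: coeff_1)
    then show ?thesis using empty rational_space.subspace_0[OF T] by simp
  next
    case (add y M')
    then have y: "y \<in> generators_upto n \<union> G" "set_mset M' \<subseteq> generators_upto (Suc n)" using M sub by auto
    show ?thesis
    proof (cases "M' = {#}")
      case True
      show ?thesis
      proof (cases "y \<in> G")
        case yG: True
        then have "y \<in> Vm (Suc n)" using G generators(1) by blast
        then have "homogeneous_part (Suc n) (prod_mset M) = y" using Vm_homogeneous_part add True by simp
        then show ?thesis using yG by (simp add: rational_space.span_base)
      next
        case False
        then obtain i where "i \<le> n" "y \<in> Vm i" using y generators_upto_weight[of y n] by blast
        then have "homogeneous_part (Suc n) (prod_mset M) = 0" using Vm_homogeneous_part add True by simp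
        then show ?thesis using rational_space.subspace_0[OF T] by simp
      qed
    next
      case False
      obtain j where j: "0 < j" "prod_mset M' \<in> Vm j" using prod_mset_Vm[OF y(2) False] by blast
      obtain i where i: "0 < i" "y \<in> Vm i" using generators_upto_weight[of y "Suc n"] y(1) sub by blast
      have p: "prod_mset M \<in> Vm (i + j)" using Vm_mult[OF i(2) j(2)] add by simp
      show ?thesis
      proof (cases "i + j = Suc n")
        case True
        then have "homogeneous_part (Suc n) (prod_mset M) = prod_mset M" using Vm_homogeneous_part[OF p] by simp
        moreover have "prod_mset M \<in> decomposable (Suc n)"
          unfolding decomposable_def using i j True add by (intro rational_space.span_base) auto
        ultimately show ?thesis by (simp add: rational_space.span_base)
      next
        case False
        then have "homogeneous_part (Suc n) (prod_mset M) = 0" using Vm_homogeneous_part[OF p] by simp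
        then show ?thesis using rational_space.subspace_0[OF T] by simp
      qed
    qed
  qed
  show ?thesis
    using x unfolding monomial_span_def
  proof (induction rule: rational_space.span_induct_alt)
    case base
    then show ?case by (simp add: rational_space.span_zero)
  next
    case (step c y z)
    then have "homogeneous_part (Suc n) y \<in> ?T" using M by blast
    then show ?case
      using step by (simp add: homogeneous_part_add homogeneous_part_scalar_mult rational_space.span_add rational_space.span_scale)
  qed
qed

text \<open>Generators are adjoined one at a time, by weight. Deleting a letter lowers the weight,
  so it sends a new generator into the algebra already built. The generator itself lies outside:
  otherwise its homogeneous part would make it dependent on the other generators modulo
  decomposables.\<close>

lemma independent_monomials_generators_upto: "independent_monomials (generators_upto n)"
proof (induction n)
  case 0
  have "independent_monomials ({} :: 'k ratfun shuffle_algebra set)"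
    unfolding independent_monomials_def
  proof (intro allI impI ballI)
    fix \<M> :: "'k ratfun shuffle_algebra multiset set" and c M
    assume "finite \<M>" "\<forall>M\<in>\<M>. set_mset M \<subseteq> {}" and M: "M \<in> \<M>"
      and rel: "(\<Sum>M\<in>\<M>. scalar (rat_const (c M)) * prod_mset M) = 0"
    then have "\<M> = {{#}}" "M = {#}" by auto
    then have "scalar (rat_const (c M)) = scalar 0" using rel by simp
    then show "c M = 0" unfolding scalar_eq_iff by simp
  qed
  then show ?case by (simp add: generators_upto_def)
next
  case (Suc n)
  have "independent_monomials (generators_upto n \<union> G)" if "finite G" "G \<subseteq> generators (Suc n)" for G
    using that
  proof (induction G rule: finite_induct)
    case empty
    then show ?case using Suc.IH by simp
  next
    case (insert s G)
    let ?X = "generators_upto n \<union> G"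
    have X_V: "?X \<subseteq> V" using generators_upto_V[of n] generators(1)[of "Suc n"] insert.prems Vm_V by blast
    have s: "s \<in> generators (Suc n)" "s \<in> Vm (Suc n)" using insert.prems generators(1) by auto
    have del: "delete b x \<in> monomial_span ?X" if "x \<in> Vm i" "i \<le> Suc n" for b x i
    proof (cases i)
      case 0
      then show ?thesis using delete_Vm_0 that rational_space.subspace_0[OF monomial_span_subspace] by simp
    next
      case (Suc m)
      then have "delete b x \<in> monomial_span (generators_upto m)"
        using Vm_delete that Vm_subset_monomial_span by blast
      moreover have "generators_upto m \<subseteq> ?X" using generators_upto_mono[of m n] Suc that by auto
      ultimately show ?thesis using monomial_span_mono by blast
    qed
    have "independent_monomials (insert s ?X)"
    proof (rule independent_monomials_insert)
      show "independent_monomials ?X" using insert by simp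
      show "s \<notin> monomial_span ?X"
      proof
        assume "s \<in> monomial_span ?X"
        then have "homogeneous_part (Suc n) s \<in> rational_space.span (G \<union> decomposable (Suc n))"
          using insert.prems by (intro homogeneous_part_monomial_span) auto
        also have "homogeneous_part (Suc n) s = s" using Vm_homogeneous_part[OF s(2)] by simp
        also have "rational_space.span (G \<union> decomposable (Suc n)) \<subseteq>
            rational_space.span ((generators (Suc n) - {s}) \<union> decomposable (Suc n))"
          using insert by (intro rational_space.span_mono) auto
        finally show False using generators(4)[OF s(1)] by simp
      qed
      show "coeff x w \<in> Set.range rat_const" if "x \<in> monomial_span ?X" for x w
        using monomial_span_V[OF X_V] that V_rational by blast
      show "coeff s w \<in> Set.range rat_const" for w using V_rational[OF Vm_V[OF s(2)]] .
      show "delete b s \<in> monomial_span ?X" for b by (rule del[OF s(2)]) simp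
      show "delete b x \<in> monomial_span ?X" if "x \<in> ?X" for x b
      proof -
        have "x \<in> generators_upto (Suc n)" using that insert.prems by (auto simp: generators_upto_Suc)
        then show ?thesis using del generators_upto_weight by blast
      qed
    qed
    then show ?case by simp
  qed
  from this[OF generators(2)[of "Suc n"] subset_refl] show ?case by (simp add: generators_upto_Suc)
qed

definition all_generators :: "'k ratfun shuffle_algebra set" where
  "all_generators = (\<Union>n. generators_upto n)"

lemma all_generators_V: "all_generators \<subseteq> V"
  using generators_upto_V by (auto simp: all_generators_def)

lemma finite_subset_generators_upto:
  "finite S \<Longrightarrow> S \<subseteq> all_generators \<Longrightarrow> \<exists>n. S \<subseteq> generators_upto n"
proof (induction S rule: finite_induct)
  case (insert s S)
  then obtain m n where "s \<in> generators_upto m" "S \<subseteq> generators_upto n" by (auto simp: all_generators_def)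
  then have "insert s S \<subseteq> generators_upto (max m n)"
    using generators_upto_mono[of m "max m n"] generators_upto_mono[of n "max m n"] by auto
  then show ?case ..
qed simp

lemma independent_monomials_all: "independent_monomials all_generators"
  unfolding independent_monomials_def
proof (intro allI impI)
  fix \<M> :: "'k ratfun shuffle_algebra multiset set" and c
  assume \<M>: "finite \<M>" "\<forall>M\<in>\<M>. set_mset M \<subseteq> all_generators"
    and rel: "(\<Sum>M\<in>\<M>. scalar (rat_const (c M)) * prod_mset M) = 0"
  have "finite (\<Union>M\<in>\<M>. set_mset M)" "(\<Union>M\<in>\<M>. set_mset M) \<subseteq> all_generators" using \<M> by auto
  then obtain n where "(\<Union>M\<in>\<M>. set_mset M) \<subseteq> generators_upto n" using finite_subset_generators_upto by blast
  then have "\<forall>M\<in>\<M>. set_mset M \<subseteq> generators_upto n" by blast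
  then show "\<forall>M\<in>\<M>. c M = 0"
    using independent_monomials_generators_upto[of n] \<M>(1) rel unfolding independent_monomials_def by blast
qed

text \<open>Passage from \<open>k\<close> to the rational functions: distinct monomials are distinct
  vectors with coefficients in \<open>k\<close>, and for such vectors linear independence over
  \<open>k\<close> persists.\<close>

theorem monomials_independent:
  assumes \<M>: "finite \<M>" "\<forall>M\<in>\<M>. set_mset M \<subseteq> all_generators"
    and rel: "(\<Sum>M\<in>\<M>. scalar (\<phi> M) * prod_mset M) = 0" and M: "M \<in> \<M>"
  shows "\<phi> M = 0"
proof -
  have ind: "\<forall>M\<in>\<N>. c M = 0"
    if "\<N> \<subseteq> \<M>" "(\<Sum>M\<in>\<N>. scalar (rat_const (c M)) * prod_mset M) = 0" for \<N> c
    using independent_monomials_all that \<M> finite_subset[OF that(1)] unfolding independent_monomials_def by blast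
  have inj: "inj_on prod_mset \<M>"
  proof (rule inj_onI, rule ccontr)
    fix P Q assume PQ: "P \<in> \<M>" "Q \<in> \<M>" "prod_mset P = prod_mset Q" "P \<noteq> Q"
    have "(\<Sum>M\<in>{P, Q}. scalar (rat_const (if M = P then 1 else - 1)) * prod_mset M) = 0"
      using PQ(3,4) by (simp add: rat_const_uminus scalar_uminus)
    from ind[OF _ this] PQ show False by simp
  qed
  have "rational_space.independent (prod_mset ` \<M>)"
    unfolding rational_space.dependent_finite[OF finite_imageI[OF \<M>(1)]]
  proof
    assume "\<exists>u. (\<exists>v\<in>prod_mset ` \<M>. u v \<noteq> 0) \<and> (\<Sum>v\<in>prod_mset ` \<M>. scalar (rat_const (u v)) * v) = 0"
    then obtain u where u: "\<exists>v\<in>prod_mset ` \<M>. u v \<noteq> 0" "(\<Sum>v\<in>prod_mset ` \<M>. scalar (rat_const (u v)) * v) = 0"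
      by blast
    from u(2) have "(\<Sum>M\<in>\<M>. scalar (rat_const (u (prod_mset M))) * prod_mset M) = 0"
      by (subst (asm) sum.reindex[OF inj]) simp
    from ind[OF subset_refl this] u(1) show False by auto
  qed
  moreover have "coeff v w \<in> Set.range rat_const" if v: "v \<in> prod_mset ` \<M>" for v w
  proof -
    obtain P where "v = prod_mset P" "P \<in> \<M>" using v by blast
    then have "v \<in> V" using monomial_span_V[OF all_generators_V] monomial_span_prod_mset[of P all_generators] \<M>(2) by blast
    then show ?thesis by (rule V_rational)
  qed
  moreover have "(\<Sum>v\<in>prod_mset ` \<M>. scalar (\<phi> (the_inv_into \<M> prod_mset v)) * v) = 0"
    using rel by (subst sum.reindex[OF inj]) (simp add: the_inv_into_f_f[OF inj])
  ultimately have "\<phi> (the_inv_into \<M> prod_mset (prod_mset M)) = 0"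
    using independent_over_ratfun[OF finite_imageI[OF \<M>(1)], where \<phi> = "\<lambda>v. \<phi> (the_inv_into \<M> prod_mset v)"] M by blast
  then show ?thesis using the_inv_into_f_f[OF inj M] by simp
qed

lemma V_subset_monomial_span: "V \<subseteq> monomial_span all_generators"
proof
  fix x assume x: "x \<in> V"
  obtain n where n: "\<forall>w. coeff x w \<noteq> 0 \<longrightarrow> length w < n" using word_length_bound by blast
  have "homogeneous_part m x \<in> monomial_span all_generators" for m
  proof -
    have "homogeneous_part m x \<in> monomial_span (generators_upto m)"
      using homogeneous_part_Vm[OF x] Vm_subset_monomial_span by blast
    then show ?thesis using monomial_span_mono[of "generators_upto m" all_generators] by (auto simp: all_generators_def)
  qed
  then have "(\<Sum>m<n. homogeneous_part m x) \<in> monomial_span all_generators"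
    by (intro rational_space.subspace_sum[OF monomial_span_subspace])
  then show "x \<in> monomial_span all_generators" using sum_homogeneous_parts[of x n] n by simp
qed

end

section \<open>Comparison with the bar construction on words\<close>

lemma degree_one_affine: "degree_one l p \<Longrightarrow> affine l p"
  by (auto simp: degree_one_def affine_def)

lemma degree_one_not_Const: "degree_one l p \<Longrightarrow> p \<noteq> Const c"
proof
  assume "degree_one l p" and c: "p = Const c"
  then obtain b a j where j: "j < l" "a j \<noteq> 0" and p: "p = Const b + (\<Sum>j<l. Const (a j) * Var j)"
    by (auto simp: degree_one_def)
  have "mpoly_deriv j p = Const (a j)"
    unfolding p using j by (simp add: mpoly_deriv_add mpoly_deriv_sum mpoly_deriv_mult mpoly_deriv_Var
        if_distrib[of "(*) _"] sum.delta cong: if_cong)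
  with j c show False by simp
qed

lemma mpoly_eval_Const_mult: "t \<noteq> 0 \<Longrightarrow> mpoly_eval (Const t * p) x = t * mpoly_eval p x"
proof -
  assume t: "t \<noteq> 0"
  then have "keys (Const t * p) = keys p" by (auto simp: in_keys_iff lookup_Const_mult)
  then show ?thesis by (simp add: mpoly_eval_def lookup_Const_mult sum_distrib_left mult.assoc)
qed

text \<open>Proportional equations with a nonzero factor have the same zero set, and the factor 0 is
  excluded by degree one.\<close>

lemma hyperplane_arrangement_nonproportional:
  assumes "hyperplane_arrangement l N \<alpha>" shows "nonproportional l N \<alpha>"
  unfolding nonproportional_def
proof (intro conjI allI impI)
  have d1: "degree_one l (\<alpha> i)" if "i < N" for i using assms that by (simp add: hyperplane_arrangement_def)
  show "affine l (\<alpha> i)" if "i < N" for i using degree_one_affine[OF d1[OF that]] .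
  show "\<alpha> i \<noteq> Const c" if "i < N" for i c using degree_one_not_Const[OF d1[OF that]] .
  fix i j t assume ij: "i < N" "j < N" and eq: "\<alpha> i = Const t * \<alpha> j"
  have "t \<noteq> 0" using degree_one_not_Const[OF d1[OF ij(1)], of 0] eq by auto
  then have "hyperplane l (\<alpha> i) = hyperplane l (\<alpha> j)"
    unfolding eq hyperplane_def by (simp add: mpoly_eval_Const_mult)
  then show "i = j" using assms ij by (auto simp: hyperplane_arrangement_def inj_on_def)
qed

lemma sums_of_image2:
  "{\<Sum>a<n. h (f a) (v a) | (n::nat) f v. \<forall>a<n. f a \<in> F \<and> v a \<in> G} = sums_of {h f v | f v. f \<in> F \<and> v \<in> G}"
proof (intro equalityI subsetI)
  fix x assume "x \<in> {\<Sum>a<n. h (f a) (v a) | (n::nat) f v. \<forall>a<n. f a \<in> F \<and> v a \<in> G}"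
  then obtain n f v where "x = (\<Sum>a<(n::nat). h (f a) (v a))" "\<forall>a<n. f a \<in> F \<and> v a \<in> G" by blast
  then show "x \<in> sums_of {h f v | f v. f \<in> F \<and> v \<in> G}"
    unfolding sums_of_def by (intro CollectI exI[of _ n] exI[of _ "\<lambda>a. h (f a) (v a)"]) auto
next
  fix x assume "x \<in> sums_of {h f v | f v. f \<in> F \<and> v \<in> G}"
  then obtain n g where x: "x = (\<Sum>a<(n::nat). g a)" and g: "\<forall>a<n. g a \<in> {h f v | f v. f \<in> F \<and> v \<in> G}"
    unfolding sums_of_def by blast
  from g have "\<forall>a. \<exists>p. a < n \<longrightarrow> g a = h (fst p) (snd p) \<and> fst p \<in> F \<and> snd p \<in> G" by fastforce
  from choice[OF this] obtain p where p: "\<forall>a. a < n \<longrightarrow> g a = h (fst (p a)) (snd (p a)) \<and> fst (p a) \<in> F \<and> snd (p a) \<in> G"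
    by blast
  then have "x = (\<Sum>a<n. h (fst (p a)) (snd (p a)))" unfolding x by (intro sum.cong) auto
  then show "x \<in> {\<Sum>a<n. h (f a) (v a) | (n::nat) f v. \<forall>a<n. f a \<in> F \<and> v a \<in> G}"
    using p by (intro CollectI exI[of _ n] exI[of _ "\<lambda>a. fst (p a)"] exI[of _ "\<lambda>a. snd (p a)"]) auto
qed

lemma sums_of_hom_image:
  assumes "h 0 = 0" "\<And>x y. h (x + y) = h x + h y" shows "h ` sums_of G = sums_of (h ` G)"
proof (intro equalityI subsetI)
  fix y assume "y \<in> h ` sums_of G"
  then obtain x where "x \<in> sums_of G" "y = h x" by blast
  then show "y \<in> sums_of (h ` G)"
    by (induction arbitrary: y rule: sums_of_induct) (auto simp: assms sums_of_0 intro: sums_of_add_generator)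
next
  fix y assume "y \<in> sums_of (h ` G)"
  then show "y \<in> h ` sums_of G"
  proof (induction rule: sums_of_induct)
    case zero
    show ?case using sums_of_0 assms(1) by (metis image_eqI)
  next
    case (add x y)
    then obtain u v where "x = h u" "u \<in> sums_of G" "y = h v" "v \<in> G" by blast
    then show ?case using sums_of_add_generator[of u G v] assms(2) by (intro image_eqI[of _ _ "u + v"]) auto
  qed
qed

lemma sums_of_sum: "(\<And>i. i \<in> A \<Longrightarrow> f i \<in> sums_of G) \<Longrightarrow> sum f A \<in> sums_of G"
  by (induction A rule: infinite_finite_induct) (auto intro: sums_of_0 sums_of_add)

text \<open>Extension of scalars from \<open>k\<close> to the rational functions; it identifies
  \<open>bar_words\<close> with \<open>V\<close>.\<close>

definition rational_words :: "(word \<Rightarrow>\<^sub>0 'k::field_char_0) \<Rightarrow> 'k ratfun shuffle_algebra" where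
  "rational_words c = of_words (Poly_Mapping.map rat_const c)"

lemma coeff_rational_words [simp]: "coeff (rational_words c) w = rat_const (lookup c w)"
  by (simp add: rational_words_def coeff.rep_eq of_words_inverse lookup_map)

lemma rational_words_add: "rational_words (c + d) = rational_words c + rational_words d"
  by (rule shuffle_algebra_eqI) (simp add: lookup_add rat_const_add)

lemma rational_words_0 [simp]: "rational_words 0 = 0"
  by (rule shuffle_algebra_eqI) simp

lemma rational_words_sum: "rational_words (sum f A) = (\<Sum>a\<in>A. rational_words (f a))"
  by (induction A rule: infinite_finite_induct) (simp_all add: rational_words_add)

lemma ex_rational_words:
  assumes "\<And>w. coeff x w \<in> Set.range (rat_const :: 'k::field_char_0 \<Rightarrow> _)"
  shows "\<exists>c. x = rational_words c"
proof -
  have 0: "inv_into UNIV rat_const 0 = (0::'k)"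
    using inv_into_f_f[of rat_const UNIV "0::'k"] by (simp add: inj_on_def)
  have "x = rational_words (Poly_Mapping.map (inv_into UNIV rat_const) (words_of x))"
    using assms by (intro shuffle_algebra_eqI) (simp add: lookup_map 0 f_inv_into_f flip: coeff.rep_eq)
  then show ?thesis by blast
qed

lemma words_of_add: "words_of (x + y) = words_of x + words_of y"
  by (rule plus_shuffle_algebra.rep_eq)

lemma words_of_0 [simp]: "words_of 0 = 0"
  by (rule zero_shuffle_algebra.rep_eq)

lemma dlog_wedge_antisym: "dlog_wedge j i p q = - dlog_wedge i j p q"
  by (simp add: dlog_wedge_def mult.commute)

lemma dlog_wedge_same [simp]: "dlog_wedge i i p q = 0"
  by (simp add: dlog_wedge_def)

definition one_forms :: "nat \<Rightarrow> (nat \<Rightarrow> 'k::field_char_0 ratfun shuffle_algebra) \<Rightarrow> (word \<Rightarrow>\<^sub>0 'k form)" where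
  "one_forms l \<eta> = (\<Sum>j<l. Poly_Mapping.map (single {j}) (words_of (\<eta> j)))"

lemma lookup_one_forms: "lookup (one_forms l \<eta>) w = one_form l (\<lambda>j. coeff (\<eta> j) w)"
  by (simp add: one_forms_def one_form_def lookup_sum lookup_map coeff.rep_eq)

lemma one_forms_add: "one_forms l \<eta> + one_forms l \<theta> = one_forms l (\<lambda>j. \<eta> j + \<theta> j)"
  by (intro poly_mapping_eqI) (simp add: lookup_add lookup_one_forms one_form_add)

lemma one_forms_0: "one_forms l (\<lambda>_. 0) = 0"
  by (intro poly_mapping_eqI) (simp add: lookup_one_forms one_form_def)

lemma one_forms_cong: "(\<And>j. j < l \<Longrightarrow> \<eta> j = \<theta> j) \<Longrightarrow> one_forms l \<eta> = one_forms l \<theta>"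
  by (simp add: one_forms_def)

context bar_construction
begin

lemma lookup_wedge_at:
  assumes c: "\<And>I. I \<in> keys c \<Longrightarrow> length I = m \<and> set I \<subseteq> {..<N}" and j: "j + 1 < m"
  shows "lookup (wedge_at l \<alpha> j c) (u, w) = two_form l (\<lambda>p q.
    if length u = j then \<Sum>a<N. \<Sum>b<N. dlog_wedge p q (\<alpha> a) (\<alpha> b) * rat_const (lookup c (u @ a # b # w)) else 0)"
proof -
  let ?W = "\<lambda>I. form_scale (rat_const (lookup c I)) (dlog l (\<alpha> (I ! j)) \<and>\<^sub>f dlog l (\<alpha> (I ! (j + 1))))"
  let ?K = "{I \<in> keys c. take j I = u \<and> drop (j + 2) I = w}"
  have "lookup (wedge_at l \<alpha> j c) (u, w) = (\<Sum>I\<in>?K. ?W I)"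
    unfolding wedge_at_def lookup_sum lookup_single when_def
    by (rule sum.mono_neutral_cong_right) auto
  also have "\<dots> = two_form l (\<lambda>p q. if length u = j then
      \<Sum>a<N. \<Sum>b<N. dlog_wedge p q (\<alpha> a) (\<alpha> b) * rat_const (lookup c (u @ a # b # w)) else 0)"
  proof (cases "length u = j")
    case False
    then have "?K = {}" using c j by auto
    then show ?thesis using False by (simp only: sum.empty if_False two_form_eq_0_iff[THEN iffD2] simp_thms)
  next
    case True
    let ?f = "\<lambda>(a, b). u @ a # b # w"
    have inj: "inj_on ?f ({..<N} \<times> {..<N})" by (auto simp: inj_on_def)
    have K: "?K \<subseteq> ?f ` ({..<N} \<times> {..<N})"
    proof
      fix I assume I: "I \<in> ?K"
      then have len: "length I = m" "set I \<subseteq> {..<N}" using c by auto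
      have "I = take j I @ I ! j # I ! (j + 1) # drop (j + 2) I"
        using len(1) j by (metis Cons_nth_drop_Suc Suc_eq_plus1 Suc_lessD add_2_eq_Suc' append_take_drop_id)
      moreover have "I ! j \<in> {..<N}" "I ! (j + 1) \<in> {..<N}" using len j by (auto simp: subset_iff)
      ultimately show "I \<in> ?f ` ({..<N} \<times> {..<N})" using I by (intro image_eqI[of _ _ "(I ! j, I ! (j + 1))"]) auto
    qed
    have "(\<Sum>I\<in>?K. ?W I) = (\<Sum>I\<in>?f ` ({..<N} \<times> {..<N}). ?W I)"
      using K True by (intro sum.mono_neutral_left) (auto simp: in_keys_iff)
    also have "\<dots> = (\<Sum>(a, b)\<in>{..<N} \<times> {..<N}. ?W (u @ a # b # w))"
      by (subst sum.reindex[OF inj]) (simp add: case_prod_unfold)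
    also have "\<dots> = (\<Sum>a<N. \<Sum>b<N. ?W (u @ a # b # w))"
      by (simp add: sum.cartesian_product)
    also have "\<dots> = (\<Sum>a<N. \<Sum>b<N. two_form l (\<lambda>p q. dlog_wedge p q (\<alpha> a) (\<alpha> b) * rat_const (lookup c (u @ a # b # w))))"
      using True by (intro sum.cong refl) (simp add: wedge_dlog form_scale_two_form nth_append mult.commute)
    finally show ?thesis using True by (simp add: two_form_sum)
  qed
  finally show ?thesis .
qed

text \<open>The condition at position \<open>j\<close> corresponds to prefixes of length
  \<open>j\<close>. A two-form records only components with increasing indices; the others follow by
  antisymmetry.\<close>

lemma integrable_words_iff: "c \<in> integrable_words l N \<alpha> m \<longleftrightarrow> rational_words c \<in> Vm m"
proof -
  have keys: "(\<forall>I\<in>keys c. length I = m \<and> set I \<subseteq> {..<N}) \<longleftrightarrow>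
      in_letters (rational_words c) \<and> (\<forall>w. coeff (rational_words c) w \<noteq> 0 \<longrightarrow> length w = m)"
    by (auto simp: in_letters_def in_keys_iff)
  let ?S = "\<lambda>p q u w. \<Sum>a<N. \<Sum>b<N. dlog_wedge p q (\<alpha> a) (\<alpha> b) * rat_const (lookup c (u @ a # b # w))"
  have "(\<forall>j. j + 1 < m \<longrightarrow> wedge_at l \<alpha> j c = 0) \<longleftrightarrow> (\<forall>u w. \<forall>p<l. \<forall>q<l. ?S p q u w = 0)"
    if c: "\<forall>I\<in>keys c. length I = m \<and> set I \<subseteq> {..<N}"
  proof (intro iffI allI impI)
    fix u w p q assume *: "\<forall>j. j + 1 < m \<longrightarrow> wedge_at l \<alpha> j c = 0" and pq: "p < l" "q < l"
    show "?S p q u w = 0"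
    proof (cases "length u + length w + 2 = m")
      case True
      then have j: "length u + 1 < m" by simp
      have "lookup (wedge_at l \<alpha> (length u) c) (u, w) = 0" using * j by simp
      moreover have "lookup (wedge_at l \<alpha> (length u) c) (u, w) =
          two_form l (\<lambda>p q. if length u = length u then ?S p q u w else 0)"
        by (rule lookup_wedge_at[OF c[rule_format] j])
      ultimately have "two_form l (\<lambda>p q. ?S p q u w) = 0" by simp
      then have S0: "?S p q u w = 0" if "p < l" "q < l" "p < q" for p q
        using that unfolding two_form_eq_0_iff by simp
      consider "p < q" | "q < p" | "p = q" by linarith
      then show ?thesis
      proof cases
        case 2
        have "?S p q u w = - ?S q p u w"
          unfolding sum_negf[symmetric]
          by (intro sum.cong refl) (simp only: dlog_wedge_antisym[of p q] mult_minus_left)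
        then show ?thesis using S0[OF pq(2,1) 2] by simp
      qed (use S0[OF pq] in auto)
    next
      case False
      then have "lookup c (u @ a # b # w) = 0" for a b
        using c[rule_format, of "u @ a # b # w"] by (auto simp: in_keys_iff)
      then show ?thesis by simp
    qed
  next
    fix j assume *: "\<forall>u w. \<forall>p<l. \<forall>q<l. ?S p q u w = 0" and j: "j + 1 < m"
    show "wedge_at l \<alpha> j c = 0"
    proof (rule poly_mapping_eqI)
      fix x show "lookup (wedge_at l \<alpha> j c) x = lookup 0 x"
        using * by (cases x) (simp add: lookup_wedge_at[OF c[rule_format] j] two_form_eq_0_iff)
    qed
  qed
  with keys show ?thesis
    unfolding integrable_words_def Vm_def V_iff by auto
qed

lemma rational_words_bar_words: "rational_words ` bar_words l N \<alpha> = V"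
proof (intro equalityI subsetI)
  fix x assume "x \<in> rational_words ` bar_words l N \<alpha>"
  then obtain n v where "x = rational_words (\<Sum>m<(n::nat). v m)" "\<forall>m<n. v m \<in> integrable_words l N \<alpha> m"
    unfolding bar_words_def by blast
  then show "x \<in> V"
    unfolding rational_words_sum integrable_words_iff using Vm_V by (auto intro: V_sum)
next
  fix x assume x: "x \<in> V"
  have "\<forall>m. \<exists>c. homogeneous_part m x = rational_words c"
    using ex_rational_words[OF V_rational[OF V_homogeneous_part[OF x]]] by blast
  from choice[OF this] obtain c where c: "\<And>m. homogeneous_part m x = rational_words (c m)" by blast
  have int: "c m \<in> integrable_words l N \<alpha> m" for m
    unfolding integrable_words_iff c[symmetric] by (rule homogeneous_part_Vm[OF x])
  obtain n where "\<forall>w. coeff x w \<noteq> 0 \<longrightarrow> length w < n" using word_length_bound by blast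
  then have "x = rational_words (\<Sum>m<n. c m)"
    unfolding rational_words_sum c[symmetric] by (intro sum_homogeneous_parts) auto
  moreover have "(\<Sum>m<n. c m) \<in> bar_words l N \<alpha>"
    unfolding bar_words_def using int by blast
  ultimately show "x \<in> rational_words ` bar_words l N \<alpha>" by blast
qed

lemma bar_carrier_eq: "bar_carrier l N \<alpha> = words_of ` B"
proof -
  have gen: "Poly_Mapping.map (\<lambda>c. rat_const c * f) v = words_of (scalar f * rational_words v)" for f and v :: "word \<Rightarrow>\<^sub>0 'k"
    by (intro poly_mapping_eqI) (simp add: lookup_map mult.commute[of "rat_const _"] flip: coeff.rep_eq)
  have "bar_carrier l N \<alpha> = sums_of {words_of (scalar f * rational_words v) | f v. f \<in> \<O> \<and> v \<in> bar_words l N \<alpha>}"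
    unfolding bar_carrier_def gen by (rule sums_of_image2)
  also have "{words_of (scalar f * rational_words v) | f v. f \<in> \<O> \<and> v \<in> bar_words l N \<alpha>} =
      words_of ` {scalar f * v | f v. f \<in> \<O> \<and> v \<in> V}"
    unfolding rational_words_bar_words[symmetric] by blast
  also have "sums_of \<dots> = words_of ` B"
    unfolding B_def by (intro sums_of_hom_image[symmetric]) (simp_all add: words_of_add)
  finally show ?thesis .
qed

text \<open>Taking coefficients of the \<open>dt_j\<close> commutes with tensoring, so a one-form
  with values in the bar construction is a family in \<open>B\<close>.\<close>

lemma bar_one_forms_eq: "bar_forms l N \<alpha> 1 = {one_forms l \<eta> | \<eta>. \<forall>j<l. \<eta> j \<in> B}"
proof -
  let ?G = "{Poly_Mapping.map (\<lambda>c. form_scale (rat_const c) \<phi>) v | \<phi> v. \<phi> \<in> forms l N \<alpha> 1 \<and> v \<in> bar_words l N \<alpha>}"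
  have bf: "bar_forms l N \<alpha> 1 = sums_of ?G"
    unfolding bar_forms_def by (rule sums_of_image2)
  show ?thesis
    unfolding bf
  proof (intro equalityI subsetI)
    fix y assume "y \<in> sums_of ?G"
    then show "y \<in> {one_forms l \<eta> | \<eta>. \<forall>j<l. \<eta> j \<in> B}"
    proof (induction rule: sums_of_induct)
      case zero
      show ?case using one_forms_0[of l, symmetric] B_0 by blast
    next
      case (add x y)
      obtain \<eta> where \<eta>: "x = one_forms l \<eta>" "\<forall>j<l. \<eta> j \<in> B" using add by blast
      obtain \<phi> v where y: "y = Poly_Mapping.map (\<lambda>c. form_scale (rat_const c) \<phi>) v"
        and \<phi>: "\<phi> \<in> forms l N \<alpha> 1" and v: "v \<in> bar_words l N \<alpha>" using add by blast
      have \<phi>_O: "lookup \<phi> {j} \<in> \<O>" for j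
        using \<phi> by (cases "{j} \<in> keys \<phi>") (auto simp: forms_def in_keys_iff)
      have \<phi>_eq: "\<phi> = one_form l (\<lambda>j. lookup \<phi> {j})"
        using \<phi> by (intro one_form_eqI) (auto simp: forms_def)
      define \<theta> where "\<theta> j = scalar (lookup \<phi> {j}) * rational_words v" for j
      have "y = one_forms l \<theta>"
      proof (rule poly_mapping_eqI)
        fix w
        have "lookup y w = form_scale (rat_const (lookup v w)) (one_form l (\<lambda>j. lookup \<phi> {j}))"
          unfolding y \<phi>_eq[symmetric] by (simp add: lookup_map)
        then show "lookup y w = lookup (one_forms l \<theta>) w"
          by (simp add: form_scale_one_form lookup_one_forms \<theta>_def mult.commute[of "rat_const _"])
      qed
      moreover have "\<theta> j \<in> B" for j
        unfolding \<theta>_def using v rational_words_bar_words \<phi>_O by (intro B_incl) auto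
      ultimately have "x + y = one_forms l (\<lambda>j. \<eta> j + \<theta> j)" "\<forall>j<l. \<eta> j + \<theta> j \<in> B"
        using \<eta> by (auto simp: one_forms_add intro: B_add)
      then show ?case by blast
    qed
  next
    fix y assume "y \<in> {one_forms l \<eta> | \<eta>. \<forall>j<l. \<eta> j \<in> B}"
    then obtain \<eta> where \<eta>: "y = one_forms l \<eta>" "\<forall>j<l. \<eta> j \<in> B" by blast
    have "Poly_Mapping.map (single {j}) (words_of x) \<in> sums_of ?G" if j: "j < l" and x: "x \<in> B" for j x
      using x
    proof (induction rule: B_induct)
      case zero
      have "Poly_Mapping.map (single {j}) (0 :: word \<Rightarrow>\<^sub>0 'k ratfun) = 0"
        by (intro poly_mapping_eqI) (simp add: lookup_map)
      then show ?case using sums_of_0 by simp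
    next
      case (add x f v)
      obtain c where c: "c \<in> bar_words l N \<alpha>" "v = rational_words c"
        using \<open>v \<in> V\<close> rational_words_bar_words by blast
      have "Poly_Mapping.map (single {j}) (words_of (x + scalar f * v)) =
          Poly_Mapping.map (single {j}) (words_of x) + Poly_Mapping.map (\<lambda>d. form_scale (rat_const d) (single {j} f)) c"
        by (intro poly_mapping_eqI)
           (simp add: lookup_map lookup_add words_of_add single_add c(2) form_scale_single mult.commute[of "rat_const _"] flip: coeff.rep_eq)
      moreover have "single {j} f \<in> forms l N \<alpha> 1" using j \<open>f \<in> \<O>\<close> by (auto simp: forms_def)
      ultimately show ?case using add c(1) by (auto intro!: sums_of_add_generator)
    qed
    then show "y \<in> sums_of ?G" unfolding \<eta>(1) one_forms_def using \<eta>(2) by (intro sums_of_sum) auto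
  qed
qed

lemma function_form_0 [simp]: "function_form 0 = 0"
  by (simp add: function_form_def)

lemma bar_zero_forms_eq: "bar_forms l N \<alpha> 0 = (\<lambda>x. Poly_Mapping.map function_form (words_of x)) ` B"
proof -
  let ?h = "\<lambda>x. Poly_Mapping.map function_form (words_of x) :: word \<Rightarrow>\<^sub>0 'k form"
  have "{Poly_Mapping.map (\<lambda>c. form_scale (rat_const c) \<phi>) v | \<phi> v. \<phi> \<in> forms l N \<alpha> 0 \<and> v \<in> bar_words l N \<alpha>} =
      ?h ` {scalar f * v | f v. f \<in> \<O> \<and> v \<in> V}"
  proof -
    have gen: "Poly_Mapping.map (\<lambda>c. form_scale (rat_const c) (function_form f)) v = ?h (scalar f * rational_words v)" for f v
      by (intro poly_mapping_eqI)
         (simp add: lookup_map function_form_def form_scale_single mult.commute[of "rat_const _"] flip: coeff.rep_eq)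
    have forms: "forms l N \<alpha> 0 = function_form ` \<O>"
    proof (intro equalityI subsetI)
      fix \<phi> assume \<phi>: "\<phi> \<in> forms l N \<alpha> 0"
      have "\<phi> = function_form (lookup \<phi> {})"
      proof (rule poly_mapping_eqI)
        fix S
        have "lookup \<phi> S = 0" if "S \<noteq> {}"
        proof -
          have "S \<notin> keys \<phi>"
          proof
            assume "S \<in> keys \<phi>"
            then have "S \<subseteq> {..<l}" "card S = 0" using \<phi> by (auto simp: forms_def)
            with that show False using finite_subset[of S "{..<l}"] by simp
          qed
          then show ?thesis by (simp add: in_keys_iff)
        qed
        then show "lookup \<phi> S = lookup (function_form (lookup \<phi> {})) S"
          by (auto simp: function_form_def lookup_single when_def)
      qed
      moreover have "lookup \<phi> {} \<in> \<O>" using \<phi> by (cases "{} \<in> keys \<phi>") (auto simp: forms_def in_keys_iff)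
      ultimately show "\<phi> \<in> function_form ` \<O>" by blast
    qed (auto simp: forms_def function_form_def split: if_splits)
    show ?thesis
    proof (intro equalityI subsetI)
      fix y assume "y \<in> {Poly_Mapping.map (\<lambda>c. form_scale (rat_const c) \<phi>) v | \<phi> v.
        \<phi> \<in> forms l N \<alpha> 0 \<and> v \<in> bar_words l N \<alpha>}"
      then obtain f v where f: "f \<in> \<O>" and v: "v \<in> bar_words l N \<alpha>"
        and y: "y = ?h (scalar f * rational_words v)"
        unfolding forms by (auto simp: gen)
      moreover have "rational_words v \<in> V" using v rational_words_bar_words by blast
      ultimately show "y \<in> ?h ` {scalar f * v | f v. f \<in> \<O> \<and> v \<in> V}" by blast
    next
      fix y assume "y \<in> ?h ` {scalar f * v | f v. f \<in> \<O> \<and> v \<in> V}"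
      then obtain f v where f: "f \<in> \<O>" and v: "v \<in> bar_words l N \<alpha>"
        and y: "y = ?h (scalar f * rational_words v)"
        unfolding rational_words_bar_words[symmetric] by blast
      have "y = Poly_Mapping.map (\<lambda>c. form_scale (rat_const c) (function_form f)) v"
        unfolding y gen ..
      then show "y \<in> {Poly_Mapping.map (\<lambda>c. form_scale (rat_const c) \<phi>) v | \<phi> v.
          \<phi> \<in> forms l N \<alpha> 0 \<and> v \<in> bar_words l N \<alpha>}"
        unfolding forms using f v by blast
    qed
  qed
  moreover have "bar_forms l N \<alpha> 0 = sums_of {Poly_Mapping.map (\<lambda>c. form_scale (rat_const c) \<phi>) v | \<phi> v.
      \<phi> \<in> forms l N \<alpha> 0 \<and> v \<in> bar_words l N \<alpha>}"
    unfolding bar_forms_def by (rule sums_of_image2)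
  ultimately have "bar_forms l N \<alpha> 0 = sums_of (?h ` {scalar f * v | f v. f \<in> \<O> \<and> v \<in> V})"
    by simp
  also have "\<dots> = ?h ` B"
    unfolding B_def
    by (rule sums_of_hom_image[symmetric])
       (intro poly_mapping_eqI, simp add: lookup_map words_of_add lookup_add function_form_def single_add)+
  finally show ?thesis .
qed

lemma bar_d_functions:
  assumes "in_letters x"
  shows "bar_d l \<alpha> 0 (Poly_Mapping.map function_form (words_of x)) = one_forms l (\<lambda>j. deriv j x)"
proof (rule poly_mapping_eqI)
  fix w
  let ?y = "Poly_Mapping.map function_form (words_of x)"
  have ly: "lookup ?y v = function_form (coeff x v)" for v by (simp add: lookup_map coeff.rep_eq)
  have "a \<in> {..<N}" if "lookup ?y (a # w) \<noteq> 0" for a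
  proof -
    have "coeff x (a # w) \<noteq> 0" using that by (auto simp: ly)
    with assms(1) have "set (a # w) \<subseteq> {..<N}" unfolding in_letters_def by blast
    then show ?thesis by simp
  qed
  then have "lookup (bar_d l \<alpha> 0 ?y) w = ext_d l (function_form (coeff x w)) +
      (\<Sum>a<N. form_scale ((- 1) ^ 0) (function_form (coeff x (a # w)) \<and>\<^sub>f dlog l (\<alpha> a)))"
    by (subst lookup_bar_d[of "{..<N}"]) (auto simp: ly)
  also have "\<dots> = one_form l (\<lambda>j. coeff (deriv j x) w)"
    by (simp add: ext_d_function_form function_form_wedge dlog_eq_one_form form_scale_one_form
        one_form_sum one_form_add coeff_deriv_eq mult.commute)
  finally show "lookup (bar_d l \<alpha> 0 ?y) w = lookup (one_forms l (\<lambda>j. deriv j x)) w"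
    by (simp add: lookup_one_forms)
qed

lemma bar_deriv_eq:
  assumes "in_letters x" "i < l" shows "bar_deriv l \<alpha> i (words_of x) = words_of (deriv i x)"
  unfolding bar_deriv_def bar_d_functions[OF assms(1)]
  by (intro poly_mapping_eqI) (simp add: lookup_map lookup_one_forms lookup_one_form assms(2) flip: coeff.rep_eq)

text \<open>In degree 1 the sign of the deletion terms compensates for the logarithmic form standing
  on the right of the wedge product, so the components of the differential are curls with respect to
  \<open>deriv\<close>.\<close>

lemma bar_d_one_forms_eq_0_iff:
  assumes "\<And>j. j < l \<Longrightarrow> in_letters (\<eta> j)"
  shows "bar_d l \<alpha> 1 (one_forms l \<eta>) = 0 \<longleftrightarrow> (\<forall>i<l. \<forall>j<l. deriv i (\<eta> j) = deriv j (\<eta> i))"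
proof -
  have l: "lookup (bar_d l \<alpha> 1 (one_forms l \<eta>)) w = two_form l (\<lambda>i j. coeff (deriv i (\<eta> j) - deriv j (\<eta> i)) w)" for w
  proof -
    have "a \<in> {..<N}" if nz: "lookup (one_forms l \<eta>) (a # w) \<noteq> 0" for a
    proof -
      have "\<exists>j<l. coeff (\<eta> j) (a # w) \<noteq> 0"
      proof (rule ccontr)
        assume "\<not> (\<exists>j<l. coeff (\<eta> j) (a # w) \<noteq> 0)"
        then have "one_form l (\<lambda>j. coeff (\<eta> j) (a # w)) = 0" by (simp add: one_form_def)
        with nz show False by (simp add: lookup_one_forms)
      qed
      then obtain j where "j < l" "coeff (\<eta> j) (a # w) \<noteq> 0" by blast
      with assms[of j] have "set (a # w) \<subseteq> {..<N}" unfolding in_letters_def by blast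
      then show ?thesis by simp
    qed
    then have "lookup (bar_d l \<alpha> 1 (one_forms l \<eta>)) w = ext_d l (one_form l (\<lambda>j. coeff (\<eta> j) w)) +
        (\<Sum>a<N. form_scale ((- 1) ^ 1) (one_form l (\<lambda>j. coeff (\<eta> j) (a # w)) \<and>\<^sub>f dlog l (\<alpha> a)))"
      by (subst lookup_bar_d[of "{..<N}"]) (auto simp: lookup_one_forms)
    also have "\<dots> = two_form l (\<lambda>i j. coeff (deriv i (\<eta> j) - deriv j (\<eta> i)) w)"
      unfolding ext_d_one_form dlog_eq_one_form wedge_one_forms form_scale_two_form two_form_sum two_form_add
      by (rule arg_cong[where f = "two_form l"])
         (simp add: fun_eq_iff coeff_deriv_eq sum_negf sum_subtractf right_diff_distrib mult.commute)
    finally show ?thesis .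
  qed
  have "bar_d l \<alpha> 1 (one_forms l \<eta>) = 0 \<longleftrightarrow> (\<forall>w. \<forall>i<l. \<forall>j<l. i < j \<longrightarrow> coeff (deriv i (\<eta> j) - deriv j (\<eta> i)) w = 0)"
    unfolding two_form_eq_0_iff[symmetric] l[symmetric] by (auto intro: poly_mapping_eqI)
  also have "\<dots> \<longleftrightarrow> (\<forall>i<l. \<forall>j<l. i < j \<longrightarrow> deriv i (\<eta> j) = deriv j (\<eta> i))"
    by (auto intro: shuffle_algebra_eqI)
  also have "\<dots> \<longleftrightarrow> (\<forall>i<l. \<forall>j<l. deriv i (\<eta> j) = deriv j (\<eta> i))"
    by (metis linorder_neqE_nat)
  finally show ?thesis .
qed

lemma bar_coboundaries_eq: "bar_coboundaries l N \<alpha> 1 = (\<lambda>x. one_forms l (\<lambda>j. deriv j x)) ` B"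
  by (simp add: bar_coboundaries_def bar_zero_forms_eq image_image bar_d_functions B_in_letters cong: image_cong)

theorem bar_cocycles_eq_coboundaries: "carrier (bar_cocycles l N \<alpha> 1) = bar_coboundaries l N \<alpha> 1"
proof (intro equalityI subsetI)
  fix y assume "y \<in> carrier (bar_cocycles l N \<alpha> 1)"
  then have "y \<in> bar_forms l N \<alpha> 1" and d: "bar_d l \<alpha> 1 y = 0" by (simp_all add: bar_cocycles_def)
  then obtain \<eta> where \<eta>: "y = one_forms l \<eta>" "\<forall>j<l. \<eta> j \<in> B" unfolding bar_one_forms_eq by blast
  have closed: "\<forall>i<l. \<forall>j<l. deriv i (\<eta> j) = deriv j (\<eta> i)"
    using d \<eta> bar_d_one_forms_eq_0_iff[of \<eta>] B_in_letters by simp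
  have "\<forall>j. \<exists>n. \<forall>w. coeff (\<eta> j) w \<noteq> 0 \<longrightarrow> length w < n" using word_length_bound by blast
  from choice[OF this] obtain n where n: "\<And>j w. coeff (\<eta> j) w \<noteq> 0 \<Longrightarrow> length w < n j" by blast
  have "length w < (\<Sum>j<l. n j)" if "j < l" "coeff (\<eta> j) w \<noteq> 0" for j w
  proof -
    have "n j \<le> (\<Sum>j<l. n j)" using that(1) by (intro member_le_sum) auto
    then show ?thesis using n[OF that(2)] by simp
  qed
  then obtain f where "f \<in> B" "\<forall>j<l. deriv j f = \<eta> j"
    using closed_imp_exact[of \<eta> "\<Sum>j<l. n j"] \<eta>(2) closed by blast
  then show "y \<in> bar_coboundaries l N \<alpha> 1" unfolding bar_coboundaries_eq \<eta>(1) by (intro image_eqI[of _ _ f] one_forms_cong) auto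
next
  fix y assume "y \<in> bar_coboundaries l N \<alpha> 1"
  then obtain x where x: "x \<in> B" "y = one_forms l (\<lambda>j. deriv j x)" unfolding bar_coboundaries_eq by blast
  have "bar_d l \<alpha> 1 y = 0"
    unfolding x(2) using x(1) deriv_commute[OF x(1)] by (subst bar_d_one_forms_eq_0_iff) (auto intro: B_in_letters deriv_B)
  moreover have "y \<in> bar_forms l N \<alpha> 1" unfolding bar_one_forms_eq x(2) using deriv_B[OF x(1)] by blast
  ultimately show "y \<in> carrier (bar_cocycles l N \<alpha> 1)" by (simp add: bar_cocycles_def)
qed

end

section \<open>The ring of the bar construction\<close>

lemma bar_function_eq: "bar_function f = words_of (scalar f)"
  by (simp add: bar_function_def scalar.rep_eq)

lemma bar_mult_words_of: "bar_mult (words_of x) (words_of y) = words_of (x * y)"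
  by (simp add: bar_mult_eq_shuffle_product times_shuffle_algebra.rep_eq)

lemma words_of_1: "words_of 1 = single [] 1"
  by (rule one_shuffle_algebra.rep_eq)

lemma words_of_eq_0_iff [simp]: "words_of x = 0 \<longleftrightarrow> x = 0"
  by (metis words_of_0 words_of_inject)

context bar_construction
begin

abbreviation "\<R> \<equiv> bar_ring l N \<alpha>"
abbreviation "\<D> \<equiv> bar_deriv l \<alpha>"

lemma bar_ring_simps [simp]:
  "carrier \<R> = words_of ` B" "monoid.mult \<R> = bar_mult" "one \<R> = words_of 1"
  "ring.zero \<R> = 0" "add \<R> = (+)"
  by (simp_all add: bar_ring_def bar_carrier_eq words_of_1)

lemma bar_deriv_words_of_B: "x \<in> B \<Longrightarrow> i < l \<Longrightarrow> \<D> i (words_of x) = words_of (deriv i x)"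
  by (simp add: bar_deriv_eq B_in_letters)

lemma cring_bar_ring: "cring \<R>"
proof (rule cringI)
  show "abelian_group \<R>"
  proof (rule abelian_groupI)
    show "\<exists>y\<in>carrier \<R>. y \<oplus>\<^bsub>\<R>\<^esub> x = \<zero>\<^bsub>\<R>\<^esub>" if "x \<in> carrier \<R>" for x
    proof -
      obtain y where "y \<in> B" "x = words_of y" using \<open>x \<in> carrier \<R>\<close> by auto
      then show ?thesis by (intro bexI[of _ "words_of (- y)"]) (simp_all add: B_uminus flip: words_of_add)
    qed
  qed (auto simp: add_ac B_add B_0 simp flip: words_of_add intro!: image_eqI[of 0 words_of 0])
  show "comm_monoid \<R>"
    by (rule comm_monoidI) (auto simp: bar_mult_words_of B_1 B_mult mult_ac)
qed (auto simp: bar_mult_words_of distrib_right simp flip: words_of_add)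

sublocale bar: cring \<R>
  by (rule cring_bar_ring)

lemma bar_a_inv: "x \<in> B \<Longrightarrow> \<ominus>\<^bsub>\<R>\<^esub> words_of x = words_of (- x)"
  by (rule bar.minus_equality) (auto simp: B_uminus simp flip: words_of_add)

lemma subring_words_of:
  assumes "S \<subseteq> B" "1 \<in> S" "\<And>x. x \<in> S \<Longrightarrow> - x \<in> S"
    "\<And>x y. x \<in> S \<Longrightarrow> y \<in> S \<Longrightarrow> x * y \<in> S" "\<And>x y. x \<in> S \<Longrightarrow> y \<in> S \<Longrightarrow> x + y \<in> S"
  shows "subring (words_of ` S) \<R>"
proof (rule bar.subringI)
  show "\<ominus>\<^bsub>\<R>\<^esub> x \<in> words_of ` S" if "x \<in> words_of ` S" for x
    using that assms(1,3) by (auto simp: bar_a_inv subset_iff)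
qed (use assms in \<open>auto simp: bar_mult_words_of simp flip: words_of_add\<close>)

abbreviation "\<K> \<equiv> bar_function ` Set.range (rat_const :: 'k \<Rightarrow> 'k ratfun)"

lemma \<K>_eq: "\<K> = words_of ` Set.range (\<lambda>c. scalar (rat_const c))"
  by (simp add: bar_function_eq image_image)

lemma subring_functions: "subring (bar_function ` \<O>) \<R>"
proof -
  have "bar_function ` \<O> = words_of ` scalar ` \<O>" by (simp add: bar_function_eq image_image)
  moreover have "subring (words_of ` scalar ` \<O>) \<R>"
    by (rule subring_words_of)
       (auto simp: B_scalar simp flip: scalar_1 scalar_uminus scalar_mult scalar_add
         intro!: imageI coord_ring_uminus coord_ring_mult coord_ring_add)
  ultimately show ?thesis by simp
qed

lemma subfield_constants: "subfield \<K> \<R>"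
proof (rule bar.subfieldI)
  have sub: "subring \<K> \<R>"
    unfolding \<K>_eq
  proof (rule subring_words_of)
    show "1 \<in> Set.range (\<lambda>c. scalar (rat_const c))" by (rule range_eqI[of _ _ 1]) simp
    show "- x \<in> Set.range (\<lambda>c. scalar (rat_const c))" if "x \<in> Set.range (\<lambda>c. scalar (rat_const c))" for x
      using that by (auto simp flip: scalar_uminus rat_const_uminus)
  qed (auto simp: B_scalar simp flip: scalar_mult rat_const_mult scalar_add rat_const_add)
  then show "subcring \<K> \<R>" by (rule bar.subcringI')
  show "Units (\<R>\<lparr>carrier := \<K>\<rparr>) = \<K> - {\<zero>\<^bsub>\<R>\<^esub>}"
  proof (intro equalityI subsetI)
    fix x assume "x \<in> Units (\<R>\<lparr>carrier := \<K>\<rparr>)"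
    then obtain y where "x \<in> \<K>" "bar_mult y x = words_of 1" by (auto simp: Units_def)
    moreover from this have "x \<noteq> 0"
      by (metis bar_mult_eq_shuffle_product shuffle_product_0_right words_of_eq_0_iff zero_neq_one)
    ultimately show "x \<in> \<K> - {\<zero>\<^bsub>\<R>\<^esub>}" by simp
  next
    fix x assume "x \<in> \<K> - {\<zero>\<^bsub>\<R>\<^esub>}"
    then obtain c where c1: "x = words_of (scalar (rat_const c))" and "x \<noteq> 0" by (auto simp: \<K>_eq)
    then have "c \<noteq> 0" by auto
    note c = c1 this
    let ?y = "words_of (scalar (rat_const (inverse c)))"
    have "?y \<in> \<K>" "x \<in> \<K>" unfolding \<K>_eq c(1) by blast+
    moreover have "bar_mult ?y x = words_of 1" "bar_mult x ?y = words_of 1"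
      using c(2) by (simp_all add: c(1) bar_mult_words_of flip: scalar_mult rat_const_mult)
    ultimately show "x \<in> Units (\<R>\<lparr>carrier := \<K>\<rparr>)" by (auto simp: Units_def)
  qed
qed

lemma differential_algebra_bar_ring: "differential_algebra \<K> \<R> l \<D>"
  unfolding differential_algebra_def derivation_def
proof (intro conjI allI impI ballI cring_bar_ring subfield_constants)
  fix i assume i: "i < l"
  show "\<D> i \<in> carrier \<R> \<rightarrow> carrier \<R>"
    using i by (auto simp: bar_deriv_words_of_B deriv_B)
  fix x y assume "x \<in> carrier \<R>" "y \<in> carrier \<R>"
  then obtain x' y' where xy: "x = words_of x'" "x' \<in> B" "y = words_of y'" "y' \<in> B" by auto
  show "\<D> i (x \<oplus>\<^bsub>\<R>\<^esub> y) = \<D> i x \<oplus>\<^bsub>\<R>\<^esub> \<D> i y"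
    using xy i by (simp add: bar_deriv_words_of_B B_add deriv_add flip: words_of_add)
  show "\<D> i (x \<otimes>\<^bsub>\<R>\<^esub> y) = \<D> i x \<otimes>\<^bsub>\<R>\<^esub> y \<oplus>\<^bsub>\<R>\<^esub> x \<otimes>\<^bsub>\<R>\<^esub> \<D> i y"
    using xy i by (simp add: bar_deriv_words_of_B B_mult bar_mult_words_of deriv_mult flip: words_of_add)
next
  fix i x assume "i < l" "x \<in> \<K>"
  then show "\<D> i x = \<zero>\<^bsub>\<R>\<^esub>" by (auto simp: \<K>_eq bar_deriv_words_of_B B_scalar deriv_scalar)
next
  fix i j x assume ij: "i < l" "j < l" and "x \<in> carrier \<R>"
  then obtain y where "x = words_of y" "y \<in> B" by auto
  then show "\<D> i (\<D> j x) = \<D> j (\<D> i x)"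
    using ij by (simp add: bar_deriv_words_of_B deriv_B deriv_commute)
qed

lemma bar_deriv_function: "f \<in> \<O> \<Longrightarrow> i < l \<Longrightarrow> \<D> i (bar_function f) = bar_function (ratfun_deriv i f)"
  by (simp add: bar_function_eq bar_deriv_words_of_B B_scalar deriv_scalar)

lemma differential_subalgebra_functions: "differential_subalgebra \<K> (bar_function ` \<O>) \<R> l \<D>"
  unfolding differential_subalgebra_def
  using subring_functions by (auto simp: bar_deriv_function \<O>_deriv)

lemma bar_function_eq_iff [simp]: "bar_function f = bar_function g \<longleftrightarrow> f = g"
  by (simp add: bar_function_eq words_of_inject)

lemma bar_function_0 [simp]: "bar_function 0 = 0"
  by (simp add: bar_function_eq)

lemma constants_functions: "constants (\<R>\<lparr>carrier := bar_function ` \<O>\<rparr>) l \<D> = \<K>"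
proof (intro equalityI subsetI)
  fix x assume "x \<in> constants (\<R>\<lparr>carrier := bar_function ` \<O>\<rparr>) l \<D>"
  then obtain f where f: "f \<in> \<O>" "x = bar_function f" and D: "\<forall>i<l. \<D> i x = 0" by (auto simp: constants_def)
  have "ratfun_deriv i f = 0" if "i < l" for i
  proof -
    have "bar_function (ratfun_deriv i f) = bar_function 0"
      using D that f bar_deriv_function[OF f(1) that] by simp
    then show ?thesis unfolding bar_function_eq_iff .
  qed
  then obtain c where "f = rat_const c" using coord_ring_constants[OF \<alpha>_nonzero \<alpha>_mpolys f(1)] by blast
  then show "x \<in> \<K>" using f by blast
next
  fix x assume "x \<in> \<K>"
  then obtain c where "x = bar_function (rat_const c)" by blast
  then show "x \<in> constants (\<R>\<lparr>carrier := bar_function ` \<O>\<rparr>) l \<D>"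
    by (auto simp: constants_def bar_deriv_function)
qed

lemma constants_bar_ring: "constants \<R> l \<D> = \<K>"
proof (intro equalityI subsetI)
  fix x assume "x \<in> constants \<R> l \<D>"
  then obtain y where y: "y \<in> B" "x = words_of y" and D: "\<forall>i<l. \<D> i x = 0" by (auto simp: constants_def)
  have "deriv i y = 0" if "i < l" for i using D that y by (simp add: bar_deriv_words_of_B)
  then obtain c where "y = scalar (rat_const c)" using constants_B[OF y(1)] by blast
  then show "x \<in> \<K>" unfolding \<K>_eq using y(2) by blast
next
  fix x assume "x \<in> \<K>"
  then show "x \<in> constants \<R> l \<D>"
    by (auto simp: constants_def \<K>_eq bar_deriv_words_of_B B_scalar deriv_scalar)
qed

lemma no_differential_ideals_functions:
  "no_nontrivial_differential_ideals (\<R>\<lparr>carrier := bar_function ` \<O>\<rparr>) l \<D>"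
  unfolding no_nontrivial_differential_ideals_def differential_ideal_def
proof (intro allI impI)
  let ?R = "\<R>\<lparr>carrier := bar_function ` \<O>\<rparr>"
  fix J assume J: "ideal J ?R \<and> (\<forall>i<l. \<forall>x\<in>J. \<D> i x \<in> J)"
  then interpret J: ideal J ?R by blast
  show "J = {\<zero>\<^bsub>?R\<^esub>} \<or> J = carrier ?R"
  proof (cases "\<exists>x\<in>J. x \<noteq> 0")
    case False
    then show ?thesis using additive_subgroup.zero_closed[OF J.is_additive_subgroup] by auto
  next
    case True
    let ?J = "{f \<in> \<O>. bar_function f \<in> J}"
    obtain f where f: "f \<in> ?J" "f \<noteq> 0" using True J.a_subset by fastforce
    have "1 \<in> ?J"
    proof (rule coord_ring_differentially_simple[OF \<alpha>_nonzero \<alpha>_mpolys])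
      show "g * h \<in> ?J" if g: "g \<in> \<O>" and h: "h \<in> ?J" for g h
      proof -
        have "bar_mult (bar_function g) (bar_function h) \<in> J" using J.I_l_closed[of "bar_function h" "bar_function g"] g h by simp
        then show ?thesis using g h by (simp add: bar_function_eq bar_mult_words_of coord_ring_mult flip: scalar_mult)
      qed
      show "ratfun_deriv i g \<in> ?J" if "i < l" "g \<in> ?J" for i g
      proof -
        have "\<D> i (bar_function g) \<in> J" using J that by blast
        then show ?thesis using that by (simp add: bar_deriv_function \<O>_deriv)
      qed
    qed (use f in auto)
    then have "\<one>\<^bsub>?R\<^esub> \<in> J" by (simp add: bar_function_eq)
    then show ?thesis using J.one_imp_carrier by blast
  qed
qed

lemma no_differential_ideals_bar_ring: "no_nontrivial_differential_ideals \<R> l \<D>"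
  unfolding no_nontrivial_differential_ideals_def differential_ideal_def
proof (intro allI impI)
  fix J assume J: "ideal J \<R> \<and> (\<forall>i<l. \<forall>x\<in>J. \<D> i x \<in> J)"
  then interpret J: ideal J \<R> by blast
  show "J = {\<zero>\<^bsub>\<R>\<^esub>} \<or> J = carrier \<R>"
  proof (cases "\<exists>x\<in>J. x \<noteq> 0")
    case False
    then show ?thesis using J.zero_closed by auto
  next
    case True
    let ?J = "{x \<in> B. words_of x \<in> J}"
    have "1 \<in> ?J"
    proof (rule B_differentially_simple)
      show "x * y \<in> ?J" if x: "x \<in> B" and y: "y \<in> ?J" for x y
        using J.I_l_closed[of "words_of y" "words_of x"] x y by (simp add: bar_mult_words_of B_mult)
      show "deriv i y \<in> ?J" if "i < l" "y \<in> ?J" for i y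
      proof -
        have "\<D> i (words_of y) \<in> J" using J that by blast
        then show ?thesis using that by (simp add: bar_deriv_words_of_B deriv_B)
      qed
      show "\<exists>x\<in>?J. x \<noteq> 0" using True J.a_subset by fastforce
    qed auto
    then have "\<one>\<^bsub>\<R>\<^esub> \<in> J" by simp
    then show ?thesis using J.one_imp_carrier by blast
  qed
qed

section \<open>The unipotent filtration\<close>

definition basis :: "nat \<Rightarrow> 'k ratfun shuffle_algebra set" where
  "basis n = (SOME F. F \<subseteq> Vm n \<and> Vm n \<subseteq> rational_space.span F \<and> finite F)"

lemma basis: "basis n \<subseteq> Vm n" "Vm n \<subseteq> rational_space.span (basis n)" "finite (basis n)"
proof -
  have "\<exists>F. F \<subseteq> Vm n \<and> Vm n \<subseteq> rational_space.span F \<and> finite F" by (rule ex_basis_Vm) blast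
  from someI_ex[OF this] show "basis n \<subseteq> Vm n" "Vm n \<subseteq> rational_space.span (basis n)" "finite (basis n)"
    unfolding basis_def by blast+
qed

text \<open>Step \<open>n\<close> adjoins a finite spanning set of the integrable words of length
  \<open>n\<close>. Their derivatives delete a letter and so lie in the previous step, which is
  unipotence.\<close>

primrec filtration :: "nat \<Rightarrow> (word \<Rightarrow>\<^sub>0 'k ratfun) set" where
  "filtration 0 = bar_function ` \<O>"
| "filtration (Suc n) = generate_ring \<R> (filtration n \<union> words_of ` basis (Suc n))"

lemma basis_B: "words_of ` basis n \<subseteq> carrier \<R>"
  using basis(1) Vm_V B_V by fastforce

lemma filtration_carrier: "filtration n \<subseteq> carrier \<R>"
proof (induction n)
  case 0
  then show ?case by (auto simp: bar_function_eq B_scalar)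
next
  case (Suc n)
  then show ?case using bar.generate_ring_incl[of "filtration n \<union> words_of ` basis (Suc n)"] basis_B by auto
qed

lemma subring_filtration: "subring (filtration n) \<R>"
proof (cases n)
  case 0
  then show ?thesis using subring_functions by simp
next
  case (Suc m)
  then show ?thesis
    using bar.generate_ring_is_subring[of "filtration m \<union> words_of ` basis n"] filtration_carrier[of m] basis_B[of n] by auto
qed

lemma filtration_Suc: "filtration n \<subseteq> filtration (Suc n)"
  by (auto intro: generate_ring.incl)

lemma filtration_mono: "m \<le> n \<Longrightarrow> filtration m \<subseteq> filtration n"
  by (rule lift_Suc_mono_le[of filtration]) (rule filtration_Suc)

lemma functions_filtration: "f \<in> \<O> \<Longrightarrow> words_of (scalar f) \<in> filtration n"
  using filtration_mono[of 0 n] by (auto simp: bar_function_eq)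

lemma filtration_add: "words_of x \<in> filtration n \<Longrightarrow> words_of y \<in> filtration n \<Longrightarrow> words_of (x + y) \<in> filtration n"
  using subringE(7)[OF subring_filtration, of "words_of x" n "words_of y"] by (simp add: words_of_add)

lemma filtration_mult: "words_of x \<in> filtration n \<Longrightarrow> words_of y \<in> filtration n \<Longrightarrow> words_of (x * y) \<in> filtration n"
  using subringE(6)[OF subring_filtration, of "words_of x" n "words_of y"] by (simp add: bar_mult_words_of)

lemma filtration_sum: "(\<And>a. a \<in> A \<Longrightarrow> words_of (f a) \<in> filtration n) \<Longrightarrow> words_of (sum f A) \<in> filtration n"
proof (induction A rule: infinite_finite_induct)
  case (insert a A)
  then show ?case by (simp add: filtration_add)
qed (use functions_filtration[of 0 n] in simp_all)

lemma Vm_filtration: "x \<in> Vm n \<Longrightarrow> words_of x \<in> filtration n"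
proof (cases n)
  case 0
  assume "x \<in> Vm n"
  then obtain c where "x = scalar (rat_const c)" using Vm_0 0 by blast
  then show ?thesis using functions_filtration by simp
next
  case (Suc m)
  assume x: "x \<in> Vm n"
  let ?P = "{x. words_of x \<in> filtration n}"
  have "rational_space.subspace ?P"
  proof (rule rational_space.subspaceI)
    show "0 \<in> ?P" using functions_filtration[of 0 n] by simp
    show "scalar (rat_const c) * x \<in> ?P" if "x \<in> ?P" for c x
      using filtration_mult[OF functions_filtration[OF coord_ring_const]] that by simp
  qed (simp add: filtration_add)
  moreover have "basis n \<subseteq> ?P" unfolding Suc by (auto intro: generate_ring.incl)
  ultimately have "rational_space.span (basis n) \<subseteq> ?P" by (intro rational_space.span_minimal)
  then show ?thesis using basis(2) x by blast
qed

lemma deriv_Vm_filtration: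
  assumes "x \<in> Vm (Suc n)" shows "words_of (deriv i x) \<in> filtration n"
  unfolding deriv_V[OF Vm_V[OF assms]]
  by (intro filtration_sum filtration_mult functions_filtration \<omega>_in_\<O> Vm_filtration Vm_delete[OF assms]) simp

text \<open>A derivation preserves a subring as soon as it maps generators of the subring into
  it.\<close>

lemma deriv_filtration: "x \<in> filtration n \<Longrightarrow> i < l \<Longrightarrow> \<D> i x \<in> filtration n"
proof (induction n arbitrary: x)
  case 0
  then show ?case by (auto simp: bar_deriv_function \<O>_deriv)
next
  case (Suc n)
  note W = subring_filtration[of "Suc n"]
  let ?G = "filtration n \<union> words_of ` basis (Suc n)"
  have carr: "generate_ring \<R> ?G \<subseteq> words_of ` B" using filtration_carrier[of "Suc n"] by simp
  have "x \<in> generate_ring \<R> ?G" using Suc.prems by simp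
  then show ?case
  proof (induction rule: generate_ring.induct)
    case one
    then show ?case using Suc.prems(2) functions_filtration[of 0 "Suc n"] by (simp add: bar_deriv_words_of_B B_1)
  next
    case (incl h)
    then show ?case
    proof
      assume "h \<in> filtration n"
      then show ?thesis using Suc.IH Suc.prems(2) filtration_Suc[of n] by blast
    next
      assume "h \<in> words_of ` basis (Suc n)"
      then obtain y where "h = words_of y" "y \<in> Vm (Suc n)" using basis(1) by blast
      then show ?thesis
        using deriv_Vm_filtration filtration_Suc[of n] bar_deriv_words_of_B[OF B_V[OF Vm_V]] Suc.prems(2) by auto
    qed
  next
    case (a_inv h)
    then obtain y where y: "h = words_of y" "y \<in> B" using carr by blast
    then have "\<D> i (\<ominus>\<^bsub>\<R>\<^esub> h) = \<ominus>\<^bsub>\<R>\<^esub> \<D> i h"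
      using Suc.prems(2) by (simp add: bar_a_inv bar_deriv_words_of_B B_uminus deriv_uminus deriv_B)
    then show ?case using subringE(5)[OF W] a_inv.IH by simp
  next
    case (eng_add x y)
    then obtain x' y' where "x = words_of x'" "x' \<in> B" "y = words_of y'" "y' \<in> B" using carr by blast
    then have "\<D> i (x \<oplus>\<^bsub>\<R>\<^esub> y) = \<D> i x \<oplus>\<^bsub>\<R>\<^esub> \<D> i y"
      using Suc.prems(2) by (simp add: bar_deriv_words_of_B B_add deriv_add flip: words_of_add)
    then show ?case using subringE(7)[OF W] eng_add.IH by simp
  next
    case (eng_mult x y)
    then obtain x' y' where "x = words_of x'" "x' \<in> B" "y = words_of y'" "y' \<in> B" using carr by blast
    then have "\<D> i (x \<otimes>\<^bsub>\<R>\<^esub> y) = \<D> i x \<otimes>\<^bsub>\<R>\<^esub> y \<oplus>\<^bsub>\<R>\<^esub> x \<otimes>\<^bsub>\<R>\<^esub> \<D> i y"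
      using Suc.prems(2) by (simp add: bar_deriv_words_of_B B_mult bar_mult_words_of deriv_mult flip: words_of_add)
    moreover have "x \<in> filtration (Suc n)" "y \<in> filtration (Suc n)" using eng_mult.hyps by simp_all
    ultimately show ?case using subringE(6,7)[OF W] eng_mult.IH by simp
  qed
qed

lemma V_filtration: "v \<in> V \<Longrightarrow> \<exists>n. words_of v \<in> filtration n"
proof -
  assume v: "v \<in> V"
  obtain n where n: "\<forall>w. coeff v w \<noteq> 0 \<longrightarrow> length w < n" using word_length_bound by blast
  have "words_of (homogeneous_part m v) \<in> filtration n" if "m < n" for m
    using Vm_filtration[OF homogeneous_part_Vm[OF v, of m]] filtration_mono[of m n] that by auto
  then have "words_of (\<Sum>m<n. homogeneous_part m v) \<in> filtration n" by (intro filtration_sum) simp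
  then show ?thesis using sum_homogeneous_parts[of v n] n by auto
qed

lemma filtration_exhausts: "carrier \<R> = (\<Union>n. filtration n)"
proof (intro equalityI subsetI)
  fix y assume "y \<in> carrier \<R>"
  then obtain x where x: "x \<in> B" "y = words_of x" by auto
  from x(1) have "\<exists>n. words_of x \<in> filtration n"
  proof (induction rule: B_induct)
    case zero
    show ?case using functions_filtration[of 0] by auto
  next
    case (add x f v)
    then obtain m n where "words_of x \<in> filtration m" "words_of v \<in> filtration n" using V_filtration by blast
    then have "words_of x \<in> filtration (max m n)" "words_of v \<in> filtration (max m n)"
      using filtration_mono[of m "max m n"] filtration_mono[of n "max m n"] by auto
    then show ?case using functions_filtration[OF \<open>f \<in> \<O>\<close>] filtration_add filtration_mult by blast
  qed
  then show "y \<in> (\<Union>n. filtration n)" using x by blast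
qed (use filtration_carrier in blast)

lemma unipotent_extension_bar_ring: "unipotent_extension \<K> (bar_function ` \<O>) \<R> l \<D>"
  unfolding unipotent_extension_def
proof (intro conjI differential_algebra_bar_ring differential_subalgebra_functions constants_functions
    no_differential_ideals_functions constants_bar_ring exI[of _ filtration] allI filtration_Suc filtration_exhausts)
  show "filtration 0 = bar_function ` \<O>" by simp
  show "differential_subalgebra \<K> (filtration n) \<R> l \<D>" for n
    unfolding differential_subalgebra_def
    using subring_filtration deriv_filtration functions_filtration by (auto simp: bar_function_eq)
  fix n
  have "\<D> j y \<in> filtration n" if "y \<in> words_of ` basis (Suc n)" "j < l" for y j
    using that basis(1)[of "Suc n"] deriv_Vm_filtration bar_deriv_words_of_B[OF B_V[OF Vm_V]] by auto
  then show "\<exists>Y. finite Y \<and> Y \<subseteq> filtration (Suc n) \<and> (\<forall>y\<in>Y. \<forall>j<l. \<D> j y \<in> filtration n) \<and>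
      filtration (Suc n) = generate_ring \<R> (filtration n \<union> Y)"
    using basis(3) by (intro exI[of _ "words_of ` basis (Suc n)"]) (auto intro: generate_ring.incl)
qed

section \<open>Evaluation of polynomials in the generators\<close>

lemma bar_pow: "x \<in> B \<Longrightarrow> words_of x [^]\<^bsub>\<R>\<^esub> (n::nat) = words_of (x ^ n)"
  by (induction n) (simp_all add: bar_mult_words_of mult.commute)

lemma B_power: "x \<in> B \<Longrightarrow> x ^ n \<in> B"
  by (induction n) (auto intro: B_1 B_mult)

lemma bar_finprod:
  assumes "finite A" "\<And>a. a \<in> A \<Longrightarrow> f a \<in> B"
  shows "(\<Otimes>\<^bsub>\<R>\<^esub>a\<in>A. words_of (f a)) = words_of (prod f A)"
  using assms by (induction A rule: finite_induct) (simp_all add: bar_mult_words_of)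

lemma bar_finsum:
  assumes "finite A" "\<And>a. a \<in> A \<Longrightarrow> f a \<in> B"
  shows "(\<Oplus>\<^bsub>\<R>\<^esub>a\<in>A. words_of (f a)) = words_of (sum f A)"
  using assms by (induction A rule: finite_induct) (simp_all add: bar.finsum_insert words_of_add)

lemma of_words_words_of [simp]: "of_words (words_of x) = x"
  by (rule words_of_inverse)

lemma words_of_of_words [simp]: "words_of (of_words x) = x"
  by (rule of_words_inverse) simp

lemma of_words_0: "of_words 0 = 0"
  using of_words_words_of[of 0] by simp

abbreviation "variables \<equiv> words_of ` all_generators"

lemma all_generators_B: "all_generators \<subseteq> B"
  using all_generators_V B_V by blast

lemma monomial_eval_eq:
  assumes "set_mset M \<subseteq> variables"
  shows "monomial_eval \<R> M = words_of (prod_mset (image_mset of_words M))"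
proof -
  have in_B: "of_words s \<in> B" if s: "s \<in> set_mset M" for s
  proof -
    obtain g where "s = words_of g" "g \<in> all_generators" using subsetD[OF assms s] by blast
    then show ?thesis using all_generators_B by auto
  qed
  have pow: "s [^]\<^bsub>\<R>\<^esub> n = words_of (of_words s ^ n)" if "s \<in> set_mset M" for s and n :: nat
    using bar_pow[OF in_B[OF that], of n] by simp
  have "monomial_eval \<R> M = (\<Otimes>\<^bsub>\<R>\<^esub>s\<in>set_mset M. words_of (of_words s ^ count M s))"
    unfolding monomial_eval_def
    by (rule bar.finprod_cong') (use in_B in \<open>auto simp: pow intro!: imageI B_power\<close>)
  also have "\<dots> = words_of (\<Prod>s\<in>set_mset M. of_words s ^ count M s)"
    using in_B by (intro bar_finprod) (auto intro: B_power)
  finally show ?thesis by (simp add: image_prod_mset_multiplicity)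
qed

lemma prod_mset_B: "set_mset M \<subseteq> variables \<Longrightarrow> prod_mset (image_mset of_words M) \<in> B"
proof (induction M)
  case (add x M)
  then have "of_words x \<in> B" using all_generators_B by auto
  with add show ?case by (simp add: B_mult)
qed (simp add: B_1)

lemma indexed_pset_finite:
  assumes "P \<in> ring.indexed_pset \<R> variables (bar_function ` \<O>)"
  shows "finite {M. P M \<noteq> 0} \<and> (\<forall>M. P M \<in> bar_function ` \<O>) \<and> (\<forall>M. P M \<noteq> 0 \<longrightarrow> set_mset M \<subseteq> variables)"
  using assms
proof (induction rule: bar.indexed_pset.induct)
  case (indexed_const k)
  have "{M. bar.indexed_const k M \<noteq> 0} \<subseteq> {{#}}" by (auto simp: bar.indexed_const_def)
  then have "finite {M. bar.indexed_const k M \<noteq> 0}" using finite_subset by blast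
  moreover have "0 \<in> bar_function ` \<O>" using imageI[OF coord_ring_0, of bar_function] by simp
  ultimately show ?case using indexed_const by (auto simp: bar.indexed_const_def)
next
  case (indexed_padd P Q)
  have "{M. bar.indexed_padd P Q M \<noteq> 0} \<subseteq> {M. P M \<noteq> 0} \<union> {M. Q M \<noteq> 0}" by (auto simp: bar.indexed_padd_def)
  then have "finite {M. bar.indexed_padd P Q M \<noteq> 0}" using indexed_padd finite_subset by blast
  moreover have "P M + Q M \<in> bar_function ` \<O>" for M
    using subringE(7)[OF subring_functions, of "P M" "Q M"] indexed_padd by simp
  moreover have "set_mset M \<subseteq> variables" if "P M + Q M \<noteq> 0" for M
  proof -
    have "P M \<noteq> 0 \<or> Q M \<noteq> 0" using that by auto
    then show ?thesis using indexed_padd by blast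
  qed
  ultimately show ?case by (simp add: bar.indexed_padd_def)
next
  case (indexed_pmult P s)
  have "{M. bar.indexed_pmult P s M \<noteq> 0} \<subseteq> add_mset s ` {M. P M \<noteq> 0}"
  proof
    fix M assume "M \<in> {M. bar.indexed_pmult P s M \<noteq> 0}"
    then have "s \<in># M" "P (M - {#s#}) \<noteq> 0" by (auto simp: bar.indexed_pmult_def split: if_splits)
    then show "M \<in> add_mset s ` {M. P M \<noteq> 0}" by (intro image_eqI[of _ _ "M - {#s#}"]) auto
  qed
  then have "finite {M. bar.indexed_pmult P s M \<noteq> 0}" using indexed_pmult finite_subset by blast
  moreover have "0 \<in> bar_function ` \<O>" using imageI[OF coord_ring_0, of bar_function] by simp
  moreover have "set_mset M \<subseteq> variables" if "s \<in># M" "P (M - {#s#}) \<noteq> 0" for M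
  proof -
    have "set_mset (M - {#s#}) \<subseteq> variables" using indexed_pmult that by blast
    moreover have "M = add_mset s (M - {#s#})" using that by simp
    ultimately show ?thesis using \<open>s \<in> variables\<close> by (metis insert_subset set_mset_add_mset_insert)
  qed
  ultimately show ?case using indexed_pmult by (auto simp: bar.indexed_pmult_def)
qed

text \<open>Summation over a finite superset \<open>\<M>\<close> of the support allows two
  polynomials to be compared term by term.\<close>

lemma polynomial_eval_eq:
  assumes "finite \<M>" "{M. P M \<noteq> 0} \<subseteq> \<M>" "\<And>M. M \<in> \<M> \<Longrightarrow> set_mset M \<subseteq> variables" "\<And>M. P M \<in> bar_function ` \<O>"
  shows "polynomial_eval \<R> P = words_of (\<Sum>M\<in>\<M>. of_words (P M) * prod_mset (image_mset of_words M))"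
proof -
  have P_B: "of_words (P M) \<in> B" for M using assms(4)[of M] by (auto simp: bar_function_eq B_scalar)
  have fin: "finite {M. P M \<noteq> 0}" using assms(1,2) finite_subset by blast
  have var: "set_mset M \<subseteq> variables" if "P M \<noteq> 0" for M using assms(2,3) that by blast
  have eq: "bar_mult (P M) (monomial_eval \<R> M) = words_of (of_words (P M) * prod_mset (image_mset of_words M))"
    if "P M \<noteq> 0" for M
    using monomial_eval_eq[OF var[OF that]] bar_mult_words_of[of "of_words (P M)"] by simp
  have in_B: "of_words (P M) * prod_mset (image_mset of_words M) \<in> B" if "P M \<noteq> 0" for M
    by (intro B_mult P_B prod_mset_B var that)
  have "polynomial_eval \<R> P = (\<Oplus>\<^bsub>\<R>\<^esub>M\<in>{M. P M \<noteq> 0}. words_of (of_words (P M) * prod_mset (image_mset of_words M)))"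
    unfolding polynomial_eval_def bar_ring_simps
    by (rule bar.finsum_cong') (use eq in_B in auto)
  also have "\<dots> = words_of (\<Sum>M\<in>{M. P M \<noteq> 0}. of_words (P M) * prod_mset (image_mset of_words M))"
    using fin in_B by (intro bar_finsum) auto
  also have "(\<Sum>M\<in>{M. P M \<noteq> 0}. of_words (P M) * prod_mset (image_mset of_words M)) =
      (\<Sum>M\<in>\<M>. of_words (P M) * prod_mset (image_mset of_words M))"
    using assms(1,2) by (intro sum.mono_neutral_left) (auto simp: of_words_0)
  finally show ?thesis .
qed


abbreviation "\<P> \<equiv> ring.indexed_pset \<R> variables (bar_function ` \<O>)"

lemma indexed_pset_eval:
  assumes "P \<in> \<P>" "finite \<M>" "{M. P M \<noteq> 0} \<subseteq> \<M>" "\<And>M. M \<in> \<M> \<Longrightarrow> set_mset M \<subseteq> variables"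
  shows "polynomial_eval \<R> P = words_of (\<Sum>M\<in>\<M>. of_words (P M) * prod_mset (image_mset of_words M))"
  using indexed_pset_finite[OF assms(1)] assms(2-4) by (intro polynomial_eval_eq) auto

lemma polynomial_eval_carrier:
  assumes "P \<in> \<P>" shows "polynomial_eval \<R> P \<in> carrier \<R>"
proof -
  note P = indexed_pset_finite[OF assms]
  have "of_words (P M) \<in> B" for M
  proof -
    have "P M \<in> bar_function ` \<O>" using P by simp
    then obtain f where "P M = bar_function f" "f \<in> \<O>" by (rule imageE)
    then show ?thesis by (simp add: bar_function_eq B_scalar)
  qed
  then have "(\<Sum>M\<in>{M. P M \<noteq> 0}. of_words (P M) * prod_mset (image_mset of_words M)) \<in> B"
    using P by (intro B_sum B_mult prod_mset_B) auto
  moreover have "polynomial_eval \<R> P = words_of (\<Sum>M\<in>{M. P M \<noteq> 0}. of_words (P M) * prod_mset (image_mset of_words M))"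
    using P by (intro indexed_pset_eval assms) auto
  ultimately show ?thesis by simp
qed

text \<open>Equal values give a relation between monomials with coefficients in \<open>\<O>\<close>,
  and the monomials are independent even over the rational functions.\<close>

lemma inj_on_polynomial_eval: "inj_on (polynomial_eval \<R>) \<P>"
proof (rule inj_onI, rule ext)
  fix P Q M
  assume PQ: "P \<in> \<P>" "Q \<in> \<P>" and eq: "polynomial_eval \<R> P = polynomial_eval \<R> Q"
  note P = indexed_pset_finite[OF PQ(1)] and Q = indexed_pset_finite[OF PQ(2)]
  let ?M = "{M. P M \<noteq> 0} \<union> {M. Q M \<noteq> 0}"
  let ?I = "image_mset of_words :: _ \<Rightarrow> 'k ratfun shuffle_algebra multiset"
  let ?W = "image_mset words_of :: 'k ratfun shuffle_algebra multiset \<Rightarrow> _"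
  have M: "finite ?M" "\<And>M. M \<in> ?M \<Longrightarrow> set_mset M \<subseteq> variables" using P Q by auto
  have WI [simp]: "?W (?I M) = M" for M by (simp add: multiset.map_comp comp_def)
  have inj: "inj_on ?I ?M" by (rule inj_on_inverseI[of _ ?W]) simp
  have "\<exists>f. \<forall>M. P M = words_of (scalar (f M))" "\<exists>g. \<forall>M. Q M = words_of (scalar (g M))"
    using P Q by (intro choice; fastforce simp: bar_function_eq image_iff)+
  then obtain f g where fg: "\<And>M. P M = words_of (scalar (f M))" "\<And>M. Q M = words_of (scalar (g M))" by blast
  have "words_of (\<Sum>M\<in>?M. scalar (f M) * prod_mset (?I M)) = words_of (\<Sum>M\<in>?M. scalar (g M) * prod_mset (?I M))"
    using indexed_pset_eval[OF PQ(1) M(1) _ M(2)] indexed_pset_eval[OF PQ(2) M(1) _ M(2)] eq by (simp add: fg)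
  then have "(\<Sum>M\<in>?M. scalar (f M - g M) * prod_mset (?I M)) = 0"
    by (simp add: words_of_inject scalar_diff left_diff_distrib sum_subtractf)
  then have rel: "(\<Sum>M\<in>?I ` ?M. scalar (f (?W M) - g (?W M)) * prod_mset M) = 0"
    by (subst sum.reindex[OF inj]) simp
  have gens: "\<forall>M\<in>?I ` ?M. set_mset M \<subseteq> all_generators"
  proof
    fix M assume "M \<in> ?I ` ?M"
    then obtain M' where M': "M = ?I M'" "set_mset M' \<subseteq> variables" using M(2) by blast
    then show "set_mset M \<subseteq> all_generators" by auto
  qed
  show "P M = Q M"
  proof (cases "M \<in> ?M")
    case True
    have "f (?W (?I M)) - g (?W (?I M)) = 0"
      by (rule monomials_independent[OF finite_imageI[OF M(1)] gens rel imageI[OF True]])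
    then show ?thesis by (simp add: fg)
  qed simp
qed

lemma monomial_indexed_pset:
  assumes "f \<in> \<O>" "set_mset M \<subseteq> variables"
  shows "(\<lambda>m. if m = M then bar_function f else 0) \<in> \<P>"
  using assms(2)
proof (induction M)
  case empty
  show ?case using bar.indexed_pset.indexed_const[of "bar_function f" "bar_function ` \<O>" variables] assms(1)
    unfolding bar.indexed_const_def bar_ring_simps(4) by (simp only: imageI)
next
  case (add s M)
  then have "bar.indexed_pmult (\<lambda>m. if m = M then bar_function f else 0) s \<in> \<P>"
    by (intro bar.indexed_pset.indexed_pmult) auto
  moreover have "bar.indexed_pmult (\<lambda>m. if m = M then bar_function f else 0) s =
      (\<lambda>m. if m = add_mset s M then bar_function f else 0)"
    by (auto simp: bar.indexed_pmult_def fun_eq_iff dest: insert_DiffM)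
  ultimately show ?case by simp
qed

lemma polynomial_eval_add:
  assumes "P \<in> \<P>" "Q \<in> \<P>"
  shows "polynomial_eval \<R> (bar.indexed_padd P Q) = polynomial_eval \<R> P + polynomial_eval \<R> Q"
proof -
  note P = indexed_pset_finite[OF assms(1)] and Q = indexed_pset_finite[OF assms(2)]
  let ?M = "{M. P M \<noteq> 0} \<union> {M. Q M \<noteq> 0}"
  have M: "finite ?M" "\<And>M. M \<in> ?M \<Longrightarrow> set_mset M \<subseteq> variables" using P Q by auto
  have add: "of_words (x + y) = of_words x + of_words y" for x y :: "word \<Rightarrow>\<^sub>0 'k ratfun"
    using of_words_words_of[of "of_words x + of_words y"] by (simp add: words_of_add)
  have "{M. bar.indexed_padd P Q M \<noteq> 0} \<subseteq> ?M" by (auto simp: bar.indexed_padd_def)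
  from indexed_pset_eval[OF bar.indexed_pset.indexed_padd[OF assms] M(1) this M(2)]
  show ?thesis
    using indexed_pset_eval[OF assms(1) M(1) _ M(2)] indexed_pset_eval[OF assms(2) M(1) _ M(2)]
    by (simp add: bar.indexed_padd_def add distrib_right sum.distrib words_of_add)
qed

text \<open>\<open>B\<close> is spanned over \<open>\<O>\<close> by \<open>V\<close>, and
  \<open>V\<close> is spanned over \<open>k\<close> by monomials in the generators.\<close>

lemma B_subset_polynomial_eval: "x \<in> B \<Longrightarrow> words_of x \<in> polynomial_eval \<R> ` \<P>"
proof (induction rule: B_induct)
  case zero
  have P: "bar.indexed_const 0 \<in> \<P>"
    using subringE(2)[OF subring_functions] by (intro bar.indexed_pset.indexed_const) simp
  have z: "bar.indexed_const 0 = (\<lambda>_. 0)" using bar.indexed_zero_def by simp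
  have "polynomial_eval \<R> (bar.indexed_const 0) = words_of 0"
    using indexed_pset_eval[OF P, of "{}"] by (simp add: z)
  then show ?case using imageI[OF P, of "polynomial_eval \<R>"] by (simp only:)
next
  case (add x f v)
  have closed: "y + z \<in> polynomial_eval \<R> ` \<P>" if yz: "y \<in> polynomial_eval \<R> ` \<P>" "z \<in> polynomial_eval \<R> ` \<P>" for y z
  proof -
    obtain P Q where PQ: "P \<in> \<P>" "Q \<in> \<P>" "y = polynomial_eval \<R> P" "z = polynomial_eval \<R> Q" using yz by blast
    then have "y + z = polynomial_eval \<R> (bar.indexed_padd P Q)" by (simp add: polynomial_eval_add)
    then show ?thesis
      using imageI[OF bar.indexed_pset.indexed_padd[OF PQ(1,2)], of "polynomial_eval \<R>"] by (simp only:)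
  qed
  have mono: "words_of (scalar g * prod_mset M) \<in> polynomial_eval \<R> ` \<P>"
    if "g \<in> \<O>" "set_mset M \<subseteq> all_generators" for g M
  proof -
    let ?N = "image_mset words_of M"
    let ?P = "\<lambda>m. if m = ?N then bar_function g else 0"
    have N: "set_mset ?N \<subseteq> variables" using that(2) by auto
    have P: "?P \<in> \<P>" by (rule monomial_indexed_pset[OF that(1) N])
    have "polynomial_eval \<R> ?P = words_of (\<Sum>M\<in>{?N}. of_words (?P M) * prod_mset (image_mset of_words M))"
      by (rule indexed_pset_eval[OF P]) (use N in auto)
    also have "\<dots> = words_of (scalar g * prod_mset M)"
      by (simp add: bar_function_eq multiset.map_comp comp_def)
    finally show ?thesis using imageI[OF P, of "polynomial_eval \<R>"] by (simp only:)
  qed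
  have "v \<in> rational_space.span (prod_mset ` {M. set_mset M \<subseteq> all_generators})"
    using V_subset_monomial_span add unfolding monomial_span_def by blast
  then have "words_of (scalar f * v) \<in> polynomial_eval \<R> ` \<P>"
  proof (induction rule: rational_space.span_induct_alt)
    case base
    show ?case using mono[of 0 "{#}"] by simp
  next
    case (step c y z)
    then obtain M where M: "y = prod_mset M" "set_mset M \<subseteq> all_generators" by blast
    have "words_of (scalar (f * rat_const c) * y) \<in> polynomial_eval \<R> ` \<P>"
      unfolding M(1) by (intro mono M(2) coord_ring_mult coord_ring_const \<open>f \<in> \<O>\<close>)
    from closed[OF this step(2)] show ?case
      by (simp add: distrib_left scalar_mult mult.assoc flip: words_of_add)
  qed
  from closed[OF add.IH this] show ?case by (simp add: words_of_add)
qed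

theorem is_polynomial_algebra_bar_ring: "is_polynomial_algebra (bar_function ` \<O>) \<R>"
  unfolding is_polynomial_algebra_def bij_betw_def
proof (intro exI[of _ variables] conjI inj_on_polynomial_eval)
  show "variables \<subseteq> carrier \<R>" using all_generators_B by auto
  show "polynomial_eval \<R> ` \<P> = carrier \<R>"
    using polynomial_eval_carrier B_subset_polynomial_eval by auto
qed

text \<open>The quotient is that of the cocycles by themselves. Their group structure is established
  on coboundaries, where it is inherited from \<open>B\<close>.\<close>

theorem trivial_group_H_DR: "trivial_group (H_DR l N \<alpha> 1)"
proof -
  let ?Z = "bar_cocycles l N \<alpha> 1"
  have simps: "monoid.mult ?Z = (+)" "one ?Z = 0" by (simp_all add: bar_cocycles_def)
  have Z: "carrier ?Z = (\<lambda>x. one_forms l (\<lambda>j. deriv j x)) ` B"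
    unfolding bar_cocycles_eq_coboundaries bar_coboundaries_eq ..
  have "comm_group ?Z"
  proof (rule comm_groupI; unfold simps Z)
    fix y assume "y \<in> (\<lambda>x. one_forms l (\<lambda>j. deriv j x)) ` B"
    then obtain x where "x \<in> B" "y = one_forms l (\<lambda>j. deriv j x)" by blast
    then show "\<exists>z\<in>(\<lambda>x. one_forms l (\<lambda>j. deriv j x)) ` B. z + y = 0"
      by (intro bexI[of _ "one_forms l (\<lambda>j. deriv j (- x))"] imageI B_uminus)
         (simp_all add: one_forms_add deriv_uminus one_forms_0)
  next
    show "0 \<in> (\<lambda>x. one_forms l (\<lambda>j. deriv j x)) ` B"
      by (rule image_eqI[OF _ B_0]) (simp add: one_forms_0)
  qed (auto simp: one_forms_add B_add add_ac simp flip: deriv_add)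
  then interpret Z: comm_group ?Z .
  have self: "subgroup (carrier ?Z) ?Z" by (rule Z.subgroup_self)
  then have "carrier ?Z \<lhd> ?Z" unfolding Z.normal_iff_subgroup .
  then interpret Q: group "?Z Mod carrier ?Z" by (rule normal.factorgroup_is_group)
  have "carrier (?Z Mod carrier ?Z) = {carrier ?Z}"
    using Z.coset_join2[OF _ self] Z.one_closed by (auto simp: FactGroup_def RCOSETS_def)
  then show ?thesis
    unfolding H_DR_def bar_cocycles_eq_coboundaries[symmetric] Q.trivial_group by blast
qed

end

theorem theorem1p2:
  fixes l N :: nat and \<alpha> :: "nat \<Rightarrow> 'k::field_char_0 mpoly"
  assumes "hyperplane_arrangement l N \<alpha>"
  shows "unipotent_Picard_Vessiot
           (bar_function ` Set.range rat_const) (bar_function ` coord_ring l N \<alpha>)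
           (bar_ring l N \<alpha>) l (bar_deriv l \<alpha>)
         \<and> is_polynomial_algebra (bar_function ` coord_ring l N \<alpha>) (bar_ring l N \<alpha>)
         \<and> trivial_group (H_DR l N \<alpha> 1)"
proof -
  interpret bar_construction l N \<alpha>
    by unfold_locales (rule hyperplane_arrangement_nonproportional[OF assms])
  show ?thesis
    unfolding unipotent_Picard_Vessiot_def
    by (intro conjI unipotent_extension_bar_ring no_differential_ideals_bar_ring constants_bar_ring
        is_polynomial_algebra_bar_ring trivial_group_H_DR)
qed

end
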